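(* Let $\Omega\subset\mathbb{R}^3$ be a bounded Lipschitz domain and $1<p<\infty$. There exists a constant $c=c(p,\Omega)>0$ such that $$\|P\|_{L^p(\Omega,\mathbb{R}^{3\times3})}\leq c\,\Big(\|\operatorname{dev}\operatorname{sym}P\|_{L^p(\Omega,\mathbb{R}^{3\times3})}+\|\operatorname{dev}\operatorname{Curl}P\|_{L^p(\Omega,\mathbb{R}^{3\times3})}\Big)$$ for all $P\in W^{1,p}_0(\operatorname{Curl};\Omega,\mathbb{R}^{3\times3})=\{P\in L^p(\Omega,\mathbb{R}^{3\times3})\mid\operatorname{Curl}P\in L^p(\Omega,\mathbb{R}^{3\times3}),\ P\times\nu=0\text{ on }\partial\Omega\}$.
   Context: For $X\in\mathbb{R}^{3\times3}$: $\operatorname{sym}X=\frac12(X+X^T)$ and $\operatorname{dev}X=X-\frac13\operatorname{tr}(X)\cdot\mathbb{1}$, where $\mathbb{1}$ is the identity matrix. For a $3\times3$ matrix field $P$, $\operatorname{Curl}P$ is the $3\times 3$ matrix field whose $i$-th row is the usual vector curl ($\nabla\times$) of the $i$-th row of $P$, taken in the sense of distributions. $\nu$ is the outward unit normal field on $\partial\Omega$, and for a matrix $P$ and a vector $b$ the product $P\times b$ is taken row-wise (each row of $P$ crossed with $b$). For $P\in L^p$ with $\operatorname{Curl}P\in L^p$, the tangential trace $P\times\nu$ is understood in $W^{-\frac1p,p}(\partial\Omega,\mathbb{R}^{3\times3})$ via $$\langle P\times(-\nu),Q\rangle_{\partial\Omega}=\int_\Omega\langle\operatorname{Curl}P,\widetilde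 Q\rangle-\langle P,\operatorname{Curl}\widetilde Q\rangle\,dx\qquad\forall\,Q\in W^{1-\frac1{p'},p'}(\partial\Omega,\mathbb{R}^{3\times3}),$$ where $p'=\frac{p}{p-1}$, $\widetilde Q\in W^{1,p'}(\Omega,\mathbb{R}^{3\times3})$ is any extension of $Q$, and $\langle X,Y\rangle=\sum_{i,j}X_{ij}Y_{ij}$ under the integral; $P\times\nu=0$ on $\partial\Omega$ means this functional vanishes. *)

theory Defs
  imports "HOL-Analysis.Analysis"
begin

section \<open>Matrices\<close>

definition sym_part :: "real^3^3 \<Rightarrow> real^3^3" where
  "sym_part X = (1/2) *\<^sub>R (X + transpose X)"

definition dev :: "real^3^3 \<Rightarrow> real^3^3" where
  "dev X = X - (1/3 * trace X) *\<^sub>R mat 1"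


section \<open>Bounded Lipschitz domains\<close>

text \<open>Near every boundary point, after an orthogonal change of coordinates \<open>T\<close>, the set is the
  strict epigraph of a Lipschitz function of the first two coordinates.\<close>

definition lipschitz_domain :: "(real^3) set \<Rightarrow> bool" where
  "lipschitz_domain \<Omega> \<longleftrightarrow> open \<Omega> \<and> connected \<Omega> \<and> \<Omega> \<noteq> {} \<and>
     (\<forall>x\<in>frontier \<Omega>. \<exists>r>0. \<exists>(T :: real^3 \<Rightarrow> real^3) L (\<gamma> :: real^2 \<Rightarrow> real).
        orthogonal_transformation T \<and> L-lipschitz_on UNIV \<gamma> \<and>
        \<Omega> \<inter> ball x r = {y \<in> ball x r. T y $ 3 > \<gamma> (vector [T y $ 1, T y $ 2])})"


section \<open>Test functions\<close>

definition partial :: "'n \<Rightarrow> (real^'n \<Rightarrow> 'b::real_normed_vector) \<Rightarrow> real^'n \<Rightarrow> 'b" where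
  "partial j f x = frechet_derivative f (at x) (axis j 1)"

primrec Ck :: "nat \<Rightarrow> (real^'n \<Rightarrow> 'b::real_normed_vector) \<Rightarrow> bool" where
  "Ck 0 f \<longleftrightarrow> continuous_on UNIV f"
| "Ck (Suc k) f \<longleftrightarrow> (\<forall>x. f differentiable at x) \<and> (\<forall>j. Ck k (partial j f))"

definition smooth :: "(real^'n \<Rightarrow> 'b::real_normed_vector) \<Rightarrow> bool" where
  "smooth f \<longleftrightarrow> (\<forall>k. Ck k f)"

definition test_function :: "(real^'n) set \<Rightarrow> (real^'n \<Rightarrow> real) \<Rightarrow> bool" where
  "test_function \<Omega> \<phi> \<longleftrightarrow>
     smooth \<phi> \<and> compact (closure {x. \<phi> x \<noteq> 0}) \<and> closure {x. \<phi> x \<noteq> 0} \<subseteq> \<Omega>"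


section \<open>Lebesgue spaces\<close>

text \<open>The elements of the Lebesgue and Sobolev spaces below are functions rather than classes of
  functions modulo null sets; their values outside \<open>\<Omega>\<close> are irrelevant.\<close>

definition Lp :: "real \<Rightarrow> (real^'n) set \<Rightarrow> (real^'n \<Rightarrow> 'b::euclidean_space) set" where
  "Lp p \<Omega> = {f. f \<in> borel_measurable (lebesgue_on \<Omega>) \<and>
                integrable (lebesgue_on \<Omega>) (\<lambda>x. norm (f x) powr p)}"

definition Lp_norm :: "real \<Rightarrow> (real^'n) set \<Rightarrow> (real^'n \<Rightarrow> 'b::euclidean_space) \<Rightarrow> real" where
  "Lp_norm p \<Omega> f = (LINT x|lebesgue_on \<Omega>. norm (f x) powr p) powr (1/p)"

definition locally_integrable :: "(real^'n) set \<Rightarrow> (real^'n \<Rightarrow> 'b::euclidean_space) \<Rightarrow> bool" where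
  "locally_integrable \<Omega> f \<longleftrightarrow> (\<forall>K. compact K \<and> K \<subseteq> \<Omega> \<longrightarrow> f absolutely_integrable_on K)"


section \<open>Distributional derivatives\<close>

definition distr_partial ::
    "(real^'n) set \<Rightarrow> 'n \<Rightarrow> (real^'n \<Rightarrow> 'b::euclidean_space) \<Rightarrow> (real^'n \<Rightarrow> real) \<Rightarrow> 'b" where
  "distr_partial \<Omega> j u \<phi> = - (LINT x|lebesgue_on \<Omega>. partial j \<phi> x *\<^sub>R u x)"

definition distr_curl ::
    "(real^3) set \<Rightarrow> (real^3 \<Rightarrow> real^3) \<Rightarrow> (real^3 \<Rightarrow> real) \<Rightarrow> real^3" where
  "distr_curl \<Omega> v \<phi> = vector
     [distr_partial \<Omega> 2 v \<phi> $ 3 - distr_partial \<Omega> 3 v \<phi> $ 2,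
      distr_partial \<Omega> 3 v \<phi> $ 1 - distr_partial \<Omega> 1 v \<phi> $ 3,
      distr_partial \<Omega> 1 v \<phi> $ 2 - distr_partial \<Omega> 2 v \<phi> $ 1]"

definition distr_Curl ::
    "(real^3) set \<Rightarrow> (real^3 \<Rightarrow> real^3^3) \<Rightarrow> (real^3 \<Rightarrow> real) \<Rightarrow> real^3^3" where
  "distr_Curl \<Omega> P \<phi> = (\<chi> i. distr_curl \<Omega> (\<lambda>x. row i (P x)) \<phi>)"

definition has_weak_partial ::
    "(real^'n) set \<Rightarrow> 'n \<Rightarrow> (real^'n \<Rightarrow> 'b::euclidean_space) \<Rightarrow> (real^'n \<Rightarrow> 'b) \<Rightarrow> bool" where
  "has_weak_partial \<Omega> j u g \<longleftrightarrow> locally_integrable \<Omega> u \<and> locally_integrable \<Omega> g \<and>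
     (\<forall>\<phi>. test_function \<Omega> \<phi> \<longrightarrow> distr_partial \<Omega> j u \<phi> = (LINT x|lebesgue_on \<Omega>. \<phi> x *\<^sub>R g x))"

definition has_weak_Curl ::
    "(real^3) set \<Rightarrow> (real^3 \<Rightarrow> real^3^3) \<Rightarrow> (real^3 \<Rightarrow> real^3^3) \<Rightarrow> bool" where
  "has_weak_Curl \<Omega> P C \<longleftrightarrow> locally_integrable \<Omega> P \<and> locally_integrable \<Omega> C \<and>
     (\<forall>\<phi>. test_function \<Omega> \<phi> \<longrightarrow> distr_Curl \<Omega> P \<phi> = (LINT x|lebesgue_on \<Omega>. \<phi> x *\<^sub>R C x))"

text \<open>A function representing the distributional \<open>Curl\<close>. Where one exists, it is unique up to null
  sets of \<open>\<Omega>\<close>; where none exists, the value is meaningless.\<close>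

definition Curl :: "(real^3) set \<Rightarrow> (real^3 \<Rightarrow> real^3^3) \<Rightarrow> real^3 \<Rightarrow> real^3^3" where
  "Curl \<Omega> P = (SOME C. has_weak_Curl \<Omega> P C)"

definition W1 :: "real \<Rightarrow> (real^'n) set \<Rightarrow> (real^'n \<Rightarrow> 'b::euclidean_space) set" where
  "W1 q \<Omega> = {u \<in> Lp q \<Omega>. \<forall>j. \<exists>g\<in>Lp q \<Omega>. has_weak_partial \<Omega> j u g}"


section \<open>Surface measure\<close>

text \<open>Two-dimensional Hausdorff measure on its Caratheodory-measurable sets, normalised (a disc of diameter \<open>d\<close> has area
  \<open>pi / 4 * d\<^sup>2\<close>) so as to be the area on surfaces. Boundedness of the covering sets is required
  because \<^const>\<open>diameter\<close> is unspecified on unbounded sets.\<close>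

definition hausdorff2_covers :: "real \<Rightarrow> 'a::metric_space set \<Rightarrow> (nat \<Rightarrow> 'a set) set" where
  "hausdorff2_covers \<delta> A =
     {C. (\<forall>n. bounded (C n) \<and> diameter (C n) \<le> \<delta>) \<and> A \<subseteq> (\<Union>n. C n)}"

definition hausdorff2_content :: "real \<Rightarrow> 'a::metric_space set \<Rightarrow> ennreal" where
  "hausdorff2_content \<delta> A =
     (INF C\<in>hausdorff2_covers \<delta> A. \<Sum>n. ennreal (pi / 4 * (diameter (C n))\<^sup>2))"

definition hausdorff2_outer :: "'a::metric_space set \<Rightarrow> ennreal" where
  "hausdorff2_outer A = (SUP \<delta>\<in>{0<..}. hausdorff2_content \<delta> A)"

definition surface_measure :: "(real^3) measure" where
  "surface_measure = measure_of UNIV (lambda_system UNIV (Pow UNIV) hausdorff2_outer) hausdorff2_outer"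

lemma hausdorff2_content_empty: "0 < \<delta> \<Longrightarrow> hausdorff2_content \<delta> ({} :: 'a::metric_space set) = 0"
proof -
  assume "0 < \<delta>"
  then have "(\<lambda>_. {}) \<in> hausdorff2_covers \<delta> ({} :: 'a set)"
    by (auto simp: hausdorff2_covers_def)
  then have "hausdorff2_content \<delta> ({} :: 'a set) \<le>
      (\<Sum>n::nat. ennreal (pi / 4 * (diameter ({} :: 'a set))\<^sup>2))"
    unfolding hausdorff2_content_def by (rule INF_lower)
  then show ?thesis by simp
qed

lemma hausdorff2_content_mono: "A \<subseteq> B \<Longrightarrow> hausdorff2_content \<delta> A \<le> hausdorff2_content \<delta> B"
  unfolding hausdorff2_content_def
  by (rule INF_superset_mono) (auto simp: hausdorff2_covers_def)

lemma hausdorff2_content_subadditive: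
  fixes A :: "nat \<Rightarrow> 'a::metric_space set"
  shows "hausdorff2_content \<delta> (\<Union>i. A i) \<le> (\<Sum>i. hausdorff2_content \<delta> (A i))"
proof (cases "\<forall>i. hausdorff2_content \<delta> (A i) < top")
  case False
  then obtain i where "hausdorff2_content \<delta> (A i) = top"
    by (metis less_top)
  then have "(\<Sum>i. hausdorff2_content \<delta> (A i)) = top"
    using sum_le_suminf[of "\<lambda>i. hausdorff2_content \<delta> (A i)" "{i}"] by (simp add: top_unique)
  then show ?thesis by simp
next
  case fin: True
  let ?w = "\<lambda>S::'a set. ennreal (pi / 4 * (diameter S)\<^sup>2)"
  show ?thesis
  proof (rule ennreal_le_epsilon)
    fix e :: real assume "0 < e"
    have "\<exists>C\<in>hausdorff2_covers \<delta> (A i).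
        (\<Sum>n. ?w (C n)) < hausdorff2_content \<delta> (A i) + ennreal (e * (1/2)^Suc i)" for i
    proof -
      have "hausdorff2_content \<delta> (A i) < hausdorff2_content \<delta> (A i) + ennreal (e * (1/2)^Suc i)"
        using fin[rule_format, of i] \<open>0 < e\<close> by simp
      then show ?thesis
        unfolding hausdorff2_content_def INF_less_iff .
    qed
    then obtain C where C: "\<And>i. C i \<in> hausdorff2_covers \<delta> (A i)"
      and Cle: "\<And>i. (\<Sum>n. ?w (C i n)) < hausdorff2_content \<delta> (A i) + ennreal (e * (1/2)^Suc i)"
      by metis
    define D where "D = case_prod C \<circ> prod_decode"
    have "D \<in> hausdorff2_covers \<delta> (\<Union>i. A i)"
    proof -
      have "x \<in> (\<Union>n. D n)" if x: "x \<in> A i" for x i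
      proof -
        obtain n where "x \<in> C i n" using C[of i] x by (auto simp: hausdorff2_covers_def)
        then have "x \<in> D (prod_encode (i, n))" by (simp add: D_def)
        then show ?thesis by blast
      qed
      then show ?thesis
        using C by (auto simp: hausdorff2_covers_def D_def split: prod.split)
    qed
    then have "hausdorff2_content \<delta> (\<Union>i. A i) \<le> (\<Sum>n. ?w (D n))"
      unfolding hausdorff2_content_def by (rule INF_lower)
    also have "\<dots> = (\<Sum>n. case_prod (\<lambda>i k. ?w (C i k)) (prod_decode n))"
      by (simp add: D_def split_beta)
    also have "\<dots> = (\<Sum>i. \<Sum>n. ?w (C i n))"
      by (rule suminf_ennreal_2dimen[where f = "\<lambda>(i, k). ?w (C i k)"]) (simp only: prod.case)
    also have "\<dots> \<le> (\<Sum>i. hausdorff2_content \<delta> (A i) + ennreal (e * (1/2)^Suc i))"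
      by (rule suminf_le[OF less_imp_le[OF Cle] summableI summableI])
    also have "\<dots> = (\<Sum>i. hausdorff2_content \<delta> (A i)) + (\<Sum>i. ennreal (e * (1/2)^Suc i))"
      by (rule suminf_add[OF summableI summableI, symmetric])
    also have "(\<Sum>i. ennreal (e * (1/2)^Suc i)) = ennreal e"
    proof (rule suminf_ennreal_eq)
      show "(\<lambda>i. e * (1/2)^Suc i) sums e"
        using sums_mult[OF power_half_series, of e] by (simp only: mult_1_right)
    qed (use \<open>0 < e\<close> in simp)
    finally show "hausdorff2_content \<delta> (\<Union>i. A i) \<le> (\<Sum>i. hausdorff2_content \<delta> (A i)) + ennreal e" .
  qed
qed

lemma outer_measure_space_hausdorff2:
  "outer_measure_space (Pow UNIV) (hausdorff2_outer :: 'a::metric_space set \<Rightarrow> ennreal)"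
proof -
  have "positive (Pow UNIV) (hausdorff2_outer :: 'a set \<Rightarrow> ennreal)"
  proof -
    have "hausdorff2_outer ({}::'a set) = (SUP \<delta>\<in>{(0::real)<..}. 0)"
      unfolding hausdorff2_outer_def by (intro SUP_cong) (auto simp: hausdorff2_content_empty)
    then show ?thesis by (simp add: positive_def)
  qed
  moreover have "increasing (Pow UNIV) (hausdorff2_outer :: 'a set \<Rightarrow> ennreal)"
    unfolding increasing_def hausdorff2_outer_def
    by (auto intro!: SUP_mono' hausdorff2_content_mono)
  moreover have "countably_subadditive (Pow UNIV) (hausdorff2_outer :: 'a set \<Rightarrow> ennreal)"
    unfolding countably_subadditive_def
  proof (intro allI impI)
    fix A :: "nat \<Rightarrow> 'a set"
    show "hausdorff2_outer (\<Union>i. A i) \<le> (\<Sum>i. hausdorff2_outer (A i))"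
      unfolding hausdorff2_outer_def[of "\<Union>i. A i"]
    proof (rule SUP_least)
      fix \<delta> :: real assume "\<delta> \<in> {0<..}"
      then have "hausdorff2_content \<delta> (A i) \<le> hausdorff2_outer (A i)" for i
        unfolding hausdorff2_outer_def by (rule SUP_upper)
      then have "(\<Sum>i. hausdorff2_content \<delta> (A i)) \<le> (\<Sum>i. hausdorff2_outer (A i))"
        by (intro suminf_le) auto
      with hausdorff2_content_subadditive[of \<delta> A]
      show "hausdorff2_content \<delta> (\<Union>i. A i) \<le> (\<Sum>i. hausdorff2_outer (A i))"
        by (rule order_trans)
    qed
  qed
  ultimately show ?thesis by (simp add: outer_measure_space_def)
qed

lemma
  shows space_surface_measure: "space surface_measure = UNIV"
    and sets_surface_measure: "sets surface_measure = lambda_system UNIV (Pow UNIV) hausdorff2_outer"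
    and emeasure_surface_measure:
      "A \<in> sets surface_measure \<Longrightarrow> emeasure surface_measure A = hausdorff2_outer A"
proof -
  have ms: "measure_space UNIV (lambda_system UNIV (Pow UNIV) hausdorff2_outer)
      (hausdorff2_outer :: (real^3) set \<Rightarrow> ennreal)"
    by (rule sigma_algebra.caratheodory_lemma[OF sigma_algebra_Pow outer_measure_space_hausdorff2])
  show "space surface_measure = UNIV"
    by (simp add: surface_measure_def space_measure_of_conv)
  show sets: "sets surface_measure = lambda_system UNIV (Pow UNIV) hausdorff2_outer"
    using ms unfolding surface_measure_def
    by (intro sigma_algebra.sets_measure_of_eq) (simp add: measure_space_def)
  show "emeasure surface_measure A = hausdorff2_outer A" if "A \<in> sets surface_measure"
    using ms that unfolding sets unfolding surface_measure_def
    by (intro emeasure_measure_of_sigma) (simp_all add: measure_space_def)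
qed


section \<open>Traces\<close>

text \<open>The trace operator is the continuous extension of restriction to the boundary, from functions
  smooth up to the boundary to all of \<open>W1 q \<Omega>\<close>; \<open>has_trace\<close> is its graph.\<close>

definition has_trace ::
    "real \<Rightarrow> (real^3) set \<Rightarrow> (real^3 \<Rightarrow> 'b::euclidean_space) \<Rightarrow> (real^3 \<Rightarrow> 'b) \<Rightarrow> bool" where
  "has_trace q \<Omega> u Q \<longleftrightarrow> u \<in> W1 q \<Omega> \<and>
     Q \<in> borel_measurable (restrict_space surface_measure (frontier \<Omega>)) \<and>
     (\<exists>f :: nat \<Rightarrow> real^3 \<Rightarrow> 'b. (\<forall>n. smooth (f n)) \<and>
        (\<lambda>n. Lp_norm q \<Omega> (\<lambda>x. f n x - u x)) \<longlonglongrightarrow> 0 \<and>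
        (\<forall>j. \<exists>g\<in>Lp q \<Omega>. has_weak_partial \<Omega> j u g \<and>
           (\<lambda>n. Lp_norm q \<Omega> (\<lambda>x. partial j (f n) x - g x)) \<longlonglongrightarrow> 0) \<and>
        (\<lambda>n. \<integral>\<^sup>+x. ennreal (norm (f n x - Q x) powr q)
               \<partial>restrict_space surface_measure (frontier \<Omega>)) \<longlonglongrightarrow> 0)"

text \<open>The space \<open>W\<^bsup>1-1/q,q\<^esup>(\<partial>\<Omega>)\<close>, as the range of the trace operator.\<close>

definition trace_space :: "real \<Rightarrow> (real^3) set \<Rightarrow> (real^3 \<Rightarrow> 'b::euclidean_space) set" where
  "trace_space q \<Omega> = {Q. \<exists>u. has_trace q \<Omega> u Q}"

text \<open>The value \<open>\<langle>P \<times> (-\<nu>), Q\<rangle>\<close> of the tangential trace, computed with the extension \<open>R\<close> of \<open>Q\<close>.\<close>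

definition tangential_pairing ::
    "(real^3) set \<Rightarrow> (real^3 \<Rightarrow> real^3^3) \<Rightarrow> (real^3 \<Rightarrow> real^3^3) \<Rightarrow> real" where
  "tangential_pairing \<Omega> P R =
     (LINT x|lebesgue_on \<Omega>. Curl \<Omega> P x \<bullet> R x - P x \<bullet> Curl \<Omega> R x)"

definition zero_tangential_trace ::
    "real \<Rightarrow> (real^3) set \<Rightarrow> (real^3 \<Rightarrow> real^3^3) \<Rightarrow> bool" where
  "zero_tangential_trace p \<Omega> P \<longleftrightarrow>
     (let p' = p / (p - 1) in
      \<forall>Q\<in>trace_space p' \<Omega>. \<forall>R\<in>W1 p' \<Omega>. has_trace p' \<Omega> R Q \<longrightarrow> tangential_pairing \<Omega> P R = 0)"

definition W0_Curl :: "real \<Rightarrow> (real^3) set \<Rightarrow> (real^3 \<Rightarrow> real^3^3) set" where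
  "W0_Curl p \<Omega> = {P \<in> Lp p \<Omega>.
     (\<exists>C\<in>Lp p \<Omega>. has_weak_Curl \<Omega> P C) \<and> zero_tangential_trace p \<Omega> P}"

end

theory Submission
  imports Defs
begin

text \<open>Since the tangential trace of \<open>P\<close> vanishes, extending \<open>P\<close> by zero extends \<open>Curl P\<close> by zero. On the
  whole space, \<open>F = Curl (dev sym P) - dev Curl P\<close> determines the Laplacians of \<open>tr P\<close> and of the axial
  vector of \<open>P\<close> as combinations of first derivatives of \<open>F\<close>. Hence, if \<open>w\<close> is the trace or a component of
  the axial vector and \<open>q = p / (p - 1)\<close>, then \<open>\<integral> w \<Delta>\<psi>\<close> is bounded by the \<open>L\<^sup>p\<close> norms of \<open>dev sym P\<close> and
  \<open>dev Curl P\<close> and the \<open>L\<^sup>q\<close> norms of the second and first derivatives of \<open>\<psi>\<close>.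

  Taking for \<open>\<psi>\<close> the Newton potential of \<open>g\<close>, cut off outside a ball, makes \<open>\<Delta>\<psi>\<close> a constant multiple of \<open>g\<close>
  on \<open>\<Omega>\<close>. So \<open>w\<close> is bounded by duality once the second derivatives of \<open>\<psi>\<close> are controlled by \<open>\<Delta>\<psi>\<close> in
  \<open>L\<^sup>q\<close>; the first derivatives follow by the Poincare inequality.

  This control needs no singular integrals. Let \<open>A\<close> average the translations by small multiples of the
  vectors \<open>\<plusminus>e\<^sub>i\<plusminus>e\<^sub>j\<close>, and let \<open>Q (x, y) + \<sigma> x y\<close> be convex for \<open>\<bar>\<sigma>\<bar> \<le> 1\<close>. Each application of \<open>A\<close> lowers
  \<open>\<integral> Q (u, g)\<close> by at least a multiple of \<open>\<integral> \<bar>D\<^sub>e u\<bar> \<bar>D\<^sub>e g\<bar>\<close>, where \<open>D\<^sub>e\<close> is the increment along a step \<open>e\<close>, so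
  \<open>\<Sum>\<^sub>k \<integral> \<bar>D\<^sub>e A\<^sup>k u\<bar> \<bar>D\<^sub>e A\<^sup>k g\<bar>\<close> is bounded by \<open>\<integral> Q (u, g)\<close>. For \<open>u = W - A\<^sup>2 W\<close> the sum without absolute
  values telescopes to \<open>\<integral> D\<^sub>e W D\<^sub>e g\<close>, and in the limit of small steps this bounds the pairing of
  \<open>\<partial>\<^sub>e\<^sup>2 W\<close> with \<open>g\<close> in terms of \<open>\<Delta>W\<close>.\<close>


section \<open>A Bellman function\<close>

text \<open>A symmetric matrix field has a trace-free Curl, so F is minus the deviatoric Curl of the
  trace part and the skew part of P alone: a first-order system for four scalar functions, which one
  more differentiation decouples into Laplacians. As P is merely in L^p, these Laplacians are
  available only when tested against \<psi>, and \<psi> need not vanish at the boundary; the zero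
  trace is what admits such \<psi>.

  The Bellman function bounds a pairing of u and g by a constant times the sum of the integrals of
  |u|^p and |g|^q, not by a product of norms. The estimates are therefore kept in this additive
  form, with Young's inequality in place of Hoelder's. Homogeneity is regained by testing with t sgn
  u |u|^(p-1), whose q-th power is t^q |u|^p: since q > 1, a suitable small t lets this term be
  absorbed, and what remains is linear in the data.\<close>

lemma convex_on_lineI:
  fixes Q :: "'a::real_vector \<Rightarrow> real"
  assumes "\<And>x d. convex_on UNIV (\<lambda>t::real. Q (x + t *\<^sub>R d))"
  shows "convex_on UNIV Q"
proof (rule convex_onI)
  fix t :: real and x y
  assume t: "0 < t" "t < 1"
  have "Q (x + ((1 - t) *\<^sub>R 0 + t *\<^sub>R 1) *\<^sub>R (y - x)) \<le> (1 - t) * Q (x + 0 *\<^sub>R (y - x)) + t * Q (x + 1 *\<^sub>R (y - x))"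
    using convex_onD[OF assms[of x "y - x"], of t 0 1] t by simp
  then show "Q ((1 - t) *\<^sub>R x + t *\<^sub>R y) \<le> (1 - t) * Q x + t * Q y"
    by (simp add: algebra_simps)
qed simp

lemma has_real_derivative_powr_comp:
  assumes "(f has_real_derivative f') (at t)" "f t > 0"
  shows "((\<lambda>t. f t powr r) has_real_derivative r * f t powr (r - 1) * f') (at t)"
  using DERIV_fun_powr[OF assms] by simp

text \<open>The expression is the second derivative along (u, v) of the function in
  \<open>bellman_regularized_convex\<close>: \<open>?T1\<close> and \<open>?T2\<close> come from the
  pure powers, \<open>?T3\<close>, \<open>?T4\<close> and \<open>?T56\<close> from the product rule
  for \<open>X * M powr s\<close>, \<open>?T7\<close> from \<sigma> x y. Of X = x^2 + \<epsilon> and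
  Y = y^2 + \<epsilon> only positivity and the bounds on x^2 and y^2 enter, so X and Y are variables
  of their own. The constants are budgets: A pays for the u part of \<open>?T56\<close>; the 7 in B
  is 2 for its v part plus 5 for closing against \<open>?T3\<close>.\<close>

lemma bellman_second_derivative_nonneg:
  fixes p q s x y u v X Y M A B :: real
  assumes p: "p > 2" and q: "q = p / (p - 1)" and s: "s = 1 - q / 2"
    and X: "X > 0" "x\<^sup>2 \<le> X" and Y: "Y > 0" "y\<^sup>2 \<le> Y" and M: "M = X powr (p - 1) + Y"
    and A: "A = 2 * (p - 1)\<^sup>2 / p" and B: "B = 7 / (q * (q - 1))" and \<sigma>: "\<bar>\<sigma>\<bar> \<le> 1"
  shows "A * (p / 2) * ((p / 2 - 1) * X powr (p / 2 - 2) * (2 * x * u)\<^sup>2 + X powr (p / 2 - 1) * (2 * u\<^sup>2))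
    + B * (q / 2) * ((q / 2 - 1) * Y powr (q / 2 - 2) * (2 * y * v)\<^sup>2 + Y powr (q / 2 - 1) * (2 * v\<^sup>2))
    + 2 * u\<^sup>2 * M powr s
    + 2 * (2 * x * u) * (s * M powr (s - 1) * ((p - 1) * X powr (p - 2) * (2 * x * u) + 2 * y * v))
    + X * (s * ((s - 1) * M powr (s - 2) * ((p - 1) * X powr (p - 2) * (2 * x * u) + 2 * y * v)\<^sup>2
        + M powr (s - 1) * ((p - 1) * ((p - 2) * X powr (p - 3) * (2 * x * u)\<^sup>2 + X powr (p - 2) * (2 * u\<^sup>2)) + 2 * v\<^sup>2)))
    + 2 * \<sigma> * u * v \<ge> 0"
    (is "?T1 + ?T2 + ?T3 + ?T4 + ?T56 + ?T7 \<ge> 0")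
proof -
  have q1: "1 < q" "q < 2" unfolding q using p by (simp_all add: less_divide_eq divide_less_eq)
  have s0: "0 < s" "s < 1/2" using q1 s by auto
  have pq: "(p - 1) * (q - 1) = 1" using p q by (simp add: field_simps)
  define K where "K = X powr (p - 1)"
  have K: "K > 0" "K \<le> M" and M0: "M > 0" and YM: "Y \<le> M" using X Y M K_def by (auto intro: add_pos_pos)
  \<comment> \<open>Conjugacy makes X a power of the first summand of M. The exponent s = 1 - q/2 is
    tuned to this: \<open>F1\<close>, \<open>F2\<close> and \<open>F3\<close> are the balances by
    which the critical terms are compared with v^2 M^(-s), |u v| and u^2 X^(p/2-1).\<close>
  have XK: "X = K powr (q - 1)" using X pq by (simp add: K_def powr_powr)
  have XM: "X \<le> M powr (q - 1)"
    unfolding XK using K q1 by (intro powr_mono2) auto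
  have F1: "X * M powr (s - 1) \<le> M powr (- s)"
  proof -
    have "X * M powr (s - 1) \<le> M powr (q - 1) * M powr (s - 1)"
      using XM by (intro mult_right_mono) auto
    also have "\<dots> = M powr (- s)" using s by (simp flip: powr_add)
    finally show ?thesis .
  qed
  have F2: "\<bar>x\<bar> * \<bar>y\<bar> * M powr (s - 1) \<le> 1"
  proof -
    have "(\<bar>x\<bar> * \<bar>y\<bar>)\<^sup>2 = x\<^sup>2 * y\<^sup>2" by (simp add: power_mult_distrib)
    also have "\<dots> \<le> M powr (q - 1) * M"
      using X Y XM YM by (intro mult_mono) auto
    also have "\<dots> = (M powr (q / 2))\<^sup>2"
      using M0 by (simp add: power2_eq_square powr_mult_base mult.commute flip: powr_add)
    finally have "\<bar>x\<bar> * \<bar>y\<bar> \<le> M powr (q / 2)" by (rule power2_le_imp_le) auto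
    then have "\<bar>x\<bar> * \<bar>y\<bar> * M powr (s - 1) \<le> M powr (q / 2) * M powr (s - 1)"
      by (intro mult_right_mono) auto
    also have "\<dots> = 1" using s M0 by (simp flip: powr_add)
    finally show ?thesis .
  qed
  have F3: "K\<^sup>2 * M powr (s - 2) \<le> X powr (p / 2 - 1)"
  proof -
    have "K\<^sup>2 * M powr (s - 2) \<le> K\<^sup>2 * K powr (s - 2)"
      using K s0 by (intro mult_left_mono powr_mono2') auto
    also have "\<dots> = K powr 2 * K powr (s - 2)" using K by simp
    also have "\<dots> = K powr s" by (simp only: powr_add[symmetric]) simp
    also have "\<dots> = X powr ((p - 1) * s)" by (simp add: K_def powr_powr)
    also have "(p - 1) * s = (p - 1) - (p - 1) * q / 2" using s by (simp add: right_diff_distrib)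
    also have "\<dots> = p / 2 - 1" using p q by simp
    finally show ?thesis .
  qed
  have T1: "?T1 \<ge> 2 * (p - 1)\<^sup>2 * (X powr (p / 2 - 1) * u\<^sup>2)"
  proof -
    have "?T1 \<ge> A * (p / 2) * (0 + X powr (p / 2 - 1) * (2 * u\<^sup>2))"
      using p A by (intro mult_left_mono add_right_mono) auto
    then show ?thesis using p A by (simp add: field_simps)
  qed
  have T2: "?T2 \<ge> 7 * (M powr (- s) * v\<^sup>2)"
  proof -
    have "Y powr (q / 2 - 2) * (2 * y * v)\<^sup>2 \<le> Y powr (q / 2 - 2) * (4 * Y * v\<^sup>2)"
      using Y by (intro mult_left_mono) (auto simp: power_mult_distrib intro!: mult_right_mono)
    also have "\<dots> = Y powr (q / 2 - 2) * Y powr 1 * (4 * v\<^sup>2)" using Y by simp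
    also have "\<dots> = Y powr (q / 2 - 1) * (4 * v\<^sup>2)" by (simp only: powr_add[symmetric]) simp
    \<comment> \<open>Since q < 2, the coefficient q/2 - 1 is negative, so an upper bound for the
      square is what is needed. With it the two terms combine to the positive multiple q (q - 1),
      which B divides out.\<close>
    finally have "(q / 2 - 1) * (Y powr (q / 2 - 2) * (2 * y * v)\<^sup>2) \<ge> (q / 2 - 1) * (Y powr (q / 2 - 1) * (4 * v\<^sup>2))"
      using q1 by (intro mult_left_mono_neg) auto
    then have "?T2 \<ge> B * (q / 2) * ((q / 2 - 1) * (Y powr (q / 2 - 1) * (4 * v\<^sup>2)) + Y powr (q / 2 - 1) * (2 * v\<^sup>2))"
      using q1 B by (intro mult_left_mono add_right_mono) auto
    also have "B * (q / 2) * ((q / 2 - 1) * (Y powr (q / 2 - 1) * (4 * v\<^sup>2)) + Y powr (q / 2 - 1) * (2 * v\<^sup>2))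
        = B * (q * (q - 1)) * (Y powr (q / 2 - 1) * v\<^sup>2)" by (simp add: algebra_simps)
    also have "\<dots> = 7 * (Y powr (- s) * v\<^sup>2)" using B q1 s by simp
    finally have 1: "?T2 \<ge> 7 * (Y powr (- s) * v\<^sup>2)" .
    have "M powr (- s) \<le> Y powr (- s)" using Y YM s0 by (intro powr_mono2') auto
    then have "7 * (M powr (- s) * v\<^sup>2) \<le> 7 * (Y powr (- s) * v\<^sup>2)" by (intro mult_left_mono mult_right_mono) auto
    with 1 show ?thesis by linarith
  qed
  have T4: "?T4 \<ge> - 4 * (\<bar>u\<bar> * \<bar>v\<bar>)"
  proof -
    \<comment> \<open>The part of M' that comes from X is a positive multiple of x u, so it
      contributes a square and may be dropped. Only the mixed part x y u v has no sign, and
      \<open>F2\<close> bounds it.\<close>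
    have 1: "(2 * x * u) * ((p - 1) * X powr (p - 2) * (2 * x * u) + 2 * y * v) \<ge> (2 * x * u) * (2 * y * v)"
    proof -
      have "(2 * x * u) * ((p - 1) * X powr (p - 2) * (2 * x * u)) = (p - 1) * X powr (p - 2) * (2 * x * u)\<^sup>2"
        by (simp add: power2_eq_square)
      also have "\<dots> \<ge> 0" using p by (intro mult_nonneg_nonneg) auto
      finally show ?thesis by (simp add: distrib_left)
    qed
    have "(2 * x * u) * (2 * y * v) = 4 * ((x * y) * (u * v))" by simp
    also have "\<dots> \<ge> - 4 * ((\<bar>x\<bar> * \<bar>y\<bar>) * (\<bar>u\<bar> * \<bar>v\<bar>))"
      using abs_ge_minus_self[of "(x * y) * (u * v)"] unfolding abs_mult by linarith
    finally have "(2 * x * u) * ((p - 1) * X powr (p - 2) * (2 * x * u) + 2 * y * v) \<ge> - 4 * ((\<bar>x\<bar> * \<bar>y\<bar>) * (\<bar>u\<bar> * \<bar>v\<bar>))"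
      using 1 by linarith
    then have "2 * s * M powr (s - 1) * ((2 * x * u) * ((p - 1) * X powr (p - 2) * (2 * x * u) + 2 * y * v))
      \<ge> 2 * s * M powr (s - 1) * (- 4 * ((\<bar>x\<bar> * \<bar>y\<bar>) * (\<bar>u\<bar> * \<bar>v\<bar>)))"
      using s0 by (intro mult_left_mono) auto
    moreover have "2 * s * M powr (s - 1) * (- 4 * ((\<bar>x\<bar> * \<bar>y\<bar>) * (\<bar>u\<bar> * \<bar>v\<bar>)))
       = - (8 * s) * (\<bar>u\<bar> * \<bar>v\<bar>) * (\<bar>x\<bar> * \<bar>y\<bar> * M powr (s - 1))" by simp
    moreover have "(8 * s) * (\<bar>u\<bar> * \<bar>v\<bar>) * (\<bar>x\<bar> * \<bar>y\<bar> * M powr (s - 1)) \<le> (4 * (\<bar>u\<bar> * \<bar>v\<bar>)) * 1"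
      using s0 F2 by (intro mult_mono) auto
    ultimately show ?thesis by (simp add: algebra_simps)
  qed
  have T56: "?T56 \<ge> - 2 * (p - 1)\<^sup>2 * (X powr (p / 2 - 1) * u\<^sup>2) - 2 * (M powr (- s) * v\<^sup>2)"
  proof -
    let ?K' = "(p - 1) * X powr (p - 2) * (2 * x * u)"
    have XK': "X * ?K'\<^sup>2 \<le> 4 * (p - 1)\<^sup>2 * (K\<^sup>2 * u\<^sup>2)"
    proof -
      have "X * ?K'\<^sup>2 = 4 * (p - 1)\<^sup>2 * ((X * (X powr (p - 2))\<^sup>2) * x\<^sup>2) * u\<^sup>2"
        by (simp add: power_mult_distrib)
      also have "\<dots> \<le> 4 * (p - 1)\<^sup>2 * ((X * (X powr (p - 2))\<^sup>2) * X) * u\<^sup>2"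
        using X by (intro mult_right_mono mult_left_mono) auto
      also have "(X * (X powr (p - 2))\<^sup>2) * X = (X powr 1 * X powr (p - 2))\<^sup>2"
        using X by (simp add: power_mult_distrib) (simp add: power2_eq_square)
      also have "\<dots> = K\<^sup>2" by (simp only: K_def powr_add[symmetric]) simp
      finally show ?thesis by simp
    qed
    have XY': "X * (2 * y * v)\<^sup>2 \<le> 4 * (X * M) * v\<^sup>2"
    proof -
      have "X * (2 * y * v)\<^sup>2 = 4 * (X * y\<^sup>2) * v\<^sup>2" by (simp add: power_mult_distrib)
      also have "\<dots> \<le> 4 * (X * M) * v\<^sup>2"
        using X Y YM by (intro mult_right_mono mult_left_mono) auto
      finally show ?thesis .
    qed
    have "(?K' + 2 * y * v)\<^sup>2 \<le> 2 * ?K'\<^sup>2 + 2 * (2 * y * v)\<^sup>2"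
      using zero_le_power2[of "?K' - 2 * y * v"] by (simp add: power2_eq_square algebra_simps)
    then have "X * (?K' + 2 * y * v)\<^sup>2 \<le> X * (2 * ?K'\<^sup>2 + 2 * (2 * y * v)\<^sup>2)"
      using X by (intro mult_left_mono) auto
    then have "X * (?K' + 2 * y * v)\<^sup>2 \<le> 8 * (p - 1)\<^sup>2 * (K\<^sup>2 * u\<^sup>2) + 8 * (X * M) * v\<^sup>2"
      using XK' XY' by (simp add: distrib_left)
    then have "M powr (s - 2) * (X * (?K' + 2 * y * v)\<^sup>2) \<le> M powr (s - 2) * (8 * (p - 1)\<^sup>2 * (K\<^sup>2 * u\<^sup>2) + 8 * (X * M) * v\<^sup>2)"
      by (intro mult_left_mono) auto
    also have "\<dots> = 8 * (p - 1)\<^sup>2 * ((K\<^sup>2 * M powr (s - 2)) * u\<^sup>2) + 8 * (X * (M powr 1 * M powr (s - 2))) * v\<^sup>2"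
      using M0 by (simp add: algebra_simps)
    also have "M powr 1 * M powr (s - 2) = M powr (s - 1)" by (simp only: powr_add[symmetric]) simp
    also have "8 * (p - 1)\<^sup>2 * ((K\<^sup>2 * M powr (s - 2)) * u\<^sup>2) + 8 * (X * M powr (s - 1)) * v\<^sup>2
      \<le> 8 * (p - 1)\<^sup>2 * (X powr (p / 2 - 1) * u\<^sup>2) + 8 * (M powr (- s)) * v\<^sup>2"
      using F1 F3 by (intro add_mono mult_left_mono mult_right_mono) auto
    finally have W: "M powr (s - 2) * (X * (?K' + 2 * y * v)\<^sup>2) \<le>
      8 * (p - 1)\<^sup>2 * (X powr (p / 2 - 1) * u\<^sup>2) + 8 * (M powr (- s)) * v\<^sup>2" (is "?L \<le> ?R") .
    \<comment> \<open>The negative contribution to \<open>?T56\<close> carries the factor s (s - 1).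
      The bound 1/4 turns the constants 8 of \<open>W\<close> into the 2 set aside in A and
      B.\<close>
    have "s * (1 - s) \<le> 1/4" using zero_le_power2[of "s - 1/2"] by (simp add: power2_eq_square algebra_simps)
    then have "s * (1 - s) * ?L \<le> 1/4 * ?R"
      using W s0 X by (intro mult_mono) auto
    moreover have "?T56 \<ge> - (s * (1 - s) * ?L)"
    proof -
      have "?T56 = - (s * (1 - s) * ?L) + X * (s * (M powr (s - 1) * ((p - 1) * ((p - 2) * X powr (p - 3) * (2 * x * u)\<^sup>2 + X powr (p - 2) * (2 * u\<^sup>2)) + 2 * v\<^sup>2)))"
        by (simp add: algebra_simps)
      moreover have "X * (s * (M powr (s - 1) * ((p - 1) * ((p - 2) * X powr (p - 3) * (2 * x * u)\<^sup>2 + X powr (p - 2) * (2 * u\<^sup>2)) + 2 * v\<^sup>2))) \<ge> 0"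
        using p s0 X by (intro mult_nonneg_nonneg add_nonneg_nonneg) auto
      ultimately show ?thesis by linarith
    qed
    ultimately show ?thesis by (simp add: algebra_simps)
  qed
  have T7: "?T7 \<ge> - 2 * (\<bar>u\<bar> * \<bar>v\<bar>)"
  proof -
    have "\<bar>\<sigma> * (u * v)\<bar> \<le> 1 * (\<bar>u\<bar> * \<bar>v\<bar>)" unfolding abs_mult using \<sigma> by (intro mult_right_mono) auto
    then show ?thesis by (simp add: algebra_simps abs_le_iff)
  qed
  \<comment> \<open>6 is 4 from \<open>T4\<close> plus 2 from \<open>T7\<close>; the quadratic form
    is positive because 2 sqrt (2 * 5) > 6.\<close>
  have fin: "2 * u\<^sup>2 * M powr s + 5 * (M powr (- s) * v\<^sup>2) \<ge> 6 * (\<bar>u\<bar> * \<bar>v\<bar>)"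
  proof -
    define m where "m = M powr s"
    have m: "m > 0" "M powr (- s) = inverse m" using M0 by (auto simp: m_def powr_minus)
    have "0 \<le> 2 * (m * \<bar>u\<bar> - 3/2 * \<bar>v\<bar>)\<^sup>2 + 1/2 * v\<^sup>2" by simp
    also have "\<dots> = m * (2 * u\<^sup>2 * m - 6 * (\<bar>u\<bar> * \<bar>v\<bar>)) + 5 * v\<^sup>2" 
      by (simp add: power2_eq_square algebra_simps)
    also have "\<dots> = m * (2 * u\<^sup>2 * m + 5 * (inverse m * v\<^sup>2) - 6 * (\<bar>u\<bar> * \<bar>v\<bar>))" using m by (simp add: field_simps)
    finally show ?thesis using m by (simp add: m_def zero_le_mult_iff)
  qed
  from T1 T2 T4 T56 T7 fin show ?thesis by (simp add: algebra_simps)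
qed

text \<open>A Nazarov--Treil Bellman function for the duality of \<open>L\<^sup>p\<close> and \<open>L\<^sup>q\<close>, with \<open>\<epsilon>\<close> removing the singularities of
  its second derivatives on the coordinate axes.\<close>

lemma bellman_regularized_convex:
  fixes p q s A B \<epsilon> \<sigma> :: real
  assumes p: "p > 2" and q: "q = p / (p - 1)" and s: "s = 1 - q / 2" and \<epsilon>: "\<epsilon> > 0"
    and A: "A = 2 * (p - 1)\<^sup>2 / p" and B: "B = 7 / (q * (q - 1))" and \<sigma>: "\<bar>\<sigma>\<bar> \<le> 1"
  shows "convex_on UNIV (\<lambda>(x, y). A * (x\<^sup>2 + \<epsilon>) powr (p / 2) + B * (y\<^sup>2 + \<epsilon>) powr (q / 2)
    + (x\<^sup>2 + \<epsilon>) * ((x\<^sup>2 + \<epsilon>) powr (p - 1) + (y\<^sup>2 + \<epsilon>)) powr s + \<sigma> * x * y)"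
proof (rule convex_on_lineI)
  fix z d :: "real \<times> real"
  obtain a c where z: "z = (a, c)" by force
  obtain u v where d: "d = (u, v)" by force
  define X where "X = (\<lambda>t. (a + t * u)\<^sup>2 + \<epsilon>)"
  define Y where "Y = (\<lambda>t. (c + t * v)\<^sup>2 + \<epsilon>)"
  define M where "M = (\<lambda>t. X t powr (p - 1) + Y t)"
  have X0: "X t > 0" and Y0: "Y t > 0" and M0: "M t > 0" for t
    using \<epsilon> by (auto simp: X_def Y_def M_def add_nonneg_pos)
  have dX: "(X has_real_derivative 2 * (a + t * u) * u) (at t)" for t
    unfolding X_def by (auto intro!: derivative_eq_intros)
  have dY: "(Y has_real_derivative 2 * (c + t * v) * v) (at t)" for t
    unfolding Y_def by (auto intro!: derivative_eq_intros)
  note pX = has_real_derivative_powr_comp[OF dX X0]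
  note pY = has_real_derivative_powr_comp[OF dY Y0]
  let ?M' = "\<lambda>t. (p - 1) * X t powr (p - 2) * (2 * (a + t * u) * u) + 2 * (c + t * v) * v"
  have dM: "(M has_real_derivative ?M' t) (at t)" for t
    unfolding M_def by (rule derivative_eq_intros pX dY refl)+ simp
  note pM = has_real_derivative_powr_comp[OF dM M0]
  have dlx: "((\<lambda>t. 2 * (a + t * u) * u) has_real_derivative 2 * u\<^sup>2) (at t)" for t
    by (auto intro!: derivative_eq_intros simp: power2_eq_square)
  have dly: "((\<lambda>t. 2 * (c + t * v) * v) has_real_derivative 2 * v\<^sup>2) (at t)" for t
    by (auto intro!: derivative_eq_intros simp: power2_eq_square)
  let ?M'' = "\<lambda>t. (p - 1) * ((p - 2) * X t powr (p - 3) * (2 * (a + t * u) * u)\<^sup>2 + X t powr (p - 2) * (2 * u\<^sup>2)) + 2 * v\<^sup>2"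
  have dM': "(?M' has_real_derivative ?M'' t) (at t)" for t
    by (rule DERIV_cong[OF DERIV_add[OF DERIV_mult[OF DERIV_cmult[OF pX[where r = "p - 2"]] dlx] dly]])
      (simp add: power2_eq_square algebra_simps)
  have dlx0: "((\<lambda>t. a + t * u) has_real_derivative u) (at t)" for t
    by (auto intro!: derivative_eq_intros)
  have dly0: "((\<lambda>t. c + t * v) has_real_derivative v) (at t)" for t
    by (auto intro!: derivative_eq_intros)
  let ?f = "\<lambda>t. A * X t powr (p / 2) + B * Y t powr (q / 2) + X t * M t powr s + \<sigma> * (a + t * u) * (c + t * v)"
  let ?f' = "\<lambda>t. A * (p / 2 * X t powr (p / 2 - 1) * (2 * (a + t * u) * u))
      + B * (q / 2 * Y t powr (q / 2 - 1) * (2 * (c + t * v) * v))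
      + ((2 * (a + t * u) * u) * M t powr s + X t * (s * M t powr (s - 1) * ?M' t))
      + \<sigma> * (u * (c + t * v) + (a + t * u) * v)"
  have df: "(?f has_real_derivative ?f' t) (at t)" for t
    by (rule DERIV_cong[OF DERIV_add[OF DERIV_add[OF DERIV_add[OF DERIV_cmult[OF pX] DERIV_cmult[OF pY]]
        DERIV_mult[OF dX pM]] DERIV_mult[OF DERIV_cmult[OF dlx0] dly0]]]) (simp add: algebra_simps)
  let ?f'' = "\<lambda>t. A * (p / 2) * ((p / 2 - 1) * X t powr (p / 2 - 2) * (2 * (a + t * u) * u)\<^sup>2 + X t powr (p / 2 - 1) * (2 * u\<^sup>2))
    + B * (q / 2) * ((q / 2 - 1) * Y t powr (q / 2 - 2) * (2 * (c + t * v) * v)\<^sup>2 + Y t powr (q / 2 - 1) * (2 * v\<^sup>2))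
    + 2 * u\<^sup>2 * M t powr s
    + 2 * (2 * (a + t * u) * u) * (s * M t powr (s - 1) * ?M' t)
    + X t * (s * ((s - 1) * M t powr (s - 2) * (?M' t)\<^sup>2 + M t powr (s - 1) * ?M'' t))
    + 2 * \<sigma> * u * v"
  have df': "(?f' has_real_derivative ?f'' t) (at t)" for t
    by (rule DERIV_cong[OF DERIV_add[OF DERIV_add[OF DERIV_add[
        OF DERIV_cmult[OF DERIV_mult[OF DERIV_cmult[OF pX] dlx]]
          DERIV_cmult[OF DERIV_mult[OF DERIV_cmult[OF pY] dly]]]
        DERIV_add[OF DERIV_mult[OF dlx pM] DERIV_mult[OF dX DERIV_mult[OF DERIV_cmult[OF pM] dM']]]]
        DERIV_cmult[OF DERIV_add[OF DERIV_cmult[OF dly0] DERIV_cmult_right[OF dlx0]]]]])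
      (simp add: power2_eq_square algebra_simps add_divide_distrib)
  have "convex_on UNIV ?f"
  proof (rule f''_ge0_imp_convex[OF convex_UNIV df df'])
    fix t
    have "(a + t * u)\<^sup>2 \<le> X t" "(c + t * v)\<^sup>2 \<le> Y t" using \<epsilon> by (auto simp: X_def Y_def)
    from bellman_second_derivative_nonneg[OF p q s X0 this(1) Y0 this(2) _ A B \<sigma>, of "M t" u v] 
    show "0 \<le> ?f'' t" by (simp only: M_def)
  qed
  then show "convex_on UNIV (\<lambda>t. case z + t *\<^sub>R d of (x, y) \<Rightarrow> A * (x\<^sup>2 + \<epsilon>) powr (p / 2) + B * (y\<^sup>2 + \<epsilon>) powr (q / 2)
    + (x\<^sup>2 + \<epsilon>) * ((x\<^sup>2 + \<epsilon>) powr (p - 1) + (y\<^sup>2 + \<epsilon>)) powr s + \<sigma> * x * y)"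
    by (simp add: z d X_def Y_def M_def)
qed

lemma square_powr_half: "(x\<^sup>2) powr (r / 2) = \<bar>x::real\<bar> powr r"
proof (cases "x = 0")
  case False
  then have "(x\<^sup>2) powr (r / 2) = (\<bar>x\<bar> powr 2) powr (r / 2)" by simp
  also have "\<dots> = \<bar>x\<bar> powr r" by (simp only: powr_powr) simp
  finally show ?thesis .
qed simp

lemma convex_on_tendsto:
  fixes Q :: "real \<Rightarrow> 'a::real_vector \<Rightarrow> real"
  assumes "\<And>\<epsilon>. \<epsilon> > 0 \<Longrightarrow> convex_on UNIV (Q \<epsilon>)" "\<And>z. ((\<lambda>\<epsilon>. Q \<epsilon> z) \<longlongrightarrow> L z) (at_right 0)"
  shows "convex_on UNIV L"
proof (rule convex_onI)
  fix t :: real and x y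
  assume t: "0 < t" "t < 1"
  show "L ((1 - t) *\<^sub>R x + t *\<^sub>R y) \<le> (1 - t) * L x + t * L y"
  proof (rule tendsto_le[OF _ tendsto_add[OF tendsto_mult_left[OF assms(2)] tendsto_mult_left[OF assms(2)]] assms(2)])
    show "\<forall>\<^sub>F \<epsilon> in at_right 0. Q \<epsilon> ((1 - t) *\<^sub>R x + t *\<^sub>R y) \<le> (1 - t) * Q \<epsilon> x + t * Q \<epsilon> y"
      using eventually_at_right_less
    proof eventually_elim
      case (elim \<epsilon>)
      from convex_onD[OF assms(1)[OF elim], of t x y] t show ?case by simp
    qed
  qed simp
qed simp

text \<open>Convexity survives the pointwise limit \<epsilon> -> 0, where the argument by second
  derivatives no longer applies. The upper bound rests on homogeneity: replacing (x, y) by (r^(1/p)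
  x, r^(1/q) y) with r > 0 multiplies every summand of Q by r.\<close>

lemma bellman_function_gt_2:
  fixes p q :: real
  assumes p: "p > 2" and q: "q = p / (p - 1)"
  obtains Q :: "real \<times> real \<Rightarrow> real" and C where "C > 0"
    "\<And>\<sigma>. \<bar>\<sigma>\<bar> \<le> 1 \<Longrightarrow> convex_on UNIV (\<lambda>z. Q z + \<sigma> * (fst z * snd z))"
    "\<And>x y. 0 \<le> Q (x, y)" "\<And>x y. Q (x, y) \<le> C * (\<bar>x\<bar> powr p + \<bar>y\<bar> powr q)"
proof -
  define s where "s = 1 - q / 2"
  define A where "A = 2 * (p - 1)\<^sup>2 / p"
  define B where "B = 7 / (q * (q - 1))"
  have q1: "1 < q" "q < 2" unfolding q using p by (simp_all add: less_divide_eq divide_less_eq)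
  have s0: "0 < s" "s < 1/2" using q1 s_def by auto
  have AB: "A \<ge> 0" "B \<ge> 0" using p q1 by (auto simp: A_def B_def)
  define Q where "Q = (\<lambda>(x::real, y::real). A * (x\<^sup>2) powr (p / 2) + B * (y\<^sup>2) powr (q / 2)
    + x\<^sup>2 * ((x\<^sup>2) powr (p - 1) + y\<^sup>2) powr s)"
  show ?thesis
  proof (rule that)
    show "A + B + 2 > 0" using AB by linarith
    show "convex_on UNIV (\<lambda>z. Q z + \<sigma> * (fst z * snd z))" if \<sigma>: "\<bar>\<sigma>\<bar> \<le> 1" for \<sigma>
    proof (rule convex_on_tendsto[OF bellman_regularized_convex[OF p q s_def _ A_def B_def \<sigma>]])
      fix z :: "real \<times> real"
      obtain x y where z: "z = (x, y)" by force
      have pos: "\<forall>\<^sub>F \<epsilon> in at_right 0. 0 < (\<epsilon>::real)" by (rule eventually_at_right_less)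
      have t1: "((\<lambda>\<epsilon>. w + \<epsilon>) \<longlongrightarrow> w) (at_right (0::real))" for w
        by (auto intro!: tendsto_eq_intros)
      have t2: "((\<lambda>\<epsilon>. (w\<^sup>2 + \<epsilon>) powr r) \<longlongrightarrow> (w\<^sup>2) powr r) (at_right (0::real))" if "r > 0" for w r
        by (rule tendsto_powr'[OF t1 tendsto_const]) (use that in \<open>auto intro!: eventually_mono[OF pos]\<close>)
      have t3: "((\<lambda>\<epsilon>. ((x\<^sup>2 + \<epsilon>) powr (p - 1) + (y\<^sup>2 + \<epsilon>)) powr s) \<longlongrightarrow> ((x\<^sup>2) powr (p - 1) + y\<^sup>2) powr s) (at_right (0::real))"
        by (rule tendsto_powr'[OF tendsto_add[OF t2 t1] tendsto_const])
           (use p s0 in \<open>auto intro!: eventually_mono[OF pos] add_nonneg_nonneg\<close>)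
      show "((\<lambda>\<epsilon>. case z of (x, y) \<Rightarrow> A * (x\<^sup>2 + \<epsilon>) powr (p / 2) + B * (y\<^sup>2 + \<epsilon>) powr (q / 2) +
             (x\<^sup>2 + \<epsilon>) * ((x\<^sup>2 + \<epsilon>) powr (p - 1) + (y\<^sup>2 + \<epsilon>)) powr s + \<sigma> * x * y) \<longlongrightarrow> Q z + \<sigma> * (fst z * snd z)) (at_right 0)"
        unfolding z Q_def prod.case fst_conv snd_conv mult.assoc[of \<sigma>]
        by (intro tendsto_intros t1 t2 t3) (use p q1 in auto)
    qed
    show "0 \<le> Q (x, y)" for x y unfolding Q_def prod.case using AB by (intro add_nonneg_nonneg mult_nonneg_nonneg) auto
    show "Q (x, y) \<le> (A + B + 2) * (\<bar>x\<bar> powr p + \<bar>y\<bar> powr q)" for x y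
    proof -
      \<comment> \<open>Bounding both variables by powers of one number m reduces the mixed summand
        to a single power of m, whose exponent 2/p + (2/q) s is 1 by the choice of s.\<close>
      define m where "m = max (\<bar>x\<bar> powr p) (\<bar>y\<bar> powr q)"
      have m0: "m \<ge> 0" by (simp add: m_def le_max_iff_disj)
      have m: "m \<le> \<bar>x\<bar> powr p + \<bar>y\<bar> powr q" by (simp add: m_def)
      have x2: "x\<^sup>2 \<le> m powr (2 / p)"
      proof -
        have "x\<^sup>2 = (\<bar>x\<bar> powr p) powr (2 / p)" using p by (simp add: powr_powr)
        also have "\<dots> \<le> m powr (2 / p)" using p by (intro powr_mono2) (auto simp: m_def)
        finally show ?thesis .
      qed
      have y2: "y\<^sup>2 \<le> m powr (2 / q)"
      proof -
        have "y\<^sup>2 = (\<bar>y\<bar> powr q) powr (2 / q)" using q1 by (simp add: powr_powr)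
        also have "\<dots> \<le> m powr (2 / q)" using q1 by (intro powr_mono2) (auto simp: m_def)
        finally show ?thesis .
      qed
      have e1: "2 / p * (p - 1) = 2 / q" using p q by simp
      have "1 / p + 1 / q = 1" unfolding q using p by (simp add: field_simps)
      moreover have "2 / p + 2 / q * s = 2 * (1 / p + 1 / q) - 1" using q1 unfolding s_def by (simp add: field_simps)
      ultimately have e2: "2 / p + 2 / q * s = 1" by simp
      have "(x\<^sup>2) powr (p - 1) \<le> (m powr (2 / p)) powr (p - 1)" using p x2 by (intro powr_mono2) auto
      also have "\<dots> = m powr (2 / q)" by (simp only: powr_powr e1)
      finally have "((x\<^sup>2) powr (p - 1) + y\<^sup>2) powr s \<le> (2 * m powr (2 / q)) powr s"
        using s0 y2 by (intro powr_mono2) auto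
      also have "\<dots> = 2 powr s * m powr (2 / q * s)" by (simp add: powr_mult powr_powr)
      also have "\<dots> \<le> 2 powr 1 * m powr (2 / q * s)" using s0 by (intro mult_right_mono powr_mono) auto
      finally have "x\<^sup>2 * ((x\<^sup>2) powr (p - 1) + y\<^sup>2) powr s \<le> m powr (2 / p) * (2 * m powr (2 / q * s))"
        using x2 by (intro mult_mono) auto
      also have "\<dots> = 2 * m powr (2 / p + 2 / q * s)" by (simp add: powr_add)
      also have "\<dots> = 2 * m" using e2 m0 by simp
      finally have "x\<^sup>2 * ((x\<^sup>2) powr (p - 1) + y\<^sup>2) powr s \<le> 2 * (\<bar>x\<bar> powr p + \<bar>y\<bar> powr q)"
        using mult_left_mono[OF m, of 2] by (rule order_trans) simp
      moreover have "A * \<bar>x\<bar> powr p \<le> A * (\<bar>x\<bar> powr p + \<bar>y\<bar> powr q)" "B * \<bar>y\<bar> powr q \<le> B * (\<bar>x\<bar> powr p + \<bar>y\<bar> powr q)"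
        using AB by (auto intro!: mult_left_mono)
      ultimately show ?thesis unfolding Q_def prod.case square_powr_half distrib_right by linarith
    qed
  qed
qed

text \<open>The conditions are symmetric under exchanging x with y together with p with q, so p < 2
  follows from p > 2 by swapping the arguments. At p = 2 the quadratic (x^2 + y^2)/2 works, since 2
  |u v| is at most u^2 + v^2.\<close>

lemma bellman_function:
  fixes p q :: real
  assumes p: "p > 1" and q: "q = p / (p - 1)"
  obtains Q :: "real \<times> real \<Rightarrow> real" and C where "C > 0"
    "\<And>\<sigma>. \<bar>\<sigma>\<bar> \<le> 1 \<Longrightarrow> convex_on UNIV (\<lambda>z. Q z + \<sigma> * (fst z * snd z))"
    "\<And>x y. 0 \<le> Q (x, y)" "\<And>x y. Q (x, y) \<le> C * (\<bar>x\<bar> powr p + \<bar>y\<bar> powr q)"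
proof -
  consider "p > 2" | "p = 2" | "p < 2" by linarith
  then show ?thesis
  proof cases
    case 1
    show ?thesis by (rule bellman_function_gt_2[OF 1 q]) (fact that)
  next
    case 2
    show ?thesis
    proof (rule that[of 1])
      show "0 \<le> ((fst (x, y))\<^sup>2 + (snd (x, y))\<^sup>2) / 2" "((fst (x, y))\<^sup>2 + (snd (x, y))\<^sup>2) / 2 \<le> 1 * (\<bar>x\<bar> powr p + \<bar>y\<bar> powr q)" for x y :: real
        using 2 q by simp_all
      show "convex_on UNIV (\<lambda>z::real \<times> real. ((fst z)\<^sup>2 + (snd z)\<^sup>2) / 2 + \<sigma> * (fst z * snd z))" if \<sigma>: "\<bar>\<sigma>\<bar> \<le> 1" for \<sigma>
      proof (rule convex_on_lineI)
        fix x d :: "real \<times> real"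
        obtain a c u v where [simp]: "x = (a, c)" "d = (u, v)" by (metis surj_pair)
        have 1: "((\<lambda>t. ((fst (x + t *\<^sub>R d))\<^sup>2 + (snd (x + t *\<^sub>R d))\<^sup>2) / 2 + \<sigma> * (fst (x + t *\<^sub>R d) * snd (x + t *\<^sub>R d)))
          has_real_derivative (a + t * u) * u + (c + t * v) * v + \<sigma> * ((a + t * u) * v + u * (c + t * v))) (at t)" for t
          by (auto intro!: derivative_eq_intros simp: distrib_left distrib_right mult_ac)
        have 2: "((\<lambda>t. (a + t * u) * u + (c + t * v) * v + \<sigma> * ((a + t * u) * v + u * (c + t * v)))
          has_real_derivative u * u + v * v + 2 * \<sigma> * (u * v)) (at t)" for t
          by (auto intro!: derivative_eq_intros simp: algebra_simps)
        have "\<bar>\<sigma> * (u * v)\<bar> \<le> 1 * (\<bar>u\<bar> * \<bar>v\<bar>)" unfolding abs_mult using \<sigma> by (intro mult_right_mono) auto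
        moreover have "2 * (\<bar>u\<bar> * \<bar>v\<bar>) \<le> u * u + v * v"
          using zero_le_power2[of "\<bar>u\<bar> - \<bar>v\<bar>"] by (simp add: power2_eq_square algebra_simps)
        ultimately have "0 \<le> u * u + v * v + 2 * \<sigma> * (u * v)" by (simp add: abs_le_iff)
        with 1 2 show "convex_on UNIV (\<lambda>t. ((fst (x + t *\<^sub>R d))\<^sup>2 + (snd (x + t *\<^sub>R d))\<^sup>2) / 2 + \<sigma> * (fst (x + t *\<^sub>R d) * snd (x + t *\<^sub>R d)))"
          by (intro f''_ge0_imp_convex) auto
      qed
    qed simp
  next
    case 3
    have q2: "q > 2" and pq: "p = q / (q - 1)" unfolding q using p 3 by (simp_all add: less_divide_eq divide_simps)
    obtain Q :: "real \<times> real \<Rightarrow> real" and C where QC: "C > 0"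
      "\<And>\<sigma>. \<bar>\<sigma>\<bar> \<le> 1 \<Longrightarrow> convex_on UNIV (\<lambda>z. Q z + \<sigma> * (fst z * snd z))"
      "\<And>x y. 0 \<le> Q (x, y)" "\<And>x y. Q (x, y) \<le> C * (\<bar>x\<bar> powr q + \<bar>y\<bar> powr p)"
      by (rule bellman_function_gt_2[OF q2 pq]) (rule that)
    show ?thesis
    proof (rule that[of C "\<lambda>z. Q (prod.swap z)"])
      show "convex_on UNIV (\<lambda>z. Q (prod.swap z) + \<sigma> * (fst z * snd z))" if \<sigma>: "\<bar>\<sigma>\<bar> \<le> 1" for \<sigma>
      proof (rule convex_onI)
        fix t :: real and x y :: "real \<times> real"
        assume "0 < t" "t < 1"
        with convex_onD[OF QC(2)[OF \<sigma>], of t "prod.swap x" "prod.swap y"]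
        show "Q (prod.swap ((1 - t) *\<^sub>R x + t *\<^sub>R y)) + \<sigma> * (fst ((1 - t) *\<^sub>R x + t *\<^sub>R y) * snd ((1 - t) *\<^sub>R x + t *\<^sub>R y))
          \<le> (1 - t) * (Q (prod.swap x) + \<sigma> * (fst x * snd x)) + t * (Q (prod.swap y) + \<sigma> * (fst y * snd y))"
          by (simp add: prod.swap_def mult.commute[of "fst _"] mult.commute[of "_ + _" "_ + _"] split_beta)
      qed simp
      show "Q (prod.swap (x, y)) \<le> C * (\<bar>x\<bar> powr p + \<bar>y\<bar> powr q)" for x y
        using QC(4)[of y x] by (simp add: add.commute)
    qed (use QC in auto)
  qed
qed

section \<open>Averages of translations\<close>

text \<open>Continuity is part of the notion, so such functions are Borel, bounded and integrable
  with any positive power, and the class is stable under translating and averaging.\<close>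

definition compactly_supported :: "('a::euclidean_space \<Rightarrow> real) \<Rightarrow> bool" where
  "compactly_supported f \<longleftrightarrow> continuous_on UNIV f \<and> bounded {x. f x \<noteq> 0}"

lemma compactly_supported_integrable:
  assumes "compactly_supported f"
  shows "integrable lborel f"
proof -
  obtain a where a: "{x. f x \<noteq> 0} \<subseteq> cbox (- a) a"
    using assms bounded_subset_cbox_symmetric by (metis compactly_supported_def)
  have "integrable lborel (\<lambda>x. indicator (cbox (- a) a) x *\<^sub>R f x)"
    using assms continuous_on_subset by (intro borel_integrable_compact) (auto simp: compactly_supported_def)
  also have "(\<lambda>x. indicator (cbox (- a) a) x *\<^sub>R f x) = f"
    using a by (force simp: indicator_def fun_eq_iff)
  finally show ?thesis .
qed

lemma compactly_supported_measurable:
  "compactly_supported f \<Longrightarrow> f \<in> borel_measurable borel"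
  by (auto simp: compactly_supported_def intro: borel_measurable_continuous_onI)

lemma compactly_supported_comp:
  assumes "compactly_supported f" "continuous_on UNIV F" "F 0 = 0"
  shows "compactly_supported (\<lambda>x. F (f x))"
proof -
  have "bounded {x. F (f x) \<noteq> 0}"
    by (rule bounded_subset[of "{x. f x \<noteq> 0}"]) (use assms in \<open>auto simp: compactly_supported_def\<close>)
  then show ?thesis
    using assms continuous_on_compose2[of UNIV F UNIV f] by (auto simp: compactly_supported_def)
qed

lemma compactly_supported_comp2:
  assumes "compactly_supported f" "compactly_supported g" "continuous_on UNIV F" "F (0, 0) = 0"
  shows "compactly_supported (\<lambda>x. F (f x, g x))"
proof -
  have "bounded ({x. f x \<noteq> 0} \<union> {x. g x \<noteq> 0})"
    using assms by (auto simp: compactly_supported_def)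
  then have "bounded {x. F (f x, g x) \<noteq> 0}"
    by (rule bounded_subset) (use assms in \<open>force simp: compactly_supported_def\<close>)
  moreover have "continuous_on UNIV (\<lambda>x. F (f x, g x))"
    by (rule continuous_on_compose2[OF assms(3)])
       (use assms in \<open>auto simp: compactly_supported_def intro!: continuous_intros\<close>)
  ultimately show ?thesis by (simp add: compactly_supported_def)
qed

lemma compactly_supported_add: "compactly_supported f \<Longrightarrow> compactly_supported g \<Longrightarrow> compactly_supported (\<lambda>x. f x + g x)"
  using compactly_supported_comp2[of f g "\<lambda>z. fst z + snd z"] by (simp add: continuous_on_add continuous_on_fst continuous_on_snd)

lemma compactly_supported_diff: "compactly_supported f \<Longrightarrow> compactly_supported g \<Longrightarrow> compactly_supported (\<lambda>x. f x - g x)"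
  using compactly_supported_comp2[of f g "\<lambda>z. fst z - snd z"] by (simp add: continuous_on_diff continuous_on_fst continuous_on_snd)

lemma compactly_supported_mult_left:
  assumes "compactly_supported f" "continuous_on UNIV g"
  shows "compactly_supported (\<lambda>x. g x * f x)"
proof -
  have "bounded {x. g x * f x \<noteq> 0}"
    by (rule bounded_subset[of "{x. f x \<noteq> 0}"]) (use assms in \<open>auto simp: compactly_supported_def\<close>)
  then show ?thesis
    using assms by (auto simp: compactly_supported_def intro!: continuous_intros)
qed

lemma compactly_supported_mult: "compactly_supported f \<Longrightarrow> compactly_supported g \<Longrightarrow> compactly_supported (\<lambda>x. f x * g x)"
  by (rule compactly_supported_mult_left) (auto simp: compactly_supported_def)

lemma compactly_supported_cmult: "compactly_supported f \<Longrightarrow> compactly_supported (\<lambda>x. c * f x)"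
  by (rule compactly_supported_mult_left) auto

lemma compactly_supported_divide: "compactly_supported f \<Longrightarrow> compactly_supported (\<lambda>x. f x / c)"
  using compactly_supported_cmult[of f "1 / c"] by simp

lemma compactly_supported_abs: "compactly_supported f \<Longrightarrow> compactly_supported (\<lambda>x. \<bar>f x\<bar>)"
  by (rule compactly_supported_comp) (auto intro!: continuous_intros)

lemma compactly_supported_zero: "compactly_supported (\<lambda>x. 0)"
  by (simp add: compactly_supported_def)

lemma compactly_supported_sum:
  "(\<And>i. i \<in> I \<Longrightarrow> compactly_supported (f i)) \<Longrightarrow> compactly_supported (\<lambda>x. \<Sum>i\<in>I. f i x)"
  by (induction I rule: infinite_finite_induct) (auto intro: compactly_supported_zero compactly_supported_add)

lemma compactly_supported_powr:
  assumes "compactly_supported f" "r > 0"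
  shows "compactly_supported (\<lambda>x. \<bar>f x\<bar> powr r)"
  using assms by (intro compactly_supported_comp[of f "\<lambda>t. \<bar>t\<bar> powr r"]) (auto intro!: continuous_intros continuous_on_powr')

lemma compactly_supported_translate:
  assumes "compactly_supported f"
  shows "compactly_supported (\<lambda>x. f (x + a))"
proof -
  have "{x. f (x + a) \<noteq> 0} = (\<lambda>y. - a + y) ` {x. f x \<noteq> 0}"
    by (auto simp: image_iff) (metis add.commute diff_add_cancel uminus_add_conv_diff)
  then have "bounded {x. f (x + a) \<noteq> 0}"
    using assms by (simp only: bounded_translation compactly_supported_def)
  moreover have "continuous_on UNIV (\<lambda>x. f (x + a))"
    by (rule continuous_on_compose2[of UNIV f]) (use assms in \<open>auto simp: compactly_supported_def intro!: continuous_intros\<close>)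
  ultimately show ?thesis by (simp add: compactly_supported_def)
qed

lemma integral_lborel_translate:
  fixes f :: "'a::euclidean_space \<Rightarrow> real"
  assumes "f \<in> borel_measurable borel"
  shows "(\<integral>x. f (x + a) \<partial>lborel) = (\<integral>x. f x \<partial>lborel)"
proof -
  have "(\<integral>x. f x \<partial>lborel) = (\<integral>x. f x \<partial>distr lborel borel ((+) a))"
    by (simp add: lborel_distr_plus)
  also have "\<dots> = (\<integral>x. f (a + x) \<partial>lborel)"
    using assms by (subst integral_distr) auto
  finally show ?thesis by (simp add: add.commute)
qed

text \<open>For steps closed under negation this is the operator (1 + T)/2 of a lazy random walk, T
  being the mean of the translations. The values of u enter as midpoints between x and x + d i
  because the strengthened convexity of Q is exploited at midpoints.\<close>

definition half_step_avg :: "'i set \<Rightarrow> ('i \<Rightarrow> 'a::euclidean_space) \<Rightarrow> ('a \<Rightarrow> real) \<Rightarrow> 'a \<Rightarrow> real" where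
  "half_step_avg I d u x = (\<Sum>i\<in>I. (u x + u (x + d i)) / 2) / card I"

definition increment :: "'a::euclidean_space \<Rightarrow> ('a \<Rightarrow> real) \<Rightarrow> 'a \<Rightarrow> real" where
  "increment e u x = u (x + e) - u x"

lemma compactly_supported_avg: "compactly_supported u \<Longrightarrow> compactly_supported (half_step_avg I d u)"
  unfolding half_step_avg_def
  by (intro compactly_supported_divide compactly_supported_sum compactly_supported_add compactly_supported_translate)

lemma compactly_supported_avg_pow: "compactly_supported u \<Longrightarrow> compactly_supported ((half_step_avg I d ^^ k) u)"
  by (induction k) (auto intro: compactly_supported_avg)

lemma compactly_supported_increment: "compactly_supported u \<Longrightarrow> compactly_supported (increment e u)"
  unfolding increment_def by (intro compactly_supported_diff compactly_supported_translate)

lemma increment_avg: "increment e (half_step_avg I d u) = half_step_avg I d (increment e u)"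
proof
  fix x
  have "(u (x + e) + u (x + e + f)) / 2 - (u x + u (x + f)) / 2 = (u (x + e) - u x + (u (x + f + e) - u (x + f))) / 2" for f
    by (simp add: add_ac diff_divide_distrib add_divide_distrib)
  moreover have "increment e (half_step_avg I d u) x = (\<Sum>i\<in>I. (u (x + e) + u (x + e + d i)) / 2 - (u x + u (x + d i)) / 2) / card I"
    by (simp only: increment_def half_step_avg_def sum_subtractf diff_divide_distrib)
  ultimately show "increment e (half_step_avg I d u) x = half_step_avg I d (increment e u) x"
    by (simp only: half_step_avg_def increment_def)
qed

lemma half_step_avg_diff: "half_step_avg I d (\<lambda>x. u x - v x) = (\<lambda>x. half_step_avg I d u x - half_step_avg I d v x)"
proof
  fix x
  have "(u x - v x + (u (x + f) - v (x + f))) / 2 = (u x + u (x + f)) / 2 - (v x + v (x + f)) / 2" for f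
    by (simp add: diff_divide_distrib add_divide_distrib)
  then show "half_step_avg I d (\<lambda>x. u x - v x) x = half_step_avg I d u x - half_step_avg I d v x"
    by (simp only: half_step_avg_def sum_subtractf diff_divide_distrib)
qed

lemma half_step_avg_pow_diff:
  "(half_step_avg I d ^^ k) (\<lambda>x. u x - v x) = (\<lambda>x. (half_step_avg I d ^^ k) u x - (half_step_avg I d ^^ k) v x)"
  by (induction k) (auto simp: half_step_avg_diff)

text \<open>A translation by d i moves to the other factor as the translation by - d i, and \<tau>
  finds that vector again among the steps.\<close>

lemma integral_avg_self_adjoint:
  assumes u: "compactly_supported u" and v: "compactly_supported v" and sym: "bij_betw \<tau> I I" "\<And>i. i \<in> I \<Longrightarrow> d (\<tau> i) = - d i"
  shows "(\<integral>x. half_step_avg I d u x * v x \<partial>lborel) = (\<integral>x. u x * half_step_avg I d v x \<partial>lborel)"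
proof -
  have int: "integrable lborel (\<lambda>x. u x * v x)" "integrable lborel (\<lambda>x. u (x + e) * v x)" "integrable lborel (\<lambda>x. u x * v (x + e))" for e
    by (auto intro!: compactly_supported_integrable compactly_supported_mult compactly_supported_translate u v)
  have T: "(\<integral>x. u (x + e) * v x \<partial>lborel) = (\<integral>x. u x * v (x + - e) \<partial>lborel)" for e
  proof -
    have "(\<integral>x. (\<lambda>y. u y * v (y + - e)) (x + e) \<partial>lborel) = (\<integral>x. u x * v (x + - e) \<partial>lborel)"
      by (rule integral_lborel_translate)
         (intro compactly_supported_measurable compactly_supported_mult compactly_supported_translate u v)
    then show ?thesis by simp
  qed
  have "(\<integral>x. half_step_avg I d u x * v x \<partial>lborel) = (\<integral>x. (\<Sum>i\<in>I. u x * v x + u (x + d i) * v x) / (2 * card I) \<partial>lborel)"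
    by (intro Bochner_Integration.integral_cong)
       (auto simp: half_step_avg_def sum_distrib_right distrib_right simp flip: sum_divide_distrib)
  also have "\<dots> = (\<Sum>i\<in>I. (\<integral>x. u x * v x \<partial>lborel) + (\<integral>x. u (x + d i) * v x \<partial>lborel)) / (2 * card I)"
    by (simp add: int)
  also have "\<dots> = (\<Sum>i\<in>I. (\<integral>x. u x * v x \<partial>lborel) + (\<integral>x. u x * v (x + - d i) \<partial>lborel)) / (2 * card I)"
    by (simp only: T)
  also have "(\<Sum>i\<in>I. (\<integral>x. u x * v x \<partial>lborel) + (\<integral>x. u x * v (x + - d i) \<partial>lborel))
     = (\<Sum>i\<in>I. (\<integral>x. u x * v x \<partial>lborel) + (\<integral>x. u x * v (x + d (\<tau> i)) \<partial>lborel))"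
    by (rule sum.cong) (auto simp: sym)
  also have "\<dots> = (\<Sum>i\<in>I. (\<integral>x. u x * v x \<partial>lborel) + (\<integral>x. u x * v (x + d i) \<partial>lborel))"
    by (rule sum.reindex_bij_betw[OF sym(1)])
  also have "\<dots> / (2 * card I) = (\<integral>x. (\<Sum>i\<in>I. u x * v x + u x * v (x + d i)) / (2 * card I) \<partial>lborel)"
    by (simp add: int)
  also have "\<dots> = (\<integral>x. u x * half_step_avg I d v x \<partial>lborel)"
    by (intro Bochner_Integration.integral_cong)
       (auto simp: half_step_avg_def sum_distrib_left distrib_left simp flip: sum_divide_distrib)
  finally show ?thesis .
qed

text \<open>The mean of x y over the two end points exceeds its value at the midpoint by exactly (a'
  - a)(b' - b)/4. Taking \<sigma> to be minus the sign of this quantity turns convexity of Q +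
  \<sigma> x y into a gain of its absolute value; this is why convexity is demanded for both signs
  of \<sigma>.\<close>

lemma bellman_midpoint:
  fixes Q :: "real \<times> real \<Rightarrow> real"
  assumes "\<And>\<sigma>. \<bar>\<sigma>\<bar> \<le> 1 \<Longrightarrow> convex_on UNIV (\<lambda>z. Q z + \<sigma> * (fst z * snd z))"
  shows "Q ((a + a') / 2, (b + b') / 2) + \<bar>a' - a\<bar> * \<bar>b' - b\<bar> / 4 \<le> (Q (a, b) + Q (a', b')) / 2"
proof -
  define \<sigma> where "\<sigma> = - sgn ((a' - a) * (b' - b))"
  have s: "\<bar>\<sigma>\<bar> \<le> 1" by (simp add: \<sigma>_def sgn_if)
  have "Q ((a + a') / 2, (b + b') / 2) + \<sigma> * ((a + a') / 2 * ((b + b') / 2))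
    \<le> (Q (a, b) + \<sigma> * (a * b)) / 2 + (Q (a', b') + \<sigma> * (a' * b')) / 2"
    using convex_onD[OF assms[OF s], of "1/2" "(a, b)" "(a', b')"] by (simp add: add_divide_distrib)
  moreover have "\<sigma> * ((a' - a) * (b' - b)) = - (\<bar>a' - a\<bar> * \<bar>b' - b\<bar>)"
    unfolding \<sigma>_def abs_mult[symmetric] by (simp add: abs_sgn mult.commute)
  moreover have "\<sigma> * ((a' - a) * (b' - b)) = 2 * (\<sigma> * (a * b)) + 2 * (\<sigma> * (a' * b')) - 4 * (\<sigma> * ((a + a') / 2 * ((b + b') / 2)))"
    by (simp add: algebra_simps add_divide_distrib)
  moreover define X where "X = \<sigma> * (a * b)"
  moreover define Y where "Y = \<sigma> * (a' * b')"
  moreover define Z where "Z = \<sigma> * ((a + a') / 2 * ((b + b') / 2))"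
  moreover define D where "D = \<bar>a' - a\<bar> * \<bar>b' - b\<bar>"
  ultimately have "Q ((a + a') / 2, (b + b') / 2) + Z \<le> (Q (a, b) + X) / 2 + (Q (a', b') + Y) / 2"
    "- D = 2 * X + 2 * Y - 4 * Z" by auto
  then show ?thesis unfolding D_def[symmetric] by (simp add: field_simps)
qed

text \<open>Jensen's inequality over the steps is followed by \<open>bellman_midpoint\<close> for
  each pair of values at x and x + d i. After integration all translated copies of Q (u, v) agree,
  so the gains appear as the drop of a single integral. The 4 is that of the midpoint gain, and card
  I comes from the mean over the steps.\<close>

lemma bellman_avg_step:
  fixes Q :: "real \<times> real \<Rightarrow> real"
  assumes Q: "\<And>\<sigma>. \<bar>\<sigma>\<bar> \<le> 1 \<Longrightarrow> convex_on UNIV (\<lambda>z. Q z + \<sigma> * (fst z * snd z))"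
    and Q0: "Q (0, 0) = 0"
    and u: "compactly_supported u" and v: "compactly_supported v" and I: "finite I" "I \<noteq> {}"
  shows "(\<integral>x. Q (half_step_avg I d u x, half_step_avg I d v x) \<partial>lborel)
      + (\<Sum>i\<in>I. \<integral>x. \<bar>increment (d i) u x\<bar> * \<bar>increment (d i) v x\<bar> \<partial>lborel) / (4 * card I)
    \<le> (\<integral>x. Q (u x, v x) \<partial>lborel)"
proof -
  define N where "N = real (card I)"
  have N: "N > 0" using I by (simp add: N_def card_gt_0_iff)
  have cQ: "convex_on UNIV Q" using Q[of 0] by simp
  have contQ: "continuous_on UNIV Q" by (rule convex_on_continuous[OF open_UNIV cQ])
  have csQ: "compactly_supported (\<lambda>x. Q (f x, g x))" if "compactly_supported f" "compactly_supported g" for f g :: "'a \<Rightarrow> real"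
    by (rule compactly_supported_comp2[of f g Q]) (use that contQ Q0 in auto)
  have csD: "compactly_supported (\<lambda>x. \<bar>increment (d i) u x\<bar> * \<bar>increment (d i) v x\<bar>)" for i
    by (intro compactly_supported_mult compactly_supported_abs compactly_supported_increment u v)
  have pt: "Q (half_step_avg I d u x, half_step_avg I d v x) + (\<Sum>i\<in>I. \<bar>increment (d i) u x\<bar> * \<bar>increment (d i) v x\<bar>) / (4 * N)
     \<le> (\<Sum>i\<in>I. (Q (u x, v x) + Q (u (x + d i), v (x + d i))) / 2) / N" for x
  proof -
    have "(half_step_avg I d u x, half_step_avg I d v x) = (\<Sum>i\<in>I. (1 / N) *\<^sub>R ((u x + u (x + d i)) / 2, (v x + v (x + d i)) / 2))"
      by (simp add: sum_prod half_step_avg_def N_def sum_divide_distrib mult.commute)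
    moreover have "Q (\<Sum>i\<in>I. (1 / N) *\<^sub>R ((u x + u (x + d i)) / 2, (v x + v (x + d i)) / 2))
        \<le> (\<Sum>i\<in>I. (1 / N) * Q ((u x + u (x + d i)) / 2, (v x + v (x + d i)) / 2))"
      by (rule convex_on_sum[OF I cQ]) (use N in \<open>auto simp: N_def\<close>)
    ultimately have "Q (half_step_avg I d u x, half_step_avg I d v x) \<le> (\<Sum>i\<in>I. (1 / N) * Q ((u x + u (x + d i)) / 2, (v x + v (x + d i)) / 2))"
      by simp
    also have "\<dots> \<le> (\<Sum>i\<in>I. (1 / N) * ((Q (u x, v x) + Q (u (x + d i), v (x + d i))) / 2 - \<bar>increment (d i) u x\<bar> * \<bar>increment (d i) v x\<bar> / 4))"
    proof (intro sum_mono mult_left_mono)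
      fix i
      show "Q ((u x + u (x + d i)) / 2, (v x + v (x + d i)) / 2) \<le> (Q (u x, v x) + Q (u (x + d i), v (x + d i))) / 2 - \<bar>increment (d i) u x\<bar> * \<bar>increment (d i) v x\<bar> / 4"
        using bellman_midpoint[OF Q, of "u x" "u (x + d i)" "v x" "v (x + d i)"] by (simp only: increment_def le_diff_eq)
    qed (use N in auto)
    also have "\<dots> = (\<Sum>i\<in>I. (Q (u x, v x) + Q (u (x + d i), v (x + d i))) / 2) / N - (\<Sum>i\<in>I. \<bar>increment (d i) u x\<bar> * \<bar>increment (d i) v x\<bar>) / (4 * N)"
      by (simp add: sum_divide_distrib sum_subtractf[symmetric] diff_divide_distrib)
    finally show ?thesis by simp
  qed
  have I1: "integrable lborel (\<lambda>x. Q (half_step_avg I d u x, half_step_avg I d v x))"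
    by (intro compactly_supported_integrable csQ compactly_supported_avg u v)
  have I2: "integrable lborel (\<lambda>x. \<bar>increment (d i) u x\<bar> * \<bar>increment (d i) v x\<bar>)" for i
    by (intro compactly_supported_integrable csD)
  have I3: "integrable lborel (\<lambda>x. Q (u x, v x))" "integrable lborel (\<lambda>x. Q (u (x + d i), v (x + d i)))" for i
    by (auto intro!: compactly_supported_integrable csQ u v compactly_supported_translate)
  have T: "(\<integral>x. Q (u (x + d i), v (x + d i)) \<partial>lborel) = (\<integral>x. Q (u x, v x) \<partial>lborel)" for i
    by (rule integral_lborel_translate[of "\<lambda>x. Q (u x, v x)"]) (intro compactly_supported_measurable csQ u v)
  have "(\<integral>x. Q (half_step_avg I d u x, half_step_avg I d v x) + (\<Sum>i\<in>I. \<bar>increment (d i) u x\<bar> * \<bar>increment (d i) v x\<bar>) / (4 * N) \<partial>lborel)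
    \<le> (\<integral>x. (\<Sum>i\<in>I. (Q (u x, v x) + Q (u (x + d i), v (x + d i))) / 2) / N \<partial>lborel)"
    by (intro integral_mono pt) (intro Bochner_Integration.integrable_add integrable_divide Bochner_Integration.integrable_sum I1 I2 I3)+
  then show ?thesis
    using N by (simp add: I1 I2 I3 T N_def)
qed

text \<open>The drops telescope and the last integral is nonnegative, so the gains of all iterates
  together cost at most the initial integral, uniformly in n. Among the gains in all directions only
  that of i is kept.\<close>

lemma bellman_avg_iterate:
  fixes Q :: "real \<times> real \<Rightarrow> real"
  assumes Q: "\<And>\<sigma>. \<bar>\<sigma>\<bar> \<le> 1 \<Longrightarrow> convex_on UNIV (\<lambda>z. Q z + \<sigma> * (fst z * snd z))"
    and Q0: "Q (0, 0) = 0" "\<And>z. 0 \<le> Q z"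
    and u: "compactly_supported u" and v: "compactly_supported v" and I: "finite I" "I \<noteq> {}" and i: "i \<in> I"
  shows "(\<Sum>k<n. \<integral>x. \<bar>increment (d i) ((half_step_avg I d ^^ k) u) x\<bar> * \<bar>increment (d i) ((half_step_avg I d ^^ k) v) x\<bar> \<partial>lborel)
    \<le> 4 * card I * (\<integral>x. Q (u x, v x) \<partial>lborel)"
proof -
  define N where "N = real (card I)"
  have N: "N > 0" using I by (simp add: N_def card_gt_0_iff)
  let ?A = "\<lambda>k u. (half_step_avg I d ^^ k) u"
  let ?D = "\<lambda>k i. \<integral>x. \<bar>increment (d i) (?A k u) x\<bar> * \<bar>increment (d i) (?A k v) x\<bar> \<partial>lborel"
  have "(\<integral>x. Q (?A n u x, ?A n v x) \<partial>lborel) + (\<Sum>k<n. ?D k i) / (4 * N) \<le> (\<integral>x. Q (u x, v x) \<partial>lborel)"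
  proof (induction n)
    case (Suc n)
    have "?D n i \<le> (\<Sum>i\<in>I. ?D n i)"
      using i I by (intro member_le_sum) (auto intro!: Bochner_Integration.integral_nonneg)
    then have "?D n i / (4 * N) \<le> (\<Sum>i\<in>I. ?D n i) / (4 * N)" using N by (intro divide_right_mono) auto
    moreover have "(\<integral>x. Q (?A (Suc n) u x, ?A (Suc n) v x) \<partial>lborel) + (\<Sum>i\<in>I. ?D n i) / (4 * N) \<le> (\<integral>x. Q (?A n u x, ?A n v x) \<partial>lborel)"
      using bellman_avg_step[OF Q Q0(1) compactly_supported_avg_pow[OF u, where k = n] compactly_supported_avg_pow[OF v, where k = n] I] by (simp add: N_def)
    ultimately show ?case using Suc by (simp add: add_divide_distrib)
  qed simp
  moreover have "(\<integral>x. Q (?A n u x, ?A n v x) \<partial>lborel) \<ge> 0" by (intro Bochner_Integration.integral_nonneg Q0)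
  ultimately have "(\<Sum>k<n. ?D k i) / (4 * N) \<le> (\<integral>x. Q (u x, v x) \<partial>lborel)" by linarith
  then show ?thesis using N by (simp add: N_def divide_le_eq mult.commute)
qed

text \<open>For v = u and the Bellman function of p = q = 2 the gains are the squared increments
  themselves, so they form a summable series.\<close>

lemma increment_avg_pow_L2_tendsto_0:
  assumes u: "compactly_supported u" and I: "finite I" "I \<noteq> {}" and i: "i \<in> I"
  shows "(\<lambda>k. \<integral>x. (increment (d i) ((half_step_avg I d ^^ k) u) x)\<^sup>2 \<partial>lborel) \<longlonglongrightarrow> 0"
proof -
  obtain Q :: "real \<times> real \<Rightarrow> real" and C where QC: "C > 0"
    "\<And>\<sigma>. \<bar>\<sigma>\<bar> \<le> 1 \<Longrightarrow> convex_on UNIV (\<lambda>z. Q z + \<sigma> * (fst z * snd z))"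
    "\<And>x y. 0 \<le> Q (x, y)" "\<And>x y. Q (x, y) \<le> C * (\<bar>x\<bar> powr 2 + \<bar>y\<bar> powr 2)"
    by (rule bellman_function[of 2 2]) auto
  have Q0: "Q (0, 0) = 0" using QC(3,4)[of 0 0] by (intro antisym) auto
  have Qn: "0 \<le> Q z" for z by (cases z) (simp add: QC(3))
  let ?a = "\<lambda>k. \<integral>x. (increment (d i) ((half_step_avg I d ^^ k) u) x)\<^sup>2 \<partial>lborel"
  have "summable ?a"
  proof (rule bounded_imp_summable)
    show "(\<Sum>k\<le>n. ?a k) \<le> 4 * card I * (\<integral>x. Q (u x, u x) \<partial>lborel)" for n
      using bellman_avg_iterate[OF QC(2) Q0 Qn u u I i, where n = "Suc n"]
      by (simp add: lessThan_Suc_atMost power2_eq_square flip: abs_mult)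
  qed auto
  then show ?thesis by (rule summable_LIMSEQ_zero)
qed

text \<open>Telescoping \<open>\<langle>D\<^sub>e A\<^sup>k W, D\<^sub>e A\<^sup>k g\<rangle>\<close> works because the step operator \<open>A\<close> is self-adjoint, which turns
  consecutive differences into \<open>\<langle>D\<^sub>e A\<^sup>k (W - A\<^sup>2 W), D\<^sub>e A\<^sup>k g\<rangle>\<close>.\<close>

lemma increment_pairing_bound:
  fixes Q :: "real \<times> real \<Rightarrow> real"
  assumes Q: "\<And>\<sigma>. \<bar>\<sigma>\<bar> \<le> 1 \<Longrightarrow> convex_on UNIV (\<lambda>z. Q z + \<sigma> * (fst z * snd z))"
    and Q0: "Q (0, 0) = 0" "\<And>z. 0 \<le> Q z"
    and W: "compactly_supported W" and g: "compactly_supported g" and I: "finite I" "I \<noteq> {}" and i: "i \<in> I"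
    and sym: "bij_betw \<tau> I I" "\<And>i. i \<in> I \<Longrightarrow> d (\<tau> i) = - d i"
  shows "\<bar>\<integral>x. increment (d i) W x * increment (d i) g x \<partial>lborel\<bar>
    \<le> 4 * card I * (\<integral>x. Q (W x - half_step_avg I d (half_step_avg I d W) x, g x) \<partial>lborel)" (is "_ \<le> ?B")
proof -
  define f where "f = (\<lambda>x. W x - half_step_avg I d (half_step_avg I d W) x)"
  have f: "compactly_supported f" unfolding f_def by (intro compactly_supported_diff compactly_supported_avg W)
  let ?A = "\<lambda>k u. (half_step_avg I d ^^ k) u"
  let ?\<Phi> = "\<lambda>k. \<integral>x. increment (d i) (?A k W) x * increment (d i) (?A k g) x \<partial>lborel"
  let ?d = "\<lambda>k. \<integral>x. increment (d i) (?A k f) x * increment (d i) (?A k g) x \<partial>lborel"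
  have csA: "compactly_supported (increment (d i) (?A k u))" if "compactly_supported u" for k u
    by (intro compactly_supported_increment compactly_supported_avg_pow that)
  have int: "integrable lborel (\<lambda>x. increment (d i) (?A k u) x * increment (d i) (?A j v) x)" if "compactly_supported u" "compactly_supported v" for k j u v
    by (intro compactly_supported_integrable compactly_supported_mult csA that)
  have step: "?\<Phi> k - ?\<Phi> (Suc k) = ?d k" for k
  proof -
    have "?\<Phi> (Suc k) = (\<integral>x. half_step_avg I d (increment (d i) (?A k W)) x * half_step_avg I d (increment (d i) (?A k g)) x \<partial>lborel)"
      by (simp add: increment_avg)
    also have "\<dots> = (\<integral>x. half_step_avg I d (half_step_avg I d (increment (d i) (?A k W))) x * increment (d i) (?A k g) x \<partial>lborel)"
      by (rule integral_avg_self_adjoint[symmetric, where d = d and \<tau> = \<tau> and I = I]) (intro compactly_supported_avg csA W g sym | assumption)+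
    also have "half_step_avg I d (half_step_avg I d (increment (d i) (?A k W))) = increment (d i) (?A (Suc (Suc k)) W)"
      by (simp add: increment_avg)
    finally have "?\<Phi> k - ?\<Phi> (Suc k) = (\<integral>x. increment (d i) (?A k W) x * increment (d i) (?A k g) x - increment (d i) (?A (Suc (Suc k)) W) x * increment (d i) (?A k g) x \<partial>lborel)"
      by (simp only: Bochner_Integration.integral_diff[OF int[OF W g] int[OF W g]])
    also have "\<dots> = ?d k"
    proof (intro Bochner_Integration.integral_cong refl)
      fix x
      have "?A k f = (\<lambda>x. ?A k W x - ?A (Suc (Suc k)) W x)"
        unfolding f_def half_step_avg_pow_diff by (simp add: funpow_swap1)
      then show "increment (d i) (?A k W) x * increment (d i) (?A k g) x - increment (d i) (?A (Suc (Suc k)) W) x * increment (d i) (?A k g) x = increment (d i) (?A k f) x * increment (d i) (?A k g) x"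
        by (simp add: increment_def algebra_simps)
    qed
    finally show ?thesis .
  qed
  have bound: "\<bar>?\<Phi> 0\<bar> \<le> ?B + \<bar>?\<Phi> n\<bar>" for n
  proof -
    have "?\<Phi> 0 - ?\<Phi> n = (\<Sum>k<n. ?d k)"
      by (induction n) (use step in \<open>auto simp: algebra_simps\<close>)
    moreover have "\<bar>\<Sum>k<n. ?d k\<bar> \<le> (\<Sum>k<n. \<integral>x. \<bar>increment (d i) (?A k f) x\<bar> * \<bar>increment (d i) (?A k g) x\<bar> \<partial>lborel)"
      by (rule order_trans[OF sum_abs], intro sum_mono) (use integral_abs_bound in \<open>simp flip: abs_mult\<close>)
    moreover have "\<dots> \<le> ?B"
      using bellman_avg_iterate[OF Q Q0 f g I i] by (simp add: f_def)
    ultimately show ?thesis by linarith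
  qed
  \<comment> \<open>The telescoped sum is bounded uniformly in n, so only its last term remains. The
    L^2 decay of both increments removes it, whatever the exponent for which Q was built.\<close>
  have "(\<lambda>n. ?\<Phi> n) \<longlonglongrightarrow> 0"
  proof (rule Lim_null_comparison)
    let ?b = "\<lambda>u n. \<integral>x. (increment (d i) (?A n u) x)\<^sup>2 \<partial>lborel"
    show "(\<lambda>n. ?b W n + ?b g n) \<longlonglongrightarrow> 0"
      using tendsto_add[OF increment_avg_pow_L2_tendsto_0[OF W I i] increment_avg_pow_L2_tendsto_0[OF g I i]] by simp
    show "\<forall>\<^sub>F n in sequentially. norm (?\<Phi> n) \<le> ?b W n + ?b g n"
    proof (intro always_eventually allI)
      fix n
      have "\<bar>?\<Phi> n\<bar> \<le> (\<integral>x. \<bar>increment (d i) (?A n W) x * increment (d i) (?A n g) x\<bar> \<partial>lborel)" by (rule integral_abs_bound)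
      also have "\<dots> \<le> (\<integral>x. (increment (d i) (?A n W) x)\<^sup>2 + (increment (d i) (?A n g) x)\<^sup>2 \<partial>lborel)"
      proof (rule integral_mono)
        show "\<bar>increment (d i) (?A n W) x * increment (d i) (?A n g) x\<bar> \<le> (increment (d i) (?A n W) x)\<^sup>2 + (increment (d i) (?A n g) x)\<^sup>2" for x
        proof -
          have "2 * \<bar>a * b\<bar> \<le> a\<^sup>2 + b\<^sup>2" for a b :: real
            using zero_le_power2[of "\<bar>a\<bar> - \<bar>b\<bar>"] by (simp add: power2_eq_square algebra_simps abs_mult)
          then show ?thesis by (smt (verit) abs_ge_zero)
        qed
      qed (use int[OF W W] int[OF g g] int[OF W g] in \<open>auto simp: power2_eq_square\<close>)
      also have "\<dots> = ?b W n + ?b g n"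
        using int[OF W W] int[OF g g] by (intro Bochner_Integration.integral_add) (auto simp: power2_eq_square)
      finally show "norm (?\<Phi> n) \<le> ?b W n + ?b g n" by simp
    qed
  qed
  then have "(\<lambda>n. ?B + \<bar>?\<Phi> n\<bar>) \<longlonglongrightarrow> ?B + 0" by (intro tendsto_add tendsto_const tendsto_rabs_zero)
  then have "\<bar>?\<Phi> 0\<bar> \<le> ?B + 0" by (rule LIMSEQ_le_const) (use bound in auto)
  then show ?thesis by simp
qed

section \<open>Smooth functions\<close>

lemma partial_eqI: "(f has_derivative f') (at x) \<Longrightarrow> partial j f x = f' (axis j 1)"
  unfolding partial_def using frechet_derivative_at by metis

lemma has_derivative_partial:
  fixes f :: "real^'n \<Rightarrow> 'b::real_normed_vector"
  assumes "f differentiable at x"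
  shows "(f has_derivative (\<lambda>h. \<Sum>j\<in>UNIV. h $ j *\<^sub>R partial j f x)) (at x)"
proof -
  let ?D = "frechet_derivative f (at x)"
  have D: "(f has_derivative ?D) (at x)" using assms by (simp add: frechet_derivative_works)
  then have lin: "linear ?D" by (rule has_derivative_linear)
  have "?D h = (\<Sum>j\<in>UNIV. h $ j *\<^sub>R partial j f x)" for h
  proof -
    have "h = (\<Sum>j\<in>UNIV. h $ j *\<^sub>R axis j 1)"
      by (simp add: basis_expansion flip: scalar_mult_eq_scaleR)
    then have "?D h = ?D (\<Sum>j\<in>UNIV. h $ j *\<^sub>R axis j 1)" by simp
    also have "\<dots> = (\<Sum>j\<in>UNIV. h $ j *\<^sub>R partial j f x)"
      by (simp add: partial_def linear_sum[OF lin] linear_scale[OF lin])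
    finally show ?thesis .
  qed
  then have "?D = (\<lambda>h. \<Sum>j\<in>UNIV. h $ j *\<^sub>R partial j f x)" by (rule ext)
  with D show ?thesis by (simp only:)
qed

lemma has_real_derivative_along:
  fixes f :: "real^'n \<Rightarrow> real"
  assumes "\<And>x. f differentiable at x"
  shows "((\<lambda>t. f (x + t *\<^sub>R v)) has_real_derivative (\<Sum>j\<in>UNIV. v $ j * partial j f (x + t *\<^sub>R v))) (at t)"
proof -
  have "((\<lambda>t. f (x + t *\<^sub>R v)) has_derivative (\<lambda>s. \<Sum>j\<in>UNIV. (s *\<^sub>R v) $ j *\<^sub>R partial j f (x + t *\<^sub>R v))) (at t)"
    by (rule has_derivative_compose[OF _ has_derivative_partial[OF assms], where f = "\<lambda>t. x + t *\<^sub>R v"])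
       (auto intro!: derivative_eq_intros)
  moreover have "(\<lambda>s. \<Sum>j\<in>UNIV. (s *\<^sub>R v) $ j *\<^sub>R partial j f (x + t *\<^sub>R v)) = (*) (\<Sum>j\<in>UNIV. v $ j * partial j f (x + t *\<^sub>R v))"
    by (auto simp: fun_eq_iff sum_distrib_left mult_ac)
  ultimately show ?thesis by (simp only: has_field_derivative_def)
qed

lemma has_real_derivative_along_axis:
  fixes f :: "real^'n \<Rightarrow> real"
  assumes "\<And>x. f differentiable at x"
  shows "((\<lambda>t. f (x + t *\<^sub>R axis j 1)) has_real_derivative partial j f (x + t *\<^sub>R axis j 1)) (at t)"
  using has_real_derivative_along[OF assms, of x "axis j 1" t]
  by (simp add: axis_def if_distrib[where f = "\<lambda>c. c * _"] cong: if_cong)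

section \<open>Calculus of continuously differentiable and smooth functions\<close>

lemma Ck_continuous: "Ck k f \<Longrightarrow> continuous_on UNIV f"
  by (cases k) (auto simp: continuous_on_eq_continuous_at differentiable_imp_continuous_within)

lemma Ck_mono_Suc: "Ck (Suc k) f \<Longrightarrow> Ck k f"
proof (induction k arbitrary: f)
  case 0
  then show ?case using Ck_continuous by fastforce
qed auto

lemma smooth_Ck: "smooth f \<Longrightarrow> Ck k f"
  by (simp add: smooth_def)

lemma smooth_differentiable: "smooth f \<Longrightarrow> f differentiable at x"
  using smooth_Ck[of f "Suc 0"] by simp

lemma smooth_continuous: "smooth f \<Longrightarrow> continuous_on UNIV f"
  using smooth_Ck[of f 0] by simp

lemma smooth_partial: "smooth f \<Longrightarrow> smooth (partial j f)"
  unfolding smooth_def using Ck.simps(2) by blast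

lemma partial_const [simp]: "partial j (\<lambda>x. c) = (\<lambda>x. 0)"
  by (rule ext) (rule partial_eqI[OF has_derivative_const])

lemma Ck_const: "Ck k (\<lambda>x. c)"
  by (induction k arbitrary: c) auto

lemma partial_bounded_linear: "bounded_linear f \<Longrightarrow> partial j f = (\<lambda>x. f (axis j 1))"
  by (rule ext) (rule partial_eqI[OF bounded_linear_imp_has_derivative])

lemma Ck_bounded_linear:
  assumes "bounded_linear f"
  shows "Ck k f"
  using assms Ck_const
  by (cases k) (auto simp: partial_bounded_linear linear_continuous_on bounded_linear_imp_differentiable)

lemma partial_add:
  "f differentiable at x \<Longrightarrow> g differentiable at x \<Longrightarrow> partial j (\<lambda>x. f x + g x) x = partial j f x + partial j g x"
  unfolding frechet_derivative_works partial_def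
  by (rule partial_eqI[unfolded partial_def, OF has_derivative_add])

lemma partial_mult:
  fixes f g :: "real^'n \<Rightarrow> real"
  shows "f differentiable at x \<Longrightarrow> g differentiable at x \<Longrightarrow>
    partial j (\<lambda>x. f x * g x) x = f x * partial j g x + partial j f x * g x"
  unfolding frechet_derivative_works partial_def
  by (rule partial_eqI[unfolded partial_def, OF has_derivative_mult])

lemma partial_scaleR_const:
  fixes f :: "real^'n \<Rightarrow> real"
  shows "f differentiable at x \<Longrightarrow> partial j (\<lambda>x. f x *\<^sub>R c) x = partial j f x *\<^sub>R c"
  unfolding frechet_derivative_works partial_def
  by (rule partial_eqI[unfolded partial_def, OF has_derivative_scaleR_left])

lemma Ck_add: "Ck k f \<Longrightarrow> Ck k g \<Longrightarrow> Ck k (\<lambda>x. f x + g x)"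
proof (induction k arbitrary: f g)
  case (Suc k)
  then have "partial j (\<lambda>x. f x + g x) = (\<lambda>x. partial j f x + partial j g x)" for j
    by (intro ext partial_add) auto
  with Suc show ?case by auto
qed (auto intro: continuous_intros)

lemma Ck_mult:
  fixes f g :: "real^'n \<Rightarrow> real"
  shows "Ck k f \<Longrightarrow> Ck k g \<Longrightarrow> Ck k (\<lambda>x. f x * g x)"
proof (induction k arbitrary: f g)
  case (Suc k)
  then have "partial j (\<lambda>x. f x * g x) = (\<lambda>x. f x * partial j g x + partial j f x * g x)" for j
    by (intro ext partial_mult) auto
  moreover have "Ck k f" "Ck k g" using Suc.prems Ck_mono_Suc by blast+
  ultimately show ?case using Suc by (auto intro: Ck_add)
qed (auto intro: continuous_intros)

lemma Ck_scaleR_const: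
  fixes f :: "real^'n \<Rightarrow> real"
  shows "Ck k f \<Longrightarrow> Ck k (\<lambda>x. f x *\<^sub>R c)"
proof (induction k arbitrary: f)
  case (Suc k)
  then have "partial j (\<lambda>x. f x *\<^sub>R c) = (\<lambda>x. partial j f x *\<^sub>R c)" for j
    by (intro ext partial_scaleR_const) auto
  with Suc show ?case by (auto simp: differentiable_scaleR)
qed (auto intro: continuous_intros)

lemma smooth_const: "smooth (\<lambda>x. c)"
  and smooth_bounded_linear: "bounded_linear f \<Longrightarrow> smooth f"
  and smooth_add: "smooth f \<Longrightarrow> smooth g \<Longrightarrow> smooth (\<lambda>x. f x + g x)"
  and smooth_mult: "smooth u \<Longrightarrow> smooth v \<Longrightarrow> smooth (\<lambda>x. u x * v x)"
  and smooth_scaleR_const: "smooth u \<Longrightarrow> smooth (\<lambda>x. u x *\<^sub>R c)"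
  for u v :: "real^'n \<Rightarrow> real"
  unfolding smooth_def by (auto intro: Ck_const Ck_bounded_linear Ck_add Ck_mult Ck_scaleR_const)

lemma smooth_cmult: "smooth f \<Longrightarrow> smooth (\<lambda>x. c * f x)" for f :: "real^'n \<Rightarrow> real"
  by (rule smooth_mult[OF smooth_const])

lemma smooth_diff: "smooth f \<Longrightarrow> smooth g \<Longrightarrow> smooth (\<lambda>x. f x - g x)" for f :: "real^'n \<Rightarrow> real"
  using smooth_add[OF _ smooth_cmult[where c = "-1"], of f g] by simp

lemma smooth_sum: "(\<And>i. i \<in> I \<Longrightarrow> smooth (f i)) \<Longrightarrow> smooth (\<lambda>x. \<Sum>i\<in>I. f i x)"
  by (induction I rule: infinite_finite_induct) (auto intro: smooth_const smooth_add)

lemma smooth_inner_self: "smooth (\<lambda>x::real^'n. x \<bullet> x)"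
  unfolding inner_vec_def inner_real_def
  by (intro smooth_sum smooth_mult smooth_bounded_linear bounded_linear_vec_nth)

lemma smooth_polynomial:
  fixes f :: "real^'n \<Rightarrow> real"
  shows "real_polynomial_function f \<Longrightarrow> smooth f"
  by (induction rule: real_polynomial_function.induct)
     (auto intro: smooth_const smooth_bounded_linear smooth_add smooth_mult)

lemma has_derivative_real_comp:
  fixes u :: "real^'n \<Rightarrow> real"
  assumes "u differentiable at x" "(F has_real_derivative F') (at (u x))"
  shows "((\<lambda>x. F (u x)) has_derivative (\<lambda>h. F' * frechet_derivative u (at x) h)) (at x)"
  using has_derivative_compose[OF assms(1)[unfolded frechet_derivative_works] assms(2)[unfolded has_field_derivative_def]]
  by simp

lemma partial_real_comp:
  fixes u :: "real^'n \<Rightarrow> real"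
  assumes "u differentiable at x" "(F has_real_derivative F') (at (u x))"
  shows "partial j (\<lambda>x. F (u x)) x = F' * partial j u x"
  using partial_eqI[OF has_derivative_real_comp[OF assms]] by (simp add: partial_def)

lemma smooth_powr:
  fixes u :: "real^'n \<Rightarrow> real"
  assumes u: "smooth u" "\<And>x. u x > 0"
  shows "smooth (\<lambda>x. u x powr a)"
proof -
  have "Ck k (\<lambda>x. u x powr a)" for k
  proof (induction k arbitrary: a)
    case 0
    have "u x \<noteq> 0" for x using u(2)[of x] by simp
    then show ?case using smooth_continuous[OF u(1)] by (auto intro!: continuous_intros)
  next
    case (Suc k)
    have d: "((\<lambda>t. t powr a) has_real_derivative a * u x powr (a - 1)) (at (u x))" for x
      using has_real_derivative_powr[OF u(2)] by simp
    have "(\<lambda>x. u x powr a) differentiable at x" for x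
      using has_derivative_real_comp[OF smooth_differentiable[OF u(1)] d] by (auto simp: differentiable_def)
    moreover have "partial j (\<lambda>x. u x powr a) = (\<lambda>x. (a * u x powr (a - 1)) * partial j u x)" for j
      using partial_real_comp[OF smooth_differentiable[OF u(1)] d] by auto
    ultimately show ?case
      using Suc smooth_Ck[OF smooth_partial[OF u(1)]] by (auto intro!: Ck_mult Ck_const)
  qed
  then show ?thesis by (simp add: smooth_def)
qed

text \<open>The function exp(-1/t), continued by 0, and its quotients by powers of t. Derivatives of
  these are combinations of others with larger index, so an induction on the order of
  differentiation never leaves the family.\<close>

definition flat_exp :: "nat \<Rightarrow> real \<Rightarrow> real" where
  "flat_exp n t = (if t > 0 then exp (- 1 / t) / t ^ n else 0)"

lemma flat_exp_tendsto_0: "(flat_exp n \<longlongrightarrow> 0) (at 0)"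
proof -
  have "((\<lambda>t. inverse t ^ n / exp (inverse t)) \<longlongrightarrow> 0) (at_right (0::real))"
    by (rule filterlim_compose[OF tendsto_power_div_exp_0 filterlim_inverse_at_top_right])
  then have "(flat_exp n \<longlongrightarrow> 0) (at_right 0)"
    by (rule Lim_transform_eventually)
       (auto simp: flat_exp_def eventually_at_filter exp_minus field_simps)
  moreover have "(flat_exp n \<longlongrightarrow> 0) (at_left 0)"
    by (rule Lim_transform_eventually[OF tendsto_const]) (auto simp: flat_exp_def eventually_at_filter)
  ultimately show ?thesis by (simp add: filterlim_at_split)
qed

lemma flat_exp_has_derivative:
  "(flat_exp n has_real_derivative flat_exp (n + 2) t - n * flat_exp (n + 1) t) (at t)"
proof -
  have pm: "t ^ (n - 1) = t * t ^ (n - 1 - Suc 0) \<or> n - 1 = 0"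
    by (cases "n - 1") auto
  consider "t > 0" | "t < 0" | "t = 0" by linarith
  then show ?thesis
  proof cases
    case 1
    have "((\<lambda>t. exp (- 1 / t) / t ^ n) has_real_derivative flat_exp (n + 2) t - n * flat_exp (n + 1) t) (at t)"
      using 1 pm by (cases n) (auto intro!: derivative_eq_intros simp: flat_exp_def field_simps power2_eq_square)
    then show ?thesis
      by (rule has_field_derivative_transform_within_open[of _ _ _ "{0<..}"]) (use 1 in \<open>auto simp: flat_exp_def\<close>)
  next
    case 2
    have "((\<lambda>t. 0) has_real_derivative flat_exp (n + 2) t - n * flat_exp (n + 1) t) (at t)"
      using 2 by (auto simp: flat_exp_def)
    then show ?thesis
      by (rule has_field_derivative_transform_within_open[of _ _ _ "{..<0}"]) (use 2 in \<open>auto simp: flat_exp_def\<close>)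
  next
    case 3
    have "((\<lambda>h. (flat_exp n (0 + h) - flat_exp n 0) / h) \<longlongrightarrow> 0) (at 0)"
      by (rule Lim_transform_eventually[OF flat_exp_tendsto_0[of "n + 1"]])
         (auto simp: flat_exp_def eventually_at_filter)
    then show ?thesis unfolding 3 DERIV_def by (simp add: flat_exp_def)
  qed
qed

lemma smooth_flat_exp:
  fixes u :: "real^'n \<Rightarrow> real"
  assumes u: "smooth u"
  shows "smooth (\<lambda>x. flat_exp n (u x))"
proof -
  have "Ck k (\<lambda>x. flat_exp n (u x))" for k
  proof (induction k arbitrary: n)
    case 0
    have "continuous_on UNIV (flat_exp n)"
      by (auto simp: continuous_on_eq_continuous_at intro: DERIV_isCont[OF flat_exp_has_derivative])
    then show ?case using continuous_on_compose2[OF _ smooth_continuous[OF u]] by auto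
  next
    case (Suc k)
    have "(\<lambda>x. flat_exp n (u x)) differentiable at x" for x
      using has_derivative_real_comp[OF smooth_differentiable[OF u] flat_exp_has_derivative] by (auto simp: differentiable_def)
    moreover have "partial j (\<lambda>x. flat_exp n (u x))
        = (\<lambda>x. (flat_exp (n + 2) (u x) + (- real n) * flat_exp (n + 1) (u x)) * partial j u x)" for j
      using partial_real_comp[OF smooth_differentiable[OF u] flat_exp_has_derivative] by auto
    moreover have "Ck k (\<lambda>x. (flat_exp (n + 2) (u x) + (- real n) * flat_exp (n + 1) (u x)) * partial j u x)" for j
      by (intro Ck_mult Ck_add Ck_const Suc smooth_Ck[OF smooth_partial[OF u]])
    ultimately show ?case by (simp only: Ck.simps) blast
  qed
  then show ?thesis by (simp add: smooth_def)
qed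

lemma smooth_cutoff:
  fixes a b :: real
  assumes "0 < a" "a < b"
  obtains \<theta> :: "real^'n \<Rightarrow> real" where "smooth \<theta>" "\<And>x. 0 \<le> \<theta> x" "\<And>x. \<theta> x \<le> 1"
    "\<And>x. norm x \<le> a \<Longrightarrow> \<theta> x = 1" "\<And>x. b \<le> norm x \<Longrightarrow> \<theta> x = 0" "\<And>x. norm x < b \<Longrightarrow> 0 < \<theta> x"
proof -
  define X where "X = (\<lambda>x::real^'n. flat_exp 0 (b\<^sup>2 - x \<bullet> x))"
  define Y where "Y = (\<lambda>x::real^'n. flat_exp 0 (x \<bullet> x - a\<^sup>2))"
  have sq: "x \<bullet> x = (norm x)\<^sup>2" for x :: "real^'n" by (simp add: power2_norm_eq_inner)
  have bx: "(norm x)\<^sup>2 < b\<^sup>2 \<longleftrightarrow> norm x < b" "b\<^sup>2 \<le> (norm x)\<^sup>2 \<longleftrightarrow> b \<le> norm x" for x :: "real^'n"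
    using assms power_mono_iff[of b "norm x" 2] by (auto simp flip: not_le)
  have ax: "a\<^sup>2 < (norm x)\<^sup>2 \<longleftrightarrow> a < norm x" "(norm x)\<^sup>2 \<le> a\<^sup>2 \<longleftrightarrow> norm x \<le> a" for x :: "real^'n"
    using assms power_mono_iff[of "norm x" a 2] by (auto simp flip: not_le)
  have X: "X x \<ge> 0" "X x > 0 \<longleftrightarrow> norm x < b" "X x = 0 \<longleftrightarrow> b \<le> norm x" for x
    using assms by (auto simp: X_def flat_exp_def sq not_less bx ax)
  have Y: "Y x \<ge> 0" "Y x > 0 \<longleftrightarrow> a < norm x" "Y x = 0 \<longleftrightarrow> norm x \<le> a" for x
    using assms by (auto simp: Y_def flat_exp_def sq not_less bx ax)
  have XY: "X x + Y x > 0" for x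
    using X[of x] Y[of x] assms by (cases "norm x < b") auto
  have sX: "smooth X" unfolding X_def by (intro smooth_flat_exp smooth_diff smooth_const smooth_inner_self)
  have sY: "smooth Y" unfolding Y_def by (intro smooth_flat_exp smooth_diff smooth_const smooth_inner_self)
  \<comment> \<open>This is X/(X + Y). As X is positive exactly inside radius b and Y exactly
    outside radius a < b, the denominator never vanishes. It is written with the power -1 so that
    \<open>smooth_powr\<close> applies.\<close>
  define \<theta> where "\<theta> = (\<lambda>x. X x * (X x + Y x) powr (- 1))"
  have \<theta>: "\<theta> x = X x / (X x + Y x)" for x using XY[of x] by (simp add: \<theta>_def powr_minus_divide)
  show ?thesis
  proof (rule that)
    show "smooth \<theta>" unfolding \<theta>_def by (intro smooth_mult smooth_powr smooth_add sX sY XY)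
    show "0 \<le> \<theta> x" "\<theta> x \<le> 1" for x using XY[of x] X[of x] Y[of x] by (auto simp: \<theta>)
    show "norm x \<le> a \<Longrightarrow> \<theta> x = 1" for x using XY[of x] Y(3)[of x] by (simp add: \<theta>)
    show "b \<le> norm x \<Longrightarrow> \<theta> x = 0" for x using X(3)[of x] by (simp add: \<theta>)
    show "norm x < b \<Longrightarrow> 0 < \<theta> x" for x using XY[of x] X(2)[of x] by (simp add: \<theta>)
  qed
qed

text \<open>The mixed second difference with step h is symmetric in i and j, and two uses of the
  mean value theorem make it h^2 times either mixed derivative at some point within 2 h of x.
  Continuity of the second derivatives then identifies the two limits.\<close>

lemma partial_commute:
  fixes f :: "real^'n \<Rightarrow> real"
  assumes f: "smooth f"
  shows "partial i (partial j f) x = partial j (partial i f) x"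
proof -
  have mv: "\<exists>z. norm (z - x) \<le> 2 * h \<and> (f (x + h *\<^sub>R axis i 1 + h *\<^sub>R axis j 1) - f (x + h *\<^sub>R axis i 1)) - (f (x + h *\<^sub>R axis j 1) - f x)
      = h * h * partial j (partial i f) z" if h: "h > 0" for h i j
  proof -
    let ?g = "\<lambda>s. f ((x + h *\<^sub>R axis j 1) + s *\<^sub>R axis i 1) - f (x + s *\<^sub>R axis i 1)"
    have "\<exists>s. 0 < s \<and> s < h \<and> ?g h - ?g 0 = (h - 0) * (partial i f ((x + h *\<^sub>R axis j 1) + s *\<^sub>R axis i 1) - partial i f (x + s *\<^sub>R axis i 1))"
      by (rule MVT2[OF h]) (intro DERIV_diff has_real_derivative_along_axis smooth_differentiable f)
    then obtain s where s: "0 < s" "s < h" "?g h - ?g 0 = h * (partial i f ((x + h *\<^sub>R axis j 1) + s *\<^sub>R axis i 1) - partial i f (x + s *\<^sub>R axis i 1))"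
      by auto
    have "\<exists>t. 0 < t \<and> t < h \<and> partial i f ((x + s *\<^sub>R axis i 1) + h *\<^sub>R axis j 1) - partial i f ((x + s *\<^sub>R axis i 1) + 0 *\<^sub>R axis j 1)
       = (h - 0) * partial j (partial i f) ((x + s *\<^sub>R axis i 1) + t *\<^sub>R axis j 1)"
      by (rule MVT2[OF h]) (intro has_real_derivative_along_axis smooth_differentiable smooth_partial f)
    then obtain t where t: "0 < t" "t < h" "partial i f ((x + s *\<^sub>R axis i 1) + h *\<^sub>R axis j 1) - partial i f (x + s *\<^sub>R axis i 1)
       = h * partial j (partial i f) ((x + s *\<^sub>R axis i 1) + t *\<^sub>R axis j 1)" by auto
    let ?z = "(x + s *\<^sub>R axis i 1) + t *\<^sub>R axis j 1"
    have "norm (?z - x) \<le> norm (s *\<^sub>R axis i (1::real) :: real^'n) + norm (t *\<^sub>R axis j (1::real) :: real^'n)"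
      using norm_triangle_ineq[of "s *\<^sub>R axis i 1" "t *\<^sub>R axis j 1 :: real^'n"] by (simp add: add.assoc)
    also have "\<dots> \<le> 2 * h" using s t by (simp add: norm_axis_1)
    finally have "norm (?z - x) \<le> 2 * h" .
    moreover have "?g h - ?g 0 = h * h * partial j (partial i f) ?z"
      using s(3) t(3) by (simp add: add_ac)
    ultimately show ?thesis by (intro exI[of _ ?z]) (simp add: add_ac)
  qed
  have cont: "isCont (partial i (partial j f)) x" for i j
    using smooth_continuous[OF smooth_partial[OF smooth_partial[OF f]]] by (simp add: continuous_on_eq_continuous_at)
  have "\<exists>z z'. norm (z - x) \<le> 2 / real (Suc n) \<and> norm (z' - x) \<le> 2 / real (Suc n) \<and> partial j (partial i f) z = partial i (partial j f) z'" for n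
  proof -
    have h: "1 / real (Suc n) > 0" by simp
    let ?h = "1 / real (Suc n)"
    obtain z where z: "norm (z - x) \<le> 2 * ?h" "(f (x + ?h *\<^sub>R axis i 1 + ?h *\<^sub>R axis j 1) - f (x + ?h *\<^sub>R axis i 1)) - (f (x + ?h *\<^sub>R axis j 1) - f x)
      = ?h * ?h * partial j (partial i f) z" using mv[OF h, of i j] by blast
    obtain z' where z': "norm (z' - x) \<le> 2 * ?h" "(f (x + ?h *\<^sub>R axis j 1 + ?h *\<^sub>R axis i 1) - f (x + ?h *\<^sub>R axis j 1)) - (f (x + ?h *\<^sub>R axis i 1) - f x)
      = ?h * ?h * partial i (partial j f) z'" using mv[OF h, of j i] by blast
    have "x + ?h *\<^sub>R axis i 1 + ?h *\<^sub>R axis j 1 = x + ?h *\<^sub>R axis j 1 + ?h *\<^sub>R axis i 1" by (simp add: add_ac)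
    then have "?h * ?h * partial j (partial i f) z = ?h * ?h * partial i (partial j f) z'"
      using z(2) z'(2) by (simp only:)
    then have "partial j (partial i f) z = partial i (partial j f) z'" by simp
    with z z' show ?thesis by auto
  qed
  then obtain z z' where z: "\<And>n. norm (z n - x) \<le> 2 / real (Suc n)" "\<And>n. norm (z' n - x) \<le> 2 / real (Suc n)"
    "\<And>n. partial j (partial i f) (z n) = partial i (partial j f) (z' n)" by metis
  have lim0: "(\<lambda>n. 2 / real (Suc n)) \<longlonglongrightarrow> 0"
    using LIMSEQ_inverse_real_of_nat tendsto_mult_right_zero[of "\<lambda>n. inverse (real (Suc n))" sequentially 2] by (simp add: field_simps)
  have "z \<longlonglongrightarrow> x" "z' \<longlonglongrightarrow> x"
    using z by (auto intro!: metric_tendsto_imp_tendsto[OF lim0] simp: dist_norm always_eventually)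
  then have "(\<lambda>n. partial j (partial i f) (z n)) \<longlonglongrightarrow> partial j (partial i f) x"
    "(\<lambda>n. partial i (partial j f) (z' n)) \<longlonglongrightarrow> partial i (partial j f) x"
    using cont isCont_tendsto_compose by blast+
  then show ?thesis using z(3) LIMSEQ_unique by auto
qed

section \<open>Second derivatives and the Laplacian in \<open>L\<^sup>p\<close>\<close>

definition laplacian :: "(real^'n \<Rightarrow> real) \<Rightarrow> real^'n \<Rightarrow> real" where
  "laplacian f x = (\<Sum>j\<in>UNIV. partial j (partial j f) x)"

text \<open>The Hessian at x as a bilinear form. It gives access to second derivatives along
  arbitrary steps and to polarisation.\<close>

definition second_form :: "(real^'n \<Rightarrow> real) \<Rightarrow> real^'n \<Rightarrow> real^'n \<Rightarrow> real^'n \<Rightarrow> real" where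
  "second_form f x v w = (\<Sum>j\<in>UNIV. \<Sum>i\<in>UNIV. v $ j * w $ i * partial i (partial j f) x)"

lemma second_form_add_left: "second_form f x (v + v') w = second_form f x v w + second_form f x v' w"
  and second_form_add_right: "second_form f x v (w + w') = second_form f x v w + second_form f x v w'"
  by (simp_all add: second_form_def algebra_simps sum.distrib)

lemma second_form_scale_left: "second_form f x (c *\<^sub>R v) w = c * second_form f x v w"
  and second_form_scale_right: "second_form f x v (c *\<^sub>R w) = c * second_form f x v w"
  by (simp_all add: second_form_def sum_distrib_left mult_ac)

lemma second_form_zero_left: "second_form f x 0 w = 0"
  and second_form_zero_right: "second_form f x v 0 = 0"
  by (simp_all add: second_form_def)

lemma second_form_sum_left: "second_form f x (\<Sum>i\<in>I. v i) w = (\<Sum>i\<in>I. second_form f x (v i) w)"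
  by (induction I rule: infinite_finite_induct) (simp_all add: second_form_zero_left second_form_add_left)

lemma second_form_sum_right: "second_form f x v (\<Sum>i\<in>I. w i) = (\<Sum>i\<in>I. second_form f x v (w i))"
  by (induction I rule: infinite_finite_induct) (simp_all add: second_form_zero_right second_form_add_right)

lemma second_form_axis: "second_form f x (axis i 1) (axis j 1) = partial j (partial i f) x"
  by (simp add: second_form_def axis_def if_distrib[where f = "\<lambda>c. c * _"] if_distrib[where f = "\<lambda>c. _ * c"] cong: if_cong)

lemma continuous_on_second_form: "smooth f \<Longrightarrow> continuous_on UNIV (\<lambda>x. second_form f x v w)"
  unfolding second_form_def
  by (intro continuous_intros smooth_continuous smooth_partial)

section \<open>Supports, bounds and derivatives of compactly supported functions\<close>

lemma partial_zero_outside: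
  fixes f :: "real^'n \<Rightarrow> 'b::real_normed_vector"
  assumes "\<And>x. x \<notin> cball 0 R \<Longrightarrow> f x = 0" "x \<notin> cball 0 R"
  shows "partial j f x = 0"
proof -
  have "((\<lambda>x. 0) has_derivative (\<lambda>h. 0)) (at x)" by simp
  then have "(f has_derivative (\<lambda>h. 0)) (at x)"
    by (rule has_derivative_transform_within_open[of "\<lambda>x. 0" "\<lambda>h. 0" x UNIV "- cball 0 R"]) (use assms in auto)
  then show ?thesis using partial_eqI by metis
qed

lemma compactly_supportedI:
  assumes "continuous_on UNIV f" "\<And>x. x \<notin> cball 0 R \<Longrightarrow> f x = 0"
  shows "compactly_supported f"
proof -
  have "bounded {x. f x \<noteq> 0}"
    by (rule bounded_subset[OF bounded_cball[of 0 R]]) (use assms(2) in blast)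
  with assms(1) show ?thesis by (simp add: compactly_supported_def)
qed

lemma compactly_supported_zero_outside:
  assumes "compactly_supported f"
  obtains R where "R > 0" "\<And>x. x \<notin> cball 0 R \<Longrightarrow> f x = 0"
proof -
  have "bounded {x. f x \<noteq> 0}" using assms by (simp add: compactly_supported_def)
  then obtain R where "\<And>x. f x \<noteq> 0 \<Longrightarrow> norm x \<le> R" unfolding bounded_iff by blast
  then show thesis by (intro that[of "max R 1"]) (force simp: le_max_iff_disj)+
qed

lemma compactly_supported_partial:
  fixes f :: "real^'n \<Rightarrow> real"
  assumes "smooth f" "compactly_supported f"
  shows "compactly_supported (partial j f)"
proof -
  obtain R where R: "\<And>x. x \<notin> cball 0 R \<Longrightarrow> f x = 0" using assms compactly_supported_zero_outside by blast
  show ?thesis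
    by (rule compactly_supportedI[OF smooth_continuous[OF smooth_partial[OF assms(1)]] partial_zero_outside[OF R]])
qed

lemma compactly_supported_bounded:
  assumes "compactly_supported f"
  obtains K where "K > 0" "\<And>x. \<bar>f x\<bar> \<le> K"
proof -
  obtain R where R: "\<And>x. x \<notin> cball 0 R \<Longrightarrow> f x = 0" using assms compactly_supported_zero_outside by blast
  have "compact (f ` cball 0 R)"
    using assms continuous_on_subset by (intro compact_continuous_image) (auto simp: compactly_supported_def)
  then have "bounded (f ` cball 0 R)" by (rule compact_imp_bounded)
  then obtain K where K: "K > 0" "\<And>x. x \<in> cball 0 R \<Longrightarrow> \<bar>f x\<bar> \<le> K" unfolding bounded_pos by auto
  then have "\<bar>f x\<bar> \<le> K" for x using R[of x] by (cases "x \<in> cball 0 R") auto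
  with K that show thesis by blast
qed

lemma compactly_supported_second_form:
  assumes "smooth f" "compactly_supported f"
  shows "compactly_supported (\<lambda>x. second_form f x v w)"
  unfolding second_form_def
  by (intro compactly_supported_sum compactly_supported_cmult compactly_supported_partial smooth_partial assms)

lemma compactly_supported_laplacian:
  assumes "smooth f" "compactly_supported f"
  shows "compactly_supported (laplacian f)"
proof -
  have "compactly_supported (\<lambda>x. laplacian f x)"
    unfolding laplacian_def by (intro compactly_supported_sum compactly_supported_partial smooth_partial assms)
  then show ?thesis by simp
qed

definition second_difference :: "'a \<Rightarrow> ('a \<Rightarrow> real) \<Rightarrow> 'a::real_vector \<Rightarrow> real" where
  "second_difference v W x = W (x + v) + W (x - v) - 2 * W x"

text \<open>Maclaurin's formula of order two for the even function t -> W (x + t v) + W (x - t v),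
  whose first derivative vanishes at 0. This is why the remainder sits at two symmetric points with
  a common s.\<close>

lemma second_difference_taylor:
  fixes W :: "real^'n \<Rightarrow> real"
  assumes W: "smooth W" and h: "h > 0"
  obtains s where "0 < s" "s < h"
    "second_difference (h *\<^sub>R v) W x = h\<^sup>2 / 2 * (second_form W (x + s *\<^sub>R v) v v + second_form W (x - s *\<^sub>R v) v v)"
proof -
  define \<phi> where "\<phi> = (\<lambda>t. W (x + t *\<^sub>R v))"
  define \<phi>' where "\<phi>' = (\<lambda>t. \<Sum>j\<in>UNIV. v $ j * partial j W (x + t *\<^sub>R v))"
  define \<phi>'' where "\<phi>'' = (\<lambda>t. second_form W (x + t *\<^sub>R v) v v)"
  have d1: "(\<phi> has_real_derivative \<phi>' t) (at t)" for t
    unfolding \<phi>_def \<phi>'_def by (rule has_real_derivative_along) (rule smooth_differentiable[OF W])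
  have d2: "(\<phi>' has_real_derivative \<phi>'' t) (at t)" for t
  proof -
    have "(\<phi>' has_real_derivative (\<Sum>j\<in>UNIV. v $ j * (\<Sum>i\<in>UNIV. v $ i * partial i (partial j W) (x + t *\<^sub>R v)))) (at t)"
      unfolding \<phi>'_def
      by (intro DERIV_sum DERIV_cmult has_real_derivative_along smooth_differentiable smooth_partial W)
    also have "(\<Sum>j\<in>UNIV. v $ j * (\<Sum>i\<in>UNIV. v $ i * partial i (partial j W) (x + t *\<^sub>R v))) = \<phi>'' t"
      by (simp add: \<phi>''_def second_form_def sum_distrib_left mult.assoc)
    finally show ?thesis .
  qed
  have m: "((\<lambda>t. F (- t)) has_real_derivative - F' (- t)) (at t)" if "\<And>t. (F has_real_derivative F' t) (at t)" for F F' :: "real \<Rightarrow> real" and t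
    using DERIV_mirror[of F "F' (- t)" t] that by simp
  define D where "D = (\<lambda>m::nat. if m = 0 then (\<lambda>t. \<phi> t + \<phi> (- t)) else if m = 1 then (\<lambda>t. \<phi>' t - \<phi>' (- t)) else (\<lambda>t. \<phi>'' t + \<phi>'' (- t)))"
  have "\<exists>t>0. t < h \<and> D 0 h = (\<Sum>m<2. D m 0 / fact m * h ^ m) + D 2 t / fact 2 * h ^ 2"
  proof (rule Maclaurin[OF h])
    show "\<forall>m t. m < 2 \<and> 0 \<le> t \<and> t \<le> h \<longrightarrow> (D m has_real_derivative D (Suc m) t) (at t)"
    proof (intro allI impI)
      fix m :: nat and t assume "m < 2 \<and> 0 \<le> t \<and> t \<le> h"
      then consider "m = 0" | "m = 1" by linarith
      then show "(D m has_real_derivative D (Suc m) t) (at t)"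
      proof cases
        case 1
        have "((\<lambda>t. \<phi> t + \<phi> (- t)) has_real_derivative \<phi>' t + (- \<phi>' (- t))) (at t)"
          by (rule DERIV_add[OF d1 m[OF d1]])
        with 1 show ?thesis by (simp add: D_def)
      next
        case 2
        have "((\<lambda>t. \<phi>' t - \<phi>' (- t)) has_real_derivative \<phi>'' t - (- \<phi>'' (- t))) (at t)"
          by (rule DERIV_diff[OF d2 m[OF d2]])
        with 2 show ?thesis by (simp add: D_def)
      qed
    qed
  qed auto
  then obtain s where s: "0 < s" "s < h" "D 0 h = (\<Sum>m<2. D m 0 / fact m * h ^ m) + D 2 s / fact 2 * h ^ 2" by blast
  have "second_difference (h *\<^sub>R v) W x = D 0 h - D 0 0"
    by (simp add: second_difference_def D_def \<phi>_def)
  also have "\<dots> = h\<^sup>2 / 2 * (\<phi>'' s + \<phi>'' (- s))"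
    unfolding s(3) by (simp add: D_def numeral_2_eq_2 field_simps)
  finally show thesis using that s by (simp add: \<phi>''_def)
qed

lemma second_difference_bound:
  fixes W :: "real^'n \<Rightarrow> real"
  assumes W: "smooth W" and h: "h > 0" and K: "\<And>x. \<bar>second_form W x v v\<bar> \<le> K"
  shows "\<bar>second_difference (h *\<^sub>R v) W x / h\<^sup>2\<bar> \<le> K"
proof -
  obtain s where s: "second_difference (h *\<^sub>R v) W x = h\<^sup>2 / 2 * (second_form W (x + s *\<^sub>R v) v v + second_form W (x - s *\<^sub>R v) v v)"
    using second_difference_taylor[OF W h] by metis
  have "\<bar>second_difference (h *\<^sub>R v) W x / h\<^sup>2\<bar> = \<bar>second_form W (x + s *\<^sub>R v) v v + second_form W (x - s *\<^sub>R v) v v\<bar> / 2"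
    using h by (simp add: s abs_mult)
  also have "\<dots> \<le> (K + K) / 2"
    by (intro divide_right_mono order_trans[OF abs_triangle_ineq] add_mono K) simp
  finally show ?thesis by simp
qed

lemma second_difference_tendsto:
  fixes W :: "real^'n \<Rightarrow> real"
  assumes W: "smooth W"
  shows "((\<lambda>h. second_difference (h *\<^sub>R v) W x / h\<^sup>2) \<longlongrightarrow> second_form W x v v) (at_right 0)"
proof -
  have "\<forall>h>0. \<exists>s. 0 < s \<and> s < h \<and> second_difference (h *\<^sub>R v) W x = h\<^sup>2 / 2 * (second_form W (x + s *\<^sub>R v) v v + second_form W (x - s *\<^sub>R v) v v)"
    using second_difference_taylor[OF W] by metis
  then obtain s where s: "\<And>h. h > 0 \<Longrightarrow> 0 < s h \<and> s h < h \<and> second_difference (h *\<^sub>R v) W x = h\<^sup>2 / 2 * (second_form W (x + s h *\<^sub>R v) v v + second_form W (x - s h *\<^sub>R v) v v)"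
    by metis
  have pos: "\<forall>\<^sub>F h in at_right 0. 0 < (h::real)" by (rule eventually_at_right_less)
  have "(s \<longlongrightarrow> 0) (at_right 0)"
  proof (rule tendsto_sandwich[OF _ _ tendsto_const])
    show "((\<lambda>h. h) \<longlongrightarrow> 0) (at_right (0::real))" by simp
  qed (use s in \<open>auto intro!: eventually_mono[OF pos] less_imp_le\<close>)
  then have "((\<lambda>h. x + s h *\<^sub>R v) \<longlongrightarrow> x) (at_right 0)" "((\<lambda>h. x - s h *\<^sub>R v) \<longlongrightarrow> x) (at_right 0)"
    by (auto intro!: tendsto_eq_intros)
  moreover have "isCont (\<lambda>y. second_form W y v v) x"
    using continuous_on_second_form[OF W] by (simp add: continuous_on_eq_continuous_at)
  ultimately have "((\<lambda>h. second_form W (x + s h *\<^sub>R v) v v) \<longlongrightarrow> second_form W x v v) (at_right 0)"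
     "((\<lambda>h. second_form W (x - s h *\<^sub>R v) v v) \<longlongrightarrow> second_form W x v v) (at_right 0)"
    by (auto intro: isCont_tendsto_compose)
  then have "((\<lambda>h. (second_form W (x + s h *\<^sub>R v) v v + second_form W (x - s h *\<^sub>R v) v v) / 2) \<longlongrightarrow> (second_form W x v v + second_form W x v v) / 2) (at_right 0)"
    by (intro tendsto_intros) auto
  moreover have "\<forall>\<^sub>F h in at_right 0. (second_form W (x + s h *\<^sub>R v) v v + second_form W (x - s h *\<^sub>R v) v v) / 2 = second_difference (h *\<^sub>R v) W x / h\<^sup>2"
    using s by (auto intro!: eventually_mono[OF pos])
  ultimately have "((\<lambda>h. second_difference (h *\<^sub>R v) W x / h\<^sup>2) \<longlongrightarrow> (second_form W x v v + second_form W x v v) / 2) (at_right 0)"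
    by (rule Lim_transform_eventually)
  then show ?thesis by simp
qed

text \<open>Discrete integration by parts: translation invariance collects the four products into a
  second difference of W against g.\<close>

lemma integral_increment_product:
  assumes W: "compactly_supported W" and g: "compactly_supported g"
  shows "(\<integral>x. increment e W x * increment e g x \<partial>lborel) = - (\<integral>x. second_difference e W x * g x \<partial>lborel)"
proof -
  have cs: "compactly_supported (\<lambda>x. W (x + a) * g (x + b))" for a b
    by (intro compactly_supported_mult compactly_supported_translate W g)
  have int: "integrable lborel (\<lambda>x. W (x + a) * g (x + b))" for a b
    by (rule compactly_supported_integrable[OF cs])
  have T: "(\<integral>x. W (x + a + e) * g (x + b + e) \<partial>lborel) = (\<integral>x. W (x + a) * g (x + b) \<partial>lborel)" for a b
    using integral_lborel_translate[of "\<lambda>x. W (x + a) * g (x + b)" e] compactly_supported_measurable[OF cs]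
    by (simp add: add_ac)
  have "(\<integral>x. increment e W x * increment e g x \<partial>lborel)
     = (\<integral>x. (W (x + e) * g (x + e) - W (x + 0) * g (x + e)) - (W (x + e) * g (x + 0) - W (x + 0) * g (x + 0)) \<partial>lborel)"
    by (simp add: increment_def algebra_simps)
  also have "\<dots> = ((\<integral>x. W (x + e) * g (x + e) \<partial>lborel) - (\<integral>x. W (x + 0) * g (x + e) \<partial>lborel)) - ((\<integral>x. W (x + e) * g (x + 0) \<partial>lborel) - (\<integral>x. W (x + 0) * g (x + 0) \<partial>lborel))"
    by (simp only: Bochner_Integration.integral_diff int Bochner_Integration.integrable_diff)
  also have "(\<integral>x. W (x + e) * g (x + e) \<partial>lborel) = (\<integral>x. W (x + 0) * g (x + 0) \<partial>lborel)"
    using T[of 0 0] by simp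
  also have "(\<integral>x. W (x + 0) * g (x + e) \<partial>lborel) = (\<integral>x. W (x + - e) * g (x + 0) \<partial>lborel)"
    using T[of "- e" 0] by simp
  also have "(\<integral>x. W (x + 0) * g (x + 0) \<partial>lborel) - (\<integral>x. W (x + - e) * g (x + 0) \<partial>lborel) - ((\<integral>x. W (x + e) * g (x + 0) \<partial>lborel) - (\<integral>x. W (x + 0) * g (x + 0) \<partial>lborel))
    = - (\<integral>x. (W (x + e) * g (x + 0) + W (x + - e) * g (x + 0)) - 2 * (W (x + 0) * g (x + 0)) \<partial>lborel)"
    by (simp only: Bochner_Integration.integral_diff Bochner_Integration.integral_add int Bochner_Integration.integrable_add Bochner_Integration.integrable_mult_right Bochner_Integration.integral_mult_right_zero)
  also have "\<dots> = - (\<integral>x. second_difference e W x * g x \<partial>lborel)"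
    by (simp add: second_difference_def algebra_simps)
  finally show ?thesis .
qed

text \<open>Expanding the double average gives first differences along the steps and along their
  pairwise sums. These are only of first order in the step length. Averaging the formula with its
  image under \<tau> pairs each vector with its negative, which produces second differences and
  turns the denominator 4 into 8.\<close>

lemma avg_twice_second_differences:
  fixes d :: "'i \<Rightarrow> 'a::euclidean_space"
  assumes I: "finite I" "I \<noteq> {}" and sym: "bij_betw \<tau> I I" "\<And>i. i \<in> I \<Longrightarrow> d (\<tau> i) = - d i"
  shows "W x - half_step_avg I d (half_step_avg I d W) x =
    - (\<Sum>i\<in>I. \<Sum>j\<in>I. second_difference (d i) W x + second_difference (d j) W x + second_difference (d i + d j) W x) / (8 * (real (card I))\<^sup>2)"
proof -
  define N where "N = real (card I)"
  have N: "N > 0" using I by (simp add: N_def card_gt_0_iff)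
  define G where "G = (\<lambda>v w. (W (x + v) - W x) + (W (x + w) - W x) + (W (x + v + w) - W x))"
  have avg: "half_step_avg I d u y = (\<Sum>j\<in>I. u y + u (y + d j)) / (2 * N)" for u y
    by (simp add: half_step_avg_def N_def sum_divide_distrib)
  have "half_step_avg I d (half_step_avg I d W) x = (\<Sum>i\<in>I. (\<Sum>j\<in>I. (W x + W (x + d j)) + (W (x + d i) + W (x + d i + d j))) / (2 * N)) / (2 * N)"
    by (simp only: avg sum.distrib add_divide_distrib)
  also have "\<dots> = (\<Sum>i\<in>I. \<Sum>j\<in>I. (W x + W (x + d j)) + (W (x + d i) + W (x + d i + d j))) / (4 * N\<^sup>2)"
    unfolding sum_divide_distrib[symmetric] by (simp add: power2_eq_square)
  finally have A: "half_step_avg I d (half_step_avg I d W) x = (\<Sum>i\<in>I. \<Sum>j\<in>I. (W x + W (x + d j)) + (W (x + d i) + W (x + d i + d j))) / (4 * N\<^sup>2)" .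
  have B: "W x = (\<Sum>i\<in>I. \<Sum>j\<in>I. 4 * W x) / (4 * N\<^sup>2)"
    using N by (simp add: N_def power2_eq_square)
  have "W x - half_step_avg I d (half_step_avg I d W) x
     = (\<Sum>i\<in>I. \<Sum>j\<in>I. 4 * W x) / (4 * N\<^sup>2) - (\<Sum>i\<in>I. \<Sum>j\<in>I. (W x + W (x + d j)) + (W (x + d i) + W (x + d i + d j))) / (4 * N\<^sup>2)"
    by (rule arg_cong2[OF B A, of minus])
  also have "\<dots> = (\<Sum>i\<in>I. \<Sum>j\<in>I. 4 * W x - ((W x + W (x + d j)) + (W (x + d i) + W (x + d i + d j)))) / (4 * N\<^sup>2)"
    by (simp only: sum_subtractf diff_divide_distrib)
  also have "(\<Sum>i\<in>I. \<Sum>j\<in>I. 4 * W x - ((W x + W (x + d j)) + (W (x + d i) + W (x + d i + d j)))) = (\<Sum>i\<in>I. \<Sum>j\<in>I. - G (d i) (d j))"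
    by (intro sum.cong refl) (simp add: G_def)
  finally have 1: "W x - half_step_avg I d (half_step_avg I d W) x = - (\<Sum>i\<in>I. \<Sum>j\<in>I. G (d i) (d j)) / (4 * N\<^sup>2)"
    by (simp add: sum_negf)
  have "(\<Sum>i\<in>I. \<Sum>j\<in>I. G (d i) (d j)) = (\<Sum>i\<in>I. \<Sum>j\<in>I. G (d (\<tau> i)) (d (\<tau> j)))"
    by (simp only: sum.reindex_bij_betw[OF sym(1), of "\<lambda>i. \<Sum>j\<in>I. G (d i) (d j)"] sum.reindex_bij_betw[OF sym(1), of "\<lambda>j. G _ (d j)"])
  also have "\<dots> = (\<Sum>i\<in>I. \<Sum>j\<in>I. G (- d i) (- d j))" by (intro sum.cong refl) (simp add: sym)
  finally have "2 * (\<Sum>i\<in>I. \<Sum>j\<in>I. G (d i) (d j)) = (\<Sum>i\<in>I. \<Sum>j\<in>I. G (d i) (d j)) + (\<Sum>i\<in>I. \<Sum>j\<in>I. G (- d i) (- d j))" by simp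
  also have "\<dots> = (\<Sum>i\<in>I. \<Sum>j\<in>I. G (d i) (d j) + G (- d i) (- d j))" by (simp only: sum.distrib)
  also have "\<dots> = (\<Sum>i\<in>I. \<Sum>j\<in>I. second_difference (d i) W x + second_difference (d j) W x + second_difference (d i + d j) W x)"
    by (intro sum.cong refl) (simp add: G_def second_difference_def algebra_simps)
  finally have 2: "(\<Sum>i\<in>I. \<Sum>j\<in>I. second_difference (d i) W x + second_difference (d j) W x + second_difference (d i + d j) W x) = 2 * (\<Sum>i\<in>I. \<Sum>j\<in>I. G (d i) (d j))"
    by simp
  show ?thesis unfolding 1 2 N_def by simp
qed


lemma tendsto_integral_compact:
  fixes f :: "nat \<Rightarrow> real^'n \<Rightarrow> real"
  assumes "\<And>k. f k \<in> borel_measurable borel" "\<And>x. (\<lambda>k. f k x) \<longlonglongrightarrow> l x"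
    and "\<And>k x. \<bar>f k x\<bar> \<le> w x" "integrable lborel w"
  shows "(\<lambda>k. \<integral>x. f k x \<partial>lborel) \<longlonglongrightarrow> (\<integral>x. l x \<partial>lborel)"
proof (rule integral_dominated_convergence[where w = w])
  show "l \<in> borel_measurable lborel"
    using borel_measurable_LIMSEQ_real[of borel f l] assms by simp
qed (use assms in auto)

text \<open>The case i = j is included: it contributes \<plusminus>2 e_i and twice the zero vector,
  repetitions being counted through the index. The family has two virtues: the Hessian summed along
  it is a multiple of the Laplacian, and the pair e_i + e_j, e_i - e_j polarises every mixed
  derivative.\<close>

definition diagonal_steps :: "'n \<times> 'n \<times> bool \<times> bool \<Rightarrow> real^'n" where
  "diagonal_steps = (\<lambda>(i, j, s, t). (if s then 1 else -1) *\<^sub>R axis i 1 + (if t then 1 else -1) *\<^sub>R axis j 1)"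

lemma diagonal_steps_bij:
  "bij_betw (\<lambda>(i, j, s, t). (i, j, \<not> s, \<not> t)) UNIV (UNIV :: ('n::finite \<times> 'n \<times> bool \<times> bool) set)"
  by (rule bij_betw_byWitness[where f' = "\<lambda>(i, j, s, t). (i, j, \<not> s, \<not> t)"]) auto

lemma diagonal_steps_uminus:
  "diagonal_steps ((\<lambda>(i, j, s, t). (i, j, \<not> s, \<not> t)) k) = - diagonal_steps k"
  by (cases k) (auto simp: diagonal_steps_def)

lemma sum_UNIV_steps:
  "(\<Sum>k\<in>(UNIV :: ('n::finite \<times> 'n \<times> bool \<times> bool) set). F k)
     = (\<Sum>i\<in>UNIV. \<Sum>j\<in>UNIV. F (i, j, True, True) + F (i, j, True, False) + F (i, j, False, True) + F (i, j, False, False))"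
  for F :: "_ \<Rightarrow> 'a::comm_monoid_add"
  by (simp add: UNIV_Times_UNIV[symmetric] sum.cartesian_product' UNIV_bool add_ac del: UNIV_Times_UNIV)

lemma sum_diagonal_steps: "(\<Sum>k\<in>UNIV. diagonal_steps k) = 0"
  by (simp add: sum_UNIV_steps diagonal_steps_def)

text \<open>For fixed i and j the mixed derivatives cancel over the four choices of signs, leaving
  four copies of each pure one.\<close>

lemma sum_second_form_diagonal_steps:
  fixes W :: "real^'n \<Rightarrow> real"
  shows "(\<Sum>k\<in>UNIV. second_form W x (diagonal_steps k) (diagonal_steps k)) = 8 * CARD('n) * laplacian W x"
proof -
  have "(\<Sum>k\<in>UNIV. second_form W x (diagonal_steps k) (diagonal_steps k))
     = (\<Sum>i\<in>UNIV. \<Sum>j\<in>UNIV. 4 * partial i (partial i W) x + 4 * partial j (partial j W) x)"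
    unfolding sum_UNIV_steps
    by (intro sum.cong refl)
       (simp add: diagonal_steps_def second_form_add_left second_form_add_right second_form_scale_left second_form_scale_right second_form_axis
         second_form_scale_left[of _ _ "-1", simplified] second_form_scale_right[of _ _ _ "-1", simplified]
         second_form_add_left[of _ _ _ "- _", simplified] second_form_add_right[of _ _ _ _ "- _", simplified])
  also have "\<dots> = 8 * CARD('n) * laplacian W x"
    by (simp add: sum.distrib laplacian_def sum_distrib_left[symmetric])
  finally show ?thesis .
qed

text \<open>The left side is the formula of \<open>avg_twice_second_differences\<close> with
  Hessians in place of second differences, that is, its limit after division by the squared step
  length. The cross terms drop out because the steps sum to zero, so only the Laplacian
  survives.\<close>

lemma avg_defect_limit:
  fixes W :: "real^'n \<Rightarrow> real"
  shows "- (\<Sum>i\<in>UNIV. \<Sum>j\<in>UNIV. second_form W x (diagonal_steps i) (diagonal_steps i) + second_form W x (diagonal_steps j) (diagonal_steps j)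
      + second_form W x (diagonal_steps i + diagonal_steps j) (diagonal_steps i + diagonal_steps j)) / (8 * (real CARD('n \<times> 'n \<times> bool \<times> bool))\<^sup>2)
     = - laplacian W x / CARD('n)"
proof -
  define N where "N = real CARD('n \<times> 'n \<times> bool \<times> bool)"
  define B where "B = second_form W x"
  let ?d = "diagonal_steps :: _ \<Rightarrow> real^'n"
  have cross: "(\<Sum>i\<in>UNIV. \<Sum>j\<in>UNIV. B (?d i) (?d j)) = 0"
    unfolding B_def second_form_sum_right[symmetric] second_form_sum_left[symmetric] sum_diagonal_steps
    by (rule second_form_zero_left)
  then have cross': "(\<Sum>i\<in>UNIV. \<Sum>j\<in>UNIV. B (?d j) (?d i)) = 0" by (subst sum.swap)
  have "(\<Sum>i\<in>UNIV. \<Sum>j\<in>UNIV. B (?d i) (?d i) + B (?d j) (?d j) + B (?d i + ?d j) (?d i + ?d j))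
     = (\<Sum>i\<in>UNIV. \<Sum>j\<in>UNIV. 2 * B (?d i) (?d i) + 2 * B (?d j) (?d j) + B (?d i) (?d j) + B (?d j) (?d i))"
    by (intro sum.cong refl) (simp add: B_def second_form_add_left second_form_add_right)
  also have "\<dots> = 4 * N * (\<Sum>i\<in>UNIV. B (?d i) (?d i))"
    by (simp add: sum.distrib cross cross' N_def sum_distrib_left[symmetric])
  also have "(\<Sum>i\<in>UNIV. B (?d i) (?d i)) = 8 * CARD('n) * laplacian W x"
    unfolding B_def by (rule sum_second_form_diagonal_steps)
  finally have S: "(\<Sum>i\<in>UNIV. \<Sum>j\<in>UNIV. B (?d i) (?d i) + B (?d j) (?d j) + B (?d i + ?d j) (?d i + ?d j)) = 4 * N * (8 * CARD('n) * laplacian W x)" .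
  have "N = 4 * (real CARD('n))\<^sup>2" by (simp add: N_def power2_eq_square)
  then show ?thesis
    unfolding B_def[symmetric] S N_def[symmetric] by (simp add: power2_eq_square field_simps)
qed

text \<open>The discrete bound is applied to W/h^2 with steps scaled by h, and h tends to 0. On the
  left, summation by parts leaves a second difference quotient of W against g; on the right, Q is
  evaluated at W/h^2 minus its double average, which tends to a multiple of the Laplacian. The
  factor in the discrete bound does not involve h, so it survives the limit.\<close>

lemma second_form_pairing_bound:
  fixes W :: "real^'n \<Rightarrow> real" and Q :: "real \<times> real \<Rightarrow> real"
  assumes Q: "\<And>\<sigma>. \<bar>\<sigma>\<bar> \<le> 1 \<Longrightarrow> convex_on UNIV (\<lambda>z. Q z + \<sigma> * (fst z * snd z))"
    and Q0: "Q (0, 0) = 0" "\<And>z. 0 \<le> Q z"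
    and W: "smooth W" "compactly_supported W" and g: "compactly_supported g"
  shows "\<bar>\<integral>x. second_form W x (diagonal_steps k) (diagonal_steps k) * g x \<partial>lborel\<bar>
    \<le> 4 * CARD('n \<times> 'n \<times> bool \<times> bool) * (\<integral>x. Q (- laplacian W x / CARD('n), g x) \<partial>lborel)"
proof -
  define N where "N = real CARD('n \<times> 'n \<times> bool \<times> bool)"
  have N: "N > 0" by (simp add: N_def card_gt_0_iff)
  let ?d = "diagonal_steps :: _ \<Rightarrow> real^'n"
  have contQ: "continuous_on UNIV Q" using convex_on_continuous[OF open_UNIV] Q[of 0] by simp
  define h where "h = (\<lambda>n. 1 / real (Suc n))"
  have h: "h n > 0" "h n \<le> 1" for n by (auto simp: h_def)
  have h0: "filterlim h (at_right 0) sequentially"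
    unfolding filterlim_at using h LIMSEQ_inverse_real_of_nat by (auto simp: h_def inverse_eq_divide)
  have sd: "(\<lambda>n. second_difference (h n *\<^sub>R v) W x / (h n)\<^sup>2) \<longlonglongrightarrow> second_form W x v v" for v x
    by (rule filterlim_compose[OF second_difference_tendsto[OF W(1)] h0])
  define V where "V = (\<lambda>n x. W x / (h n)\<^sup>2)"
  have V: "compactly_supported (V n)" for n unfolding V_def by (intro compactly_supported_divide W)
  have sdV: "second_difference v (V n) x = second_difference v W x / (h n)\<^sup>2" for v n x
    by (simp add: second_difference_def V_def add_divide_distrib diff_divide_distrib)
  define d where "d = (\<lambda>n k. h n *\<^sub>R ?d k)"
  define f where "f = (\<lambda>n x. V n x - half_step_avg UNIV (d n) (half_step_avg UNIV (d n) (V n)) x)"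
  have csf: "compactly_supported (f n)" for n
    unfolding f_def by (intro compactly_supported_diff compactly_supported_avg V)
  have bound: "\<bar>\<integral>x. increment (d n k) (V n) x * increment (d n k) g x \<partial>lborel\<bar> \<le> 4 * N * (\<integral>x. Q (f n x, g x) \<partial>lborel)" for n
  proof -
    have "\<bar>\<integral>x. increment (d n k) (V n) x * increment (d n k) g x \<partial>lborel\<bar> \<le> real (4 * CARD('n \<times> 'n \<times> bool \<times> bool)) * (\<integral>x. Q (f n x, g x) \<partial>lborel)"
      unfolding f_def
      by (rule increment_pairing_bound[OF Q Q0 V g _ _ _ diagonal_steps_bij]) (auto simp: d_def diagonal_steps_uminus)
    then show ?thesis unfolding N_def by (simp only: of_nat_mult of_nat_numeral)
  qed
  have "(\<integral>x. increment (d n k) (V n) x * increment (d n k) g x \<partial>lborel) = - (\<integral>x. second_difference (d n k) W x / (h n)\<^sup>2 * g x \<partial>lborel)" for n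
    by (simp add: integral_increment_product[OF V g] sdV)
  with bound have bound: "\<bar>\<integral>x. second_difference (d n k) W x / (h n)\<^sup>2 * g x \<partial>lborel\<bar> \<le> 4 * N * (\<integral>x. Q (f n x, g x) \<partial>lborel)" for n
    by simp
  have "\<forall>v. \<exists>K. K > 0 \<and> (\<forall>x. \<bar>second_form W x v v\<bar> \<le> K)"
    using compactly_supported_bounded[OF compactly_supported_second_form[OF W]] by metis
  then obtain K where K: "\<And>v. K v > 0" "\<And>v x. \<bar>second_form W x v v\<bar> \<le> K v" by metis
  have sdK: "\<bar>second_difference (h n *\<^sub>R v) W x / (h n)\<^sup>2\<bar> \<le> K v" for n v x
    by (rule second_difference_bound[OF W(1) h(1) K(2)])
  have lim1: "(\<lambda>n. \<integral>x. second_difference (d n k) W x / (h n)\<^sup>2 * g x \<partial>lborel) \<longlonglongrightarrow> (\<integral>x. second_form W x (?d k) (?d k) * g x \<partial>lborel)"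
  proof (rule tendsto_integral_compact[where w = "\<lambda>x. K (?d k) * \<bar>g x\<bar>"])
    show "(\<lambda>x. second_difference (d n k) W x / (h n)\<^sup>2 * g x) \<in> borel_measurable borel" for n
      unfolding second_difference_def diff_conv_add_uminus
      by (intro borel_measurable_times borel_measurable_divide borel_measurable_add borel_measurable_uminus borel_measurable_const
          compactly_supported_measurable compactly_supported_translate W g)
    show "(\<lambda>n. second_difference (d n k) W x / (h n)\<^sup>2 * g x) \<longlonglongrightarrow> second_form W x (?d k) (?d k) * g x" for x
      unfolding d_def by (intro tendsto_mult sd tendsto_const)
    show "\<bar>second_difference (d n k) W x / (h n)\<^sup>2 * g x\<bar> \<le> K (?d k) * \<bar>g x\<bar>" for n x
      unfolding d_def abs_mult[of _ "g x"] by (intro mult_right_mono sdK) simp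
    show "integrable lborel (\<lambda>x. K (?d k) * \<bar>g x\<bar>)"
      by (intro compactly_supported_integrable compactly_supported_cmult compactly_supported_abs g)
  qed
  have f_eq: "f n x = - (\<Sum>i\<in>UNIV. \<Sum>j\<in>UNIV. second_difference (h n *\<^sub>R ?d i) W x / (h n)\<^sup>2 + second_difference (h n *\<^sub>R ?d j) W x / (h n)\<^sup>2
      + second_difference (h n *\<^sub>R (?d i + ?d j)) W x / (h n)\<^sup>2) / (8 * N\<^sup>2)" for n x
    unfolding f_def N_def
    by (subst avg_twice_second_differences[OF _ _ diagonal_steps_bij])
       (auto simp: d_def diagonal_steps_uminus sdV scaleR_add_right)
  have f_lim: "(\<lambda>n. f n x) \<longlonglongrightarrow> - laplacian W x / CARD('n)" for x
    unfolding f_eq avg_defect_limit[symmetric] N_def[symmetric]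
    by (intro tendsto_divide tendsto_minus tendsto_sum tendsto_add sd tendsto_const) (use N in simp)
  define L where "L = (\<Sum>i\<in>UNIV. \<Sum>j\<in>UNIV. K (?d i) + K (?d j) + K (?d i + ?d j)) / (8 * N\<^sup>2)"
  have S0: "0 \<le> (\<Sum>i\<in>UNIV. \<Sum>j\<in>UNIV. K (?d i) + K (?d j) + K (?d i + ?d j))"
    by (intro sum_nonneg add_nonneg_nonneg less_imp_le K)
  have f_bound: "\<bar>f n x\<bar> \<le> L" for n x
    unfolding f_eq L_def abs_divide abs_minus_cancel
    by (intro frac_le order_trans[OF sum_abs] sum_mono order_trans[OF abs_triangle_ineq] add_mono sdK S0)
      (use N in auto)
  obtain RW where RW: "RW > 0" "\<And>x. x \<notin> cball 0 RW \<Longrightarrow> W x = 0" using compactly_supported_zero_outside[OF W(2)] by metis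
  obtain Rg where Rg: "Rg > 0" "\<And>x. x \<notin> cball 0 Rg \<Longrightarrow> g x = 0" using compactly_supported_zero_outside[OF g] by metis
  \<comment> \<open>The 4 covers the sum of two steps, each of norm at most 2, scaled by h \<le> 1.
    Outside this ball every f n vanishes, so the integrals of Q have a dominating function
    independent of n.\<close>
  define R where "R = max (RW + 4) Rg"
  have dn: "norm (?d i) \<le> 2" for i
  proof -
    obtain a b s t where "i = (a, b, s, t)" by (cases i)
    then show ?thesis
      using norm_triangle_ineq[of "(if s then 1 else -1) *\<^sub>R axis a 1 :: real^'n" "(if t then 1 else -1) *\<^sub>R axis b 1"]
      by (simp add: diagonal_steps_def norm_axis_1 split: if_splits)
  qed
  have f0: "f n x = 0" if x: "x \<notin> cball 0 R" for n x
  proof -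
    have far: "W (x + v) = 0" if "norm v \<le> 4" for v
    proof (rule RW(2))
      have "norm x \<le> norm (x + v) + norm v" using norm_triangle_ineq4[of "x + v" v] by simp
      with x that show "x + v \<notin> cball 0 RW" by (auto simp: R_def)
    qed
    have sd0: "second_difference (h n *\<^sub>R v) W x = 0" if "norm v \<le> 4" for v
    proof -
      have "norm (h n *\<^sub>R v) \<le> 1 * 4" unfolding norm_scaleR using h[of n] that by (intro mult_mono) auto
      then show ?thesis using far[of "h n *\<^sub>R v"] far[of "- (h n *\<^sub>R v)"] far[of 0] by (simp add: second_difference_def)
    qed
    have "norm (?d i) \<le> 4" "norm (?d i + ?d j) \<le> 4" for i j
      using dn[of i] dn[of j] norm_triangle_ineq[of "?d i" "?d j"] by auto
    then show ?thesis unfolding f_eq by (simp add: sd0)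
  qed
  obtain G where G: "\<And>x. \<bar>g x\<bar> \<le> G" using compactly_supported_bounded[OF g] by metis
  have "compact (Q ` cbox (- L, - G) (L, G))"
    by (rule compact_continuous_image[OF continuous_on_subset[OF contQ]]) auto
  then have "bounded (Q ` cbox (- L, - G) (L, G))" by (rule compact_imp_bounded)
  then obtain M where M: "M > 0" "\<And>z. z \<in> cbox (- L, - G) (L, G) \<Longrightarrow> \<bar>Q z\<bar> \<le> M" unfolding bounded_pos by auto
  have lim2: "(\<lambda>n. \<integral>x. Q (f n x, g x) \<partial>lborel) \<longlonglongrightarrow> (\<integral>x. Q (- laplacian W x / CARD('n), g x) \<partial>lborel)"
  proof (rule tendsto_integral_compact[where w = "\<lambda>x. indicator (cball 0 R) x *\<^sub>R M"])
    show "(\<lambda>x. Q (f n x, g x)) \<in> borel_measurable borel" for n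
      by (rule compactly_supported_measurable[OF compactly_supported_comp2[OF csf g contQ Q0(1)]])
    show "(\<lambda>n. Q (f n x, g x)) \<longlonglongrightarrow> Q (- laplacian W x / CARD('n), g x)" for x
    proof (rule isCont_tendsto_compose[where g = Q and f = "\<lambda>n. (f n x, g x)"])
      show "isCont Q (- laplacian W x / CARD('n), g x)" using contQ by (simp add: continuous_on_eq_continuous_at)
      show "(\<lambda>n. (f n x, g x)) \<longlonglongrightarrow> (- laplacian W x / CARD('n), g x)" by (intro tendsto_Pair f_lim tendsto_const)
    qed
    show "\<bar>Q (f n x, g x)\<bar> \<le> indicator (cball 0 R) x *\<^sub>R M" for n x
    proof (cases "x \<in> cball 0 R")
      case True
      have "\<bar>Q (f n x, g x)\<bar> \<le> M"
        using f_bound[of n x] G[of x] by (intro M) (auto simp: cbox_Pair_eq abs_le_iff)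
      with True show ?thesis by simp
    next
      case False
      then have "g x = 0" using Rg(2)[of x] by (auto simp: R_def)
      with f0[OF False] False show ?thesis by (simp add: Q0)
    qed
    show "integrable lborel (\<lambda>x::real^'n. indicator (cball 0 R) x *\<^sub>R M)"
      by (intro borel_integrable_compact) auto
  qed
  have "\<bar>\<integral>x. second_form W x (?d k) (?d k) * g x \<partial>lborel\<bar> \<le> 4 * N * (\<integral>x. Q (- laplacian W x / CARD('n), g x) \<partial>lborel)"
  proof (rule LIMSEQ_le[OF tendsto_rabs[OF lim1] tendsto_mult_left[OF lim2]])
    show "\<exists>m. \<forall>n\<ge>m. \<bar>\<integral>x. second_difference (d n k) W x / (h n)\<^sup>2 * g x \<partial>lborel\<bar> \<le> 4 * N * (\<integral>x. Q (f n x, g x) \<partial>lborel)"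
      using bound by blast
  qed
  then show ?thesis unfolding N_def by (simp only: of_nat_mult of_nat_numeral)
qed

text \<open>The growth bound of Q turns the Bellman integral into a sum of integrals of powers; the
  division of the Laplacian by the dimension only decreases it. Polarisation with e_i + e_j and e_i
  - e_j then reaches every mixed derivative.\<close>

lemma calderon_zygmund_pairing:
  fixes p q :: real
  assumes p: "p > 1" and q: "q = p / (p - 1)"
  obtains K where "K > 0"
    "\<And>(W :: real^'n \<Rightarrow> real) g i j. \<lbrakk>smooth W; compactly_supported W; compactly_supported g\<rbrakk> \<Longrightarrow>
      \<bar>\<integral>x. partial i (partial j W) x * g x \<partial>lborel\<bar>
      \<le> K * ((\<integral>x. \<bar>laplacian W x\<bar> powr p \<partial>lborel) + (\<integral>x. \<bar>g x\<bar> powr q \<partial>lborel))"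
proof -
  have q1: "q > 1" unfolding q using p by (simp add: less_divide_eq)
  obtain Q :: "real \<times> real \<Rightarrow> real" and C where QC: "C > 0"
    "\<And>\<sigma>. \<bar>\<sigma>\<bar> \<le> 1 \<Longrightarrow> convex_on UNIV (\<lambda>z. Q z + \<sigma> * (fst z * snd z))"
    "\<And>x y. 0 \<le> Q (x, y)" "\<And>x y. Q (x, y) \<le> C * (\<bar>x\<bar> powr p + \<bar>y\<bar> powr q)"
    by (rule bellman_function[OF p q]) (rule that)
  have Q0: "Q (0, 0) = 0" using QC(3,4)[of 0 0] by (intro antisym) auto
  have Qn: "0 \<le> Q z" for z by (cases z) (simp add: QC(3))
  have contQ: "continuous_on UNIV Q" using convex_on_continuous[OF open_UNIV] QC(2)[of 0] by simp
  define N where "N = 4 * real CARD('n \<times> 'n \<times> bool \<times> bool)"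
  have N: "N > 0" by (simp add: N_def card_gt_0_iff)
  show ?thesis
  proof (rule that)
    show "N * C > 0" using N QC by simp
    fix W :: "real^'n \<Rightarrow> real" and g :: "real^'n \<Rightarrow> real" and i j :: 'n
    assume W: "smooth W" "compactly_supported W" and g: "compactly_supported g"
    let ?R = "N * C * ((\<integral>x. \<bar>laplacian W x\<bar> powr p \<partial>lborel) + (\<integral>x. \<bar>g x\<bar> powr q \<partial>lborel))"
    have csL: "compactly_supported (\<lambda>x. - laplacian W x / CARD('n))"
      using compactly_supported_cmult[OF compactly_supported_laplacian[OF W], of "- 1 / CARD('n)"] by simp
    have int: "integrable lborel (\<lambda>x. \<bar>laplacian W x\<bar> powr p)" "integrable lborel (\<lambda>x. \<bar>g x\<bar> powr q)"
      using p q1 by (auto intro!: compactly_supported_integrable compactly_supported_powr compactly_supported_laplacian W g)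
    have "(\<integral>x. Q (- laplacian W x / CARD('n), g x) \<partial>lborel) \<le> (\<integral>x. C * (\<bar>laplacian W x\<bar> powr p + \<bar>g x\<bar> powr q) \<partial>lborel)"
    proof (rule integral_mono)
      show "integrable lborel (\<lambda>x. Q (- laplacian W x / CARD('n), g x))"
        by (intro compactly_supported_integrable compactly_supported_comp2[OF csL g contQ Q0])
      show "integrable lborel (\<lambda>x. C * (\<bar>laplacian W x\<bar> powr p + \<bar>g x\<bar> powr q))" using int by auto
      fix x
      have "\<bar>- laplacian W x / CARD('n)\<bar> \<le> \<bar>laplacian W x\<bar>"
        by (simp add: divide_le_eq mult_le_cancel_left1 Suc_le_eq[symmetric] del: Suc_le_eq)
      then have "\<bar>- laplacian W x / CARD('n)\<bar> powr p \<le> \<bar>laplacian W x\<bar> powr p" using p by (intro powr_mono2) auto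
      then show "Q (- laplacian W x / CARD('n), g x) \<le> C * (\<bar>laplacian W x\<bar> powr p + \<bar>g x\<bar> powr q)"
        using QC(1) by (intro order_trans[OF QC(4)] mult_left_mono add_right_mono) auto
    qed
    also have "\<dots> = C * ((\<integral>x. \<bar>laplacian W x\<bar> powr p \<partial>lborel) + (\<integral>x. \<bar>g x\<bar> powr q \<partial>lborel))" using int by simp
    finally have "N * (\<integral>x. Q (- laplacian W x / CARD('n), g x) \<partial>lborel) \<le> ?R" using N by (simp add: mult.assoc)
    have bd: "\<bar>\<integral>x. second_form W x (diagonal_steps k) (diagonal_steps k) * g x \<partial>lborel\<bar> \<le> ?R" for k
    proof -
      have "\<bar>\<integral>x. second_form W x (diagonal_steps k) (diagonal_steps k) * g x \<partial>lborel\<bar>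
        \<le> real (4 * CARD('n \<times> 'n \<times> bool \<times> bool)) * (\<integral>x. Q (- laplacian W x / CARD('n), g x) \<partial>lborel)"
        by (rule second_form_pairing_bound[OF QC(2) Q0 Qn W g])
      also have "real (4 * CARD('n \<times> 'n \<times> bool \<times> bool)) = N" unfolding N_def by (simp only: of_nat_mult of_nat_numeral)
      also note \<open>N * (\<integral>x. Q (- laplacian W x / CARD('n), g x) \<partial>lborel) \<le> ?R\<close>
      finally show ?thesis .
    qed
    let ?I = "\<lambda>k. \<integral>x. second_form W x (diagonal_steps k) (diagonal_steps k) * g x \<partial>lborel"
    have intk: "integrable lborel (\<lambda>x. second_form W x v w * g x)" for v w
      by (intro compactly_supported_integrable compactly_supported_mult compactly_supported_second_form W g)
    have "4 * partial i (partial j W) x = second_form W x (diagonal_steps (i, j, True, True)) (diagonal_steps (i, j, True, True))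
        - second_form W x (diagonal_steps (i, j, True, False)) (diagonal_steps (i, j, True, False))" for x
      using partial_commute[OF W(1), of i j x]
      by (simp add: diagonal_steps_def second_form_add_left second_form_add_right second_form_axis
         second_form_scale_left[of _ _ "-1", simplified] second_form_scale_right[of _ _ _ "-1", simplified]
         second_form_add_left[of _ _ _ "- _", simplified] second_form_add_right[of _ _ _ _ "- _", simplified])
    then have "4 * (partial i (partial j W) x * g x) = second_form W x (diagonal_steps (i, j, True, True)) (diagonal_steps (i, j, True, True)) * g x
        - second_form W x (diagonal_steps (i, j, True, False)) (diagonal_steps (i, j, True, False)) * g x" for x
      by (simp only: mult.assoc[symmetric] left_diff_distrib)
    then have "4 * (\<integral>x. partial i (partial j W) x * g x \<partial>lborel) = ?I (i, j, True, True) - ?I (i, j, True, False)"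
      by (simp only: integral_mult_right_zero[symmetric] Bochner_Integration.integral_diff[OF intk intk, symmetric])
    then show "\<bar>\<integral>x. partial i (partial j W) x * g x \<partial>lborel\<bar> \<le> ?R"
      using bd[of "(i, j, True, True)"] bd[of "(i, j, True, False)"] by linarith
  qed
qed

text \<open>sgn jumps at 0, but the function is the difference of the powers of the positive and the
  negative part of t, both of which are continuous.\<close>

lemma continuous_sgn_powr:
  fixes r :: real
  assumes r: "r > 0"
  shows "continuous_on UNIV (\<lambda>t::real. sgn t * \<bar>t\<bar> powr r)"
proof -
  have c: "continuous_on UNIV (\<lambda>t::real. max (s * t) 0 powr r)" for s
  proof (rule continuous_on_powr')
    show "continuous_on UNIV (\<lambda>t::real. max (s * t) 0)" by (intro continuous_on_max continuous_intros)
  qed (use r in auto)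
  have "(\<lambda>t::real. sgn t * \<bar>t\<bar> powr r) = (\<lambda>t. max (1 * t) 0 powr r - max (- 1 * t) 0 powr r)"
    by (rule ext) (auto simp: sgn_if max_def)
  then show ?thesis by (simp only: continuous_on_diff[OF c c])
qed

text \<open>The pairing is tested with g = t sgn u |u|^(p-1), where u is the mixed derivative. The
  left side becomes t times the integral of |u|^p, and the g term on the right K t^q times the same
  integral. That integral is finite because u is compactly supported, so the term can be
  absorbed.\<close>

theorem calderon_zygmund:
  fixes p :: real
  assumes p: "p > 1"
  obtains C where "C > 0"
    "\<And>(W :: real^'n \<Rightarrow> real) i j. \<lbrakk>smooth W; compactly_supported W\<rbrakk> \<Longrightarrow>
      (\<integral>x. \<bar>partial i (partial j W) x\<bar> powr p \<partial>lborel) \<le> C * (\<integral>x. \<bar>laplacian W x\<bar> powr p \<partial>lborel)"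
proof -
  define q where "q = p / (p - 1)"
  have q1: "q > 1" unfolding q_def using p by (simp add: less_divide_eq)
  have pq: "(p - 1) * q = p" using p by (simp add: q_def)
  obtain K where K: "K > 0"
    "\<And>(W :: real^'n \<Rightarrow> real) g i j. \<lbrakk>smooth W; compactly_supported W; compactly_supported g\<rbrakk> \<Longrightarrow>
      \<bar>\<integral>x. partial i (partial j W) x * g x \<partial>lborel\<bar>
      \<le> K * ((\<integral>x. \<bar>laplacian W x\<bar> powr p \<partial>lborel) + (\<integral>x. \<bar>g x\<bar> powr q \<partial>lborel))"
    using calderon_zygmund_pairing[OF p q_def, where 'n = 'n] by blast
  \<comment> \<open>The solution of K t^q = t/2: exactly half of the left side is absorbed.\<close>
  define t where "t = (1 / (2 * K)) powr (1 / (q - 1))"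
  have t: "t > 0" using K by (simp add: t_def)
  have "t powr q = t powr (q - 1) * t powr 1" by (simp only: powr_add[symmetric]) simp
  also have "t powr (q - 1) = 1 / (2 * K)" unfolding t_def using q1 K by (simp add: powr_powr)
  finally have tq: "K * t powr q = t / 2" using K t by simp
  show ?thesis
  proof (rule that)
    show "2 * K / t > 0" using K t by simp
    fix W :: "real^'n \<Rightarrow> real" and i j :: 'n
    assume W: "smooth W" "compactly_supported W"
    define u where "u = partial i (partial j W)"
    have u: "compactly_supported u" unfolding u_def by (intro compactly_supported_partial smooth_partial W)
    define F where "F = (\<lambda>r::real. sgn r * \<bar>r\<bar> powr (p - 1))"
    have F: "continuous_on UNIV F"
      unfolding F_def using p by (intro continuous_sgn_powr) simp
    define g where "g = (\<lambda>x. t * F (u x))"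
    have g: "compactly_supported g"
      unfolding g_def by (rule compactly_supported_cmult, rule compactly_supported_comp[OF u F]) (simp add: F_def)
    have ug: "u x * g x = t * \<bar>u x\<bar> powr p" for x
    proof -
      have "u x * sgn (u x) = \<bar>u x\<bar> powr 1" by (auto simp: sgn_if)
      then have "u x * sgn (u x) * \<bar>u x\<bar> powr (p - 1) = \<bar>u x\<bar> powr 1 * \<bar>u x\<bar> powr (p - 1)" by (simp only:)
      also have "\<dots> = \<bar>u x\<bar> powr p" by (simp only: powr_add[symmetric]) simp
      finally show ?thesis by (simp add: g_def F_def mult_ac)
    qed
    have gq: "\<bar>g x\<bar> powr q = t powr q * \<bar>u x\<bar> powr p" for x
    proof -
      have "\<bar>g x\<bar> = t * \<bar>u x\<bar> powr (p - 1)" using t by (simp add: g_def F_def abs_mult abs_sgn_eq)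
      then show ?thesis using t by (simp add: powr_mult powr_powr pq)
    qed
    let ?u = "\<integral>x. \<bar>u x\<bar> powr p \<partial>lborel" and ?l = "\<integral>x. \<bar>laplacian W x\<bar> powr p \<partial>lborel"
    have "t * ?u = (\<integral>x. u x * g x \<partial>lborel)" by (simp add: ug)
    also have "\<dots> \<le> K * (?l + (\<integral>x. \<bar>g x\<bar> powr q \<partial>lborel))"
      using K(2)[OF W g, of i j] unfolding u_def by (rule order_trans[OF abs_ge_self])
    also have "(\<integral>x. \<bar>g x\<bar> powr q \<partial>lborel) = t powr q * ?u" by (simp add: gq)
    also have "K * (?l + t powr q * ?u) = K * ?l + (K * t powr q) * ?u" by (simp add: algebra_simps)
    also have "\<dots> = K * ?l + t / 2 * ?u" by (simp only: tq)
    finally have "t * ?u \<le> 2 * K * ?l" by linarith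
    then have "?u * t \<le> 2 * K * ?l" by (simp only: mult.commute[of t])
    then have "?u \<le> 2 * K * ?l / t" by (simp only: pos_le_divide_eq[OF t])
    then show "(\<integral>x. \<bar>partial i (partial j W) x\<bar> powr p \<partial>lborel) \<le> 2 * K / t * ?l"
      by (simp only: u_def times_divide_eq_left)
  qed
qed

section \<open>Poincare inequality and convolution\<close>

lemma young_powr:
  fixes p q a b :: real
  assumes p: "p > 1" and q: "q = p / (p - 1)" and ab: "a \<ge> 0" "b \<ge> 0"
  shows "a * b \<le> a powr p + b powr q"
proof -
  have q1: "q > 1" unfolding q using p by (simp add: less_divide_eq)
  have "1 / p + 1 / q = 1" unfolding q using p by (simp add: field_simps)
  then have "a * b \<le> a powr p / p + b powr q / q" by (intro Youngs_inequality p q1 ab)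
  also have "\<dots> \<le> a powr p + b powr q"
    using p q1 by (intro add_mono) (auto simp: divide_le_eq mult_le_cancel_left1)
  finally show ?thesis .
qed

text \<open>The free weight s makes the first term as small as an absorption requires, at the price
  of a negative power of s in front of the second.\<close>

lemma young_powr_scaled:
  fixes p q a b s :: real
  assumes p: "p > 1" and q: "q = p / (p - 1)" and ab: "a \<ge> 0" "b \<ge> 0" and s: "s > 0"
  shows "a * b \<le> s * a powr p + s powr (- q / p) * b powr q"
proof -
  have "a * b = (s powr (1 / p) * a) * (s powr (- 1 / p) * b)"
    using s by (simp add: powr_minus field_simps)
  also have "\<dots> \<le> (s powr (1 / p) * a) powr p + (s powr (- 1 / p) * b) powr q"
    by (rule young_powr[OF p q]) (use ab in auto)
  also have "\<dots> = s * a powr p + s powr (- q / p) * b powr q"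
    using p s ab by (simp add: powr_mult powr_powr)
  finally show ?thesis .
qed

lemma powr_add_le:
  fixes a b r :: real
  assumes "a \<ge> 0" "b \<ge> 0" "r \<ge> 0"
  shows "(a + b) powr r \<le> 2 powr r * (a powr r + b powr r)"
proof -
  have "(a + b) powr r \<le> (2 * max a b) powr r" using assms by (intro powr_mono2) auto
  also have "\<dots> = 2 powr r * max a b powr r" using assms by (simp add: powr_mult)
  also have "max a b powr r \<le> a powr r + b powr r" by (simp add: max_def)
  finally show ?thesis by (simp add: mult_left_mono)
qed

text \<open>Difference quotients of F integrate to 0 by translation invariance. The mean value
  theorem bounds them by a multiple of the indicator of a fixed ball, so the limit may be taken
  under the integral.\<close>

lemma integral_partial_eq_0:
  fixes F :: "real^'n \<Rightarrow> real"
  assumes dF: "\<And>x. F differentiable at x" and cF: "continuous_on UNIV (partial j F)" and F: "compactly_supported F"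
  shows "(\<integral>x. partial j F x \<partial>lborel) = 0"
proof -
  obtain R where R: "R > 0" "\<And>x. x \<notin> cball 0 R \<Longrightarrow> F x = 0" using compactly_supported_zero_outside[OF F] by metis
  have cs: "compactly_supported (partial j F)"
    by (rule compactly_supportedI[OF cF partial_zero_outside[OF R(2)]])
  obtain K where K: "K > 0" "\<And>x. \<bar>partial j F x\<bar> \<le> K" using compactly_supported_bounded[OF cs] by metis
  define h where "h = (\<lambda>n. 1 / real (Suc n))"
  have h: "h n > 0" "h n \<le> 1" for n by (auto simp: h_def)
  have h0: "filterlim h (at 0) sequentially"
    unfolding filterlim_at using h LIMSEQ_inverse_real_of_nat by (auto simp: h_def inverse_eq_divide)
  let ?f = "\<lambda>n x. (F (x + h n *\<^sub>R axis j 1) - F x) / h n"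
  have csf: "compactly_supported (?f n)" for n
    by (intro compactly_supported_divide compactly_supported_diff compactly_supported_translate F)
  have lim: "(\<lambda>n. \<integral>x. ?f n x \<partial>lborel) \<longlonglongrightarrow> (\<integral>x. partial j F x \<partial>lborel)"
  proof (rule tendsto_integral_compact[where w = "\<lambda>x. indicator (cball 0 (R + 1)) x *\<^sub>R K"])
    show "?f n \<in> borel_measurable borel" for n by (rule compactly_supported_measurable[OF csf])
    show "(\<lambda>n. ?f n x) \<longlonglongrightarrow> partial j F x" for x
    proof -
      have "((\<lambda>t. F (x + t *\<^sub>R axis j 1)) has_real_derivative partial j F (x + 0 *\<^sub>R axis j 1)) (at 0)"
        by (rule has_real_derivative_along_axis[OF dF])
      then have "((\<lambda>t. (F (x + (0 + t) *\<^sub>R axis j 1) - F (x + 0 *\<^sub>R axis j 1)) / t) \<longlongrightarrow> partial j F x) (at 0)"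
        by (simp add: DERIV_def)
      from filterlim_compose[OF this h0] show ?thesis by simp
    qed
    show "\<bar>?f n x\<bar> \<le> indicator (cball 0 (R + 1)) x *\<^sub>R K" for n x
    proof (cases "x \<in> cball 0 (R + 1)")
      case True
      have "\<exists>z. 0 < z \<and> z < h n \<and> F (x + h n *\<^sub>R axis j 1) - F (x + 0 *\<^sub>R axis j 1) = (h n - 0) * partial j F (x + z *\<^sub>R axis j 1)"
        by (rule MVT2[OF h(1)]) (rule has_real_derivative_along_axis[OF dF])
      then obtain z where "F (x + h n *\<^sub>R axis j 1) - F x = h n * partial j F (x + z *\<^sub>R axis j 1)" by auto
      then have "?f n x = partial j F (x + z *\<^sub>R axis j 1)" using h(1)[of n] by simp
      then show ?thesis using K True by simp
    next
      case False
      have "norm x \<le> norm (x + h n *\<^sub>R axis j 1) + norm (h n *\<^sub>R axis j 1 :: real^'n)"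
        using norm_triangle_ineq4[of "x + h n *\<^sub>R axis j 1" "h n *\<^sub>R axis j 1"] by simp
      then have "norm x \<le> norm (x + h n *\<^sub>R axis j 1) + h n"
        using h[of n] by (simp add: norm_axis_1)
      then have "F (x + h n *\<^sub>R axis j 1) = 0" using h[of n] False by (intro R(2)) auto
      moreover have "F x = 0" using False by (intro R(2)) auto
      ultimately show ?thesis using False by simp
    qed
    show "integrable lborel (\<lambda>x::real^'n. indicator (cball 0 (R + 1)) x *\<^sub>R K)"
      by (intro borel_integrable_compact) auto
  qed
  have zero: "(\<integral>x. ?f n x \<partial>lborel) = 0" for n
  proof -
    have "(\<integral>x. ?f n x \<partial>lborel) = ((\<integral>x. F (x + h n *\<^sub>R axis j 1) \<partial>lborel) - (\<integral>x. F x \<partial>lborel)) / h n"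
      by (simp add: compactly_supported_integrable compactly_supported_translate F)
    then show ?thesis by (simp add: integral_lborel_translate[OF compactly_supported_measurable[OF F]])
  qed
  show ?thesis using lim unfolding zero by (rule LIMSEQ_unique[OF _ tendsto_const])
qed

lemma abs_powr_has_real_derivative:
  fixes q :: real
  assumes q: "q > 1"
  shows "((\<lambda>t. \<bar>t\<bar> powr q) has_real_derivative q * (sgn t * \<bar>t\<bar> powr (q - 1))) (at t)"
proof -
  consider "t > 0" | "t < 0" | "t = 0" by linarith
  then show ?thesis
  proof cases
    case 1
    have "((\<lambda>t. t powr q) has_real_derivative q * (sgn t * \<bar>t\<bar> powr (q - 1))) (at t)"
      using has_real_derivative_powr[OF 1, of q] 1 by simp
    then show ?thesis
      by (rule has_field_derivative_transform_within_open[of _ _ _ "{0<..}"]) (use 1 in auto)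
  next
    case 2
    have "((\<lambda>t. (- t) powr q) has_real_derivative q * (- t) powr (q - 1) * (- 1)) (at t)"
      by (rule has_real_derivative_powr_comp) (use 2 in \<open>auto intro!: derivative_eq_intros\<close>)
    then have "((\<lambda>t. (- t) powr q) has_real_derivative q * (sgn t * \<bar>t\<bar> powr (q - 1))) (at t)"
      using 2 by simp
    then show ?thesis
      by (rule has_field_derivative_transform_within_open[of _ _ _ "{..<0}"]) (use 2 in auto)
  next
    case 3
    \<comment> \<open>At 0 the difference quotient has absolute value |h|^(q-1), which tends to 0
      because q > 1.\<close>
    have "((\<lambda>h. \<bar>h\<bar> powr (q - 1)) \<longlongrightarrow> \<bar>0\<bar> powr (q - 1)) (at (0::real))"
      by (rule tendsto_powr'[OF tendsto_rabs[OF tendsto_ident_at] tendsto_const]) (use q in auto)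
    then have lim: "((\<lambda>h. \<bar>h\<bar> powr (q - 1)) \<longlongrightarrow> 0) (at (0::real))" by simp
    have "((\<lambda>h. (\<bar>0 + h\<bar> powr q - \<bar>0\<bar> powr q) / h) \<longlongrightarrow> 0) (at (0::real))"
    proof (rule Lim_null_comparison[OF _ lim])
      have "norm ((\<bar>0 + h\<bar> powr q - \<bar>0\<bar> powr q) / h) \<le> \<bar>h\<bar> powr (q - 1)" if "h \<noteq> 0" for h :: real
      proof -
        have "\<bar>h\<bar> powr q = \<bar>h\<bar> powr (q - 1) * \<bar>h\<bar> powr 1" by (simp only: powr_add[symmetric]) simp
        then show ?thesis using that by (simp add: abs_mult)
      qed
      then show "\<forall>\<^sub>F h in at 0. norm ((\<bar>0 + h\<bar> powr q - \<bar>0\<bar> powr q) / h) \<le> \<bar>h\<bar> powr (q - 1)"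
        by (auto simp: eventually_at_filter)
    qed
    then show ?thesis using 3 by (simp add: DERIV_def)
  qed
qed

text \<open>The derivative of x_j |u|^q in direction j integrates to 0, which expresses the integral
  of |u|^q through x_j |u|^(q-1) times the derivative of u. As |x_j| \<le> R wherever u is nonzero,
  Young's inequality splits the product so that half of the integral can be absorbed.\<close>

lemma poincare_powr:
  fixes q R :: real
  assumes q: "q > 1" and R: "R > 0"
  obtains C where "C > 0"
    "\<And>(u :: real^'n \<Rightarrow> real) j. \<lbrakk>smooth u; \<And>x. x \<notin> cball 0 R \<Longrightarrow> u x = 0\<rbrakk> \<Longrightarrow>
      (\<integral>x. \<bar>u x\<bar> powr q \<partial>lborel) \<le> C * (\<integral>x. \<bar>partial j u x\<bar> powr q \<partial>lborel)"
proof -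
  define p where "p = q / (q - 1)"
  have p: "p > 1" unfolding p_def using q by (simp add: less_divide_eq)
  have qp: "q = p / (p - 1)" using q by (simp add: p_def field_simps)
  have e: "(q - 1) * p = q" using q by (simp add: p_def)
  \<comment> \<open>The factor 2 pays for the absorbed half; the rest is the Young coefficient for
    the weight 1/2, with q R from differentiating the power and bounding x_j.\<close>
  define C where "C = 2 * ((1/2) powr (- q / p) * (q * R) powr q)"
  show ?thesis
  proof (rule that)
    show "C > 0" using q R by (simp add: C_def)
    fix u :: "real^'n \<Rightarrow> real" and j :: 'n
    assume u: "smooth u" and u0: "\<And>x. x \<notin> cball 0 R \<Longrightarrow> u x = 0"
    have csu: "compactly_supported u" by (rule compactly_supportedI[OF smooth_continuous[OF u] u0])
    have csp: "compactly_supported (partial j u)" by (rule compactly_supported_partial[OF u csu])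
    let ?s = "\<lambda>x. sgn (u x) * \<bar>u x\<bar> powr (q - 1)"
    have css: "compactly_supported ?s"
      by (rule compactly_supported_comp[OF csu continuous_sgn_powr]) (use q in auto)
    let ?F = "\<lambda>x. x $ j * \<bar>u x\<bar> powr q"
    have csF: "compactly_supported ?F"
      using q by (intro compactly_supported_mult_left compactly_supported_powr csu) (auto intro!: continuous_intros)
    have dpow: "(\<lambda>x. \<bar>u x\<bar> powr q) differentiable at x" "partial j (\<lambda>x. \<bar>u x\<bar> powr q) x = q * ?s x * partial j u x" for x
      using has_derivative_real_comp[OF smooth_differentiable[OF u] abs_powr_has_real_derivative[OF q]]
        partial_real_comp[OF smooth_differentiable[OF u] abs_powr_has_real_derivative[OF q]]
      by (auto simp: differentiable_def)
    have dx: "(\<lambda>x::real^'n. x $ j) differentiable at x" "partial j (\<lambda>x::real^'n. x $ j) x = 1" for x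
      using bounded_linear_imp_differentiable[OF bounded_linear_vec_nth] partial_bounded_linear[OF bounded_linear_vec_nth[of j], of j]
      by auto
    have pF: "partial j ?F = (\<lambda>x. x $ j * (q * ?s x * partial j u x) + \<bar>u x\<bar> powr q)"
      by (rule ext) (simp add: partial_mult[OF dx(1) dpow(1)] dx(2) dpow(2))
    have cs1: "compactly_supported (\<lambda>x. x $ j * (q * ?s x * partial j u x))"
    proof (rule compactly_supported_mult_left)
      show "compactly_supported (\<lambda>x. q * ?s x * partial j u x)"
        by (rule compactly_supported_mult[OF compactly_supported_cmult[OF css] csp])
    qed (auto intro!: continuous_intros)
    have cs2: "compactly_supported (\<lambda>x. \<bar>u x\<bar> powr q)" using q by (intro compactly_supported_powr csu) simp
    have cs3: "compactly_supported (\<lambda>x. \<bar>partial j u x\<bar> powr q)" using q by (intro compactly_supported_powr csp) simp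
    have "(\<integral>x. partial j ?F x \<partial>lborel) = 0"
    proof (rule integral_partial_eq_0)
      show "?F differentiable at x" for x using dx(1) dpow(1) by (rule differentiable_mult)
      show "continuous_on UNIV (partial j ?F)"
        unfolding pF using compactly_supported_add[OF cs1 cs2] by (simp add: compactly_supported_def)
    qed (rule csF)
    then have "(\<integral>x. x $ j * (q * ?s x * partial j u x) \<partial>lborel) + (\<integral>x. \<bar>u x\<bar> powr q \<partial>lborel) = 0"
      unfolding pF by (simp only: Bochner_Integration.integral_add compactly_supported_integrable cs1 cs2)
    then have "(\<integral>x. \<bar>u x\<bar> powr q \<partial>lborel) = - (\<integral>x. x $ j * (q * ?s x * partial j u x) \<partial>lborel)" by linarith
    also have "\<dots> \<le> (\<integral>x. \<bar>x $ j * (q * ?s x * partial j u x)\<bar> \<partial>lborel)"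
      using integral_abs_bound[of lborel "\<lambda>x. x $ j * (q * ?s x * partial j u x)"] by linarith
    also have "\<dots> \<le> (\<integral>x. 1/2 * \<bar>u x\<bar> powr q + ((1/2) powr (- q / p) * (q * R) powr q) * \<bar>partial j u x\<bar> powr q \<partial>lborel)"
    proof (rule integral_mono)
      show "integrable lborel (\<lambda>x. \<bar>x $ j * (q * ?s x * partial j u x)\<bar>)"
        by (intro compactly_supported_integrable compactly_supported_abs cs1)
      show "integrable lborel (\<lambda>x. 1/2 * \<bar>u x\<bar> powr q + ((1/2) powr (- q / p) * (q * R) powr q) * \<bar>partial j u x\<bar> powr q)"
        by (intro compactly_supported_integrable compactly_supported_add compactly_supported_cmult cs2 cs3)
      show "\<bar>x $ j * (q * ?s x * partial j u x)\<bar> \<le> 1/2 * \<bar>u x\<bar> powr q + ((1/2) powr (- q / p) * (q * R) powr q) * \<bar>partial j u x\<bar> powr q" for x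
      proof (cases "x \<in> cball 0 R")
        case True
        have xj: "\<bar>x $ j\<bar> \<le> R" using component_le_norm_cart[of x j] True by auto
        have s1: "\<bar>?s x\<bar> = \<bar>u x\<bar> powr (q - 1)" by (auto simp: abs_mult abs_sgn_eq)
        have "\<bar>x $ j * (q * ?s x * partial j u x)\<bar> = \<bar>x $ j\<bar> * (\<bar>u x\<bar> powr (q - 1) * (q * \<bar>partial j u x\<bar>))"
          using q by (simp only: abs_mult[of "x $ j"] abs_mult[of _ "partial j u x"] abs_mult[of q] s1) simp
        also have "\<dots> \<le> R * (\<bar>u x\<bar> powr (q - 1) * (q * \<bar>partial j u x\<bar>))"
          using xj q by (intro mult_right_mono) auto
        also have "\<dots> = \<bar>u x\<bar> powr (q - 1) * (q * R * \<bar>partial j u x\<bar>)" by simp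
        also have "\<dots> \<le> 1/2 * (\<bar>u x\<bar> powr (q - 1)) powr p + (1/2) powr (- q / p) * (q * R * \<bar>partial j u x\<bar>) powr q"
          by (rule young_powr_scaled[OF p qp]) (use q R in auto)
        also have "\<dots> = 1/2 * \<bar>u x\<bar> powr q + ((1/2) powr (- q / p) * (q * R) powr q) * \<bar>partial j u x\<bar> powr q"
          using q R by (simp add: powr_powr e powr_mult)
        finally show ?thesis .
      next
        case False
        then have "u x = 0" by (rule u0)
        then show ?thesis by simp
      qed
    qed
    also have "\<dots> = 1/2 * (\<integral>x. \<bar>u x\<bar> powr q \<partial>lborel) + ((1/2) powr (- q / p) * (q * R) powr q) * (\<integral>x. \<bar>partial j u x\<bar> powr q \<partial>lborel)"
      by (simp only: Bochner_Integration.integral_add integral_mult_right_zero compactly_supported_integrable compactly_supported_cmult cs2 cs3)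
    finally show "(\<integral>x. \<bar>u x\<bar> powr q \<partial>lborel) \<le> C * (\<integral>x. \<bar>partial j u x\<bar> powr q \<partial>lborel)"
      unfolding C_def by linarith
  qed
qed

section \<open>Convolution with a smooth kernel\<close>

definition convolve :: "(real^'n \<Rightarrow> real) \<Rightarrow> (real^'n \<Rightarrow> real) \<Rightarrow> real^'n \<Rightarrow> real" where
  "convolve g K x = (\<integral>y. g y * K (x - y) \<partial>lborel)"

lemma compactly_supported_convolve_integrand:
  assumes g: "compactly_supported g" and K: "continuous_on UNIV K"
  shows "compactly_supported (\<lambda>y. g y * K (x - y))"
proof -
  have "continuous_on UNIV (\<lambda>y. K (x - y))"
    by (rule continuous_on_compose2[OF K]) (auto intro!: continuous_intros)
  from compactly_supported_mult_left[OF g this] show ?thesis by (simp add: mult.commute)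
qed

text \<open>All derivatives fall on K, as g is only continuous. The integral is first confined to a
  box containing the support of g, where differentiation under the integral sign needs only
  continuity; no decay of K is involved.\<close>

lemma convolve_has_derivative:
  assumes g: "compactly_supported g" and K: "smooth K"
  shows "(convolve g K has_derivative (\<lambda>h. \<Sum>j\<in>UNIV. h $ j * convolve g (partial j K) x)) (at x)"
proof -
  obtain a where a: "{x. g x \<noteq> 0} \<subseteq> cbox (- a) a"
    using g bounded_subset_cbox_symmetric by (metis compactly_supported_def)
  have conv: "convolve g L x = integral (cbox (- a) a) (\<lambda>y. g y * L (x - y))" if "continuous_on UNIV L" for L x
  proof -
    have "convolve g L x = integral UNIV (\<lambda>y. g y * L (x - y))"
      unfolding convolve_def
      by (rule integral_lborel[symmetric]) (rule compactly_supported_integrable[OF compactly_supported_convolve_integrand[OF g that]])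
    also have "\<dots> = integral UNIV (\<lambda>y. if y \<in> cbox (- a) a then g y * L (x - y) else 0)"
      using a by (intro arg_cong[where f = "integral UNIV"]) force
    also have "\<dots> = integral (cbox (- a) a) (\<lambda>y. g y * L (x - y))" by (rule integral_restrict_UNIV)
    finally show ?thesis .
  qed
  have cont: "continuous_on S (\<lambda>y. g y * L (x - y))" if "continuous_on UNIV L" for L x S
    using compactly_supported_convolve_integrand[OF g that] continuous_on_subset by (fastforce simp: compactly_supported_def)
  define D where "D = (\<lambda>x y. \<Sum>j\<in>UNIV. (g y * partial j K (x - y)) *\<^sub>R blinfun_inner_left (axis j 1 :: real^'a))"
  have D: "blinfun_apply (D x y) h = (\<Sum>j\<in>UNIV. h $ j * (g y * partial j K (x - y)))" for x y h
    by (simp add: D_def blinfun.sum_left blinfun.scaleR_left inner_axis mult.commute)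
  have contD: "continuous_on (UNIV \<times> cbox (- a) a) (\<lambda>(x, y). D x y)"
  proof -
    have "continuous_on (UNIV \<times> cbox (- a) a) (\<lambda>z. g (snd z) * partial j K (fst z - snd z))" for j
    proof (rule continuous_on_mult)
      show "continuous_on (UNIV \<times> cbox (- a) a) (\<lambda>z. g (snd z))"
        by (rule continuous_on_compose2[of UNIV g]) (use g in \<open>auto simp: compactly_supported_def intro!: continuous_intros\<close>)
      show "continuous_on (UNIV \<times> cbox (- a) a) (\<lambda>z. partial j K (fst z - snd z))"
        by (rule continuous_on_compose2[OF smooth_continuous[OF smooth_partial[OF K]]]) (auto intro!: continuous_intros)
    qed
    then show ?thesis unfolding D_def split_beta by (intro continuous_on_sum continuous_on_scaleR continuous_on_const)
  qed
  have "((\<lambda>x. integral (cbox (- a) a) (\<lambda>y. g y * K (x - y))) has_derivative blinfun_apply (integral (cbox (- a) a) (D x))) (at x within UNIV)"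
  proof (rule leibniz_rule[where fx = D, OF _ _ contD])
    show "((\<lambda>x. g y * K (x - y)) has_derivative blinfun_apply (D x y)) (at x within UNIV)" for x y
    proof -
      have "((\<lambda>x. K (x - y)) has_derivative (\<lambda>h. \<Sum>j\<in>UNIV. h $ j *\<^sub>R partial j K (x - y))) (at x)"
        by (rule has_derivative_compose[OF _ has_derivative_partial[OF smooth_differentiable[OF K]]]) (auto intro!: derivative_eq_intros)
      then have "((\<lambda>x. g y * K (x - y)) has_derivative (\<lambda>h. g y * (\<Sum>j\<in>UNIV. h $ j *\<^sub>R partial j K (x - y)))) (at x)"
        by (rule has_derivative_mult_right)
      moreover have "(\<lambda>h. g y * (\<Sum>j\<in>UNIV. h $ j *\<^sub>R partial j K (x - y))) = blinfun_apply (D x y)"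
        by (rule ext) (simp add: D sum_distrib_left mult_ac)
      ultimately show ?thesis by simp
    qed
    show "(\<lambda>y. g y * K (x - y)) integrable_on cbox (- a) a" for x
      by (intro integrable_continuous cont smooth_continuous K)
  qed auto
  moreover have "blinfun_apply (integral (cbox (- a) a) (D x)) = (\<lambda>h. \<Sum>j\<in>UNIV. h $ j * convolve g (partial j K) x)"
  proof
    fix h
    have "continuous_on (cbox (- a) a) (\<lambda>y. case (x, y) of (x, y) \<Rightarrow> D x y)"
      by (rule continuous_on_compose2[OF contD]) (auto intro!: continuous_intros)
    then have "continuous_on (cbox (- a) a) (D x)" by simp
    then have "blinfun_apply (integral (cbox (- a) a) (D x)) h = integral (cbox (- a) a) (\<lambda>y. blinfun_apply (D x y) h)"
      by (intro blinfun_apply_integral integrable_continuous)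
    also have "\<dots> = (\<Sum>j\<in>UNIV. h $ j * integral (cbox (- a) a) (\<lambda>y. g y * partial j K (x - y)))"
      unfolding D using cont[OF smooth_continuous[OF smooth_partial[OF K]]]
      by (subst integral_sum) (auto intro!: integrable_continuous integrable_on_mult_right continuous_on_mult_left)
    also have "\<dots> = (\<Sum>j\<in>UNIV. h $ j * convolve g (partial j K) x)"
      by (simp add: conv smooth_continuous smooth_partial K)
    finally show "blinfun_apply (integral (cbox (- a) a) (D x)) h = (\<Sum>j\<in>UNIV. h $ j * convolve g (partial j K) x)" .
  qed
  moreover have "convolve g K = (\<lambda>x. integral (cbox (- a) a) (\<lambda>y. g y * K (x - y)))"
    by (rule ext) (rule conv[OF smooth_continuous[OF K]])
  ultimately show ?thesis by simp
qed

lemma partial_convolve: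
  assumes "compactly_supported g" "smooth K"
  shows "partial j (convolve g K) = convolve g (partial j K)"
proof
  fix x
  have "partial j (convolve g K) x = (\<Sum>i\<in>UNIV. axis j 1 $ i * convolve g (partial i K) x)"
    by (rule partial_eqI[OF convolve_has_derivative[OF assms]])
  also have "\<dots> = convolve g (partial j K) x"
    by (simp add: axis_def if_distrib[where f = "\<lambda>c. c * _"] cong: if_cong)
  finally show "partial j (convolve g K) x = convolve g (partial j K) x" .
qed

lemma smooth_convolve:
  assumes g: "compactly_supported g" and K: "smooth K"
  shows "smooth (convolve g K)"
proof -
  have diff: "convolve g K differentiable at x" if "smooth K" for K x
    using convolve_has_derivative[OF g that] by (auto simp: differentiable_def)
  have "Ck k (convolve g K)" if "smooth K" for k K
    using that
  proof (induction k arbitrary: K)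
    case 0
    then show ?case using diff by (auto simp: continuous_on_eq_continuous_at differentiable_imp_continuous_within)
  next
    case (Suc k)
    then show ?case by (simp add: diff partial_convolve[OF g] smooth_partial)
  qed
  with K show ?thesis by (simp add: smooth_def)
qed

lemma partial_locally_constant:
  fixes f :: "real^'n \<Rightarrow> 'b::real_normed_vector"
  assumes "open S" "x \<in> S" "\<And>y. y \<in> S \<Longrightarrow> f y = c"
  shows "partial j f x = 0"
proof -
  have "((\<lambda>x. c) has_derivative (\<lambda>h. 0)) (at x)" by simp
  then have "(f has_derivative (\<lambda>h. 0)) (at x)"
    by (rule has_derivative_transform_within_open[of "\<lambda>x. c" "\<lambda>h. 0" x UNIV S]) (use assms in auto)
  then show ?thesis using partial_eqI by metis
qed

lemma laplacian_mult:
  fixes f g :: "real^'n \<Rightarrow> real"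
  assumes f: "smooth f" and g: "smooth g"
  shows "laplacian (\<lambda>x. f x * g x) x = f x * laplacian g x + 2 * (\<Sum>j\<in>UNIV. partial j f x * partial j g x) + laplacian f x * g x"
proof -
  note d = smooth_differentiable smooth_partial f g
  have 1: "partial j (\<lambda>x. f x * g x) = (\<lambda>x. f x * partial j g x + partial j f x * g x)" for j
    by (intro ext partial_mult d)
  have 2: "partial j (partial j (\<lambda>x. f x * g x)) x
    = f x * partial j (partial j g) x + 2 * (partial j f x * partial j g x) + partial j (partial j f) x * g x" for j
    unfolding 1
    by (simp add: partial_add partial_mult d differentiable_mult)
  show ?thesis unfolding laplacian_def 2 by (simp add: sum.distrib sum_distrib_left sum_distrib_right)
qed

section \<open>The Newton potential\<close>

text \<open>The function -1/|x|, whose Laplacian is 4 pi times the point mass at 0, made smooth by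
  adding \<eta>^2 to |x|^2. The normalising factor is left out and reappears as
  \<open>newton_mass\<close>.\<close>

definition newton_kernel :: "real \<Rightarrow> real^3 \<Rightarrow> real" where
  "newton_kernel \<eta> x = - ((x \<bullet> x + \<eta>\<^sup>2) powr (- 1/2))"

text \<open>The Laplacian of \<open>newton_kernel \<eta>\<close> for \<eta> > 0. It is \<eta>^(-3)
  times a rescaling of the function for \<eta> = 1, hence a nonnegative approximate identity of
  constant mass.\<close>

definition newton_mollifier :: "real \<Rightarrow> real^3 \<Rightarrow> real" where
  "newton_mollifier \<eta> x = 3 * \<eta>\<^sup>2 * (x \<bullet> x + \<eta>\<^sup>2) powr (- 5/2)"

lemma smooth_inner_powr:
  assumes "\<eta> > 0"
  shows "smooth (\<lambda>x::real^'n. (x \<bullet> x + \<eta>\<^sup>2) powr a)"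
  by (intro smooth_powr smooth_add smooth_inner_self smooth_const) (use assms in \<open>auto intro: add_nonneg_pos\<close>)

lemma partial_component: "partial j (\<lambda>x::real^'n. x $ i) x = (if i = j then 1 else 0)"
  using partial_bounded_linear[OF bounded_linear_vec_nth[of i], of j] by (simp add: axis_def)

lemma smooth_component: "smooth (\<lambda>x::real^'n. x $ i)"
  by (rule smooth_bounded_linear[OF bounded_linear_vec_nth])

lemma partial_inner_self: "partial j (\<lambda>x::real^'n. x \<bullet> x + c) x = 2 * x $ j"
proof -
  have "((\<lambda>x::real^'n. x \<bullet> x + c) has_derivative (\<lambda>h. x \<bullet> h + h \<bullet> x)) (at x)"
    by (auto intro!: derivative_eq_intros)
  from partial_eqI[OF this, of j] show ?thesis by (simp add: inner_axis inner_axis' )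
qed

lemma partial_inner_powr:
  assumes "\<eta> > 0"
  shows "partial j (\<lambda>x::real^'n. (x \<bullet> x + \<eta>\<^sup>2) powr a) = (\<lambda>x. 2 * a * (x $ j * (x \<bullet> x + \<eta>\<^sup>2) powr (a - 1)))"
proof
  fix x :: "real^'n"
  have pos: "x \<bullet> x + \<eta>\<^sup>2 > 0" using assms by (auto intro: add_nonneg_pos)
  have d: "((\<lambda>t. t powr a) has_real_derivative a * (x \<bullet> x + \<eta>\<^sup>2) powr (a - 1)) (at (x \<bullet> x + \<eta>\<^sup>2))"
    using has_real_derivative_powr[OF pos] by simp
  have "(\<lambda>x::real^'n. x \<bullet> x + \<eta>\<^sup>2) differentiable at x"
    by (intro smooth_differentiable smooth_add smooth_inner_self smooth_const)
  from partial_real_comp[OF this d, of j]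
  show "partial j (\<lambda>x::real^'n. (x \<bullet> x + \<eta>\<^sup>2) powr a) x = 2 * a * (x $ j * (x \<bullet> x + \<eta>\<^sup>2) powr (a - 1))"
    by (simp add: partial_inner_self)
qed

lemma smooth_newton_kernel: "\<eta> > 0 \<Longrightarrow> smooth (newton_kernel \<eta>)"
  using smooth_cmult[OF smooth_inner_powr[of \<eta> "- 1/2"], of "-1"] by (simp add: newton_kernel_def[abs_def])

lemma partial_newton_kernel:
  assumes "\<eta> > 0"
  shows "partial j (newton_kernel \<eta>) = (\<lambda>x. x $ j * (x \<bullet> x + \<eta>\<^sup>2) powr (- 3/2))"
proof
  fix x :: "real^3"
  have "newton_kernel \<eta> = (\<lambda>x. (- 1) * (x \<bullet> x + \<eta>\<^sup>2) powr (- 1/2))" by (auto simp: newton_kernel_def)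
  then have "partial j (newton_kernel \<eta>) x = partial j (\<lambda>x. (- 1) * (x \<bullet> x + \<eta>\<^sup>2) powr (- 1/2)) x" by simp
  also have "\<dots> = (-1) * partial j (\<lambda>x. (x \<bullet> x + \<eta>\<^sup>2) powr (- 1/2)) x + partial j (\<lambda>x. -1) x * (x \<bullet> x + \<eta>\<^sup>2) powr (- 1/2)"
    by (rule partial_mult) (auto intro!: smooth_differentiable smooth_inner_powr assms)
  also have "\<dots> = x $ j * (x \<bullet> x + \<eta>\<^sup>2) powr (- 3/2)"
    by (simp add: partial_inner_powr[OF assms])
  finally show "partial j (newton_kernel \<eta>) x = x $ j * (x \<bullet> x + \<eta>\<^sup>2) powr (- 3/2)" .
qed

lemma laplacian_newton_kernel:
  assumes \<eta>: "\<eta> > 0"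
  shows "laplacian (newton_kernel \<eta>) = newton_mollifier \<eta>"
proof
  fix x :: "real^3"
  let ?r = "x \<bullet> x + \<eta>\<^sup>2"
  have pos: "?r > 0" using \<eta> by (auto intro: add_nonneg_pos)
  have 1: "partial j (partial j (newton_kernel \<eta>)) x = ?r powr (- 3/2) - 3 * (x $ j)\<^sup>2 * ?r powr (- 5/2)" for j
  proof -
    have "partial j (partial j (newton_kernel \<eta>)) x
      = x $ j * partial j (\<lambda>x. (x \<bullet> x + \<eta>\<^sup>2) powr (- 3/2)) x + partial j (\<lambda>x. x $ j) x * ?r powr (- 3/2)"
      unfolding partial_newton_kernel[OF \<eta>]
      by (rule partial_mult) (auto intro!: smooth_differentiable smooth_inner_powr smooth_component \<eta>)
    also have "\<dots> = ?r powr (- 3/2) - 3 * (x $ j)\<^sup>2 * ?r powr (- 5/2)"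
      unfolding partial_inner_powr[OF \<eta>] partial_component by (simp add: power2_eq_square)
    finally show ?thesis .
  qed
  have "laplacian (newton_kernel \<eta>) x = 3 * ?r powr (- 3/2) - 3 * (x \<bullet> x) * ?r powr (- 5/2)"
    by (simp add: laplacian_def 1 sum_subtractf inner_vec_def power2_eq_square sum_distrib_left[symmetric] sum_distrib_right[symmetric])
  \<comment> \<open>Splitting off one factor |x|^2 + \<eta>^2 lets the terms with 3 |x|^2 cancel and
    leaves 3 \<eta>^2.\<close>
  also have "?r powr (- 3/2) = ?r powr (- 5/2) * ?r powr 1" by (simp only: powr_add[symmetric]) simp
  also have "?r powr 1 = ?r" using pos by simp
  finally show "laplacian (newton_kernel \<eta>) x = newton_mollifier \<eta> x"
    by (simp add: newton_mollifier_def algebra_simps)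
qed

lemma newton_kernel_bounds:
  assumes "norm z \<ge> 1"
  shows "\<bar>newton_kernel \<eta> z\<bar> \<le> 1" "\<eta> > 0 \<Longrightarrow> \<bar>partial j (newton_kernel \<eta>) z\<bar> \<le> 1"
proof -
  have "z \<bullet> z = (norm z)\<^sup>2" by (simp add: power2_norm_eq_inner)
  then have "z \<bullet> z \<ge> 1" using assms by simp
  then have r: "z \<bullet> z + \<eta>\<^sup>2 \<ge> 1" by (simp add: add_increasing2)
  have "(z \<bullet> z + \<eta>\<^sup>2) powr (- 1/2) \<le> 1 powr (- 1/2)" using r by (intro powr_mono2') auto
  then show "\<bar>newton_kernel \<eta> z\<bar> \<le> 1" by (simp add: newton_kernel_def)
  assume \<eta>: "\<eta> > 0"
  have "\<bar>z $ j\<bar> \<le> (z \<bullet> z + \<eta>\<^sup>2) powr (1/2)"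
  proof -
    have "\<bar>z $ j\<bar> \<le> norm z" by (rule component_le_norm_cart)
    also have "norm z = (z \<bullet> z) powr (1/2)" by (simp add: norm_eq_sqrt_inner powr_half_sqrt)
    also have "\<dots> \<le> (z \<bullet> z + \<eta>\<^sup>2) powr (1/2)" by (intro powr_mono2) auto
    finally show ?thesis .
  qed
  then have "\<bar>z $ j\<bar> * (z \<bullet> z + \<eta>\<^sup>2) powr (- 3/2) \<le> (z \<bullet> z + \<eta>\<^sup>2) powr (1/2) * (z \<bullet> z + \<eta>\<^sup>2) powr (- 3/2)"
    by (intro mult_right_mono) auto
  also have "\<dots> = (z \<bullet> z + \<eta>\<^sup>2) powr (- 1)" by (simp only: powr_add[symmetric]) simp
  also have "\<dots> \<le> 1 powr (- 1)" using r by (intro powr_mono2') auto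
  finally show "\<bar>partial j (newton_kernel \<eta>) z\<bar> \<le> 1" by (simp add: partial_newton_kernel[OF \<eta>] abs_mult)
qed

lemma continuous_newton_mollifier: "\<eta> > 0 \<Longrightarrow> continuous_on UNIV (newton_mollifier \<eta>)"
  using smooth_continuous[OF smooth_cmult[OF smooth_inner_powr[of \<eta> "- 5/2"], of "3 * \<eta>\<^sup>2"]]
  by (simp add: newton_mollifier_def[abs_def])

lemma newton_mollifier_nonneg: "newton_mollifier \<eta> x \<ge> 0"
  by (simp add: newton_mollifier_def)

text \<open>If 2^k is the first power of two to reach |x|, the integrand is at most a multiple of
  32^(-k), while the ball of radius 2^k has volume proportional to 8^k. The resulting series is
  geometric with ratio 1/4.\<close>

lemma integrable_newton_mollifier_1: "integrable lborel (newton_mollifier 1)"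
proof (rule integrableI_bounded)
  show "newton_mollifier 1 \<in> borel_measurable lborel"
    using borel_measurable_continuous_onI[OF continuous_newton_mollifier[of 1]] by simp
  \<comment> \<open>96 = 3 * 32: for k > 0 the decay is read off at radius 2^(k-1), and the shift by
    one costs a factor 32.\<close>
  define c where "c = (\<lambda>k::nat. 96 * (1/32) ^ k :: real)"
  have pt: "\<exists>k. norm x \<le> 2 ^ k \<and> newton_mollifier 1 x \<le> c k" for x
  proof -
    define k where "k = (LEAST k. norm x \<le> 2 ^ k)"
    have "\<exists>k. norm x \<le> 2 ^ k" using real_arch_pow[of 2 "norm x"] by (auto intro: less_imp_le)
    then have k: "norm x \<le> 2 ^ k" unfolding k_def by (rule LeastI_ex)
    have xx: "x \<bullet> x = (norm x)\<^sup>2" by (simp add: power2_norm_eq_inner)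
    have "newton_mollifier 1 x \<le> c k"
    proof (cases k)
      case 0
      have "(x \<bullet> x + 1) powr (- 5/2) \<le> 1 powr (- 5/2)" by (intro powr_mono2') auto
      then show ?thesis by (simp add: newton_mollifier_def c_def 0)
    next
      case (Suc m)
      then have "\<not> norm x \<le> 2 ^ m" unfolding k_def using not_less_Least[of m "\<lambda>k. norm x \<le> 2 ^ k"] by simp
      then have "(2 ^ m)\<^sup>2 \<le> (norm x)\<^sup>2" by (intro power_mono) auto
      then have "(2 ^ m)\<^sup>2 \<le> x \<bullet> x + 1" unfolding xx by linarith
      then have "(x \<bullet> x + 1) powr (- 5/2) \<le> ((2 ^ m)\<^sup>2) powr (- 5/2)" by (intro powr_mono2') auto
      also have "((2 ^ m)\<^sup>2) powr (- 5/2) = \<bar>(2::real) ^ m\<bar> powr (- 5)" using square_powr_half[of "2 ^ m" "- 5"] by simp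
      also have "\<dots> = inverse (((2::real) ^ m) powr 5)" by (simp only: powr_minus) simp
      also have "((2::real) ^ m) powr 5 = ((2::real) ^ m) ^ 5" by (rule powr_numeral) simp
      also have "((2::real) ^ m) ^ 5 = (2 ^ 5) ^ m" by (simp only: power_mult[symmetric] mult.commute)
      also have "inverse ((2 ^ 5 :: real) ^ m) = (1/32) ^ m" by (simp add: power_one_over inverse_eq_divide)
      finally show ?thesis by (simp add: newton_mollifier_def c_def Suc)
    qed
    with k show ?thesis by blast
  qed
  define V where "V = unit_ball_vol 3"
  have V: "V \<ge> 0" by (simp add: V_def)
  have "(\<integral>\<^sup>+x. ennreal (norm (newton_mollifier 1 x)) \<partial>lborel) \<le> (\<integral>\<^sup>+x. (\<Sum>k. ennreal (c k) * indicator (cball (0::real^3) (2 ^ k)) x) \<partial>lborel)"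
  proof (rule nn_integral_mono)
    fix x :: "real^3"
    obtain k where k: "norm x \<le> 2 ^ k" "newton_mollifier 1 x \<le> c k" using pt by blast
    have "ennreal (norm (newton_mollifier 1 x)) \<le> ennreal (c k) * indicator (cball 0 (2 ^ k)) x"
      using k newton_mollifier_nonneg[of 1 x] by (simp add: ennreal_leI)
    also have "\<dots> \<le> (\<Sum>k. ennreal (c k) * indicator (cball 0 (2 ^ k)) x)"
    proof -
      define f where "f = (\<lambda>k. ennreal (c k) * indicator (cball 0 (2 ^ k)) x)"
      have "sum f {k} \<le> suminf f" by (rule sum_le_suminf) auto
      then have "f k \<le> suminf f" by simp
      then show ?thesis unfolding f_def .
    qed
    finally show "ennreal (norm (newton_mollifier 1 x)) \<le> (\<Sum>k. ennreal (c k) * indicator (cball 0 (2 ^ k)) x)" .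
  qed
  also have "\<dots> = (\<Sum>k. \<integral>\<^sup>+x. ennreal (c k) * indicator (cball (0::real^3) (2 ^ k)) x \<partial>lborel)"
    by (intro nn_integral_suminf) (auto intro!: borel_measurable_times_ennreal borel_measurable_indicator)
  also have "\<dots> = (\<Sum>k. ennreal (96 * V * (1/4) ^ k))"
  proof (intro suminf_cong)
    fix k :: nat
    have "(\<integral>\<^sup>+x. ennreal (c k) * indicator (cball (0::real^3) (2 ^ k)) x \<partial>lborel) = ennreal (c k) * emeasure lborel (cball (0::real^3) (2 ^ k))"
      by (simp add: nn_integral_cmult_indicator)
    also have "emeasure lborel (cball (0::real^3) (2 ^ k)) = ennreal (V * (2 ^ k) ^ 3)"
      by (simp add: emeasure_cball V_def)
    also have "ennreal (c k) * ennreal (V * (2 ^ k) ^ 3) = ennreal (c k * (V * (2 ^ k) ^ 3))"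
      using V by (intro ennreal_mult[symmetric]) (auto simp: c_def)
    also have "c k * (V * (2 ^ k) ^ 3) = 96 * V * (1/4) ^ k"
    proof -
      have "(1/32) ^ k * ((2::real) ^ k) ^ 3 = (1/32 * 8) ^ k"
        unfolding power_mult_distrib power_mult[symmetric] mult.commute[of k] by (simp add: power_mult)
      then show ?thesis by (simp add: c_def algebra_simps)
    qed
    finally show "(\<integral>\<^sup>+x. ennreal (c k) * indicator (cball (0::real^3) (2 ^ k)) x \<partial>lborel) = ennreal (96 * V * (1/4) ^ k)" .
  qed
  also have "\<dots> = ennreal (\<Sum>k. 96 * V * (1/4) ^ k)"
    using V by (intro suminf_ennreal2) (auto intro!: summable_mult summable_geometric)
  also have "\<dots> < \<infinity>" by simp
  finally show "(\<integral>\<^sup>+x. ennreal (norm (newton_mollifier 1 x)) \<partial>lborel) < \<infinity>" .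
qed

text \<open>The value is 4 pi; it is carried along as a positive constant.\<close>

definition newton_mass :: real where
  "newton_mass = (\<integral>x. newton_mollifier 1 x \<partial>lborel)"

lemma newton_mass_pos: "newton_mass > 0"
proof -
  have "newton_mass \<ge> 0" unfolding newton_mass_def by (intro Bochner_Integration.integral_nonneg newton_mollifier_nonneg)
  moreover have "newton_mass \<noteq> 0"
  proof
    assume "newton_mass = 0"
    then have "AE x in lborel. newton_mollifier 1 x = 0"
      unfolding newton_mass_def
      using integral_nonneg_eq_0_iff_AE[OF integrable_newton_mollifier_1] newton_mollifier_nonneg by auto
    moreover have "newton_mollifier 1 x \<noteq> 0" for x
    proof -
      have "x \<bullet> x + 1 > 0" by (intro add_nonneg_pos) auto
      then show ?thesis by (simp add: newton_mollifier_def)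
    qed
    ultimately have "AE x::real^3 in lborel. False" by simp
    then show False by (simp add: eventually_False ae_filter_eq_bot_iff)
  qed
  ultimately show ?thesis by simp
qed

lemma integral_lborel_affine:
  fixes F :: "'a::euclidean_space \<Rightarrow> real"
  assumes F: "F \<in> borel_measurable borel" and c: "c \<noteq> 0"
  shows "(\<integral>y. F y \<partial>lborel) = (\<integral>z. \<bar>c\<bar> ^ DIM('a) * F (t + c *\<^sub>R z) \<partial>lborel)"
proof -
  have "(\<integral>y. F y \<partial>lborel) = (\<integral>y. F y \<partial>density (distr lborel borel (\<lambda>x. t + c *\<^sub>R x)) (\<lambda>_. ennreal (\<bar>c\<bar> ^ DIM('a))))"
    using lborel_affine[OF c, of t] by (simp add: ennreal_power)
  also have "\<dots> = (\<integral>y. \<bar>c\<bar> ^ DIM('a) * F y \<partial>distr lborel borel (\<lambda>x. t + c *\<^sub>R x))"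
    using F by (subst integral_density) auto
  also have "\<dots> = (\<integral>z. \<bar>c\<bar> ^ DIM('a) * F (t + c *\<^sub>R z) \<partial>lborel)"
    using F by (subst integral_distr) auto
  finally show ?thesis .
qed

text \<open>Substituting y = x - \<eta> z moves \<eta> from the kernel into the argument of g, so
  bounds and convergence become statements about translates of g against one fixed integrable
  weight.\<close>

lemma convolve_newton_mollifier_rescaled:
  assumes g: "compactly_supported g" and \<eta>: "\<eta> > 0"
  shows "convolve g (newton_mollifier \<eta>) x = (\<integral>z. g (x - \<eta> *\<^sub>R z) * newton_mollifier 1 z \<partial>lborel)"
proof -
  have m: "(\<lambda>y. g y * newton_mollifier \<eta> (x - y)) \<in> borel_measurable borel"
    by (intro compactly_supported_measurable compactly_supported_convolve_integrand g continuous_newton_mollifier \<eta>)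
  have s: "\<eta> ^ 3 * newton_mollifier \<eta> (\<eta> *\<^sub>R z) = newton_mollifier 1 z" for z
  proof -
    have "(\<eta> *\<^sub>R z) \<bullet> (\<eta> *\<^sub>R z) + \<eta>\<^sup>2 = \<eta>\<^sup>2 * (z \<bullet> z + 1)" by (simp add: power2_eq_square algebra_simps)
    then have "((\<eta> *\<^sub>R z) \<bullet> (\<eta> *\<^sub>R z) + \<eta>\<^sup>2) powr (- 5/2) = (\<eta>\<^sup>2) powr (- 5/2) * (z \<bullet> z + 1) powr (- 5/2)"
      by (simp add: powr_mult add_nonneg_nonneg)
    also have "(\<eta>\<^sup>2) powr (- 5/2) = \<eta> powr (- 5)" using square_powr_half[of \<eta> "- 5"] \<eta> by simp
    also have "\<eta> powr (- 5) = 1 / \<eta> ^ 5" using \<eta> by (simp add: powr_minus powr_numeral inverse_eq_divide)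
    finally have "newton_mollifier \<eta> (\<eta> *\<^sub>R z) = 3 * \<eta>\<^sup>2 * (1 / \<eta> ^ 5 * (z \<bullet> z + 1) powr (- 5/2))"
      by (simp add: newton_mollifier_def)
    then show ?thesis using \<eta> by (simp add: newton_mollifier_def power2_eq_square numeral_eq_Suc)
  qed
  have "convolve g (newton_mollifier \<eta>) x = (\<integral>z. \<bar>- \<eta>\<bar> ^ DIM(real^3) * (g (x + (- \<eta>) *\<^sub>R z) * newton_mollifier \<eta> (x - (x + (- \<eta>) *\<^sub>R z))) \<partial>lborel)"
    unfolding convolve_def by (rule integral_lborel_affine[OF m]) (use \<eta> in auto)
  also have "\<dots> = (\<integral>z. g (x - \<eta> *\<^sub>R z) * (\<eta> ^ 3 * newton_mollifier \<eta> (\<eta> *\<^sub>R z)) \<partial>lborel)"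
    using \<eta> by (simp add: mult_ac)
  finally show ?thesis by (simp only: s)
qed

lemma convolve_newton_mollifier_bound:
  assumes g: "compactly_supported g" and G: "\<And>x. \<bar>g x\<bar> \<le> G" and \<eta>: "\<eta> > 0"
  shows "\<bar>convolve g (newton_mollifier \<eta>) x\<bar> \<le> G * newton_mass"
proof -
  have le: "\<bar>g (x - \<eta> *\<^sub>R z) * newton_mollifier 1 z\<bar> \<le> G * newton_mollifier 1 z" for z
    using G newton_mollifier_nonneg[of 1 z] by (simp add: abs_mult mult_right_mono)
  have int: "integrable lborel (\<lambda>z. G * newton_mollifier 1 z)" using integrable_newton_mollifier_1 by simp
  have "(\<lambda>z. g (x - \<eta> *\<^sub>R z) * newton_mollifier 1 z) \<in> borel_measurable lborel"
    using borel_measurable_continuous_onI[OF continuous_newton_mollifier[of 1]]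
    by (auto intro!: borel_measurable_times measurable_compose[OF _ compactly_supported_measurable[OF g]])
  then have int': "integrable lborel (\<lambda>z. g (x - \<eta> *\<^sub>R z) * newton_mollifier 1 z)"
    using le by (intro Bochner_Integration.integrable_bound[OF int]) (auto intro!: always_eventually order_trans[OF le abs_ge_self])
  have "\<bar>convolve g (newton_mollifier \<eta>) x\<bar> \<le> (\<integral>z. \<bar>g (x - \<eta> *\<^sub>R z) * newton_mollifier 1 z\<bar> \<partial>lborel)"
    unfolding convolve_newton_mollifier_rescaled[OF g \<eta>] by (rule integral_abs_bound)
  also have "\<dots> \<le> (\<integral>z. G * newton_mollifier 1 z \<partial>lborel)"
    by (rule integral_mono[OF integrable_abs[OF int'] int le])
  finally show ?thesis by (simp add: newton_mass_def)
qed

lemma convolve_newton_mollifier_tendsto: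
  assumes g: "compactly_supported g" and \<eta>: "\<And>n. \<eta> n > 0" "\<eta> \<longlonglongrightarrow> 0"
  shows "(\<lambda>n. convolve g (newton_mollifier (\<eta> n)) x) \<longlonglongrightarrow> newton_mass * g x"
proof -
  obtain G where G: "\<And>x. \<bar>g x\<bar> \<le> G" using compactly_supported_bounded[OF g] by metis
  have gm: "g \<in> borel_measurable borel" by (rule compactly_supported_measurable[OF g])
  have nm: "newton_mollifier 1 \<in> borel_measurable borel"
    by (rule borel_measurable_continuous_onI[OF continuous_newton_mollifier]) simp
  have "(\<lambda>n. \<integral>z. g (x - \<eta> n *\<^sub>R z) * newton_mollifier 1 z \<partial>lborel) \<longlonglongrightarrow> (\<integral>z. g x * newton_mollifier 1 z \<partial>lborel)"
  proof (rule tendsto_integral_compact[where w = "\<lambda>z. G * newton_mollifier 1 z"])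
    show "(\<lambda>z. g (x - \<eta> n *\<^sub>R z) * newton_mollifier 1 z) \<in> borel_measurable borel" for n
      by (intro borel_measurable_times nm measurable_compose[OF _ gm]) auto
    show "(\<lambda>n. g (x - \<eta> n *\<^sub>R z) * newton_mollifier 1 z) \<longlonglongrightarrow> g x * newton_mollifier 1 z" for z
    proof (intro tendsto_mult tendsto_const)
      have "(\<lambda>n. x - \<eta> n *\<^sub>R z) \<longlonglongrightarrow> x - 0 *\<^sub>R z" by (intro tendsto_intros \<eta>)
      moreover have "isCont g x" using g by (simp add: compactly_supported_def continuous_on_eq_continuous_at)
      ultimately show "(\<lambda>n. g (x - \<eta> n *\<^sub>R z)) \<longlonglongrightarrow> g x" by (auto intro: isCont_tendsto_compose)
    qed
    show "\<bar>g (x - \<eta> n *\<^sub>R z) * newton_mollifier 1 z\<bar> \<le> G * newton_mollifier 1 z" for n z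
      using G newton_mollifier_nonneg[of 1 z] by (simp add: abs_mult mult_right_mono)
    show "integrable lborel (\<lambda>z. G * newton_mollifier 1 z)"
      using integrable_newton_mollifier_1 by simp
  qed
  then show ?thesis by (simp add: convolve_newton_mollifier_rescaled[OF g \<eta>(1)] newton_mass_def mult.commute)
qed

lemma laplacian_convolve:
  assumes "compactly_supported g" "smooth K"
  shows "laplacian (convolve g K) x = convolve g (laplacian K) x"
proof -
  have "integrable lborel (\<lambda>y. g y * partial j (partial j K) (x - y))" for j
    by (intro compactly_supported_integrable compactly_supported_convolve_integrand smooth_continuous smooth_partial assms)
  then have "(\<integral>y. (\<Sum>j\<in>UNIV. g y * partial j (partial j K) (x - y)) \<partial>lborel) = (\<Sum>j\<in>UNIV. \<integral>y. g y * partial j (partial j K) (x - y) \<partial>lborel)"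
    by (intro Bochner_Integration.integral_sum)
  then show ?thesis
    by (simp add: laplacian_def partial_convolve assms smooth_partial convolve_def sum_distrib_left)
qed

text \<open>For y in the support of g the point x - y keeps distance at least 1 from the origin, so
  a kernel is only met where it is bounded by 1. For the regularised Newton kernels this makes the
  bound uniform in \<eta>.\<close>

lemma convolve_far_bound:
  assumes g: "compactly_supported g" "\<And>x. x \<notin> cball 0 R \<Longrightarrow> g x = 0" and K: "continuous_on UNIV K"
    and K1: "\<And>z. norm z \<ge> 1 \<Longrightarrow> \<bar>K z\<bar> \<le> 1" and x: "norm x \<ge> R + 1"
  shows "\<bar>convolve g K x\<bar> \<le> (\<integral>y. \<bar>g y\<bar> \<partial>lborel)"
proof -
  have int: "integrable lborel (\<lambda>y. g y * K (x - y))"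
    by (intro compactly_supported_integrable compactly_supported_convolve_integrand g K)
  have "\<bar>convolve g K x\<bar> \<le> (\<integral>y. \<bar>g y * K (x - y)\<bar> \<partial>lborel)"
    unfolding convolve_def by (rule integral_abs_bound)
  also have "\<dots> \<le> (\<integral>y. \<bar>g y\<bar> \<partial>lborel)"
  proof (rule integral_mono)
    show "\<bar>g y * K (x - y)\<bar> \<le> \<bar>g y\<bar>" for y
    proof (cases "y \<in> cball 0 R")
      case True
      have "norm (x - y) \<ge> 1" using norm_triangle_ineq2[of x y] True x by simp
      from K1[OF this] show ?thesis by (simp add: abs_mult mult_left_le)
    qed (simp add: g)
  qed (use int g compactly_supported_integrable compactly_supported_abs in auto)
  finally show ?thesis .
qed

section \<open>Duality with the Laplacian\<close>

text \<open>The gradient is reached from the Hessian by the Poincare inequality for each partial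
  derivative of \<psi>, which vanishes outside the same ball; this is how R enters the
  constant.\<close>

lemma hessian_gradient_bound:
  fixes q R :: real
  assumes q: "q > 1" and R: "R > 0"
  obtains C where "C > 0"
    "\<And>\<psi> :: real^'n \<Rightarrow> real. \<lbrakk>smooth \<psi>; \<And>x. x \<notin> cball 0 R \<Longrightarrow> \<psi> x = 0\<rbrakk> \<Longrightarrow>
      (\<Sum>i\<in>UNIV. \<Sum>j\<in>UNIV. \<integral>x. \<bar>partial i (partial j \<psi>) x\<bar> powr q \<partial>lborel) + (\<Sum>j\<in>UNIV. \<integral>x. \<bar>partial j \<psi> x\<bar> powr q \<partial>lborel)
      \<le> C * (\<integral>x. \<bar>laplacian \<psi> x\<bar> powr q \<partial>lborel)"
proof -
  obtain A where A: "A > 0"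
    "\<And>(W :: real^'n \<Rightarrow> real) i j. \<lbrakk>smooth W; compactly_supported W\<rbrakk> \<Longrightarrow>
      (\<integral>x. \<bar>partial i (partial j W) x\<bar> powr q \<partial>lborel) \<le> A * (\<integral>x. \<bar>laplacian W x\<bar> powr q \<partial>lborel)"
    using calderon_zygmund[OF q, where 'n = 'n] by blast
  obtain B where B: "B > 0"
    "\<And>(u :: real^'n \<Rightarrow> real) j. \<lbrakk>smooth u; \<And>x. x \<notin> cball 0 R \<Longrightarrow> u x = 0\<rbrakk> \<Longrightarrow>
      (\<integral>x. \<bar>u x\<bar> powr q \<partial>lborel) \<le> B * (\<integral>x. \<bar>partial j u x\<bar> powr q \<partial>lborel)"
    using poincare_powr[OF q R, where 'n = 'n] by blast
  define n where "n = real CARD('n)"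
  have n: "n > 0" by (simp add: n_def)
  show ?thesis
  proof (rule that)
    show "n * n * A + n * (B * A) > 0" using n A B by (intro add_pos_pos mult_pos_pos)
    fix \<psi> :: "real^'n \<Rightarrow> real"
    assume \<psi>: "smooth \<psi>" and 0: "\<And>x. x \<notin> cball 0 R \<Longrightarrow> \<psi> x = 0"
    have cs: "compactly_supported \<psi>" by (rule compactly_supportedI[OF smooth_continuous[OF \<psi>] 0])
    let ?L = "\<integral>x. \<bar>laplacian \<psi> x\<bar> powr q \<partial>lborel"
    have 1: "(\<integral>x. \<bar>partial i (partial j \<psi>) x\<bar> powr q \<partial>lborel) \<le> A * ?L" for i j
      by (rule A(2)[OF \<psi> cs])
    have 2: "(\<integral>x. \<bar>partial j \<psi> x\<bar> powr q \<partial>lborel) \<le> B * (A * ?L)" for j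
    proof -
      have "(\<integral>x. \<bar>partial j \<psi> x\<bar> powr q \<partial>lborel) \<le> B * (\<integral>x. \<bar>partial j (partial j \<psi>) x\<bar> powr q \<partial>lborel)"
        by (rule B(2)[OF smooth_partial[OF \<psi>] partial_zero_outside[OF 0]])
      also have "\<dots> \<le> B * (A * ?L)" using B(1) 1 by (intro mult_left_mono) auto
      finally show ?thesis .
    qed
    have "(\<Sum>i\<in>UNIV. \<Sum>j\<in>UNIV. \<integral>x. \<bar>partial i (partial j \<psi>) x\<bar> powr q \<partial>lborel) + (\<Sum>j\<in>UNIV. \<integral>x. \<bar>partial j \<psi> x\<bar> powr q \<partial>lborel)
      \<le> (\<Sum>i\<in>(UNIV::'n set). \<Sum>j\<in>(UNIV::'n set). A * ?L) + (\<Sum>j\<in>(UNIV::'n set). B * (A * ?L))"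
      by (intro add_mono sum_mono 1 2)
    also have "\<dots> = (n * n * A + n * (B * A)) * ?L" by (simp add: n_def algebra_simps)
    finally show "(\<Sum>i\<in>UNIV. \<Sum>j\<in>UNIV. \<integral>x. \<bar>partial i (partial j \<psi>) x\<bar> powr q \<partial>lborel) + (\<Sum>j\<in>UNIV. \<integral>x. \<bar>partial j \<psi> x\<bar> powr q \<partial>lborel)
      \<le> (n * n * A + n * (B * A)) * ?L" .
  qed
qed

text \<open>Hoelder's inequality on a ball, obtained by absorption. With m the integral of |g|,
  write m^q as the integral of m^(q-1) |g| and apply Young's inequality pointwise. For the weight
  1/(2 V), V being the volume of the ball, the first term integrates to half of m^q.\<close>

lemma integral_abs_powr_le:
  fixes q R :: real
  assumes q: "q > 1" and R: "R > 0"
  obtains C where "C > 0"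
    "\<And>g :: 'a::euclidean_space \<Rightarrow> real. \<lbrakk>compactly_supported g; \<And>x. x \<notin> cball 0 R \<Longrightarrow> g x = 0\<rbrakk> \<Longrightarrow>
      (\<integral>x. \<bar>g x\<bar> \<partial>lborel) powr q \<le> C * (\<integral>x. \<bar>g x\<bar> powr q \<partial>lborel)"
proof -
  define p where "p = q / (q - 1)"
  have p: "p > 1" unfolding p_def using q by (simp add: less_divide_eq)
  have qp: "q = p / (p - 1)" using q by (simp add: p_def field_simps)
  have e: "(q - 1) * p = q" using q by (simp add: p_def)
  define V where "V = measure lborel (cball (0::'a) R)"
  have V: "V > 0" using R by (simp add: V_def content_cball_pos)
  define s where "s = 1 / (2 * V)"
  have s: "s > 0" using V by (simp add: s_def)
  show ?thesis
  proof (rule that)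
    show "2 * s powr (- q / p) > 0" using s by simp
    fix g :: "'a \<Rightarrow> real"
    assume g: "compactly_supported g" and g0: "\<And>x. x \<notin> cball 0 R \<Longrightarrow> g x = 0"
    define m where "m = (\<integral>x. \<bar>g x\<bar> \<partial>lborel)"
    have m: "m \<ge> 0" by (simp add: m_def)
    have int: "integrable lborel (\<lambda>x. \<bar>g x\<bar>)" by (intro compactly_supported_integrable compactly_supported_abs g)
    have intq: "integrable lborel (\<lambda>x. \<bar>g x\<bar> powr q)" using q by (intro compactly_supported_integrable compactly_supported_powr g) auto
    have inti: "integrable lborel (\<lambda>x::'a. indicator (cball 0 R) x *\<^sub>R (s * m powr q))"
      by (intro borel_integrable_compact) auto
    have "m powr q = m powr (q - 1) * m"
      using m q by (cases "m = 0") (auto simp: powr_diff)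
    also have "\<dots> = (\<integral>x. m powr (q - 1) * \<bar>g x\<bar> \<partial>lborel)" by (simp add: m_def)
    also have "\<dots> \<le> (\<integral>x. indicator (cball 0 R) x *\<^sub>R (s * m powr q) + s powr (- q / p) * \<bar>g x\<bar> powr q \<partial>lborel)"
    proof (rule integral_mono)
      show "m powr (q - 1) * \<bar>g x\<bar> \<le> indicator (cball 0 R) x *\<^sub>R (s * m powr q) + s powr (- q / p) * \<bar>g x\<bar> powr q" for x
      proof (cases "x \<in> cball 0 R")
        case True
        have "m powr (q - 1) * \<bar>g x\<bar> \<le> s * (m powr (q - 1)) powr p + s powr (- q / p) * \<bar>g x\<bar> powr q"
          by (rule young_powr_scaled[OF p qp _ _ s]) auto
        then show ?thesis using True by (simp add: powr_powr e)
      qed (simp add: g0)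
    qed (use int intq inti in auto)
    also have "\<dots> = V * (s * m powr q) + s powr (- q / p) * (\<integral>x. \<bar>g x\<bar> powr q \<partial>lborel)"
    proof -
      have "(\<integral>x. indicator (cball (0::'a) R) x *\<^sub>R (s * m powr q) \<partial>lborel) = V * (s * m powr q)"
        by (simp add: V_def)
      then show ?thesis using intq inti by (simp add: Bochner_Integration.integral_add)
    qed
    also have "V * (s * m powr q) = m powr q / 2" using V by (simp add: s_def)
    finally show "m powr q \<le> 2 * s powr (- q / p) * (\<integral>x. \<bar>g x\<bar> powr q \<partial>lborel)" by linarith
  qed
qed

lemma borel_imp_lebesgue_on: "f \<in> borel_measurable borel \<Longrightarrow> f \<in> borel_measurable (lebesgue_on S)"
  by (intro measurable_restrict_space1 measurable_completion) simp

lemma integrable_bounded_times: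
  fixes w f :: "'a \<Rightarrow> real"
  assumes "integrable M w" "f \<in> borel_measurable M" "\<And>x. x \<in> space M \<Longrightarrow> \<bar>f x\<bar> \<le> B"
  shows "integrable M (\<lambda>x. w x * f x)"
proof (rule Bochner_Integration.integrable_bound[where f = "\<lambda>x. B * w x"])
  show "AE x in M. norm (w x * f x) \<le> norm (B * w x)"
  proof (rule AE_I2)
    fix x assume "x \<in> space M"
    then have "\<bar>f x\<bar> \<le> \<bar>B\<bar>" using assms(3) by fastforce
    then show "norm (w x * f x) \<le> norm (B * w x)" by (simp add: abs_mult mult.commute mult_right_mono mult_left_mono)
  qed
qed (use assms in auto)

lemma integrable_of_powr_integrable:
  fixes w :: "'a::euclidean_space \<Rightarrow> real"
  assumes S: "S \<in> lmeasurable" and w: "w \<in> borel_measurable (lebesgue_on S)" "integrable (lebesgue_on S) (\<lambda>x. \<bar>w x\<bar> powr p)" and p: "p \<ge> 1"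
  shows "integrable (lebesgue_on S) w"
proof (rule Bochner_Integration.integrable_bound[where f = "\<lambda>x. 1 + \<bar>w x\<bar> powr p"])
  have "integrable (lebesgue_on S) (\<lambda>x. 1::real)"
    by (rule finite_measure.integrable_const[OF finite_measure_lebesgue_on[OF S]])
  then show "integrable (lebesgue_on S) (\<lambda>x. 1 + \<bar>w x\<bar> powr p)" using w by auto
  show "AE x in lebesgue_on S. norm (w x) \<le> norm (1 + \<bar>w x\<bar> powr p)"
  proof (rule AE_I2)
    fix x
    have "\<bar>w x\<bar> \<le> 1 + \<bar>w x\<bar> powr p"
    proof (cases "\<bar>w x\<bar> \<le> 1")
      case False
      then have "\<bar>w x\<bar> powr 1 \<le> \<bar>w x\<bar> powr p" using p by (intro powr_mono) auto
      then show ?thesis using False by simp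
    qed (simp add: add_increasing2)
    then show "norm (w x) \<le> norm (1 + \<bar>w x\<bar> powr p)" by simp
  qed
qed (use w in auto)

text \<open>Testing the hypothesis with \<open>\<psi> = \<theta> G\<close>, where \<open>\<theta>\<close> is a cutoff and \<open>G = g * N\<^sub>\<eta>\<close> the regularised
  Newton potential, recovers \<open>\<integral> w g\<close> up to the factor \<^const>\<open>newton_mass\<close> as \<open>\<eta> \<rightarrow> 0\<close>. Away from the
  support of \<open>g\<close> the kernel is bounded, so the terms in which \<open>\<theta>\<close> is differentiated are harmless.\<close>

lemma laplacian_duality_continuous:
  fixes q R K :: real
  assumes q: "q > 1" and R: "R > 0" and K: "K \<ge> 0"
  obtains C where "C > 0"
    "\<And>S w A g. \<lbrakk>S \<in> lmeasurable; S \<subseteq> cball (0::real^3) R; integrable (lebesgue_on S) w;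
      \<And>\<psi>. \<lbrakk>smooth \<psi>; compactly_supported \<psi>\<rbrakk> \<Longrightarrow> \<bar>LINT x|lebesgue_on S. w x * laplacian \<psi> x\<bar> \<le> A +
        K * ((\<Sum>i\<in>UNIV. \<Sum>j\<in>UNIV. \<integral>x. \<bar>partial i (partial j \<psi>) x\<bar> powr q \<partial>lborel) + (\<Sum>j\<in>UNIV. \<integral>x. \<bar>partial j \<psi> x\<bar> powr q \<partial>lborel));
      compactly_supported g; \<And>x. x \<notin> cball 0 R \<Longrightarrow> g x = 0\<rbrakk> \<Longrightarrow>
      newton_mass * \<bar>LINT x|lebesgue_on S. w x * g x\<bar> \<le> A + C * (\<integral>x. \<bar>g x\<bar> powr q \<partial>lborel)"
proof -
  have R3: "R + 3 > 0" using R by simp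
  obtain H where H: "H > 0"
    "\<And>\<psi> :: real^3 \<Rightarrow> real. \<lbrakk>smooth \<psi>; \<And>x. x \<notin> cball 0 (R + 3) \<Longrightarrow> \<psi> x = 0\<rbrakk> \<Longrightarrow>
      (\<Sum>i\<in>UNIV. \<Sum>j\<in>UNIV. \<integral>x. \<bar>partial i (partial j \<psi>) x\<bar> powr q \<partial>lborel) + (\<Sum>j\<in>UNIV. \<integral>x. \<bar>partial j \<psi> x\<bar> powr q \<partial>lborel)
      \<le> H * (\<integral>x. \<bar>laplacian \<psi> x\<bar> powr q \<partial>lborel)"
    using hessian_gradient_bound[OF q R3, where 'n = 3] by blast
  obtain D where D: "D > 0"
    "\<And>g :: real^3 \<Rightarrow> real. \<lbrakk>compactly_supported g; \<And>x. x \<notin> cball 0 R \<Longrightarrow> g x = 0\<rbrakk> \<Longrightarrow>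
      (\<integral>x. \<bar>g x\<bar> \<partial>lborel) powr q \<le> D * (\<integral>x. \<bar>g x\<bar> powr q \<partial>lborel)"
    using integral_abs_powr_le[OF q R, where 'a = "real^3"] by blast
  have ab: "0 < R + 2" "R + 2 < R + 3" using R by auto
  obtain \<theta> :: "real^3 \<Rightarrow> real" where \<theta>: "smooth \<theta>" "\<And>x. 0 \<le> \<theta> x" "\<And>x. \<theta> x \<le> 1"
    "\<And>x. norm x \<le> R + 2 \<Longrightarrow> \<theta> x = 1" "\<And>x. R + 3 \<le> norm x \<Longrightarrow> \<theta> x = 0" "\<And>x. norm x < R + 3 \<Longrightarrow> 0 < \<theta> x"
    by (rule smooth_cutoff[OF ab, where 'n = 3]) (rule that, assumption, assumption, assumption, blast, blast, blast)
  have \<theta>0: "\<theta> x = 0" if "x \<notin> cball 0 (R + 3)" for x using that \<theta>(5) by simp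
  have cs\<theta>: "compactly_supported \<theta>" by (rule compactly_supportedI[OF smooth_continuous[OF \<theta>(1)] \<theta>0])
  have d\<theta>: "partial j \<theta> x = 0" if "norm x < R + 2" for j x
    by (rule partial_locally_constant[of "ball 0 (R + 2)"]) (use that \<theta>(4) in auto)
  have l\<theta>: "laplacian \<theta> x = 0" if "norm x < R + 2" for x
  proof -
    have "partial j (partial j \<theta>) x = 0" for j
      by (rule partial_locally_constant[of "ball 0 (R + 2)"]) (use that d\<theta> in auto)
    then show ?thesis by (simp add: laplacian_def)
  qed
  have "\<exists>B. \<forall>x. \<bar>partial j \<theta> x\<bar> \<le> B" for j
    using compactly_supported_bounded[OF compactly_supported_partial[OF \<theta>(1) cs\<theta>]] by metis
  then obtain B where B: "\<And>j x. \<bar>partial j \<theta> x\<bar> \<le> B j" by metis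
  obtain B' where B': "\<And>x. \<bar>laplacian \<theta> x\<bar> \<le> B'"
    using compactly_supported_bounded[OF compactly_supported_laplacian[OF \<theta>(1) cs\<theta>]] by metis
  \<comment> \<open>Bounds what differentiating the cutoff adds to the Laplacian of \<theta> G, per
    unit of the integral of |g|.\<close>
  define E where "E = 2 * (\<Sum>j\<in>UNIV. B j) + B'"
  have B0: "B j \<ge> 0" for j using B[of j 0] abs_ge_zero order_trans by blast
  have B'0: "B' \<ge> 0" using B'[of 0] abs_ge_zero order_trans by blast
  have E0: "E \<ge> 0" unfolding E_def by (intro add_nonneg_nonneg mult_nonneg_nonneg sum_nonneg B0 B'0) simp
  define V where "V = measure lborel (cball (0::real^3) (R + 3))"
  have V0: "V \<ge> 0" by (simp add: V_def)
  \<comment> \<open>The summand 1 keeps C positive also when K = 0. The rest collects the mollified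
    g, the cutoff terms, the Hessian bound and K.\<close>
  define C where "C = 1 + K * (H * (2 powr q * (newton_mass powr q + V * (E powr q * D))))"
  show ?thesis
  proof (rule that)
    show "C > 0" unfolding C_def using K H(1) D(1) V0 by (intro add_pos_nonneg mult_nonneg_nonneg add_nonneg_nonneg) auto
    fix S :: "(real^3) set" and w g :: "real^3 \<Rightarrow> real" and A :: real
    assume S: "S \<in> lmeasurable" "S \<subseteq> cball (0::real^3) R" and w: "integrable (lebesgue_on S) w"
      and hyp: "\<And>\<psi>. \<lbrakk>smooth \<psi>; compactly_supported \<psi>\<rbrakk> \<Longrightarrow> \<bar>LINT x|lebesgue_on S. w x * laplacian \<psi> x\<bar> \<le> A +
        K * ((\<Sum>i\<in>UNIV. \<Sum>j\<in>UNIV. \<integral>x. \<bar>partial i (partial j \<psi>) x\<bar> powr q \<partial>lborel) + (\<Sum>j\<in>UNIV. \<integral>x. \<bar>partial j \<psi> x\<bar> powr q \<partial>lborel))"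
      and g: "compactly_supported g" and g0: "\<And>x. x \<notin> cball 0 R \<Longrightarrow> g x = 0"
    define m where "m = (\<integral>y. \<bar>g y\<bar> \<partial>lborel)"
    have m0: "m \<ge> 0" by (simp add: m_def)
    define \<eta> where "\<eta> = (\<lambda>n. 1 / real (Suc n))"
    have \<eta>: "\<eta> n > 0" for n by (simp add: \<eta>_def)
    have \<eta>0: "\<eta> \<longlonglongrightarrow> 0" using LIMSEQ_inverse_real_of_nat by (simp add: \<eta>_def inverse_eq_divide)
    define G where "G = (\<lambda>n. convolve g (newton_kernel (\<eta> n)))"
    define c where "c = (\<lambda>n. convolve g (newton_mollifier (\<eta> n)))"
    have sG: "smooth (G n)" for n unfolding G_def by (rule smooth_convolve[OF g smooth_newton_kernel[OF \<eta>]])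
    have lG: "laplacian (G n) x = c n x" for n x
      unfolding G_def c_def by (simp add: laplacian_convolve[OF g smooth_newton_kernel[OF \<eta>]] laplacian_newton_kernel[OF \<eta>])
    \<comment> \<open>The derivatives of \<theta> vanish for |x| < R + 2, so G and its gradient meet
      them only at a distance from the ball of radius R that carries g. There both are bounded by m,
      uniformly in n.\<close>
    have G1: "\<bar>G n x\<bar> \<le> m" "\<bar>partial j (G n) x\<bar> \<le> m" if "norm x \<ge> R + 1" for n x j
      unfolding G_def m_def partial_convolve[OF g smooth_newton_kernel[OF \<eta>]]
      by (rule convolve_far_bound[OF g g0 _ _ that]; auto intro!: smooth_continuous smooth_partial smooth_newton_kernel \<eta> newton_kernel_bounds)+
    obtain g1 where g1: "\<And>x. \<bar>g x\<bar> \<le> g1" using compactly_supported_bounded[OF g] by metis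
    have cb: "\<bar>c n x\<bar> \<le> g1 * newton_mass" for n x
      unfolding c_def by (rule convolve_newton_mollifier_bound[OF g g1 \<eta>])
    have clim: "(\<lambda>n. c n x) \<longlonglongrightarrow> newton_mass * g x" for x
      unfolding c_def by (rule convolve_newton_mollifier_tendsto[OF g \<eta> \<eta>0])
    have ccont: "continuous_on UNIV (c n)" for n
    proof -
      have "c n = (\<lambda>x. \<Sum>j\<in>UNIV. partial j (partial j (G n)) x)" using lG[of n] by (auto simp: laplacian_def)
      then show ?thesis by (simp add: continuous_on_sum smooth_continuous smooth_partial sG)
    qed
    define \<psi> where "\<psi> = (\<lambda>n x. \<theta> x * G n x)"
    have s\<psi>: "smooth (\<psi> n)" for n unfolding \<psi>_def by (rule smooth_mult[OF \<theta>(1) sG])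
    have \<psi>0: "\<psi> n x = 0" if "x \<notin> cball 0 (R + 3)" for n x unfolding \<psi>_def using \<theta>0[OF that] by simp
    have cs\<psi>: "compactly_supported (\<psi> n)" for n by (rule compactly_supportedI[OF smooth_continuous[OF s\<psi>] \<psi>0])
    have l\<psi>: "laplacian (\<psi> n) x = \<theta> x * c n x + 2 * (\<Sum>j\<in>UNIV. partial j \<theta> x * partial j (G n) x) + laplacian \<theta> x * G n x" for n x
      unfolding \<psi>_def by (simp add: laplacian_mult[OF \<theta>(1) sG] lG)
    have near: "laplacian (\<psi> n) x = c n x" if "norm x < R + 2" for n x
      unfolding l\<psi> using that by (simp add: d\<theta> l\<theta> \<theta>(4))
    have bound: "\<bar>laplacian (\<psi> n) x\<bar> \<le> \<bar>c n x\<bar> + E * m" for n x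
    proof (cases "norm x < R + 2")
      case True
      then show ?thesis using E0 m0 by (simp add: near)
    next
      case False
      then have far: "norm x \<ge> R + 1" by simp
      have "\<bar>laplacian (\<psi> n) x\<bar> \<le> \<bar>\<theta> x * c n x\<bar> + \<bar>2 * (\<Sum>j\<in>UNIV. partial j \<theta> x * partial j (G n) x)\<bar> + \<bar>laplacian \<theta> x * G n x\<bar>"
        unfolding l\<psi> by linarith
      also have "\<bar>\<theta> x * c n x\<bar> \<le> \<bar>c n x\<bar>" using \<theta>(2,3)[of x] by (simp add: abs_mult mult_left_le_one_le)
      also have "\<bar>2 * (\<Sum>j\<in>UNIV. partial j \<theta> x * partial j (G n) x)\<bar> \<le> 2 * (\<Sum>j\<in>UNIV. B j * m)"
        unfolding abs_mult[of 2]
        by (intro mult_mono order_trans[OF sum_abs] sum_mono) (auto simp: abs_mult intro!: mult_mono B G1(2)[OF far] B0)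
      also have "\<bar>laplacian \<theta> x * G n x\<bar> \<le> B' * m"
        unfolding abs_mult by (intro mult_mono B' G1(1)[OF far] B'0) auto
      finally show ?thesis unfolding E_def sum_distrib_right[symmetric] by (simp add: algebra_simps)
    qed
    have l0: "laplacian (\<psi> n) x = 0" if "x \<notin> cball 0 (R + 3)" for n x
    proof -
      have "partial j (partial j (\<psi> n)) x = 0" for j
        by (rule partial_zero_outside[OF partial_zero_outside[OF \<psi>0] that])
      then show ?thesis by (simp add: laplacian_def)
    qed
    let ?I = "\<lambda>x. indicator (cball (0::real^3) (R + 3)) x :: real"
    have intc: "integrable lborel (\<lambda>x. ?I x *\<^sub>R \<bar>c n x\<bar> powr q)" for n
      using q ccont[of n] by (intro borel_integrable_compact continuous_on_powr' continuous_on_rabs) (auto intro: continuous_on_subset)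
    have intk: "integrable lborel (\<lambda>x. ?I x *\<^sub>R k)" for k :: real
      by (intro borel_integrable_compact) auto
    have Lq: "(\<integral>x. \<bar>laplacian (\<psi> n) x\<bar> powr q \<partial>lborel) \<le> 2 powr q * ((\<integral>x. ?I x *\<^sub>R \<bar>c n x\<bar> powr q \<partial>lborel) + V * (E * m) powr q)" for n
    proof -
      have "(\<integral>x. \<bar>laplacian (\<psi> n) x\<bar> powr q \<partial>lborel) \<le> (\<integral>x. 2 powr q * (?I x *\<^sub>R \<bar>c n x\<bar> powr q + ?I x *\<^sub>R (E * m) powr q) \<partial>lborel)"
      proof (rule integral_mono)
        show "integrable lborel (\<lambda>x. \<bar>laplacian (\<psi> n) x\<bar> powr q)"
          using q by (intro compactly_supported_integrable compactly_supported_powr compactly_supported_laplacian s\<psi> cs\<psi>) auto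
        show "integrable lborel (\<lambda>x. 2 powr q * (?I x *\<^sub>R \<bar>c n x\<bar> powr q + ?I x *\<^sub>R (E * m) powr q))"
          by (rule integrable_mult_right[OF Bochner_Integration.integrable_add[OF intc intk]])
        show "\<bar>laplacian (\<psi> n) x\<bar> powr q \<le> 2 powr q * (?I x *\<^sub>R \<bar>c n x\<bar> powr q + ?I x *\<^sub>R (E * m) powr q)" for x
        proof (cases "x \<in> cball 0 (R + 3)")
          case True
          have "\<bar>laplacian (\<psi> n) x\<bar> powr q \<le> (\<bar>c n x\<bar> + E * m) powr q"
            using q bound by (intro powr_mono2) auto
          also have "\<dots> \<le> 2 powr q * (\<bar>c n x\<bar> powr q + (E * m) powr q)"
            using q E0 m0 by (intro powr_add_le) auto
          finally show ?thesis using True by simp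
        qed (simp add: l0)
      qed
      also have "\<dots> = 2 powr q * ((\<integral>x. ?I x *\<^sub>R \<bar>c n x\<bar> powr q \<partial>lborel) + (\<integral>x. ?I x *\<^sub>R (E * m) powr q \<partial>lborel))"
        by (simp only: integral_mult_right_zero Bochner_Integration.integral_add[OF intc intk])
      also have "(\<integral>x. ?I x *\<^sub>R (E * m) powr q \<partial>lborel) = V * (E * m) powr q" by (simp add: V_def)
      finally show ?thesis .
    qed
    \<comment> \<open>On S the cutoff is 1, so the hypothesis for \<psi> speaks of c n itself. The
      Hessian bound then returns from all derivatives of \<psi> to its Laplacian; it needs a support
      ball fixed in advance, here of radius R + 3.\<close>
    have step: "\<bar>LINT x|lebesgue_on S. w x * c n x\<bar> \<le> A + K * (H * (2 powr q * ((\<integral>x. ?I x *\<^sub>R \<bar>c n x\<bar> powr q \<partial>lborel) + V * (E * m) powr q)))" for n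
    proof -
      have "(LINT x|lebesgue_on S. w x * c n x) = (LINT x|lebesgue_on S. w x * laplacian (\<psi> n) x)"
        using S(2) by (intro Bochner_Integration.integral_cong refl) (auto simp: near)
      also have "\<bar>\<dots>\<bar> \<le> A + K * ((\<Sum>i\<in>UNIV. \<Sum>j\<in>UNIV. \<integral>x. \<bar>partial i (partial j (\<psi> n)) x\<bar> powr q \<partial>lborel) + (\<Sum>j\<in>UNIV. \<integral>x. \<bar>partial j (\<psi> n) x\<bar> powr q \<partial>lborel))"
        by (rule hyp[OF s\<psi> cs\<psi>])
      also have "\<dots> \<le> A + K * (H * (\<integral>x. \<bar>laplacian (\<psi> n) x\<bar> powr q \<partial>lborel))"
        using K by (intro add_left_mono mult_left_mono H(2)[OF s\<psi> \<psi>0]) auto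
      also have "\<dots> \<le> A + K * (H * (2 powr q * ((\<integral>x. ?I x *\<^sub>R \<bar>c n x\<bar> powr q \<partial>lborel) + V * (E * m) powr q)))"
        using K H(1) by (intro add_left_mono mult_left_mono Lq) auto
      finally show ?thesis .
    qed
    have lim1: "(\<lambda>n. LINT x|lebesgue_on S. w x * c n x) \<longlonglongrightarrow> (LINT x|lebesgue_on S. w x * (newton_mass * g x))"
    proof (rule integral_dominated_convergence[where w = "\<lambda>x. (g1 * newton_mass) * \<bar>w x\<bar>"])
      show "(\<lambda>x. w x * (newton_mass * g x)) \<in> borel_measurable (lebesgue_on S)"
        by (rule borel_measurable_times[OF borel_measurable_integrable[OF w] borel_imp_lebesgue_on])
           (use compactly_supported_measurable[OF g] in auto)
      show "(\<lambda>x. w x * c n x) \<in> borel_measurable (lebesgue_on S)" for n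
        by (rule borel_measurable_times[OF borel_measurable_integrable[OF w] borel_imp_lebesgue_on[OF borel_measurable_continuous_onI[OF ccont]]])
      show "AE x in lebesgue_on S. (\<lambda>n. w x * c n x) \<longlonglongrightarrow> w x * (newton_mass * g x)"
        by (intro AE_I2 tendsto_mult tendsto_const clim)
      show "AE x in lebesgue_on S. norm (w x * c n x) \<le> (g1 * newton_mass) * \<bar>w x\<bar>" for n
        using cb by (intro AE_I2) (simp add: abs_mult mult.commute mult_right_mono mult_left_mono)
    qed (use w in auto)
    have lim2: "(\<lambda>n. \<integral>x. ?I x *\<^sub>R \<bar>c n x\<bar> powr q \<partial>lborel) \<longlonglongrightarrow> (\<integral>x. ?I x *\<^sub>R \<bar>newton_mass * g x\<bar> powr q \<partial>lborel)"
    proof (rule tendsto_integral_compact[where w = "\<lambda>x. ?I x *\<^sub>R (g1 * newton_mass) powr q"])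
      show "(\<lambda>x. ?I x *\<^sub>R \<bar>c n x\<bar> powr q) \<in> borel_measurable borel" for n using intc[of n] by simp
      show "(\<lambda>n. ?I x *\<^sub>R \<bar>c n x\<bar> powr q) \<longlonglongrightarrow> ?I x *\<^sub>R \<bar>newton_mass * g x\<bar> powr q" for x
        using q by (intro tendsto_scaleR tendsto_const tendsto_powr' tendsto_rabs clim) auto
      show "\<bar>?I x *\<^sub>R \<bar>c n x\<bar> powr q\<bar> \<le> ?I x *\<^sub>R (g1 * newton_mass) powr q" for n x
        using q cb[of n x] by (auto simp: indicator_def intro!: powr_mono2)
    qed (rule intk)
    have "\<bar>LINT x|lebesgue_on S. w x * (newton_mass * g x)\<bar> \<le> A + K * (H * (2 powr q * ((\<integral>x. ?I x *\<^sub>R \<bar>newton_mass * g x\<bar> powr q \<partial>lborel) + V * (E * m) powr q)))"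
    proof (rule LIMSEQ_le[OF tendsto_rabs[OF lim1]])
      show "(\<lambda>n. A + K * (H * (2 powr q * ((\<integral>x. ?I x *\<^sub>R \<bar>c n x\<bar> powr q \<partial>lborel) + V * (E * m) powr q))))
        \<longlonglongrightarrow> A + K * (H * (2 powr q * ((\<integral>x. ?I x *\<^sub>R \<bar>newton_mass * g x\<bar> powr q \<partial>lborel) + V * (E * m) powr q)))"
        by (intro tendsto_add tendsto_mult tendsto_const lim2)
    qed (use step in blast)
    moreover have "(\<integral>x. ?I x *\<^sub>R \<bar>newton_mass * g x\<bar> powr q \<partial>lborel) = newton_mass powr q * (\<integral>x. \<bar>g x\<bar> powr q \<partial>lborel)"
    proof -
      have "?I x *\<^sub>R \<bar>newton_mass * g x\<bar> powr q = newton_mass powr q * \<bar>g x\<bar> powr q" for x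
      proof (cases "x \<in> cball 0 R")
        case True
        then show ?thesis using newton_mass_pos by (simp add: abs_mult powr_mult)
      qed (simp add: g0)
      then show ?thesis by simp
    qed
    moreover have "V * (E * m) powr q \<le> V * (E powr q * (D * (\<integral>x. \<bar>g x\<bar> powr q \<partial>lborel)))"
      using V0 E0 m0 D(2)[OF g g0] by (auto simp: powr_mult m_def intro!: mult_left_mono)
    ultimately have "\<bar>LINT x|lebesgue_on S. w x * (newton_mass * g x)\<bar> \<le> A + K * (H * (2 powr q * (newton_mass powr q * (\<integral>x. \<bar>g x\<bar> powr q \<partial>lborel) + V * (E powr q * (D * (\<integral>x. \<bar>g x\<bar> powr q \<partial>lborel))))))"
      using K H(1) by (smt (verit, best) mult_left_mono powr_ge_zero)
    also have "\<dots> \<le> A + C * (\<integral>x. \<bar>g x\<bar> powr q \<partial>lborel)"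
      by (simp add: C_def algebra_simps Bochner_Integration.integral_nonneg)
    also have "(LINT x|lebesgue_on S. w x * (newton_mass * g x)) = newton_mass * (LINT x|lebesgue_on S. w x * g x)"
      by (simp add: mult.left_commute[of _ newton_mass])
    finally show "newton_mass * \<bar>LINT x|lebesgue_on S. w x * g x\<bar> \<le> A + C * (\<integral>x. \<bar>g x\<bar> powr q \<partial>lborel)"
      using newton_mass_pos by (simp add: abs_mult)
  qed
qed

section \<open>From continuous to bounded measurable test functions\<close>

lemma AE_lebesgue_on_not_in:
  assumes "negligible N" "S \<in> sets lebesgue"
  shows "AE x in lebesgue_on S. x \<notin> N"
proof -
  have "AE x in lebesgue. x \<notin> N" using assms by (intro AE_not_in) (simp add: negligible_iff_null_sets)
  then show ?thesis using assms by (subst AE_restrict_space_iff) auto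
qed

text \<open>Measurability supplies continuous functions converging almost everywhere. Clamping them
  to [-M, M] and multiplying by a cutoff that is 1 on the ball of radius R leaves the limit
  unchanged and provides a common bound and a common support.\<close>

lemma bounded_measurable_approx:
  fixes h :: "'a::euclidean_space \<Rightarrow> real"
  assumes S: "S \<in> sets lebesgue" "S \<subseteq> cball 0 R" and R: "R > 0"
    and h: "h \<in> borel_measurable (lebesgue_on S)" "\<And>x. \<bar>h x\<bar> \<le> M"
  obtains N k where "negligible N" "\<And>n. compactly_supported (k n)" "\<And>n x. x \<notin> cball 0 (R + 1) \<Longrightarrow> k n x = 0"
    "\<And>n x. \<bar>k n x\<bar> \<le> M" "\<And>x. x \<notin> N \<Longrightarrow> (\<lambda>n. k n x) \<longlonglongrightarrow> (if x \<in> S then h x else 0)"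
proof -
  have M: "M \<ge> 0" using h(2)[of 0] by linarith
  have "h measurable_on S" using h S by (simp add: measurable_on_iff_borel_measurable)
  then obtain N g where N: "negligible N" "\<And>n. continuous_on UNIV (g n)"
    "\<And>x. x \<notin> N \<Longrightarrow> (\<lambda>n. g n x) \<longlonglongrightarrow> (if x \<in> S then h x else 0)"
    unfolding measurable_on_def by blast
  define \<theta> where "\<theta> = (\<lambda>x::'a. max 0 (min 1 (R + 1 - norm x)))"
  define k where "k = (\<lambda>n x. \<theta> x * max (- M) (min M (g n x)))"
  have \<theta>: "0 \<le> \<theta> x" "\<theta> x \<le> 1" for x by (auto simp: \<theta>_def)
  show ?thesis
  proof (rule that[OF N(1), of k])
    show k0: "k n x = 0" if "x \<notin> cball 0 (R + 1)" for n x using that by (simp add: k_def \<theta>_def)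
    have "continuous_on UNIV (k n)" for n
      unfolding k_def \<theta>_def by (intro continuous_on_mult continuous_on_max continuous_on_min continuous_intros N)
    then show "compactly_supported (k n)" for n using k0 by (rule compactly_supportedI)
    show "\<bar>k n x\<bar> \<le> M" for n x
    proof -
      have "\<bar>k n x\<bar> = \<theta> x * \<bar>max (- M) (min M (g n x))\<bar>" using \<theta> by (simp add: k_def abs_mult)
      also have "\<dots> \<le> 1 * M" using \<theta> M by (intro mult_mono) auto
      finally show ?thesis by simp
    qed
    show "(\<lambda>n. k n x) \<longlonglongrightarrow> (if x \<in> S then h x else 0)" if "x \<notin> N" for x
    proof -
      have "(\<lambda>n. k n x) \<longlonglongrightarrow> \<theta> x * max (- M) (min M (if x \<in> S then h x else 0))"
        unfolding k_def by (intro tendsto_mult tendsto_max tendsto_min tendsto_const N(3)[OF that])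
      moreover have "\<theta> x * max (- M) (min M (if x \<in> S then h x else 0)) = (if x \<in> S then h x else 0)"
      proof (cases "x \<in> S")
        case True
        then have "\<theta> x = 1" using S(2) by (auto simp: \<theta>_def subset_iff)
        then show ?thesis using h(2)[of x] True by simp
      qed (use M in simp)
      ultimately show ?thesis by simp
    qed
  qed
qed

text \<open>Dominated convergence along the approximations of h. They reach into the ball of radius
  R + 1, but their limit is 0 off S, so the integrals of the q-th powers over the whole space tend
  to the integral over S. The constants are general, so that A = C = 0 yields an orthogonality
  statement.\<close>

lemma pairing_bound_bounded:
  fixes w h :: "real^3 \<Rightarrow> real"
  assumes S: "S \<in> lmeasurable" "S \<subseteq> cball 0 R" and R: "R > 0" and q: "q > 0"
    and w: "integrable (lebesgue_on S) w"
    and h: "h \<in> borel_measurable (lebesgue_on S)" "\<And>x. \<bar>h x\<bar> \<le> M"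
    and hyp: "\<And>g. \<lbrakk>compactly_supported g; \<And>x. x \<notin> cball 0 (R + 1) \<Longrightarrow> g x = 0\<rbrakk> \<Longrightarrow>
       \<kappa> * \<bar>LINT x|lebesgue_on S. w x * g x\<bar> \<le> A + C * (\<integral>x. \<bar>g x\<bar> powr q \<partial>lborel)"
  shows "\<kappa> * \<bar>LINT x|lebesgue_on S. w x * h x\<bar> \<le> A + C * (LINT x|lebesgue_on S. \<bar>h x\<bar> powr q)"
proof -
  have Sm: "S \<in> sets lebesgue" by (rule fmeasurableD[OF S(1)])
  show ?thesis
  proof (rule bounded_measurable_approx[OF Sm S(2) R h])
    fix N k
    assume k: "negligible N" "\<And>n. compactly_supported (k n)" "\<And>n x. x \<notin> cball 0 (R + 1) \<Longrightarrow> k n x = 0"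
      "\<And>n x. \<bar>k n x\<bar> \<le> M" "\<And>x. x \<notin> N \<Longrightarrow> (\<lambda>n. k n x) \<longlonglongrightarrow> (if x \<in> S then h x else 0)"
    have km: "k n \<in> borel_measurable borel" for n by (rule compactly_supported_measurable[OF k(2)])
    have lim1: "(\<lambda>n. LINT x|lebesgue_on S. w x * k n x) \<longlonglongrightarrow> (LINT x|lebesgue_on S. w x * h x)"
    proof (rule integral_dominated_convergence[where w = "\<lambda>x. M * \<bar>w x\<bar>"])
      show "(\<lambda>x. w x * h x) \<in> borel_measurable (lebesgue_on S)" using w h by auto
      show "(\<lambda>x. w x * k n x) \<in> borel_measurable (lebesgue_on S)" for n
        by (rule borel_measurable_times[OF borel_measurable_integrable[OF w] borel_imp_lebesgue_on[OF km]])
      show "AE x in lebesgue_on S. (\<lambda>n. w x * k n x) \<longlonglongrightarrow> w x * h x"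
        using AE_lebesgue_on_not_in[OF k(1) Sm] AE_space
      proof eventually_elim
        case (elim x)
        then have "(\<lambda>n. k n x) \<longlonglongrightarrow> h x" using k(5)[of x] by simp
        then show ?case by (intro tendsto_mult tendsto_const)
      qed
      show "AE x in lebesgue_on S. norm (w x * k n x) \<le> M * \<bar>w x\<bar>" for n
        using k(4) by (intro AE_I2) (simp add: abs_mult mult.commute[of M] mult_left_mono)
    qed (use w in auto)
    define h0 where "h0 = (\<lambda>x. if x \<in> S then h x else 0)"
    have h0: "h0 \<in> borel_measurable lebesgue"
      unfolding h0_def using h Sm by (simp add: borel_measurable_if)
    have "(\<lambda>n. LINT x|lebesgue. \<bar>k n x\<bar> powr q) \<longlonglongrightarrow> (LINT x|lebesgue. \<bar>h0 x\<bar> powr q)"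
    proof (rule integral_dominated_convergence[where w = "\<lambda>x. indicator (cball 0 (R + 1)) x *\<^sub>R M powr q"])
      show "(\<lambda>x. \<bar>h0 x\<bar> powr q) \<in> borel_measurable lebesgue" using h0 by auto
      show "(\<lambda>x. \<bar>k n x\<bar> powr q) \<in> borel_measurable lebesgue" for n
        using km[of n] by (intro measurable_completion) simp
      show "integrable lebesgue (\<lambda>x::real^3. indicator (cball 0 (R + 1)) x *\<^sub>R M powr q)"
      proof -
        have i: "integrable lborel (\<lambda>x::real^3. indicator (cball 0 (R + 1)) x *\<^sub>R M powr q)"
          by (intro borel_integrable_compact) auto
        show ?thesis using i by (rule integrable_completion[THEN iffD2, rotated]) (rule borel_measurable_integrable[OF i])
      qed
      show "AE x in lebesgue. (\<lambda>n. \<bar>k n x\<bar> powr q) \<longlonglongrightarrow> \<bar>h0 x\<bar> powr q"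
      proof (rule AE_mp[OF AE_not_in[of N]])
        show "N \<in> null_sets lebesgue" using k(1) by (simp add: negligible_iff_null_sets)
        show "AE x in lebesgue. x \<notin> N \<longrightarrow> (\<lambda>n. \<bar>k n x\<bar> powr q) \<longlonglongrightarrow> \<bar>h0 x\<bar> powr q"
          unfolding h0_def using q by (intro AE_I2 impI tendsto_powr' tendsto_rabs tendsto_const k(5)) auto
      qed
      show "AE x in lebesgue. norm (\<bar>k n x\<bar> powr q) \<le> indicator (cball 0 (R + 1)) x *\<^sub>R M powr q" for n
      proof (rule AE_I2)
        fix x :: "real^3"
        show "norm (\<bar>k n x\<bar> powr q) \<le> indicator (cball 0 (R + 1)) x *\<^sub>R M powr q"
          using k(3)[of x n] k(4)[of n x] q by (cases "x \<in> cball 0 (R + 1)") (auto intro!: powr_mono2)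
      qed
    qed
    moreover have "(LINT x|lebesgue. \<bar>k n x\<bar> powr q) = (\<integral>x. \<bar>k n x\<bar> powr q \<partial>lborel)" for n
      using km[of n] by (intro integral_completion) simp
    moreover have "(LINT x|lebesgue. \<bar>h0 x\<bar> powr q) = (LINT x|lebesgue_on S. \<bar>h x\<bar> powr q)"
      using Sm by (subst integral_restrict_space) (auto simp: h0_def indicator_def intro!: Bochner_Integration.integral_cong)
    ultimately have lim2: "(\<lambda>n. \<integral>x. \<bar>k n x\<bar> powr q \<partial>lborel) \<longlonglongrightarrow> (LINT x|lebesgue_on S. \<bar>h x\<bar> powr q)" by simp
    show ?thesis
    proof (rule LIMSEQ_le)
      show "(\<lambda>n. \<kappa> * \<bar>LINT x|lebesgue_on S. w x * k n x\<bar>) \<longlonglongrightarrow> \<kappa> * \<bar>LINT x|lebesgue_on S. w x * h x\<bar>"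
        by (intro tendsto_mult tendsto_rabs tendsto_const lim1)
      show "(\<lambda>n. A + C * (\<integral>x. \<bar>k n x\<bar> powr q \<partial>lborel)) \<longlonglongrightarrow> A + C * (LINT x|lebesgue_on S. \<bar>h x\<bar> powr q)"
        by (intro tendsto_add tendsto_mult tendsto_const lim2)
      show "\<exists>n0. \<forall>n\<ge>n0. \<kappa> * \<bar>LINT x|lebesgue_on S. w x * k n x\<bar> \<le> A + C * (\<integral>x. \<bar>k n x\<bar> powr q \<partial>lborel)"
        using hyp[OF k(2) k(3)] by blast
    qed
  qed
qed

text \<open>The test function is t sgn w |w|^(p-1), set to 0 where |w| > n so as to be bounded. With
  C t^q = \<kappa> t / 2 half of the left side is absorbed, and n is sent to infinity by dominated
  convergence. The outcome is proportional to A, which restores the homogeneity lost in the additive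
  form.\<close>

lemma powr_bound_from_pairing:
  fixes w :: "'a::euclidean_space \<Rightarrow> real"
  assumes p: "p > 1" and q: "q = p / (p - 1)" and C: "C > 0" and \<kappa>: "\<kappa> > 0" and S: "S \<in> sets lebesgue"
    and w: "w \<in> borel_measurable (lebesgue_on S)" "integrable (lebesgue_on S) (\<lambda>x. \<bar>w x\<bar> powr p)"
    and hyp: "\<And>h M. \<lbrakk>h \<in> borel_measurable (lebesgue_on S); \<And>x. \<bar>h x\<bar> \<le> M\<rbrakk> \<Longrightarrow>
      \<kappa> * \<bar>LINT x|lebesgue_on S. w x * h x\<bar> \<le> A + C * (LINT x|lebesgue_on S. \<bar>h x\<bar> powr q)"
  shows "(LINT x|lebesgue_on S. \<bar>w x\<bar> powr p) \<le> 2 / (\<kappa> * (\<kappa> / (2 * C)) powr (1 / (q - 1))) * A"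
proof -
  have q1: "q > 1" unfolding q using p by (simp add: less_divide_eq)
  have pq: "(p - 1) * q = p" using p by (simp add: q)
  define t where "t = (\<kappa> / (2 * C)) powr (1 / (q - 1))"
  have t: "t > 0" using C \<kappa> by (simp add: t_def)
  have "t powr q = t powr (q - 1) * t powr 1" by (simp only: powr_add[symmetric]) simp
  also have "t powr (q - 1) = \<kappa> / (2 * C)" unfolding t_def using q1 C \<kappa> by (simp add: powr_powr)
  finally have tq: "C * t powr q = \<kappa> * t / 2" using C t by simp
  define I where "I = (\<lambda>n::nat. LINT x|lebesgue_on S. (if \<bar>w x\<bar> \<le> n then \<bar>w x\<bar> powr p else 0))"
  have bound: "I n \<le> 2 / (\<kappa> * t) * A" for n
  proof -
    define h where "h = (\<lambda>x. if \<bar>w x\<bar> \<le> n then t * (sgn (w x) * \<bar>w x\<bar> powr (p - 1)) else 0)"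
    have hm: "h \<in> borel_measurable (lebesgue_on S)"
      unfolding h_def using w(1) by measurable
    have hM: "\<bar>h x\<bar> \<le> t * real n powr (p - 1)" for x
      using t p by (auto simp: h_def abs_mult abs_sgn_eq intro!: powr_mono2)
    have wh: "w x * h x = t * (if \<bar>w x\<bar> \<le> n then \<bar>w x\<bar> powr p else 0)" for x
    proof -
      have "w x * sgn (w x) = \<bar>w x\<bar> powr 1" by (auto simp: sgn_if)
      then have "(w x * sgn (w x)) * \<bar>w x\<bar> powr (p - 1) = \<bar>w x\<bar> powr 1 * \<bar>w x\<bar> powr (p - 1)" by (simp only:)
      also have "\<dots> = \<bar>w x\<bar> powr p" by (simp only: powr_add[symmetric]) simp
      finally show ?thesis by (simp add: h_def mult_ac)
    qed
    have hq: "\<bar>h x\<bar> powr q = t powr q * (if \<bar>w x\<bar> \<le> n then \<bar>w x\<bar> powr p else 0)" for x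
    proof -
      have "\<bar>h x\<bar> = (if \<bar>w x\<bar> \<le> n then t * \<bar>w x\<bar> powr (p - 1) else 0)" using t by (simp add: h_def abs_mult abs_sgn_eq)
      then show ?thesis using t q1 by (simp add: powr_mult powr_powr pq)
    qed
    have I0: "I n \<ge> 0" unfolding I_def by (intro Bochner_Integration.integral_nonneg) auto
    have "\<kappa> * \<bar>t * I n\<bar> \<le> A + C * (t powr q * I n)"
      using hyp[OF hm hM] by (simp add: wh hq I_def)
    then have "\<kappa> * t * I n \<le> A + (C * t powr q) * I n" using t I0 by (simp add: mult.assoc)
    then have "I n * (\<kappa> * t) \<le> 2 * A" unfolding tq by (simp add: mult_ac)
    then have "I n \<le> (2 * A) / (\<kappa> * t)" using t \<kappa> by (simp only: pos_le_divide_eq mult_pos_pos)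
    then show ?thesis by simp
  qed
  have "I \<longlonglongrightarrow> (LINT x|lebesgue_on S. \<bar>w x\<bar> powr p)"
    unfolding I_def
  proof (rule integral_dominated_convergence[where w = "\<lambda>x. \<bar>w x\<bar> powr p"])
    show "(\<lambda>x. \<bar>w x\<bar> powr p) \<in> borel_measurable (lebesgue_on S)" using w by auto
    show "(\<lambda>x. if \<bar>w x\<bar> \<le> real n then \<bar>w x\<bar> powr p else 0) \<in> borel_measurable (lebesgue_on S)" for n
      using w(1) by measurable
    show "AE x in lebesgue_on S. (\<lambda>n. if \<bar>w x\<bar> \<le> real n then \<bar>w x\<bar> powr p else 0) \<longlonglongrightarrow> \<bar>w x\<bar> powr p"
    proof (intro AE_I2 tendsto_eventually)
      fix x
      obtain n0 where "\<bar>w x\<bar> \<le> real n0" using real_arch_simple by blast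
      then show "\<forall>\<^sub>F n in sequentially. (if \<bar>w x\<bar> \<le> real n then \<bar>w x\<bar> powr p else 0) = \<bar>w x\<bar> powr p"
        by (intro eventually_sequentiallyI[of n0]) (simp add: order_trans[OF _ of_nat_mono])
    qed
  qed (use w in auto)
  then have "(LINT x|lebesgue_on S. \<bar>w x\<bar> powr p) \<le> 2 / (\<kappa> * t) * A"
    by (rule LIMSEQ_le_const2) (use bound in blast)
  then show ?thesis by (simp only: t_def)
qed

lemma laplacian_duality:
  fixes p q R K :: real
  assumes p: "p > 1" and q: "q = p / (p - 1)" and R: "R > 0" and K: "K \<ge> 0"
  obtains C where "C > 0"
    "\<And>S w A. \<lbrakk>S \<in> lmeasurable; S \<subseteq> cball (0::real^3) R; w \<in> borel_measurable (lebesgue_on S);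
      integrable (lebesgue_on S) (\<lambda>x. \<bar>w x\<bar> powr p);
      \<And>\<psi>. \<lbrakk>smooth \<psi>; compactly_supported \<psi>\<rbrakk> \<Longrightarrow> \<bar>LINT x|lebesgue_on S. w x * laplacian \<psi> x\<bar> \<le> A +
        K * ((\<Sum>i\<in>UNIV. \<Sum>j\<in>UNIV. \<integral>x. \<bar>partial i (partial j \<psi>) x\<bar> powr q \<partial>lborel) + (\<Sum>j\<in>UNIV. \<integral>x. \<bar>partial j \<psi> x\<bar> powr q \<partial>lborel))\<rbrakk> \<Longrightarrow>
      (LINT x|lebesgue_on S. \<bar>w x\<bar> powr p) \<le> C * A"
proof -
  have q1: "q > 1" unfolding q using p by (simp add: less_divide_eq)
  \<comment> \<open>The continuous approximants used for measurable test functions live in a ball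
    whose radius exceeds R by 1.\<close>
  have R1: "R + 1 > 0" using R by simp
  show ?thesis
  proof (rule laplacian_duality_continuous[OF q1 R1 K])
    fix C
    assume C: "C > 0" and cont: "\<And>S w A g. \<lbrakk>S \<in> lmeasurable; S \<subseteq> cball (0::real^3) (R + 1); integrable (lebesgue_on S) w;
      \<And>\<psi>. \<lbrakk>smooth \<psi>; compactly_supported \<psi>\<rbrakk> \<Longrightarrow> \<bar>LINT x|lebesgue_on S. w x * laplacian \<psi> x\<bar> \<le> A +
        K * ((\<Sum>i\<in>UNIV. \<Sum>j\<in>UNIV. \<integral>x. \<bar>partial i (partial j \<psi>) x\<bar> powr q \<partial>lborel) + (\<Sum>j\<in>UNIV. \<integral>x. \<bar>partial j \<psi> x\<bar> powr q \<partial>lborel));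
      compactly_supported g; \<And>x. x \<notin> cball 0 (R + 1) \<Longrightarrow> g x = 0\<rbrakk> \<Longrightarrow>
      newton_mass * \<bar>LINT x|lebesgue_on S. w x * g x\<bar> \<le> A + C * (\<integral>x. \<bar>g x\<bar> powr q \<partial>lborel)"
    show thesis
    proof (rule that)
      show "2 / (newton_mass * (newton_mass / (2 * C)) powr (1 / (q - 1))) > 0"
        using newton_mass_pos C by simp
      fix S :: "(real^3) set" and w :: "real^3 \<Rightarrow> real" and A :: real
      assume S: "S \<in> lmeasurable" "S \<subseteq> cball 0 R" and w: "w \<in> borel_measurable (lebesgue_on S)"
          "integrable (lebesgue_on S) (\<lambda>x. \<bar>w x\<bar> powr p)"
        and hyp: "\<And>\<psi>. \<lbrakk>smooth \<psi>; compactly_supported \<psi>\<rbrakk> \<Longrightarrow> \<bar>LINT x|lebesgue_on S. w x * laplacian \<psi> x\<bar> \<le> A +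
          K * ((\<Sum>i\<in>UNIV. \<Sum>j\<in>UNIV. \<integral>x. \<bar>partial i (partial j \<psi>) x\<bar> powr q \<partial>lborel) + (\<Sum>j\<in>UNIV. \<integral>x. \<bar>partial j \<psi> x\<bar> powr q \<partial>lborel))"
      have iw: "integrable (lebesgue_on S) w" using integrable_of_powr_integrable[OF S(1) w] p by simp
      have S1: "S \<subseteq> cball 0 (R + 1)" using S(2) by (auto simp: subset_iff)
      show "(LINT x|lebesgue_on S. \<bar>w x\<bar> powr p) \<le> 2 / (newton_mass * (newton_mass / (2 * C)) powr (1 / (q - 1))) * A"
      proof (rule powr_bound_from_pairing[OF p q C newton_mass_pos fmeasurableD[OF S(1)] w])
        fix h :: "real^3 \<Rightarrow> real" and M
        assume h: "h \<in> borel_measurable (lebesgue_on S)" "\<And>x. \<bar>h x\<bar> \<le> M"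
        show "newton_mass * \<bar>LINT x|lebesgue_on S. w x * h x\<bar> \<le> A + C * (LINT x|lebesgue_on S. \<bar>h x\<bar> powr q)"
          by (rule pairing_bound_bounded[OF S R _ iw h]) (use q1 cont[OF S(1) S1 iw hyp] in auto)
      qed
    qed
  qed
qed

section \<open>Measurability for the surface measure\<close>

lemma hausdorff2_content_antimono:
  "\<delta> \<le> \<delta>' \<Longrightarrow> hausdorff2_content \<delta>' A \<le> hausdorff2_content \<delta> A"
  unfolding hausdorff2_content_def
  by (rule INF_superset_mono) (auto simp: hausdorff2_covers_def intro: order_trans)

lemma hausdorff2_outer_mono: "A \<subseteq> B \<Longrightarrow> hausdorff2_outer A \<le> hausdorff2_outer B"
  unfolding hausdorff2_outer_def by (intro SUP_mono' hausdorff2_content_mono)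

lemma hausdorff2_outer_empty: "hausdorff2_outer ({} :: 'a::metric_space set) = 0"
  using outer_measure_space_hausdorff2[where 'a = 'a] by (simp add: outer_measure_space_def positive_def)

lemma hausdorff2_outer_Union_le:
  "hausdorff2_outer (\<Union>i. A i :: 'a::metric_space set) \<le> (\<Sum>i. hausdorff2_outer (A i))"
  unfolding hausdorff2_outer_def[of "\<Union>i. A i"]
proof (rule SUP_least)
  fix \<delta> :: real assume \<delta>: "\<delta> \<in> {0<..}"
  have "hausdorff2_content \<delta> (\<Union>i. A i) \<le> (\<Sum>i. hausdorff2_content \<delta> (A i))"
    by (rule hausdorff2_content_subadditive)
  also have "\<dots> \<le> (\<Sum>i. hausdorff2_outer (A i))"
    unfolding hausdorff2_outer_def using \<delta> by (intro suminf_le summableI SUP_upper)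
  finally show "hausdorff2_content \<delta> (\<Union>i. A i) \<le> (\<Sum>i. hausdorff2_outer (A i))" .
qed

lemma hausdorff2_outer_Un_le:
  "hausdorff2_outer (A \<union> B :: 'a::metric_space set) \<le> hausdorff2_outer A + hausdorff2_outer B"
proof -
  let ?F = "\<lambda>i::nat. if i = 0 then A else if i = 1 then B else {}"
  have "(\<Union>i. ?F i) = A \<union> B"
  proof -
    have "x \<in> (\<Union>i. ?F i)" if "x \<in> A \<union> B" for x
      using that UN_I[of 0 UNIV x ?F] UN_I[of 1 UNIV x ?F] by auto
    then show ?thesis by (auto split: if_splits)
  qed
  then have "hausdorff2_outer (A \<union> B) \<le> (\<Sum>i. hausdorff2_outer (?F i))"
    using hausdorff2_outer_Union_le[of ?F] by simp
  also have "\<dots> = (\<Sum>i\<in>{0, 1}. hausdorff2_outer (?F i))"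
    by (rule suminf_finite) (auto simp: hausdorff2_outer_empty)
  also have "\<dots> = hausdorff2_outer A + hausdorff2_outer B" by simp
  finally show ?thesis .
qed

text \<open>A set of diameter at most \<delta> cannot meet both A and B, so a cover of the union
  splits into one of A and one of B. Members not assigned to a cover are replaced by the empty set,
  whose diameter is 0.\<close>

lemma hausdorff2_content_separated:
  assumes sep: "\<And>x y. x \<in> A \<Longrightarrow> y \<in> B \<Longrightarrow> \<delta> < dist x y" and \<delta>: "\<delta> > 0"
  shows "hausdorff2_content \<delta> A + hausdorff2_content \<delta> B \<le> hausdorff2_content \<delta> (A \<union> B)"
  unfolding hausdorff2_content_def[of \<delta> "A \<union> B"]
proof (rule INF_greatest)
  fix C assume C: "C \<in> hausdorff2_covers \<delta> (A \<union> B)"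
  let ?w = "\<lambda>S. ennreal (pi / 4 * (diameter S)\<^sup>2)"
  define CA where "CA = (\<lambda>n. if C n \<inter> A \<noteq> {} then C n else {})"
  define CB where "CB = (\<lambda>n. if C n \<inter> A \<noteq> {} then {} else C n)"
  have bd: "bounded (C n)" "diameter (C n) \<le> \<delta>" for n using C by (auto simp: hausdorff2_covers_def)
  have "CA \<in> hausdorff2_covers \<delta> A"
    using C \<delta> by (fastforce simp: hausdorff2_covers_def CA_def)
  then have a: "hausdorff2_content \<delta> A \<le> (\<Sum>n. ?w (CA n))"
    unfolding hausdorff2_content_def by (rule INF_lower)
  have "B \<subseteq> (\<Union>n. CB n)"
  proof
    fix y assume y: "y \<in> B"
    then obtain n where n: "y \<in> C n" using C by (auto simp: hausdorff2_covers_def)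
    have "C n \<inter> A = {}"
    proof (rule ccontr)
      assume "C n \<inter> A \<noteq> {}"
      then obtain x where x: "x \<in> C n" "x \<in> A" by blast
      have "dist x y \<le> \<delta>" using diameter_bounded_bound[OF bd(1) x(1) n] bd(2)[of n] by simp
      with sep[OF x(2) y] show False by simp
    qed
    with n show "y \<in> (\<Union>n. CB n)" by (auto simp: CB_def)
  qed
  then have "CB \<in> hausdorff2_covers \<delta> B"
    using bd \<delta> by (auto simp: hausdorff2_covers_def CB_def)
  then have b: "hausdorff2_content \<delta> B \<le> (\<Sum>n. ?w (CB n))"
    unfolding hausdorff2_content_def by (rule INF_lower)
  have "(\<Sum>n. ?w (CA n)) + (\<Sum>n. ?w (CB n)) = (\<Sum>n. ?w (CA n) + ?w (CB n))"
    by (rule suminf_add[OF summableI summableI])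
  also have "\<dots> = (\<Sum>n. ?w (C n))" by (intro suminf_cong) (simp add: CA_def CB_def)
  finally show "hausdorff2_content \<delta> A + hausdorff2_content \<delta> B \<le> (\<Sum>n. ?w (C n))"
    using add_mono[OF a b] by simp
qed

text \<open>Contents grow as \<delta> shrinks, so the two sides may be compared at a common scale
  below d, where contents of separated sets add. The two suprema are then taken
  independently.\<close>

lemma hausdorff2_outer_separated:
  assumes d: "d > 0" and sep: "\<And>x y. x \<in> A \<Longrightarrow> y \<in> B \<Longrightarrow> d \<le> dist x y"
  shows "hausdorff2_outer A + hausdorff2_outer B \<le> hausdorff2_outer (A \<union> B)"
proof -
  have le: "hausdorff2_content \<delta> A + hausdorff2_content \<delta>' B \<le> hausdorff2_outer (A \<union> B)" if "\<delta> > 0" "\<delta>' > 0" for \<delta> \<delta>'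
  proof -
    define \<epsilon> where "\<epsilon> = min (d / 2) (min \<delta> \<delta>')"
    have \<epsilon>: "\<epsilon> > 0" "\<epsilon> < d" "\<epsilon> \<le> \<delta>" "\<epsilon> \<le> \<delta>'" using d that by (auto simp: \<epsilon>_def)
    have "hausdorff2_content \<delta> A + hausdorff2_content \<delta>' B \<le> hausdorff2_content \<epsilon> A + hausdorff2_content \<epsilon> B"
      using \<epsilon> by (intro add_mono hausdorff2_content_antimono)
    also have "\<dots> \<le> hausdorff2_content \<epsilon> (A \<union> B)"
      using sep \<epsilon> by (intro hausdorff2_content_separated) (auto intro: less_le_trans)
    also have "\<dots> \<le> hausdorff2_outer (A \<union> B)"
      unfolding hausdorff2_outer_def using \<epsilon> by (intro SUP_upper) auto
    finally show ?thesis .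
  qed
  have ne: "{0::real<..} \<noteq> {}" by (auto intro: exI[of _ 1])
  have "hausdorff2_outer A + hausdorff2_content \<delta>' B \<le> hausdorff2_outer (A \<union> B)" if "\<delta>' > 0" for \<delta>'
    unfolding hausdorff2_outer_def[of A] ennreal_SUP_add_left[OF ne, symmetric]
    by (rule SUP_least) (use le that in auto)
  then show ?thesis
    unfolding hausdorff2_outer_def[of B] ennreal_SUP_add_right[OF ne]
    by (intro SUP_least) auto
qed

lemma hausdorff2_outer_sum_separated:
  fixes D :: "nat \<Rightarrow> 'a::metric_space set"
  assumes "\<And>n m. n < m \<Longrightarrow> \<exists>d>0. \<forall>x\<in>D n. \<forall>y\<in>D m. d \<le> dist x y"
  shows "(\<Sum>n<N. hausdorff2_outer (D n)) \<le> hausdorff2_outer (\<Union>n<N. D n)"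
proof (induction N)
  case (Suc N)
  have "\<forall>n. \<exists>d. n < N \<longrightarrow> 0 < d \<and> (\<forall>x\<in>D n. \<forall>y\<in>D N. d \<le> dist x y)" using assms by blast
  then obtain d where d: "\<And>n. n < N \<Longrightarrow> 0 < d n" "\<And>n x y. \<lbrakk>n < N; x \<in> D n; y \<in> D N\<rbrakk> \<Longrightarrow> d n \<le> dist x y"
    by metis
  \<comment> \<open>The 1 keeps the set nonempty when N = 0.\<close>
  define e where "e = Min (insert 1 (d ` {..<N}))"
  have e: "e > 0" unfolding e_def using d(1) by (subst Min_gr_iff) auto
  have ed: "e \<le> d n" if "n < N" for n unfolding e_def using that by (intro Min_le) auto
  have "(\<Sum>n<Suc N. hausdorff2_outer (D n)) \<le> hausdorff2_outer (\<Union>n<N. D n) + hausdorff2_outer (D N)"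
    using Suc by (simp add: add_right_mono)
  also have "\<dots> \<le> hausdorff2_outer ((\<Union>n<N. D n) \<union> D N)"
    by (rule hausdorff2_outer_separated[OF e]) (use d(2) ed order_trans in blast)
  also have "(\<Union>n<N. D n) \<union> D N = (\<Union>n<Suc N. D n)" by (simp add: lessThan_Suc Un_commute)
  finally show ?case .
qed simp

text \<open>Caratheodory's criterion. At distance at least 1/(n+1) from A additivity follows from
  separation; the difficulty is that E - A may come arbitrarily close to A. The missing part is
  covered by layers, whose outer measures beyond the n-th form the tail of a convergent
  series.\<close>

lemma hausdorff2_outer_closed_split:
  fixes A E :: "'a::metric_space set"
  assumes A: "closed A"
  shows "hausdorff2_outer (A \<inter> E) + hausdorff2_outer (E - A) \<le> hausdorff2_outer E"
proof (cases "A = {} \<or> hausdorff2_outer E = top")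
  case True
  then show ?thesis by (auto simp: hausdorff2_outer_empty)
next
  case False
  then have ne: "A \<noteq> {}" and fin: "hausdorff2_outer E < top" by (auto simp: less_top)
  define G where "G = (\<lambda>n. {x \<in> E. infdist x A \<ge> 1 / real (n + 1)})"
  define D where "D = (\<lambda>n. G (Suc n) - G n)"
  have far: "hausdorff2_outer (A \<inter> E) + hausdorff2_outer (G n) \<le> hausdorff2_outer E" for n
  proof -
    have "hausdorff2_outer (A \<inter> E) + hausdorff2_outer (G n) \<le> hausdorff2_outer (A \<inter> E \<union> G n)"
    proof (rule hausdorff2_outer_separated[of "1 / real (n + 1)"])
      fix x y assume "x \<in> A \<inter> E" "y \<in> G n"
      then show "1 / real (n + 1) \<le> dist x y" using infdist_le[of x A y] by (auto simp: G_def dist_commute)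
    qed simp
    also have "\<dots> \<le> hausdorff2_outer E" by (rule hausdorff2_outer_mono) (auto simp: G_def)
    finally show ?thesis .
  qed
  \<comment> \<open>Neighbouring layers may touch, but layers two indices apart have positive
    distance. Hence even and odd layers are summed apart, and each half costs at most the outer
    measure of E.\<close>
  have layers: "\<exists>d>0. \<forall>x\<in>D n. \<forall>y\<in>D m. d \<le> dist x y" if "n + 2 \<le> m" for n m
  proof (intro exI conjI ballI)
    show "1 / real (n + 2) - 1 / real (n + 3) > 0"
      using divide_strict_left_mono[of "real (n + 2)" "real (n + 3)" 1] by simp
    fix x y assume xy: "x \<in> D n" "y \<in> D m"
    have "infdist x A \<ge> 1 / real (n + 2)" using xy by (auto simp: D_def G_def)
    moreover have "infdist y A < 1 / real (m + 1)" using xy by (auto simp: D_def G_def)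
    moreover have "1 / real (m + 1) \<le> 1 / real (n + 3)" using that by (intro divide_left_mono) auto
    moreover have "infdist x A \<le> infdist y A + dist x y" by (rule infdist_triangle)
    ultimately show "1 / real (n + 2) - 1 / real (n + 3) \<le> dist x y" by linarith
  qed
  have half: "(\<Sum>n<N. hausdorff2_outer (D (2 * n + c))) \<le> hausdorff2_outer E" for N c
  proof -
    have "(\<Sum>n<N. hausdorff2_outer (D (2 * n + c))) \<le> hausdorff2_outer (\<Union>n<N. D (2 * n + c))"
      by (rule hausdorff2_outer_sum_separated) (rule layers, simp)
    also have "\<dots> \<le> hausdorff2_outer E" by (rule hausdorff2_outer_mono) (auto simp: D_def G_def)
    finally show ?thesis .
  qed
  have "(\<Sum>n<N. hausdorff2_outer (D n)) \<le> hausdorff2_outer E + hausdorff2_outer E" for N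
  proof -
    have "(\<Sum>n<N. hausdorff2_outer (D n)) \<le> (\<Sum>n<2 * N. hausdorff2_outer (D n))"
      by (rule sum_mono2) auto
    also have "\<dots> = (\<Sum>n<N. hausdorff2_outer (D (2 * n + 0))) + (\<Sum>n<N. hausdorff2_outer (D (2 * n + 1)))"
      by (induction N) (auto simp: add_ac)
    also have "\<dots> \<le> hausdorff2_outer E + hausdorff2_outer E" by (intro add_mono half)
    finally show ?thesis .
  qed
  then have "(\<Sum>n. hausdorff2_outer (D n)) \<le> hausdorff2_outer E + hausdorff2_outer E"
    by (intro suminf_le_const summableI) auto
  also have "\<dots> < top" using fin by (simp add: ennreal_add_less_top)
  finally have sumfin: "(\<Sum>n. hausdorff2_outer (D n)) \<noteq> top" by simp
  have tail: "(\<lambda>n. \<Sum>k. hausdorff2_outer (D (k + n))) \<longlonglongrightarrow> 0"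
  proof -
    define r where "r = (\<lambda>n. enn2real (hausdorff2_outer (D n)))"
    have "hausdorff2_outer (D n) \<le> hausdorff2_outer E" for n
      by (rule hausdorff2_outer_mono) (auto simp: D_def G_def)
    then have "hausdorff2_outer (D n) < top" for n using fin by (rule le_less_trans)
    then have r: "hausdorff2_outer (D n) = ennreal (r n)" for n by (simp add: r_def)
    have r0: "r n \<ge> 0" for n by (simp add: r_def)
    have sr: "summable r" using sumfin r0 unfolding r by (intro summable_suminf_not_top) auto
    have "(\<Sum>k. hausdorff2_outer (D (k + n))) = ennreal (\<Sum>k. r (k + n))" for n
      unfolding r using r0 sr by (intro suminf_ennreal2) (auto simp: summable_iff_shift)
    moreover have "(\<lambda>n. \<Sum>k. r (k + n)) \<longlonglongrightarrow> 0" by (rule suminf_exist_split2[OF sr])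
    ultimately show ?thesis using tendsto_ennrealI[of "\<lambda>n. \<Sum>k. r (k + n)" 0] by simp
  qed
  have "hausdorff2_outer (A \<inter> E) + hausdorff2_outer (E - A) \<le> hausdorff2_outer E + (\<Sum>k. hausdorff2_outer (D (k + n)))" for n
  proof -
    have "E - A \<subseteq> G n \<union> (\<Union>k. D (k + n))"
    proof
      fix x assume x: "x \<in> E - A"
      \<comment> \<open>Closedness of A enters here: each point of E - A has positive distance from
        A and so lies in some \<open>G N\<close>.\<close>
      then have "infdist x A > 0"
        using infdist_pos_not_in_closed[OF A ne, of x] by simp
      then obtain N where N: "inverse (real (Suc N)) < infdist x A" using reals_Archimedean by blast
      define k where "k = (LEAST k. x \<in> G k)"
      have "x \<in> G N" using x N by (auto simp: G_def inverse_eq_divide)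
      then have k: "x \<in> G k" unfolding k_def by (rule LeastI)
      show "x \<in> G n \<union> (\<Union>k. D (k + n))"
      proof (cases "k \<le> n")
        case True
        have "1 / real (n + 1) \<le> 1 / real (k + 1)" using True by (intro divide_left_mono) auto
        then show ?thesis using k by (auto simp: G_def)
      next
        case False
        then obtain j where j: "k = Suc (j + n)" by (metis add.commute less_imp_Suc_add not_le add_Suc_right)
        have "x \<notin> G (j + n)" using not_less_Least[of "j + n" "\<lambda>k. x \<in> G k"] j unfolding k_def by simp
        then have "x \<in> D (j + n)" using k by (simp add: D_def j)
        then show ?thesis by blast
      qed
    qed
    then have "hausdorff2_outer (E - A) \<le> hausdorff2_outer (G n \<union> (\<Union>k. D (k + n)))" by (rule hausdorff2_outer_mono)
    also have "\<dots> \<le> hausdorff2_outer (G n) + hausdorff2_outer (\<Union>k. D (k + n))" by (rule hausdorff2_outer_Un_le)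
    also have "\<dots> \<le> hausdorff2_outer (G n) + (\<Sum>k. hausdorff2_outer (D (k + n)))"
      by (intro add_left_mono hausdorff2_outer_Union_le)
    finally have "hausdorff2_outer (A \<inter> E) + hausdorff2_outer (E - A)
      \<le> hausdorff2_outer (A \<inter> E) + hausdorff2_outer (G n) + (\<Sum>k. hausdorff2_outer (D (k + n)))"
      by (simp add: add.assoc add_left_mono)
    also have "\<dots> \<le> hausdorff2_outer E + (\<Sum>k. hausdorff2_outer (D (k + n)))" by (intro add_right_mono far)
    finally show ?thesis .
  qed
  moreover have "(\<lambda>n. hausdorff2_outer E + (\<Sum>k. hausdorff2_outer (D (k + n)))) \<longlonglongrightarrow> hausdorff2_outer E + 0"
    by (intro tendsto_add tendsto_const tail)
  ultimately show ?thesis by (simp add: LIMSEQ_le_const)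
qed

text \<open>The surface measure lives on the Caratheodory measurable sets, whereas a trace must be a
  measurable function. That these sets include the Borel sets is what makes the restriction of a
  smooth function an admissible trace.\<close>

lemma sets_borel_subset_surface_measure: "sets borel \<subseteq> sets surface_measure"
proof -
  have closed: "A \<in> sets surface_measure" if "closed A" for A :: "(real^3) set"
    unfolding sets_surface_measure lambda_system_def
  proof (intro CollectI conjI ballI)
    fix E :: "(real^3) set"
    have "hausdorff2_outer E \<le> hausdorff2_outer ((A \<inter> E) \<union> (E - A))" by (rule hausdorff2_outer_mono) auto
    also have "\<dots> \<le> hausdorff2_outer (A \<inter> E) + hausdorff2_outer (E - A)" by (rule hausdorff2_outer_Un_le)
    finally have "hausdorff2_outer (A \<inter> E) + hausdorff2_outer (E - A) = hausdorff2_outer E"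
      using hausdorff2_outer_closed_split[OF that, of E] by (intro antisym)
    moreover have "(UNIV - A) \<inter> E = E - A" by auto
    ultimately show "hausdorff2_outer (A \<inter> E) + hausdorff2_outer ((UNIV - A) \<inter> E) = hausdorff2_outer E" by simp
  qed simp
  have "sigma_sets UNIV {A :: (real^3) set. closed A} \<subseteq> sets surface_measure"
    using sets.sigma_sets_subset[of "{A. closed A}" surface_measure] closed
    by (auto simp: space_surface_measure)
  then show ?thesis by (simp add: borel_eq_closed)
qed

lemma continuous_measurable_surface:
  fixes f :: "real^3 \<Rightarrow> 'b::topological_space"
  assumes "continuous_on UNIV f"
  shows "f \<in> borel_measurable (restrict_space surface_measure S)"
proof (rule measurable_restrict_space1, rule measurableI)
  fix B :: "'b set" assume "B \<in> sets borel"
  then have "f -` B \<inter> space borel \<in> sets borel"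
    using borel_measurable_continuous_onI[OF assms] measurable_sets by blast
  then show "f -` B \<inter> space surface_measure \<in> sets surface_measure"
    using sets_borel_subset_surface_measure by (auto simp: space_surface_measure)
qed simp

section \<open>Weak Curl and vanishing tangential trace\<close>

lemma set_integrable_iff_integrable_on:
  fixes f :: "'a::euclidean_space \<Rightarrow> 'b::euclidean_space"
  assumes "S \<in> sets lebesgue"
  shows "f absolutely_integrable_on S \<longleftrightarrow> integrable (lebesgue_on S) f"
  using assms by (simp add: set_integrable_def integrable_restrict_space)

lemma continuous_locally_integrable:
  fixes f :: "real^'n \<Rightarrow> 'b::euclidean_space"
  assumes "continuous_on UNIV f"
  shows "locally_integrable \<Omega> f"
  unfolding locally_integrable_def
proof (intro allI impI)
  fix K :: "(real^'n) set" assume "compact K \<and> K \<subseteq> \<Omega>"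
  then have "integrable lborel (\<lambda>x. indicator K x *\<^sub>R f x)"
    using assms continuous_on_subset by (intro borel_integrable_compact) auto
  then show "f absolutely_integrable_on K"
    unfolding set_integrable_def
    by (rule integrable_completion[THEN iffD2, rotated]) (use \<open>integrable lborel _\<close> in \<open>rule borel_measurable_integrable\<close>)
qed

lemma integrable_compact_times_locally_integrable:
  fixes g :: "real^'n \<Rightarrow> 'b::euclidean_space" and \<psi> :: "real^'n \<Rightarrow> real"
  assumes \<Omega>: "open \<Omega>" and g: "locally_integrable \<Omega> g" and \<psi>: "continuous_on UNIV \<psi>"
    and K: "compact K" "K \<subseteq> \<Omega>" "\<And>x. x \<notin> K \<Longrightarrow> \<psi> x = 0"
  shows "integrable (lebesgue_on \<Omega>) (\<lambda>x. \<psi> x *\<^sub>R g x)"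
proof -
  have Km: "K \<in> sets lebesgue" using K(1) by (simp add: compact_imp_closed borel_closed)
  have "(\<lambda>x. \<psi> x *\<^sub>R g x) absolutely_integrable_on K"
  proof (rule absolutely_integrable_bounded_measurable_product[where h = "(*\<^sub>R)"])
    show "bilinear ((*\<^sub>R) :: real \<Rightarrow> 'b \<Rightarrow> 'b)"
      by (simp add: bilinear_conv_bounded_bilinear bounded_bilinear_scaleR)
    show "\<psi> \<in> borel_measurable (lebesgue_on K)"
      by (rule borel_imp_lebesgue_on[OF borel_measurable_continuous_onI[OF \<psi>]])
    show "bounded (\<psi> ` K)"
      by (intro compact_imp_bounded compact_continuous_image K continuous_on_subset[OF \<psi>]) auto
    show "g absolutely_integrable_on K" using g K by (simp add: locally_integrable_def)
  qed (rule Km)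
  then have "integrable lebesgue (\<lambda>x. indicator K x *\<^sub>R (\<psi> x *\<^sub>R g x))" by (simp add: set_integrable_def)
  moreover have "(\<lambda>x. indicator K x *\<^sub>R (\<psi> x *\<^sub>R g x)) = (\<lambda>x. indicator \<Omega> x *\<^sub>R (\<psi> x *\<^sub>R g x))"
    using K by (auto simp: indicator_def fun_eq_iff)
  ultimately have int: "integrable lebesgue (\<lambda>x. indicator \<Omega> x *\<^sub>R (\<psi> x *\<^sub>R g x))" by (simp only:)
  have "\<Omega> \<inter> space lebesgue \<in> sets lebesgue" using \<Omega> by simp
  from integrable_restrict_space[OF this, THEN iffD2, OF int] show ?thesis .
qed

lemma test_function_zero_outside:
  assumes "test_function \<Omega> \<phi>" "x \<notin> closure {x. \<phi> x \<noteq> 0}"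
  shows "\<phi> x = 0" "partial j \<phi> x = 0"
proof -
  have 0: "\<phi> y = 0" if "y \<notin> closure {x. \<phi> x \<noteq> 0}" for y
  proof (rule ccontr)
    assume "\<phi> y \<noteq> 0"
    then have "y \<in> closure {x. \<phi> x \<noteq> 0}" by (intro subsetD[OF closure_subset]) simp
    with that show False by simp
  qed
  show "\<phi> x = 0" by (rule 0[OF assms(2)])
  show "partial j \<phi> x = 0"
  proof (rule partial_locally_constant)
    show "open (- closure {x. \<phi> x \<noteq> 0})" by (rule open_Compl[OF closed_closure])
    show "x \<in> - closure {x. \<phi> x \<noteq> 0}" using assms(2) by (simp only: Compl_iff not_False_eq_True)
    show "\<phi> y = 0" if "y \<in> - closure {x. \<phi> x \<noteq> 0}" for y by (rule 0[OF ComplD[OF that]])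
  qed
qed

lemma test_function_integrable:
  fixes g :: "real^'n \<Rightarrow> 'b::euclidean_space"
  assumes \<Omega>: "open \<Omega>" and \<phi>: "test_function \<Omega> \<phi>" and g: "locally_integrable \<Omega> g"
  shows "integrable (lebesgue_on \<Omega>) (\<lambda>x. \<phi> x *\<^sub>R g x)" "integrable (lebesgue_on \<Omega>) (\<lambda>x. partial j \<phi> x *\<^sub>R g x)"
proof -
  let ?K = "closure {x. \<phi> x \<noteq> 0}"
  have K: "smooth \<phi>" "compact ?K" "?K \<subseteq> \<Omega>" using \<phi> by (simp_all add: test_function_def)
  show "integrable (lebesgue_on \<Omega>) (\<lambda>x. \<phi> x *\<^sub>R g x)"
    by (rule integrable_compact_times_locally_integrable[OF \<Omega> g smooth_continuous[OF K(1)] K(2,3)])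
       (rule test_function_zero_outside[OF \<phi>])
  show "integrable (lebesgue_on \<Omega>) (\<lambda>x. partial j \<phi> x *\<^sub>R g x)"
    by (rule integrable_compact_times_locally_integrable[OF \<Omega> g smooth_continuous[OF smooth_partial[OF K(1)]] K(2,3)])
       (rule test_function_zero_outside[OF \<phi>])
qed

lemma smooth_bump:
  fixes a :: "real^'n"
  assumes "r > 0"
  obtains b :: "real^'n \<Rightarrow> real" where "smooth b" "\<And>x. x \<in> ball a r \<Longrightarrow> b x > 0" "\<And>x. x \<notin> ball a r \<Longrightarrow> b x = 0"
proof -
  have "(x - a) \<bullet> (x - a) = x \<bullet> x - 2 * (a \<bullet> x) + a \<bullet> a" for x
    by (simp add: inner_diff_left inner_diff_right inner_commute)
  moreover have "smooth (\<lambda>x. x \<bullet> x - 2 * (a \<bullet> x) + a \<bullet> a)"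
    by (intro smooth_add smooth_diff smooth_cmult smooth_const smooth_inner_self smooth_bounded_linear bounded_linear_inner_right)
  ultimately have s: "smooth (\<lambda>x. (x - a) \<bullet> (x - a))" by simp
  have n: "(x - a) \<bullet> (x - a) < r\<^sup>2 \<longleftrightarrow> x \<in> ball a r" for x
    using assms power_mono_iff[of r "dist a x" 2]
    by (auto simp: dist_norm norm_minus_commute power2_norm_eq_inner[symmetric] simp flip: not_le)
  show thesis
  proof (rule that)
    show "smooth (\<lambda>x. flat_exp 0 (r\<^sup>2 - (x - a) \<bullet> (x - a)))"
      by (intro smooth_flat_exp smooth_diff smooth_const s)
  qed (auto simp: flat_exp_def n)
qed

text \<open>With a bump b positive exactly on the ball, b times a polynomial is a test function. So
  u = b f is orthogonal to polynomials, by Stone-Weierstrass to compactly supported continuous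
  functions, and by approximation to sgn u, which forces the integral of |u| to vanish.\<close>

lemma fundamental_lemma_ball:
  fixes f :: "real^3 \<Rightarrow> real"
  assumes \<Omega>: "open \<Omega>" and f: "locally_integrable \<Omega> f" and r: "r > 0" and S: "cball a r \<subseteq> \<Omega>"
    and zero: "\<And>\<phi>. test_function \<Omega> \<phi> \<Longrightarrow> (LINT x|lebesgue_on \<Omega>. \<phi> x * f x) = 0"
  shows "negligible {x \<in> ball a r. f x \<noteq> 0}"
proof (rule smooth_bump[OF r, of a])
  fix b :: "real^3 \<Rightarrow> real"
  assume b: "smooth b" "\<And>x. x \<in> ball a r \<Longrightarrow> b x > 0" "\<And>x. x \<notin> ball a r \<Longrightarrow> b x = 0"
  let ?S = "cball a r"
  define u where "u = (\<lambda>x. b x * f x)"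
  have lS: "?S \<in> lmeasurable" and Sm: "?S \<in> sets lebesgue" and Om: "\<Omega> \<in> sets lebesgue"
    using \<Omega> by auto
  define R where "R = norm a + r"
  have R: "R > 0" "?S \<subseteq> cball 0 R"
    using r norm_ge_zero[of a] by (auto simp: R_def dist_norm intro: add_nonneg_pos)
      (metis add.commute add_left_mono diff_add_cancel norm_minus_commute norm_triangle_ineq order_trans)
  have "f absolutely_integrable_on ?S" using f S by (simp add: locally_integrable_def)
  then have fi: "integrable (lebesgue_on ?S) f" using Sm by (simp add: set_integrable_iff_integrable_on)
  have csb: "compactly_supported b"
  proof (rule compactly_supportedI[OF smooth_continuous[OF b(1)]])
    show "b x = 0" if "x \<notin> cball 0 R" for x by (rule b(3)) (use R(2) that ball_subset_cball in blast)
  qed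
  obtain B where B: "\<And>x. \<bar>b x\<bar> \<le> B" using compactly_supported_bounded[OF csb] by metis
  have "integrable (lebesgue_on ?S) (\<lambda>x. f x * b x)"
    using B by (intro integrable_bounded_times[OF fi]) (auto intro!: borel_imp_lebesgue_on borel_measurable_continuous_onI smooth_continuous b)
  then have ui: "integrable (lebesgue_on ?S) u" by (simp add: u_def mult.commute)
  have poly: "(LINT x|lebesgue_on ?S. u x * P x) = 0" if P: "real_polynomial_function P" for P
  proof -
    have "{x. b x * P x \<noteq> 0} \<subseteq> ?S" using b(3) by force
    then have cl: "closure {x. b x * P x \<noteq> 0} \<subseteq> ?S" by (rule closure_minimal) simp
    then have comp: "compact (closure {x. b x * P x \<noteq> 0})"
      using bounded_subset[OF bounded_cball] by (auto simp: compact_eq_bounded_closed)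
    have "test_function \<Omega> (\<lambda>x. b x * P x)"
      unfolding test_function_def
      by (intro conjI smooth_mult[OF b(1) smooth_polynomial[OF P]] comp subset_trans[OF cl S])
    from zero[OF this] have "(LINT x|lebesgue_on \<Omega>. b x * P x * f x) = 0" .
    moreover have "(LINT x|lebesgue_on \<Omega>. b x * P x * f x) = (LINT x|lebesgue. indicator \<Omega> x *\<^sub>R (b x * P x * f x))"
      using Om by (simp add: integral_restrict_space)
    moreover have "(\<lambda>x. indicator \<Omega> x *\<^sub>R (b x * P x * f x)) = (\<lambda>x. indicator ?S x *\<^sub>R (u x * P x))"
      using S b(3) by (force simp: fun_eq_iff indicator_def u_def)
    moreover have "(LINT x|lebesgue. indicator ?S x *\<^sub>R (u x * P x)) = (LINT x|lebesgue_on ?S. u x * P x)"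
      using Sm by (simp add: integral_restrict_space)
    ultimately show ?thesis by simp
  qed
  \<comment> \<open>The factors 1 and 0 give the statement the shape of the hypothesis of
    \<open>pairing_bound_bounded\<close> with \<kappa> = 1, A = C = 0 and q = 1.\<close>
  have cont: "1 * \<bar>LINT x|lebesgue_on ?S. u x * g x\<bar> \<le> 0 + 0 * (\<integral>x. \<bar>g x\<bar> powr 1 \<partial>lborel)" if g: "compactly_supported g" for g
  proof -
    define I where "I = (LINT x|lebesgue_on ?S. \<bar>u x\<bar>)"
    have I0: "I \<ge> 0" by (simp add: I_def)
    have gc: "continuous_on UNIV g" using g by (simp add: compactly_supported_def)
    have small: "\<bar>LINT x|lebesgue_on ?S. u x * g x\<bar> \<le> e * I" if e: "e > 0" for e
    proof -
      obtain P where P: "real_polynomial_function P" "\<And>x. x \<in> ?S \<Longrightarrow> \<bar>g x - P x\<bar> < e"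
        using Stone_Weierstrass_real_polynomial_function[OF compact_cball continuous_on_subset[OF gc subset_UNIV] e, of a r] by blast
      have Pc: "continuous_on UNIV P" by (rule smooth_continuous[OF smooth_polynomial[OF P(1)]])
      have bdd: "\<exists>M. \<forall>x\<in>?S. \<bar>h x\<bar> \<le> M" if "continuous_on UNIV h" for h :: "real^3 \<Rightarrow> real"
      proof -
        have "bounded (h ` ?S)"
          by (intro compact_imp_bounded compact_continuous_image continuous_on_subset[OF that]) auto
        then show ?thesis by (auto simp: bounded_iff)
      qed
      have ih: "integrable (lebesgue_on ?S) (\<lambda>x. u x * h x)" if hc: "continuous_on UNIV h" for h
      proof -
        obtain M where "\<forall>x\<in>?S. \<bar>h x\<bar> \<le> M" using bdd[OF hc] by blast
        then show ?thesis
          by (intro integrable_bounded_times[OF ui, of _ M] borel_imp_lebesgue_on borel_measurable_continuous_onI hc) auto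
      qed
      have "(LINT x|lebesgue_on ?S. u x * g x) = (LINT x|lebesgue_on ?S. u x * g x) - (LINT x|lebesgue_on ?S. u x * P x)"
        using poly[OF P(1)] by simp
      also have "\<dots> = (LINT x|lebesgue_on ?S. u x * g x - u x * P x)"
        by (rule Bochner_Integration.integral_diff[symmetric, OF ih[OF gc] ih[OF Pc]])
      also have "\<bar>\<dots>\<bar> \<le> (LINT x|lebesgue_on ?S. \<bar>u x * g x - u x * P x\<bar>)" by (rule integral_abs_bound)
      also have "\<dots> \<le> (LINT x|lebesgue_on ?S. e * \<bar>u x\<bar>)"
      proof (rule integral_mono)
        fix x assume "x \<in> space (lebesgue_on ?S)"
        then have "\<bar>g x - P x\<bar> \<le> e" using P(2)[of x] by simp
        then have "\<bar>u x\<bar> * \<bar>g x - P x\<bar> \<le> \<bar>u x\<bar> * e" by (rule mult_left_mono) simp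
        then show "\<bar>u x * g x - u x * P x\<bar> \<le> e * \<bar>u x\<bar>"
          by (simp only: right_diff_distrib[symmetric] abs_mult mult.commute[of e])
      qed (use ih[OF gc] ih[OF Pc] ui in auto)
      also have "\<dots> = e * I" by (simp add: I_def)
      finally show ?thesis .
    qed
    have "\<bar>LINT x|lebesgue_on ?S. u x * g x\<bar> \<le> 0"
    proof (rule field_le_epsilon)
      fix d :: real assume d: "d > 0"
      have "\<bar>LINT x|lebesgue_on ?S. u x * g x\<bar> \<le> d / (I + 1) * I" using I0 d by (intro small) simp
      also have "\<dots> \<le> d" using I0 d by (simp add: divide_le_eq)
      finally show "\<bar>LINT x|lebesgue_on ?S. u x * g x\<bar> \<le> 0 + d" by simp
    qed
    then show ?thesis by simp
  qed
  define h where "h = (\<lambda>x. sgn (u x))"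
  have "1 * \<bar>LINT x|lebesgue_on ?S. u x * h x\<bar> \<le> 0 + 0 * (LINT x|lebesgue_on ?S. \<bar>h x\<bar> powr 1)"
  proof (rule pairing_bound_bounded[OF lS R(2) R(1) _ ui, of 1 h 1])
    show "h \<in> borel_measurable (lebesgue_on ?S)" unfolding h_def using ui by auto
  qed (use cont in \<open>auto simp: h_def sgn_if\<close>)
  moreover have "u x * h x = \<bar>u x\<bar>" for x by (simp add: h_def abs_sgn)
  ultimately have "(LINT x|lebesgue_on ?S. \<bar>u x\<bar>) \<le> 0" by simp
  moreover have "0 \<le> (LINT x|lebesgue_on ?S. \<bar>u x\<bar>)" by (intro Bochner_Integration.integral_nonneg) simp
  ultimately have "(LINT x|lebesgue_on ?S. \<bar>u x\<bar>) = 0" by (rule antisym)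
  then have "AE x in lebesgue_on ?S. \<bar>u x\<bar> = 0"
    using integral_nonneg_eq_0_iff_AE[of "lebesgue_on ?S" "\<lambda>x. \<bar>u x\<bar>"] ui by simp
  then have "AE x in lebesgue. x \<in> ?S \<longrightarrow> u x = 0"
    using Sm by (subst (asm) AE_restrict_space_iff) auto
  then obtain N where N: "N \<in> null_sets lebesgue" "{x. \<not> (x \<in> ?S \<longrightarrow> u x = 0)} \<subseteq> N"
    by (auto simp: eventually_ae_filter)
  have "{x \<in> ball a r. f x \<noteq> 0} \<subseteq> N"
  proof
    fix x assume "x \<in> {x \<in> ball a r. f x \<noteq> 0}"
    then have "x \<in> ?S" "u x \<noteq> 0" using b(2)[of x] by (auto simp: u_def)
    with N(2) show "x \<in> N" by blast
  qed
  then show ?thesis using N(1) negligible_iff_null_sets negligible_subset by blast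
qed

text \<open>Countably many balls cover an open set, so the exceptional null sets of the balls may be
  united.\<close>

lemma fundamental_lemma:
  fixes f :: "real^3 \<Rightarrow> real"
  assumes \<Omega>: "open \<Omega>" and f: "locally_integrable \<Omega> f"
    and zero: "\<And>\<phi>. test_function \<Omega> \<phi> \<Longrightarrow> (LINT x|lebesgue_on \<Omega>. \<phi> x * f x) = 0"
  shows "negligible {x \<in> \<Omega>. f x \<noteq> 0}"
proof -
  define F where "F = {ball a r |a r. r > 0 \<and> cball a r \<subseteq> \<Omega>}"
  have "\<And>S. S \<in> F \<Longrightarrow> open S" by (auto simp: F_def)
  then obtain F' where F': "F' \<subseteq> F" "countable F'" "\<Union>F' = \<Union>F" using Lindelof by metis
  have "\<Omega> \<subseteq> \<Union>F"
  proof
    fix x assume "x \<in> \<Omega>"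
    then obtain r where "r > 0" "cball x r \<subseteq> \<Omega>" using \<Omega> open_contains_cball by blast
    then have "ball x r \<in> F" "x \<in> ball x r" by (auto simp: F_def)
    then show "x \<in> \<Union>F" by blast
  qed
  then have "{x \<in> \<Omega>. f x \<noteq> 0} \<subseteq> \<Union>((\<lambda>S. {x \<in> S. f x \<noteq> 0}) ` F')" using F'(3) by blast
  moreover have "negligible (\<Union>((\<lambda>S. {x \<in> S. f x \<noteq> 0}) ` F'))"
  proof (rule negligible_countable_Union)
    show "countable ((\<lambda>S. {x \<in> S. f x \<noteq> 0}) ` F')" using F'(2) by simp
    fix T assume "T \<in> (\<lambda>S. {x \<in> S. f x \<noteq> 0}) ` F'"
    then obtain a r where "T = {x \<in> ball a r. f x \<noteq> 0}" "r > 0" "cball a r \<subseteq> \<Omega>" using F'(1) by (auto simp: F_def)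
    then show "negligible T" using fundamental_lemma_ball[OF \<Omega> f _ _ zero] by simp
  qed
  ultimately show ?thesis using negligible_subset by blast
qed

lemma integral_component2:
  fixes f :: "'a \<Rightarrow> real^'n^'m"
  assumes "integrable M f"
  shows "(LINT x|M. f x) $ i $ j = (LINT x|M. f x $ i $ j)"
proof -
  have "bounded_linear (\<lambda>A :: real^'n^'m. A $ i $ j)"
    by (intro bounded_linear_compose[OF bounded_linear_vec_nth bounded_linear_vec_nth])
  from integral_bounded_linear[OF this assms] show ?thesis by simp
qed

lemma locally_integrable_component2:
  fixes f :: "real^'k \<Rightarrow> real^'n^'m"
  assumes "locally_integrable \<Omega> f"
  shows "locally_integrable \<Omega> (\<lambda>x. f x $ i $ j)"
proof -
  have l: "bounded_linear (\<lambda>A :: real^'n^'m. A $ i $ j)"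
    by (intro bounded_linear_compose[OF bounded_linear_vec_nth bounded_linear_vec_nth])
  show ?thesis
    using assms absolutely_integrable_linear[OF _ l] by (auto simp: locally_integrable_def o_def)
qed

lemma locally_integrable_diff:
  "locally_integrable \<Omega> f \<Longrightarrow> locally_integrable \<Omega> g \<Longrightarrow> locally_integrable \<Omega> (\<lambda>x. f x - g x)"
  by (auto simp: locally_integrable_def intro: set_integral_diff)

text \<open>\<open>Curl\<close> is an arbitrary choice among the weak curls. Uniqueness up to null
  sets is what allows an explicit weak curl to replace it under the integral.\<close>

lemma has_weak_Curl_unique:
  assumes \<Omega>: "open \<Omega>" and C: "has_weak_Curl \<Omega> P C" and C': "has_weak_Curl \<Omega> P C'"
  shows "negligible {x \<in> \<Omega>. C x \<noteq> C' x}"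
proof -
  have lC: "locally_integrable \<Omega> C" and lC': "locally_integrable \<Omega> C'" using C C' by (auto simp: has_weak_Curl_def)
  have comp: "negligible {x \<in> \<Omega>. C x $ i $ j - C' x $ i $ j \<noteq> 0}" for i j
  proof (rule fundamental_lemma[OF \<Omega>])
    show "locally_integrable \<Omega> (\<lambda>x. C x $ i $ j - C' x $ i $ j)"
      by (intro locally_integrable_diff locally_integrable_component2 lC lC')
    fix \<phi> assume \<phi>: "test_function \<Omega> \<phi>"
    have eq: "(LINT x|lebesgue_on \<Omega>. \<phi> x *\<^sub>R C x) = (LINT x|lebesgue_on \<Omega>. \<phi> x *\<^sub>R C' x)"
      using C C' \<phi> by (simp add: has_weak_Curl_def)
    note iC = test_function_integrable(1)[OF \<Omega> \<phi> lC] and iC' = test_function_integrable(1)[OF \<Omega> \<phi> lC']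
    have "(LINT x|lebesgue_on \<Omega>. \<phi> x * (C x $ i $ j - C' x $ i $ j))
       = (LINT x|lebesgue_on \<Omega>. (\<phi> x *\<^sub>R C x - \<phi> x *\<^sub>R C' x) $ i $ j)"
      by (simp add: right_diff_distrib)
    also have "\<dots> = (LINT x|lebesgue_on \<Omega>. \<phi> x *\<^sub>R C x - \<phi> x *\<^sub>R C' x) $ i $ j"
      by (rule integral_component2[symmetric]) (intro Bochner_Integration.integrable_diff iC iC')
    also have "\<dots> = 0" using eq by (simp add: Bochner_Integration.integral_diff[OF iC iC'])
    finally show "(LINT x|lebesgue_on \<Omega>. \<phi> x * (C x $ i $ j - C' x $ i $ j)) = 0" .
  qed
  have "{x \<in> \<Omega>. C x \<noteq> C' x} \<subseteq> (\<Union>(i, j)\<in>UNIV. {x \<in> \<Omega>. C x $ i $ j - C' x $ i $ j \<noteq> 0})"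
    by (auto simp: vec_eq_iff)
  moreover have "negligible (\<Union>(i, j)\<in>UNIV. {x \<in> \<Omega>. C x $ i $ j - C' x $ i $ j \<noteq> 0})"
    by (rule negligible_Union) (use comp in auto)
  ultimately show ?thesis using negligible_subset by blast
qed

lemma has_weak_Curl_Curl: "has_weak_Curl \<Omega> P C \<Longrightarrow> has_weak_Curl \<Omega> P (Curl \<Omega> P)"
  unfolding Curl_def by (rule someI[of "has_weak_Curl \<Omega> P"])

lemma measurable_lebesgue_on_cong_negligible:
  fixes f g :: "'a::euclidean_space \<Rightarrow> 'b::euclidean_space"
  assumes S: "S \<in> sets lebesgue" and f: "f \<in> borel_measurable (lebesgue_on S)"
    and n: "negligible {x \<in> S. f x \<noteq> g x}"
  shows "g \<in> borel_measurable (lebesgue_on S)"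
proof -
  let ?f = "\<lambda>x. if x \<in> S then f x else 0" and ?g = "\<lambda>x. if x \<in> S then g x else 0"
  have "?f \<in> borel_measurable lebesgue" using f S by (simp add: borel_measurable_if)
  moreover have "AE x in lebesgue. ?f x = ?g x"
  proof (rule AE_I')
    show "{x \<in> S. f x \<noteq> g x} \<in> null_sets lebesgue" using n by (simp add: negligible_iff_null_sets)
  qed auto
  ultimately have "?g \<in> borel_measurable lebesgue" by (rule borel_measurable_AE)
  then show ?thesis using S by (simp add: borel_measurable_if)
qed

lemma AE_lebesgue_on_cong_negligible:
  assumes "S \<in> sets lebesgue" "negligible {x \<in> S. f x \<noteq> g x}"
  shows "AE x in lebesgue_on S. f x = g x"
  using AE_lebesgue_on_not_in[OF assms(2,1)] AE_space by eventually_elim auto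

section \<open>Smooth fields as test fields for the tangential trace\<close>

lemma integral_lebesgue_on_vanishing:
  fixes F :: "real^'n \<Rightarrow> real"
  assumes S: "S \<in> sets lebesgue" and F: "F \<in> borel_measurable borel" "\<And>x. x \<notin> S \<Longrightarrow> F x = 0"
  shows "(LINT x|lebesgue_on S. F x) = (\<integral>x. F x \<partial>lborel)"
proof -
  have eq: "(\<lambda>x. indicator S x *\<^sub>R F x) = F" by (rule ext) (use F(2) in \<open>auto simp: indicator_def\<close>)
  have "(LINT x|lebesgue_on S. F x) = (LINT x|lebesgue. indicator S x *\<^sub>R F x)"
    by (rule integral_restrict_space) (use S in simp)
  also have "\<dots> = (LINT x|lebesgue. F x)" unfolding eq ..
  also have "\<dots> = (\<integral>x. F x \<partial>lborel)" by (rule integral_completion) (use F in simp)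
  finally show ?thesis .
qed

lemma integration_by_parts_test:
  fixes \<phi> \<theta> :: "real^'n \<Rightarrow> real"
  assumes \<Omega>: "open \<Omega>" and \<theta>: "test_function \<Omega> \<theta>" and \<phi>: "smooth \<phi>"
  shows "- (LINT x|lebesgue_on \<Omega>. partial k \<theta> x * \<phi> x) = (LINT x|lebesgue_on \<Omega>. \<theta> x * partial k \<phi> x)"
proof -
  let ?K = "closure {x. \<theta> x \<noteq> 0}"
  have s\<theta>: "smooth \<theta>" and K: "compact ?K" "?K \<subseteq> \<Omega>" using \<theta> by (simp_all add: test_function_def)
  have out: "\<theta> x = 0" "partial k \<theta> x = 0" if "x \<notin> \<Omega>" for x
    using test_function_zero_outside[OF \<theta>, of x] K(2) that by blast+
  obtain R where "\<forall>x\<in>?K. norm x \<le> R" using compact_imp_bounded[OF K(1)] unfolding bounded_iff by blast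
  then have R: "?K \<subseteq> cball 0 R" by (auto simp del: closure_eq)
  have cs: "compactly_supported \<theta>"
    by (rule compactly_supportedI[OF smooth_continuous[OF s\<theta>]]) (rule test_function_zero_outside[OF \<theta>], use R in blast)
  have m: "(\<lambda>x. \<theta> x * partial k \<phi> x) \<in> borel_measurable borel" "(\<lambda>x. partial k \<theta> x * \<phi> x) \<in> borel_measurable borel"
    by (intro borel_measurable_continuous_onI continuous_on_mult smooth_continuous smooth_partial s\<theta> \<phi>)+
  have cs1: "compactly_supported (\<lambda>x. \<theta> x * partial k \<phi> x)"
    using compactly_supported_mult_left[OF cs smooth_continuous[OF smooth_partial[OF \<phi>]], of k] by (simp add: mult.commute)
  have cs2: "compactly_supported (\<lambda>x. partial k \<theta> x * \<phi> x)"
    using compactly_supported_mult_left[OF compactly_supported_partial[OF s\<theta> cs] smooth_continuous[OF \<phi>], of k] by (simp add: mult.commute)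
  have cs3: "compactly_supported (\<lambda>x. \<theta> x * \<phi> x)"
    using compactly_supported_mult_left[OF cs smooth_continuous[OF \<phi>]] by (simp add: mult.commute)
  have pm: "partial k (\<lambda>x. \<theta> x * \<phi> x) = (\<lambda>x. \<theta> x * partial k \<phi> x + partial k \<theta> x * \<phi> x)"
    by (intro ext partial_mult smooth_differentiable s\<theta> \<phi>)
  have "(\<integral>x. partial k (\<lambda>x. \<theta> x * \<phi> x) x \<partial>lborel) = 0"
    by (rule integral_partial_eq_0[OF smooth_differentiable smooth_continuous cs3])
       (intro smooth_mult smooth_partial s\<theta> \<phi>)+
  then have "(\<integral>x. \<theta> x * partial k \<phi> x \<partial>lborel) + (\<integral>x. partial k \<theta> x * \<phi> x \<partial>lborel) = 0"
    unfolding pm by (simp add: Bochner_Integration.integral_add[OF compactly_supported_integrable[OF cs1] compactly_supported_integrable[OF cs2]])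
  moreover have "(LINT x|lebesgue_on \<Omega>. \<theta> x * partial k \<phi> x) = (\<integral>x. \<theta> x * partial k \<phi> x \<partial>lborel)"
    by (rule integral_lebesgue_on_vanishing[OF _ m(1)]) (use \<Omega> out in auto)
  moreover have "(LINT x|lebesgue_on \<Omega>. partial k \<theta> x * \<phi> x) = (\<integral>x. partial k \<theta> x * \<phi> x \<partial>lborel)"
    by (rule integral_lebesgue_on_vanishing[OF _ m(2)]) (use \<Omega> out in auto)
  ultimately show ?thesis by linarith
qed

text \<open>The curl of \<open>x \<mapsto> \<phi> x *\<^sub>R c\<close>.\<close>

definition grad_cross :: "(real^3 \<Rightarrow> real) \<Rightarrow> real^3 \<Rightarrow> real^3 \<Rightarrow> real^3" where
  "grad_cross \<phi> c x = vector
     [partial 2 \<phi> x * c $ 3 - partial 3 \<phi> x * c $ 2,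
      partial 3 \<phi> x * c $ 1 - partial 1 \<phi> x * c $ 3,
      partial 1 \<phi> x * c $ 2 - partial 2 \<phi> x * c $ 1]"

lemma grad_cross_nth:
  "grad_cross \<phi> c x $ 1 = partial 2 \<phi> x * c $ 3 - partial 3 \<phi> x * c $ 2"
  "grad_cross \<phi> c x $ 2 = partial 3 \<phi> x * c $ 1 - partial 1 \<phi> x * c $ 3"
  "grad_cross \<phi> c x $ 3 = partial 1 \<phi> x * c $ 2 - partial 2 \<phi> x * c $ 1"
  by (simp_all add: grad_cross_def)

lemma continuous_on_vec3:
  fixes f :: "'a::topological_space \<Rightarrow> real^3"
  assumes "\<And>i. continuous_on S (\<lambda>x. f x $ i)"
  shows "continuous_on S f"
  using continuous_on_vec_lambda[of S "\<lambda>i x. f x $ i"] assms by simp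

lemma continuous_on_grad_cross: "smooth \<phi> \<Longrightarrow> continuous_on UNIV (grad_cross \<phi> c)"
proof (rule continuous_on_vec3)
  fix i :: 3 assume \<phi>: "smooth \<phi>"
  consider "i = 1" | "i = 2" | "i = 3" using exhaust_3 by blast
  then show "continuous_on UNIV (\<lambda>x. grad_cross \<phi> c x $ i)"
    by cases (auto simp: grad_cross_nth intro!: continuous_intros smooth_continuous[OF smooth_partial[OF \<phi>]])
qed

lemma bounded_linear_axis: "bounded_linear (\<lambda>v. axis i v :: ('a::euclidean_space)^'n)"
  unfolding linear_conv_bounded_linear[symmetric] by (intro linearI) (auto simp: axis_def vec_eq_iff)

text \<open>Curl acts on each row separately, so a field whose only nonzero row is \<phi> c has a
  Curl with only that row. Inserted into the tangential pairing, such fields isolate one row of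
  P.\<close>

lemma has_weak_Curl_smooth_row:
  assumes \<Omega>: "open \<Omega>" and \<phi>: "smooth \<phi>"
  shows "has_weak_Curl \<Omega> (\<lambda>x. \<phi> x *\<^sub>R axis i c) (\<lambda>x. axis i (grad_cross \<phi> c x))"
  unfolding has_weak_Curl_def
proof (intro conjI allI impI)
  have cR: "continuous_on UNIV (\<lambda>x. \<phi> x *\<^sub>R axis i c)"
    by (intro continuous_intros smooth_continuous \<phi>)
  have cC: "continuous_on UNIV (\<lambda>x. axis i (grad_cross \<phi> c x))"
    by (rule bounded_linear.continuous_on[OF bounded_linear_axis continuous_on_grad_cross[OF \<phi>]])
  show "locally_integrable \<Omega> (\<lambda>x. \<phi> x *\<^sub>R axis i c)" by (rule continuous_locally_integrable[OF cR])
  show lC: "locally_integrable \<Omega> (\<lambda>x. axis i (grad_cross \<phi> c x))" by (rule continuous_locally_integrable[OF cC])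
  fix \<theta> :: "real^3 \<Rightarrow> real" assume \<theta>: "test_function \<Omega> \<theta>"
  define T where "T = (\<lambda>k. LINT x|lebesgue_on \<Omega>. \<theta> x * partial k \<phi> x)"
  have iT: "integrable (lebesgue_on \<Omega>) (\<lambda>x. \<theta> x * partial k \<phi> x)" for k
    using test_function_integrable(1)[OF \<Omega> \<theta> continuous_locally_integrable[OF smooth_continuous[OF smooth_partial[OF \<phi>]]], of k] by simp
  have dp: "distr_partial \<Omega> k (\<lambda>x. row a (\<phi> x *\<^sub>R axis i c)) \<theta> = T k *\<^sub>R (axis i c $ a)" for k a
  proof -
    have "row a (\<phi> x *\<^sub>R axis i c) = \<phi> x *\<^sub>R (axis i c $ a)" for x by (simp add: row_def vec_eq_iff)
    then have "distr_partial \<Omega> k (\<lambda>x. row a (\<phi> x *\<^sub>R axis i c)) \<theta> = - (LINT x|lebesgue_on \<Omega>. (partial k \<theta> x * \<phi> x) *\<^sub>R (axis i c $ a))"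
      by (simp add: distr_partial_def)
    also have "(LINT x|lebesgue_on \<Omega>. (partial k \<theta> x * \<phi> x) *\<^sub>R (axis i c $ a)) = (LINT x|lebesgue_on \<Omega>. partial k \<theta> x * \<phi> x) *\<^sub>R (axis i c $ a)"
      by (rule integral_scaleR_left)
        (use test_function_integrable(2)[OF \<Omega> \<theta> continuous_locally_integrable[OF smooth_continuous[OF \<phi>]], of k] in simp)
    also have "- \<dots> = T k *\<^sub>R (axis i c $ a)"
      unfolding T_def integration_by_parts_test[OF \<Omega> \<theta> \<phi>, symmetric] by simp
    finally show ?thesis .
  qed
  have iC: "integrable (lebesgue_on \<Omega>) (\<lambda>x. \<theta> x *\<^sub>R axis i (grad_cross \<phi> c x))"
    by (rule test_function_integrable(1)[OF \<Omega> \<theta> lC])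
  have gc: "(LINT x|lebesgue_on \<Omega>. \<theta> x * grad_cross \<phi> c x $ b) =
     (vector [T 2 * c $ 3 - T 3 * c $ 2, T 3 * c $ 1 - T 1 * c $ 3, T 1 * c $ 2 - T 2 * c $ 1] :: real^3) $ b" for b
  proof -
    have d: "(LINT x|lebesgue_on \<Omega>. \<theta> x * (partial k \<phi> x * s - partial l \<phi> x * t)) = T k * s - T l * t" for k l s t
    proof -
      have "(LINT x|lebesgue_on \<Omega>. \<theta> x * (partial k \<phi> x * s - partial l \<phi> x * t))
        = (LINT x|lebesgue_on \<Omega>. (\<theta> x * partial k \<phi> x) * s - (\<theta> x * partial l \<phi> x) * t)" by (simp add: algebra_simps)
      then show ?thesis using iT by (simp add: T_def)
    qed
    consider "b = 1" | "b = 2" | "b = 3" using exhaust_3 by blast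
    then show ?thesis by cases (simp_all add: grad_cross_nth d)
  qed
  show "distr_Curl \<Omega> (\<lambda>x. \<phi> x *\<^sub>R axis i c) \<theta> = (LINT x|lebesgue_on \<Omega>. \<theta> x *\<^sub>R axis i (grad_cross \<phi> c x))"
    unfolding vec_eq_iff
  proof (intro allI)
    fix a b :: 3
    have "(LINT x|lebesgue_on \<Omega>. \<theta> x *\<^sub>R axis i (grad_cross \<phi> c x)) $ a $ b = (LINT x|lebesgue_on \<Omega>. (\<theta> x *\<^sub>R axis i (grad_cross \<phi> c x)) $ a $ b)"
      by (rule integral_component2[OF iC])
    also have "\<dots> = (if a = i then LINT x|lebesgue_on \<Omega>. \<theta> x * grad_cross \<phi> c x $ b else 0)"
      by (simp add: axis_def)
    also have "\<dots> = distr_Curl \<Omega> (\<lambda>x. \<phi> x *\<^sub>R axis i c) \<theta> $ a $ b"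
    proof -
      consider "b = 1" | "b = 2" | "b = 3" using exhaust_3 by blast
      then show ?thesis unfolding gc distr_Curl_def distr_curl_def dp
        by cases (auto simp: axis_def)
    qed
    finally show "distr_Curl \<Omega> (\<lambda>x. \<phi> x *\<^sub>R axis i c) \<theta> $ a $ b = (LINT x|lebesgue_on \<Omega>. \<theta> x *\<^sub>R axis i (grad_cross \<phi> c x)) $ a $ b" ..
  qed
qed

lemma open_bounded_lmeasurable: "open \<Omega> \<Longrightarrow> bounded \<Omega> \<Longrightarrow> (\<Omega> :: 'a::euclidean_space set) \<in> lmeasurable"
  by (rule lmeasurable_open)

lemma continuous_in_Lp:
  fixes f :: "real^'n \<Rightarrow> 'b::euclidean_space"
  assumes \<Omega>: "open \<Omega>" "bounded \<Omega>" and f: "continuous_on UNIV f" and q: "q > 0"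
  shows "f \<in> Lp q \<Omega>"
proof -
  have m: "f \<in> borel_measurable (lebesgue_on \<Omega>)" by (rule borel_imp_lebesgue_on[OF borel_measurable_continuous_onI[OF f]])
  have "bounded (f ` closure \<Omega>)"
    using \<Omega> by (intro compact_imp_bounded compact_continuous_image continuous_on_subset[OF f]) (auto simp: compact_closure)
  then obtain B where B: "\<And>x. x \<in> closure \<Omega> \<Longrightarrow> norm (f x) \<le> B" by (auto simp: bounded_iff)
  have "integrable (lebesgue_on \<Omega>) (\<lambda>x. norm (f x) powr q)"
  proof (rule finite_measure.integrable_const_bound[OF finite_measure_lebesgue_on[OF open_bounded_lmeasurable[OF \<Omega>]]])
    show "AE x in lebesgue_on \<Omega>. norm (norm (f x) powr q) \<le> B powr q"
      using q by (intro AE_I2) (auto intro!: powr_mono2 B subsetD[OF closure_subset])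
  qed (use m in auto)
  with m show ?thesis by (simp add: Lp_def)
qed

lemma has_weak_partial_smooth:
  fixes \<phi> :: "real^'n \<Rightarrow> real" and c :: "'b::euclidean_space"
  assumes \<Omega>: "open \<Omega>" and \<phi>: "smooth \<phi>"
  shows "has_weak_partial \<Omega> k (\<lambda>x. \<phi> x *\<^sub>R c) (\<lambda>x. partial k \<phi> x *\<^sub>R c)"
  unfolding has_weak_partial_def
proof (intro conjI allI impI)
  show "locally_integrable \<Omega> (\<lambda>x. \<phi> x *\<^sub>R c)" "locally_integrable \<Omega> (\<lambda>x. partial k \<phi> x *\<^sub>R c)"
    by (intro continuous_locally_integrable continuous_intros smooth_continuous smooth_partial \<phi>)+
  fix \<theta> :: "real^'n \<Rightarrow> real" assume \<theta>: "test_function \<Omega> \<theta>"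
  have i1: "integrable (lebesgue_on \<Omega>) (\<lambda>x. partial k \<theta> x * \<phi> x)"
    using test_function_integrable(2)[OF \<Omega> \<theta> continuous_locally_integrable[OF smooth_continuous[OF \<phi>]], of k] by simp
  have i2: "integrable (lebesgue_on \<Omega>) (\<lambda>x. \<theta> x * partial k \<phi> x)"
    using test_function_integrable(1)[OF \<Omega> \<theta> continuous_locally_integrable[OF smooth_continuous[OF smooth_partial[OF \<phi>]]], of k] by simp
  have "distr_partial \<Omega> k (\<lambda>x. \<phi> x *\<^sub>R c) \<theta> = - (LINT x|lebesgue_on \<Omega>. partial k \<theta> x * \<phi> x) *\<^sub>R c"
    using i1 by (simp add: distr_partial_def integral_scaleR_left)
  also have "\<dots> = (LINT x|lebesgue_on \<Omega>. \<theta> x * partial k \<phi> x) *\<^sub>R c"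
    by (simp only: integration_by_parts_test[OF \<Omega> \<theta> \<phi>])
  also have "\<dots> = (LINT x|lebesgue_on \<Omega>. \<theta> x *\<^sub>R partial k \<phi> x *\<^sub>R c)"
    using i2 by (simp add: integral_scaleR_left)
  finally show "distr_partial \<Omega> k (\<lambda>x. \<phi> x *\<^sub>R c) \<theta> = (LINT x|lebesgue_on \<Omega>. \<theta> x *\<^sub>R partial k \<phi> x *\<^sub>R c)" .
qed

lemma partial_scaleR_const_smooth:
  "smooth \<phi> \<Longrightarrow> partial k (\<lambda>x. \<phi> x *\<^sub>R c) = (\<lambda>x. partial k \<phi> x *\<^sub>R c)" for \<phi> :: "real^'n \<Rightarrow> real"
  by (intro ext partial_scaleR_const smooth_differentiable)

text \<open>The constant sequence serves as approximating sequence; what remains is integrability on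
  a bounded set, the weak derivatives, and measurability for the surface measure.\<close>

lemma has_trace_smooth:
  fixes \<phi> :: "real^3 \<Rightarrow> real" and c :: "'b::euclidean_space"
  assumes \<Omega>: "open \<Omega>" "bounded \<Omega>" and \<phi>: "smooth \<phi>" and q: "q > 0"
  shows "has_trace q \<Omega> (\<lambda>x. \<phi> x *\<^sub>R c) (\<lambda>x. \<phi> x *\<^sub>R c)"
proof -
  have cR: "continuous_on UNIV (\<lambda>x. \<phi> x *\<^sub>R c)" by (intro continuous_intros smooth_continuous \<phi>)
  have g: "(\<lambda>x. partial j \<phi> x *\<^sub>R c) \<in> Lp q \<Omega>" for j
    by (intro continuous_in_Lp[OF \<Omega> _ q] continuous_intros smooth_continuous smooth_partial \<phi>)
  have wp: "has_weak_partial \<Omega> j (\<lambda>x. \<phi> x *\<^sub>R c) (\<lambda>x. partial j \<phi> x *\<^sub>R c)" for j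
    by (rule has_weak_partial_smooth[OF \<Omega>(1) \<phi>])
  have W: "(\<lambda>x. \<phi> x *\<^sub>R c) \<in> W1 q \<Omega>"
    unfolding W1_def using continuous_in_Lp[OF \<Omega> cR q] g wp by blast
  have Lp0: "Lp_norm q \<Omega> (\<lambda>x. 0 :: 'b) = 0" by (simp add: Lp_norm_def)
  show ?thesis
    unfolding has_trace_def
  proof (intro conjI exI[of _ "\<lambda>n x. \<phi> x *\<^sub>R c"] allI)
    show "\<exists>g\<in>Lp q \<Omega>. has_weak_partial \<Omega> j (\<lambda>x. \<phi> x *\<^sub>R c) g \<and>
      (\<lambda>n. Lp_norm q \<Omega> (\<lambda>x. partial j (\<lambda>x. \<phi> x *\<^sub>R c) x - g x)) \<longlonglongrightarrow> 0" for j
      using g wp by (intro bexI[of _ "\<lambda>x. partial j \<phi> x *\<^sub>R c"]) (auto simp: partial_scaleR_const_smooth[OF \<phi>] Lp0)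
  qed (use W continuous_measurable_surface[OF cR] smooth_scaleR_const[OF \<phi>] in \<open>auto simp: Lp0\<close>)
qed

lemma Lp_integrable:
  fixes f :: "real^'n \<Rightarrow> 'b::euclidean_space"
  assumes \<Omega>: "\<Omega> \<in> lmeasurable" and p: "p \<ge> 1" and f: "f \<in> Lp p \<Omega>"
  shows "integrable (lebesgue_on \<Omega>) f"
proof -
  have m: "f \<in> borel_measurable (lebesgue_on \<Omega>)" and i: "integrable (lebesgue_on \<Omega>) (\<lambda>x. norm (f x) powr p)"
    using f by (auto simp: Lp_def)
  have "integrable (lebesgue_on \<Omega>) (\<lambda>x. norm (f x))"
    by (rule integrable_of_powr_integrable[OF \<Omega> _ _ p]) (use m i in auto)
  with m show ?thesis by (simp add: integrable_norm_iff)
qed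

text \<open>The vanishing tangential trace says that the extension of \<open>P\<close> by zero has the extension of
  \<open>Curl P\<close> by zero as its distributional \<open>Curl\<close> on the whole space: the test function \<open>\<phi>\<close> below
  need not vanish near the boundary.\<close>

lemma zero_trace_identity:
  assumes \<Omega>: "open \<Omega>" "bounded \<Omega>" and p: "1 < p" and P: "P \<in> W0_Curl p \<Omega>" and \<phi>: "smooth \<phi>"
  shows "(LINT x|lebesgue_on \<Omega>. \<phi> x * (Curl \<Omega> P x $ i \<bullet> c)) = (LINT x|lebesgue_on \<Omega>. P x $ i \<bullet> grad_cross \<phi> c x)"
    and "Curl \<Omega> P \<in> Lp p \<Omega>"
proof -
  define p' where "p' = p / (p - 1)"
  have p': "p' > 0" using p by (simp add: p'_def)
  have Om: "\<Omega> \<in> sets lebesgue" and Ol: "\<Omega> \<in> lmeasurable" using \<Omega> open_bounded_lmeasurable by auto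
  obtain C where C: "C \<in> Lp p \<Omega>" "has_weak_Curl \<Omega> P C" and PL: "P \<in> Lp p \<Omega>" and z: "zero_tangential_trace p \<Omega> P"
    using P by (auto simp: W0_Curl_def)
  \<comment> \<open>The definition of the space provides some weak curl in L^p, whereas the pairing
    uses the chosen \<open>Curl\<close>. Both agree outside a null set, so integrability is
    inherited.\<close>
  have n: "negligible {x \<in> \<Omega>. C x \<noteq> Curl \<Omega> P x}"
    by (rule has_weak_Curl_unique[OF \<Omega>(1) C(2) has_weak_Curl_Curl[OF C(2)]])
  have Cm: "C \<in> borel_measurable (lebesgue_on \<Omega>)" and Ci: "integrable (lebesgue_on \<Omega>) (\<lambda>x. norm (C x) powr p)"
    using C by (auto simp: Lp_def)
  have Km: "Curl \<Omega> P \<in> borel_measurable (lebesgue_on \<Omega>)"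
    by (rule measurable_lebesgue_on_cong_negligible[OF Om Cm n])
  have "integrable (lebesgue_on \<Omega>) (\<lambda>x. norm (Curl \<Omega> P x) powr p)"
    by (rule integrable_cong_AE_imp[OF Ci]) (use Km AE_lebesgue_on_cong_negligible[OF Om n] in auto)
  with Km show KL: "Curl \<Omega> P \<in> Lp p \<Omega>" by (simp add: Lp_def)
  \<comment> \<open>This field is smooth up to the boundary and serves as its own trace, so it is an
    admissible extension.\<close>
  define R where "R = (\<lambda>x. \<phi> x *\<^sub>R (axis i c :: real^3^3))"
  define D where "D = (\<lambda>x. axis i (grad_cross \<phi> c x) :: real^3^3)"
  have cR: "continuous_on UNIV R" unfolding R_def by (intro continuous_intros smooth_continuous \<phi>)
  have cD: "continuous_on UNIV D" unfolding D_def
    by (rule bounded_linear.continuous_on[OF bounded_linear_axis continuous_on_grad_cross[OF \<phi>]])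
  have tr: "has_trace p' \<Omega> R R" unfolding R_def by (rule has_trace_smooth[OF \<Omega> \<phi> p'])
  have "R \<in> trace_space p' \<Omega>" using tr by (auto simp: trace_space_def)
  moreover have "R \<in> W1 p' \<Omega>" using tr by (simp add: has_trace_def)
  ultimately have "tangential_pairing \<Omega> P R = 0"
    using z tr unfolding zero_tangential_trace_def Let_def p'_def[symmetric] by blast
  then have zero: "(LINT x|lebesgue_on \<Omega>. Curl \<Omega> P x \<bullet> R x - P x \<bullet> Curl \<Omega> R x) = 0"
    by (simp add: tangential_pairing_def)
  have wD: "has_weak_Curl \<Omega> R D" unfolding R_def D_def by (rule has_weak_Curl_smooth_row[OF \<Omega>(1) \<phi>])
  have nD: "negligible {x \<in> \<Omega>. D x \<noteq> Curl \<Omega> R x}"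
    by (rule has_weak_Curl_unique[OF \<Omega>(1) wD has_weak_Curl_Curl[OF wD]])
  have Dm: "D \<in> borel_measurable (lebesgue_on \<Omega>)" and Rm: "R \<in> borel_measurable (lebesgue_on \<Omega>)"
    by (rule borel_imp_lebesgue_on[OF borel_measurable_continuous_onI], rule cD)
       (rule borel_imp_lebesgue_on[OF borel_measurable_continuous_onI], rule cR)
  have KRm: "Curl \<Omega> R \<in> borel_measurable (lebesgue_on \<Omega>)"
    by (rule measurable_lebesgue_on_cong_negligible[OF Om Dm nD])
  have Pm: "P \<in> borel_measurable (lebesgue_on \<Omega>)" using PL by (simp add: Lp_def)
  have "(LINT x|lebesgue_on \<Omega>. Curl \<Omega> P x \<bullet> R x - P x \<bullet> Curl \<Omega> R x) = (LINT x|lebesgue_on \<Omega>. Curl \<Omega> P x \<bullet> R x - P x \<bullet> D x)"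
  proof (rule integral_cong_AE)
    show "AE x in lebesgue_on \<Omega>. Curl \<Omega> P x \<bullet> R x - P x \<bullet> Curl \<Omega> R x = Curl \<Omega> P x \<bullet> R x - P x \<bullet> D x"
      using AE_lebesgue_on_cong_negligible[OF Om nD] by eventually_elim simp
  qed (use Km Rm Pm KRm Dm in auto)
  have int: "integrable (lebesgue_on \<Omega>) (\<lambda>x. F x \<bullet> G x)" if F: "F \<in> Lp p \<Omega>" and G: "continuous_on UNIV G" for F G :: "real^3 \<Rightarrow> real^3^3"
  proof -
    have "bounded (G ` closure \<Omega>)"
      using \<Omega> by (intro compact_imp_bounded compact_continuous_image continuous_on_subset[OF G]) (auto simp: compact_closure)
    then obtain B where B: "\<And>x. x \<in> closure \<Omega> \<Longrightarrow> norm (G x) \<le> B" by (auto simp: bounded_iff)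
    have Fi: "integrable (lebesgue_on \<Omega>) F" using Lp_integrable[OF Ol _ F] p by simp
    show ?thesis
    proof (rule Bochner_Integration.integrable_bound)
      show "integrable (lebesgue_on \<Omega>) (\<lambda>x. norm (F x) * B)" using Fi by auto
      show "(\<lambda>x. F x \<bullet> G x) \<in> borel_measurable (lebesgue_on \<Omega>)"
        using Fi borel_imp_lebesgue_on[OF borel_measurable_continuous_onI[OF G]] by auto
      show "AE x in lebesgue_on \<Omega>. norm (F x \<bullet> G x) \<le> norm (norm (F x) * B)"
      proof (rule AE_I2)
        fix x assume "x \<in> space (lebesgue_on \<Omega>)"
        then have b: "norm (G x) \<le> B" using B[of x] closure_subset by auto
        have "norm (F x \<bullet> G x) \<le> norm (F x) * norm (G x)" using Cauchy_Schwarz_ineq2 by simp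
        also have "\<dots> \<le> norm (F x) * B" using b by (intro mult_left_mono) auto
        finally show "norm (F x \<bullet> G x) \<le> norm (norm (F x) * B)" by simp
      qed
    qed
  qed
  have "(LINT x|lebesgue_on \<Omega>. Curl \<Omega> P x \<bullet> R x) - (LINT x|lebesgue_on \<Omega>. P x \<bullet> D x) = 0"
    using zero \<open>_ = (LINT x|lebesgue_on \<Omega>. Curl \<Omega> P x \<bullet> R x - P x \<bullet> D x)\<close>
    by (simp add: Bochner_Integration.integral_diff[OF int[OF KL cR] int[OF PL cD]])
  moreover have "Curl \<Omega> P x \<bullet> R x = \<phi> x * (Curl \<Omega> P x $ i \<bullet> c)" "P x \<bullet> D x = P x $ i \<bullet> grad_cross \<phi> c x" for x
    by (simp_all add: R_def D_def inner_axis)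
  ultimately show "(LINT x|lebesgue_on \<Omega>. \<phi> x * (Curl \<Omega> P x $ i \<bullet> c)) = (LINT x|lebesgue_on \<Omega>. P x $ i \<bullet> grad_cross \<phi> c x)"
    by simp
qed

section \<open>Trace and axial vector of a matrix field\<close>

lemma Lp_bounded_linear:
  fixes f :: "real^'n \<Rightarrow> 'b::euclidean_space" and L :: "'b \<Rightarrow> 'c::euclidean_space"
  assumes f: "f \<in> Lp p \<Omega>" and L: "bounded_linear L" and p: "p > 0"
  shows "(\<lambda>x. L (f x)) \<in> Lp p \<Omega>"
proof -
  have m: "f \<in> borel_measurable (lebesgue_on \<Omega>)" and i: "integrable (lebesgue_on \<Omega>) (\<lambda>x. norm (f x) powr p)"
    using f by (auto simp: Lp_def)
  have m': "(\<lambda>x. L (f x)) \<in> borel_measurable (lebesgue_on \<Omega>)"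
    by (rule measurable_compose[OF m borel_measurable_continuous_onI[OF linear_continuous_on[OF L]]])
  obtain B where B: "B > 0" "\<And>x. norm (L x) \<le> norm x * B" using bounded_linear.pos_bounded[OF L] by blast
  have "integrable (lebesgue_on \<Omega>) (\<lambda>x. norm (L (f x)) powr p)"
  proof (rule Bochner_Integration.integrable_bound)
    show "integrable (lebesgue_on \<Omega>) (\<lambda>x. B powr p * norm (f x) powr p)" using i by simp
    show "(\<lambda>x. norm (L (f x)) powr p) \<in> borel_measurable (lebesgue_on \<Omega>)" using m' by measurable
    show "AE x in lebesgue_on \<Omega>. norm (norm (L (f x)) powr p) \<le> norm (B powr p * norm (f x) powr p)"
    proof (rule AE_I2)
      fix x
      have "norm (L (f x)) powr p \<le> (norm (f x) * B) powr p" using B p by (intro powr_mono2) auto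
      then show "norm (norm (L (f x)) powr p) \<le> norm (B powr p * norm (f x) powr p)"
        using B by (simp add: powr_mult mult.commute)
    qed
  qed
  with m' show ?thesis by (simp add: Lp_def)
qed

lemma dev_sym_part_nth:
  "dev (sym_part X) $ i $ j = (X $ i $ j + X $ j $ i) / 2 - (if i = j then (X $ 1 $ 1 + X $ 2 $ 2 + X $ 3 $ 3) / 3 else 0)"
  by (simp add: dev_def sym_part_def transpose_def trace_def mat_def sum_3)

lemma dev_nth: "dev X $ i $ j = X $ i $ j - (if i = j then (X $ 1 $ 1 + X $ 2 $ 2 + X $ 3 $ 3) / 3 else 0)"
  by (simp add: dev_def trace_def mat_def sum_3)

lemma bounded_linear_dev_sym_part: "bounded_linear (\<lambda>X. dev (sym_part X))"
  unfolding linear_conv_bounded_linear[symmetric]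
  by (intro linearI) (simp_all add: vec_eq_iff dev_sym_part_nth field_simps)

lemma bounded_linear_dev: "bounded_linear dev"
  unfolding linear_conv_bounded_linear[symmetric]
  by (intro linearI) (simp_all add: vec_eq_iff dev_nth field_simps)

lemma bounded_linear_nth2: "bounded_linear (\<lambda>X :: real^'n^'m. X $ i $ j)"
  by (intro bounded_linear_compose[OF bounded_linear_vec_nth bounded_linear_vec_nth])

text \<open>\<open>P i l k m\<close>, \<open>S i l k m\<close> stand for the pairings of \<open>P\<^sub>i\<^sub>l\<close> and \<open>(dev sym P)\<^sub>i\<^sub>l\<close> with \<open>\<partial>\<^sub>k\<partial>\<^sub>m\<psi>\<close>, and
  \<open>Y i j m\<close>, \<open>D i j m\<close> for those of \<open>(Curl P)\<^sub>i\<^sub>j\<close> and \<open>(dev Curl P)\<^sub>i\<^sub>j\<close> with \<open>\<partial>\<^sub>m\<psi>\<close>. With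
  \<open>F = Curl (dev sym P) - dev Curl P\<close>, the trace part \<open>\<zeta>\<close> and the axial vector \<open>a\<close> of \<open>P\<close> satisfy
  \<open>\<Delta>\<zeta> = - \<epsilon>\<^sub>l\<^sub>m\<^sub>i \<partial>\<^sub>mF\<^sub>i\<^sub>l / 2\<close> and \<open>\<Delta>a\<^sub>j = \<partial>\<^sub>iF\<^sub>i\<^sub>j + \<partial>\<^sub>iF\<^sub>j\<^sub>i / 2\<close>.\<close>

lemma laplacian_identities:
  fixes P S :: "3 \<Rightarrow> 3 \<Rightarrow> 3 \<Rightarrow> 3 \<Rightarrow> real" and Y D :: "3 \<Rightarrow> 3 \<Rightarrow> 3 \<Rightarrow> real"
  assumes sym: "\<And>i l k m. P i l k m = P i l m k"
    and Y: "\<And>i m. Y i 1 m = P i 2 3 m - P i 3 2 m" "\<And>i m. Y i 2 m = P i 3 1 m - P i 1 3 m"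
      "\<And>i m. Y i 3 m = P i 1 2 m - P i 2 1 m"
    and S: "\<And>i l k m. S i l k m = (P i l k m + P l i k m) / 2 - (if i = l then (P 1 1 k m + P 2 2 k m + P 3 3 k m) / 3 else 0)"
    and D: "\<And>i j m. D i j m = Y i j m - (if i = j then (Y 1 1 m + Y 2 2 m + Y 3 3 m) / 3 else 0)"
    and TS: "\<And>i l k m. \<bar>S i l k m\<bar> \<le> T" and TD: "\<And>i j m. \<bar>D i j m\<bar> \<le> T"
  shows "\<bar>\<Sum>k\<in>UNIV. (P 1 1 k k + P 2 2 k k + P 3 3 k k) / 3\<bar> \<le> 14 * T"
    and "\<bar>\<Sum>k\<in>UNIV. (P 3 2 k k - P 2 3 k k) / 2\<bar> \<le> 14 * T"
    and "\<bar>\<Sum>k\<in>UNIV. (P 1 3 k k - P 3 1 k k) / 2\<bar> \<le> 14 * T"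
    and "\<bar>\<Sum>k\<in>UNIV. (P 2 1 k k - P 1 2 k k) / 2\<bar> \<le> 14 * T"
proof -
  \<comment> \<open>\<open>F1 i m\<close> stands for the pairing of \<psi> with the m-th derivative
    of the entry (i, 1) of F: moving derivatives onto \<psi> accounts for the signs.
    \<open>F2\<close> and \<open>F3\<close> belong to the second and third columns.\<close>
  define F1 where "F1 = (\<lambda>i m. S i 3 2 m - S i 2 3 m + D i 1 m)"
  define F2 where "F2 = (\<lambda>i m. S i 1 3 m - S i 3 1 m + D i 2 m)"
  define F3 where "F3 = (\<lambda>i m. S i 2 1 m - S i 1 2 m + D i 3 m)"
  have b: "\<bar>F1 i m\<bar> \<le> 3 * T" "\<bar>F2 i m\<bar> \<le> 3 * T" "\<bar>F3 i m\<bar> \<le> 3 * T" for i m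
    using TS[of i 3 2 m] TS[of i 2 3 m] TD[of i 1 m] TS[of i 1 3 m] TS[of i 3 1 m] TD[of i 2 m]
      TS[of i 2 1 m] TS[of i 1 2 m] TD[of i 3 m]
    unfolding F1_def F2_def F3_def by linarith+
  have bound1: "\<bar>(a + b + c - d - e - f) / 2\<bar> \<le> 14 * T"
    if "\<bar>a\<bar> \<le> 3 * T" "\<bar>b\<bar> \<le> 3 * T" "\<bar>c\<bar> \<le> 3 * T" "\<bar>d\<bar> \<le> 3 * T" "\<bar>e\<bar> \<le> 3 * T" "\<bar>f\<bar> \<le> 3 * T" for a b c d e f
    using that by argo
  \<comment> \<open>Three terms of size 3 T and half of three more make 13.5 T, rounded up to 14 T.
    The identity for the trace part stays below 9 T and shares the constant.\<close>
  have bound2: "\<bar>a + b + c + (d + e + f) / 2\<bar> \<le> 14 * T"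
    if "\<bar>a\<bar> \<le> 3 * T" "\<bar>b\<bar> \<le> 3 * T" "\<bar>c\<bar> \<le> 3 * T" "\<bar>d\<bar> \<le> 3 * T" "\<bar>e\<bar> \<le> 3 * T" "\<bar>f\<bar> \<le> 3 * T" for a b c d e f
    using that by argo
  have s: "P i l 2 1 = P i l 1 2" "P i l 3 1 = P i l 1 3" "P i l 3 2 = P i l 2 3" for i l
    by (rule sym)+
  note defs = F1_def F2_def F3_def S D Y s sum_3
  have eq: "(\<Sum>k\<in>UNIV. (P 1 1 k k + P 2 2 k k + P 3 3 k k) / 3) = (F1 2 3 + F2 3 1 + F3 1 2 - F1 3 2 - F2 1 3 - F3 2 1) / 2"
    by (simp add: defs) (simp add: field_simps)
  show "\<bar>\<Sum>k\<in>UNIV. (P 1 1 k k + P 2 2 k k + P 3 3 k k) / 3\<bar> \<le> 14 * T"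
    unfolding eq by (rule bound1; rule b)
  have eq: "(\<Sum>k\<in>UNIV. (P 3 2 k k - P 2 3 k k) / 2) = F1 1 1 + F1 2 2 + F1 3 3 + (F1 1 1 + F2 1 2 + F3 1 3) / 2"
    by (simp add: defs) (simp add: field_simps)
  show "\<bar>\<Sum>k\<in>UNIV. (P 3 2 k k - P 2 3 k k) / 2\<bar> \<le> 14 * T"
    unfolding eq by (rule bound2; rule b)
  have eq: "(\<Sum>k\<in>UNIV. (P 1 3 k k - P 3 1 k k) / 2) = F2 1 1 + F2 2 2 + F2 3 3 + (F1 2 1 + F2 2 2 + F3 2 3) / 2"
    by (simp add: defs) (simp add: field_simps)
  show "\<bar>\<Sum>k\<in>UNIV. (P 1 3 k k - P 3 1 k k) / 2\<bar> \<le> 14 * T"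
    unfolding eq by (rule bound2; rule b)
  have eq: "(\<Sum>k\<in>UNIV. (P 2 1 k k - P 1 2 k k) / 2) = F3 1 1 + F3 2 2 + F3 3 3 + (F1 3 1 + F2 3 2 + F3 3 3) / 2"
    by (simp add: defs) (simp add: field_simps)
  show "\<bar>\<Sum>k\<in>UNIV. (P 2 1 k k - P 1 2 k k) / 2\<bar> \<le> 14 * T"
    unfolding eq by (rule bound2; rule b)
qed

text \<open>X is the sum of its deviatoric symmetric part, a multiple of the identity and a skew
  part. Summing absolute values of entries counts the multiple of the identity three times and each
  axial component twice.\<close>

lemma norm_le_dev_sym_part:
  fixes X :: "real^3^3"
  shows "norm X \<le> norm (dev (sym_part X)) + 3 * \<bar>(X $ 1 $ 1 + X $ 2 $ 2 + X $ 3 $ 3) / 3\<bar>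
    + 2 * \<bar>(X $ 3 $ 2 - X $ 2 $ 3) / 2\<bar> + 2 * \<bar>(X $ 1 $ 3 - X $ 3 $ 1) / 2\<bar> + 2 * \<bar>(X $ 2 $ 1 - X $ 1 $ 2) / 2\<bar>"
proof -
  define Z where "Z = X - dev (sym_part X)"
  have "norm Z \<le> (\<Sum>i\<in>UNIV. norm (Z $ i))" unfolding norm_vec_def by (rule L2_set_le_sum) auto
  also have "\<dots> \<le> (\<Sum>i\<in>UNIV. \<Sum>j\<in>UNIV. \<bar>Z $ i $ j\<bar>)" by (intro sum_mono norm_le_l1_cart)
  also have "\<dots> = 3 * \<bar>(X $ 1 $ 1 + X $ 2 $ 2 + X $ 3 $ 3) / 3\<bar>
    + 2 * \<bar>(X $ 3 $ 2 - X $ 2 $ 3) / 2\<bar> + 2 * \<bar>(X $ 1 $ 3 - X $ 3 $ 1) / 2\<bar> + 2 * \<bar>(X $ 2 $ 1 - X $ 1 $ 2) / 2\<bar>"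
    by (simp add: Z_def sum_3 dev_sym_part_nth) (simp add: field_simps abs_minus_commute)
  finally have "norm Z \<le> 3 * \<bar>(X $ 1 $ 1 + X $ 2 $ 2 + X $ 3 $ 3) / 3\<bar>
    + 2 * \<bar>(X $ 3 $ 2 - X $ 2 $ 3) / 2\<bar> + 2 * \<bar>(X $ 1 $ 3 - X $ 3 $ 1) / 2\<bar> + 2 * \<bar>(X $ 2 $ 1 - X $ 1 $ 2) / 2\<bar>" .
  moreover have "norm X \<le> norm (dev (sym_part X)) + norm Z"
    using norm_triangle_ineq[of "dev (sym_part X)" Z] by (simp add: Z_def)
  ultimately show ?thesis by linarith
qed

text \<open>10 = 1 + 3 + 2 + 2 + 2: every term is replaced by the largest, whose power is in turn
  below the sum of all powers.\<close>

lemma powr_weighted_sum_le: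
  fixes a b c d e p :: real
  assumes "a \<ge> 0" "b \<ge> 0" "c \<ge> 0" "d \<ge> 0" "e \<ge> 0" and p: "p \<ge> 0"
  shows "(a + 3 * b + 2 * c + 2 * d + 2 * e) powr p \<le> 10 powr p * (a powr p + b powr p + c powr p + d powr p + e powr p)"
proof -
  define m where "m = Max {a, b, c, d, e}"
  have le: "a \<le> m" "b \<le> m" "c \<le> m" "d \<le> m" "e \<le> m" unfolding m_def by (intro Max_ge; simp)+
  have "m \<in> {a, b, c, d, e}" unfolding m_def by (intro Max_in) auto
  then have m: "m powr p \<le> a powr p + b powr p + c powr p + d powr p + e powr p"
    by (auto simp: add_increasing add_increasing2 add_nonneg_nonneg)
  have "(a + 3 * b + 2 * c + 2 * d + 2 * e) powr p \<le> (10 * m) powr p"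
    using assms le by (intro powr_mono2) linarith+
  also have "\<dots> = 10 powr p * m powr p" using assms le by (simp add: powr_mult)
  also have "\<dots> \<le> 10 powr p * (a powr p + b powr p + c powr p + d powr p + e powr p)" using m by (intro mult_left_mono) auto
  finally show ?thesis .
qed

text \<open>The pairings of P, its Curl and their deviatoric parts with derivatives of \<psi>
  satisfy the algebraic hypotheses of \<open>laplacian_identities\<close>. Young's inequality bounds
  those of dev sym P and dev Curl P by A + H, which takes the place of T.\<close>

lemma W0_Curl_laplacian_bound:
  fixes P :: "real^3 \<Rightarrow> real^3^3"
  assumes \<Omega>: "open \<Omega>" "bounded \<Omega>" and p: "1 < p" and q: "q = p / (p - 1)" and P: "P \<in> W0_Curl p \<Omega>"
    and \<psi>: "smooth \<psi>" "compactly_supported \<psi>"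
  defines "A \<equiv> (LINT x|lebesgue_on \<Omega>. norm (dev (sym_part (P x))) powr p) + (LINT x|lebesgue_on \<Omega>. norm (dev (Curl \<Omega> P x)) powr p)"
    and "H \<equiv> (\<Sum>i\<in>UNIV. \<Sum>j\<in>UNIV. \<integral>x. \<bar>partial i (partial j \<psi>) x\<bar> powr q \<partial>lborel) + (\<Sum>j\<in>UNIV. \<integral>x. \<bar>partial j \<psi> x\<bar> powr q \<partial>lborel)"
  shows "\<bar>LINT x|lebesgue_on \<Omega>. (P x $ 1 $ 1 + P x $ 2 $ 2 + P x $ 3 $ 3) / 3 * laplacian \<psi> x\<bar> \<le> 14 * (A + H)"
    and "\<bar>LINT x|lebesgue_on \<Omega>. (P x $ 3 $ 2 - P x $ 2 $ 3) / 2 * laplacian \<psi> x\<bar> \<le> 14 * (A + H)"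
    and "\<bar>LINT x|lebesgue_on \<Omega>. (P x $ 1 $ 3 - P x $ 3 $ 1) / 2 * laplacian \<psi> x\<bar> \<le> 14 * (A + H)"
    and "\<bar>LINT x|lebesgue_on \<Omega>. (P x $ 2 $ 1 - P x $ 1 $ 2) / 2 * laplacian \<psi> x\<bar> \<le> 14 * (A + H)"
proof -
  have Om: "\<Omega> \<in> sets lebesgue" and Ol: "\<Omega> \<in> lmeasurable" using \<Omega> open_bounded_lmeasurable by auto
  have q1: "q > 1" unfolding q using p by (simp add: less_divide_eq)
  define C where "C = Curl \<Omega> P"
  have PL: "P \<in> Lp p \<Omega>" using P by (simp add: W0_Curl_def)
  have CL: "C \<in> Lp p \<Omega>" unfolding C_def by (rule zero_trace_identity(2)[OF \<Omega> p P \<psi>(1)])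
  define S where "S = (\<lambda>x. dev (sym_part (P x)))"
  define D where "D = (\<lambda>x. dev (C x))"
  have SL: "S \<in> Lp p \<Omega>" unfolding S_def by (rule Lp_bounded_linear[OF PL bounded_linear_dev_sym_part]) (use p in simp)
  have DL: "D \<in> Lp p \<Omega>" unfolding D_def by (rule Lp_bounded_linear[OF CL bounded_linear_dev]) (use p in simp)
  have int: "integrable (lebesgue_on \<Omega>) (\<lambda>x. f x * g x)" if f: "integrable (lebesgue_on \<Omega>) f" and g: "compactly_supported g" for f g :: "real^3 \<Rightarrow> real"
  proof -
    obtain B where "\<And>x. \<bar>g x\<bar> \<le> B" using compactly_supported_bounded[OF g] by metis
    then show ?thesis
      by (intro integrable_bounded_times[OF f, of _ B] borel_imp_lebesgue_on compactly_supported_measurable g)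
  qed
  have ent: "integrable (lebesgue_on \<Omega>) (\<lambda>x. F x $ i $ j)" if F: "F \<in> Lp p \<Omega>" for F :: "real^3 \<Rightarrow> real^3^3" and i j
    by (rule integrable_bounded_linear[OF bounded_linear_nth2 Lp_integrable[OF Ol _ F]]) (use p in simp)
  have cs2: "compactly_supported (partial k (partial m \<psi>))" for k m
    by (intro compactly_supported_partial smooth_partial \<psi>)
  have cs1: "compactly_supported (partial m \<psi>)" for m
    by (intro compactly_supported_partial \<psi>)
  have H2: "(\<integral>x. \<bar>partial k (partial m \<psi>) x\<bar> powr q \<partial>lborel) \<le> H" for k m
  proof -
    have "(\<integral>x. \<bar>partial k (partial m \<psi>) x\<bar> powr q \<partial>lborel) \<le> (\<Sum>j\<in>UNIV. \<integral>x. \<bar>partial k (partial j \<psi>) x\<bar> powr q \<partial>lborel)"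
      by (rule member_le_sum[of m UNIV "\<lambda>j. \<integral>x. \<bar>partial k (partial j \<psi>) x\<bar> powr q \<partial>lborel"]) auto
    also have "\<dots> \<le> (\<Sum>i\<in>UNIV. \<Sum>j\<in>UNIV. \<integral>x. \<bar>partial i (partial j \<psi>) x\<bar> powr q \<partial>lborel)"
      by (rule member_le_sum[of k UNIV "\<lambda>i. \<Sum>j\<in>UNIV. \<integral>x. \<bar>partial i (partial j \<psi>) x\<bar> powr q \<partial>lborel"]) (auto intro!: sum_nonneg)
    finally show ?thesis unfolding H_def by (smt (verit) sum_nonneg Bochner_Integration.integral_nonneg powr_ge_zero)
  qed
  have H1: "(\<integral>x. \<bar>partial m \<psi> x\<bar> powr q \<partial>lborel) \<le> H" for m
  proof -
    have "(\<integral>x. \<bar>partial m \<psi> x\<bar> powr q \<partial>lborel) \<le> (\<Sum>j\<in>UNIV. \<integral>x. \<bar>partial j \<psi> x\<bar> powr q \<partial>lborel)"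
      by (rule member_le_sum[of m UNIV "\<lambda>j. \<integral>x. \<bar>partial j \<psi> x\<bar> powr q \<partial>lborel"]) auto
    moreover have "0 \<le> (\<Sum>i\<in>UNIV. \<Sum>j\<in>UNIV. \<integral>x. \<bar>partial i (partial j \<psi>) x\<bar> powr q \<partial>lborel)"
      by (intro sum_nonneg Bochner_Integration.integral_nonneg) auto
    ultimately show ?thesis unfolding H_def by linarith
  qed
  have young: "\<bar>LINT x|lebesgue_on \<Omega>. F x $ i $ j * g x\<bar> \<le> (LINT x|lebesgue_on \<Omega>. norm (F x) powr p) + (\<integral>x. \<bar>g x\<bar> powr q \<partial>lborel)"
    if F: "F \<in> Lp p \<Omega>" and g: "compactly_supported g" for F :: "real^3 \<Rightarrow> real^3^3" and g i j
  proof -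
    have Fi: "integrable (lebesgue_on \<Omega>) (\<lambda>x. norm (F x) powr p)" using F by (simp add: Lp_def)
    have gi: "integrable lborel (\<lambda>x. \<bar>g x\<bar> powr q)" using q1 by (intro compactly_supported_integrable compactly_supported_powr g) simp
    have gl: "integrable lebesgue (\<lambda>x. \<bar>g x\<bar> powr q)"
      using gi by (rule integrable_completion[THEN iffD2, rotated]) (rule borel_measurable_integrable[OF gi])
    have gO: "integrable (lebesgue_on \<Omega>) (\<lambda>x. \<bar>g x\<bar> powr q)"
      using Om gl by (intro integrable_restrict_space[THEN iffD2] integrable_mult_indicator) auto
    have fgi: "integrable (lebesgue_on \<Omega>) (\<lambda>x. F x $ i $ j * g x)" by (rule int[OF ent[OF F] g])
    have "\<bar>LINT x|lebesgue_on \<Omega>. F x $ i $ j * g x\<bar> \<le> (LINT x|lebesgue_on \<Omega>. \<bar>F x $ i $ j * g x\<bar>)" by (rule integral_abs_bound)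
    also have "\<dots> \<le> (LINT x|lebesgue_on \<Omega>. norm (F x) powr p + \<bar>g x\<bar> powr q)"
    proof (rule integral_mono)
      show "\<bar>F x $ i $ j * g x\<bar> \<le> norm (F x) powr p + \<bar>g x\<bar> powr q" for x
      proof -
        have "\<bar>F x $ i $ j\<bar> \<le> norm (F x)"
          using component_le_norm_cart[of "F x $ i" j] Finite_Cartesian_Product.norm_nth_le[of "F x" i] by (rule order_trans)
        then have "\<bar>F x $ i $ j * g x\<bar> \<le> norm (F x) * \<bar>g x\<bar>" by (simp add: abs_mult mult_right_mono)
        also have "\<dots> \<le> norm (F x) powr p + \<bar>g x\<bar> powr q" by (rule young_powr[OF p q]) auto
        finally show ?thesis .
      qed
    qed (use fgi Fi gO in auto)
    also have "\<dots> = (LINT x|lebesgue_on \<Omega>. norm (F x) powr p) + (LINT x|lebesgue_on \<Omega>. \<bar>g x\<bar> powr q)"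
      by (rule Bochner_Integration.integral_add[OF Fi gO])
    also have "(LINT x|lebesgue_on \<Omega>. \<bar>g x\<bar> powr q) \<le> (\<integral>x. \<bar>g x\<bar> powr q \<partial>lborel)"
    proof -
      have "(LINT x|lebesgue_on \<Omega>. \<bar>g x\<bar> powr q) = (LINT x|lebesgue. indicator \<Omega> x *\<^sub>R \<bar>g x\<bar> powr q)"
        by (rule integral_restrict_space) (use Om in simp)
      also have "\<dots> \<le> (LINT x|lebesgue. \<bar>g x\<bar> powr q)"
        using Om gl by (intro integral_mono integrable_mult_indicator) (auto simp: indicator_def)
      also have "\<dots> = (\<integral>x. \<bar>g x\<bar> powr q \<partial>lborel)" by (rule integral_completion) (rule borel_measurable_integrable[OF gi])
      finally show ?thesis .
    qed
    finally show ?thesis by simp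
  qed
  define Pi where "Pi = (\<lambda>i l k m. LINT x|lebesgue_on \<Omega>. P x $ i $ l * partial k (partial m \<psi>) x)"
  define Si where "Si = (\<lambda>i l k m. LINT x|lebesgue_on \<Omega>. S x $ i $ l * partial k (partial m \<psi>) x)"
  define Yi where "Yi = (\<lambda>i j m. LINT x|lebesgue_on \<Omega>. C x $ i $ j * partial m \<psi> x)"
  define Di where "Di = (\<lambda>i j m. LINT x|lebesgue_on \<Omega>. D x $ i $ j * partial m \<psi> x)"
  note iP = int[OF ent[OF PL] cs2] and iC = int[OF ent[OF CL] cs1]
  have sym: "Pi i l k m = Pi i l m k" for i l k m
    unfolding Pi_def by (simp only: partial_commute[OF \<psi>(1)])
  \<comment> \<open>\<open>zero_trace_identity\<close> with a derivative of \<psi> as \<phi> and a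
    coordinate vector as c. The vanishing trace is used here: no boundary term appears although
    \<psi> is unrestricted at the boundary.\<close>
  have gx: "(LINT x|lebesgue_on \<Omega>. C x $ i $ j * partial m \<psi> x) = (LINT x|lebesgue_on \<Omega>. P x $ i \<bullet> grad_cross (partial m \<psi>) (axis j 1) x)" for i j m
    using zero_trace_identity(1)[OF \<Omega> p P smooth_partial[OF \<psi>(1)], of m i "axis j 1"]
    by (simp add: C_def inner_axis mult.commute)
  have Y: "Yi i 1 m = Pi i 2 3 m - Pi i 3 2 m" "Yi i 2 m = Pi i 3 1 m - Pi i 1 3 m" "Yi i 3 m = Pi i 1 2 m - Pi i 2 1 m" for i m
    unfolding Yi_def gx Pi_def Bochner_Integration.integral_diff[OF iP iP, symmetric]
    by (intro Bochner_Integration.integral_cong refl; simp add: inner_vec_def sum_3 grad_cross_nth axis_def)+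
  have Sx: "Si i l k m = (Pi i l k m + Pi l i k m) / 2 - (if i = l then (Pi 1 1 k m + Pi 2 2 k m + Pi 3 3 k m) / 3 else 0)" for i l k m
  proof -
    let ?g = "partial k (partial m \<psi>)"
    have "Si i l k m = (LINT x|lebesgue_on \<Omega>. (P x $ i $ l * ?g x + P x $ l $ i * ?g x) / 2
       - (if i = l then 1 / 3 else 0) * (P x $ 1 $ 1 * ?g x + P x $ 2 $ 2 * ?g x + P x $ 3 $ 3 * ?g x))"
      unfolding Si_def S_def
      by (intro Bochner_Integration.integral_cong refl) (simp add: dev_sym_part_nth algebra_simps add_divide_distrib)
    then show ?thesis by (simp add: Pi_def iP)
  qed
  have Dx: "Di i j m = Yi i j m - (if i = j then (Yi 1 1 m + Yi 2 2 m + Yi 3 3 m) / 3 else 0)" for i j m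
  proof -
    let ?g = "partial m \<psi>"
    have "Di i j m = (LINT x|lebesgue_on \<Omega>. C x $ i $ j * ?g x
       - (if i = j then 1 / 3 else 0) * (C x $ 1 $ 1 * ?g x + C x $ 2 $ 2 * ?g x + C x $ 3 $ 3 * ?g x))"
      unfolding Di_def D_def
      by (intro Bochner_Integration.integral_cong refl) (simp add: dev_nth algebra_simps add_divide_distrib)
    then show ?thesis by (simp add: Yi_def iC)
  qed
  have A: "A = (LINT x|lebesgue_on \<Omega>. norm (S x) powr p) + (LINT x|lebesgue_on \<Omega>. norm (D x) powr p)"
    by (simp add: A_def S_def D_def C_def)
  have nn: "0 \<le> (LINT x|lebesgue_on \<Omega>. norm (S x) powr p)" "0 \<le> (LINT x|lebesgue_on \<Omega>. norm (D x) powr p)"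
    by (intro Bochner_Integration.integral_nonneg; simp)+
  have TS: "\<bar>Si i l k m\<bar> \<le> A + H" for i l k m
    unfolding Si_def A using young[OF SL cs2, of i l k m] H2[of k m] nn by linarith
  have TD: "\<bar>Di i j m\<bar> \<le> A + H" for i j m
    unfolding Di_def A using young[OF DL cs1, of i j m] H1[of m] nn by linarith
  note bounds = laplacian_identities[OF sym Y Sx Dx TS TD]
  have "(LINT x|lebesgue_on \<Omega>. (P x $ 1 $ 1 + P x $ 2 $ 2 + P x $ 3 $ 3) / 3 * laplacian \<psi> x) = (\<Sum>k\<in>UNIV. (Pi 1 1 k k + Pi 2 2 k k + Pi 3 3 k k) / 3)"
  proof -
    have "(LINT x|lebesgue_on \<Omega>. (P x $ 1 $ 1 + P x $ 2 $ 2 + P x $ 3 $ 3) / 3 * laplacian \<psi> x)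
      = (LINT x|lebesgue_on \<Omega>. (\<Sum>k\<in>UNIV. (P x $ 1 $ 1 * partial k (partial k \<psi>) x + P x $ 2 $ 2 * partial k (partial k \<psi>) x + P x $ 3 $ 3 * partial k (partial k \<psi>) x) / 3))"
      by (intro Bochner_Integration.integral_cong refl) (simp add: laplacian_def sum_3 field_simps)
    then show ?thesis by (simp add: Pi_def iP)
  qed
  with bounds(1) show "\<bar>LINT x|lebesgue_on \<Omega>. (P x $ 1 $ 1 + P x $ 2 $ 2 + P x $ 3 $ 3) / 3 * laplacian \<psi> x\<bar> \<le> 14 * (A + H)" by simp
  have skew: "(LINT x|lebesgue_on \<Omega>. (P x $ i $ j - P x $ j $ i) / 2 * laplacian \<psi> x) = (\<Sum>k\<in>UNIV. (Pi i j k k - Pi j i k k) / 2)" for i j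
  proof -
    have "(LINT x|lebesgue_on \<Omega>. (P x $ i $ j - P x $ j $ i) / 2 * laplacian \<psi> x)
      = (LINT x|lebesgue_on \<Omega>. (\<Sum>k\<in>UNIV. (P x $ i $ j * partial k (partial k \<psi>) x - P x $ j $ i * partial k (partial k \<psi>) x) / 2))"
      by (intro Bochner_Integration.integral_cong refl) (simp add: laplacian_def sum_3 field_simps)
    then show ?thesis by (simp add: Pi_def iP)
  qed
  show "\<bar>LINT x|lebesgue_on \<Omega>. (P x $ 3 $ 2 - P x $ 2 $ 3) / 2 * laplacian \<psi> x\<bar> \<le> 14 * (A + H)"
    "\<bar>LINT x|lebesgue_on \<Omega>. (P x $ 1 $ 3 - P x $ 3 $ 1) / 2 * laplacian \<psi> x\<bar> \<le> 14 * (A + H)"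
    "\<bar>LINT x|lebesgue_on \<Omega>. (P x $ 2 $ 1 - P x $ 1 $ 2) / 2 * laplacian \<psi> x\<bar> \<le> 14 * (A + H)"
    unfolding skew by (rule bounds)+
qed

theorem theorem1p2:
  fixes \<Omega> :: "(real^3) set" and p :: real
  assumes "bounded \<Omega>" and "lipschitz_domain \<Omega>" and "1 < p"
  shows "\<exists>c>0. \<forall>P\<in>W0_Curl p \<Omega>.
    Lp_norm p \<Omega> P \<le>
      c * (Lp_norm p \<Omega> (\<lambda>x. dev (sym_part (P x))) + Lp_norm p \<Omega> (\<lambda>x. dev (Curl \<Omega> P x)))"
proof -
  have \<Omega>: "open \<Omega>" "bounded \<Omega>" using assms by (auto simp: lipschitz_domain_def)
  note p = \<open>1 < p\<close>
  define q where "q = p / (p - 1)"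
  have Ol: "\<Omega> \<in> lmeasurable" by (rule open_bounded_lmeasurable[OF \<Omega>])
  obtain R where R: "R > 0" "\<Omega> \<subseteq> cball 0 R"
    using \<Omega>(2) unfolding bounded_pos by (auto simp: subset_iff)
  have K: "(14::real) \<ge> 0" by simp
  show ?thesis
  proof (rule laplacian_duality[OF p q_def R(1) K])
    fix C
    assume C: "C > 0" and dual: "\<And>S w A. \<lbrakk>S \<in> lmeasurable; S \<subseteq> cball (0::real^3) R; w \<in> borel_measurable (lebesgue_on S);
      integrable (lebesgue_on S) (\<lambda>x. \<bar>w x\<bar> powr p);
      \<And>\<psi>. \<lbrakk>smooth \<psi>; compactly_supported \<psi>\<rbrakk> \<Longrightarrow> \<bar>LINT x|lebesgue_on S. w x * laplacian \<psi> x\<bar> \<le> A +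
        14 * ((\<Sum>i\<in>UNIV. \<Sum>j\<in>UNIV. \<integral>x. \<bar>partial i (partial j \<psi>) x\<bar> powr q \<partial>lborel) + (\<Sum>j\<in>UNIV. \<integral>x. \<bar>partial j \<psi> x\<bar> powr q \<partial>lborel))\<rbrakk> \<Longrightarrow>
      (LINT x|lebesgue_on S. \<bar>w x\<bar> powr p) \<le> C * A"
    \<comment> \<open>56 = 4 * 14: four scalar components, each bounded by C * 14 (s + d). The 1
      stands for dev sym P itself, and 10^p comes from \<open>powr_weighted_sum_le\<close>.\<close>
    define Z where "Z = 10 powr p * (1 + 56 * C)"
    have Z: "Z > 0" using C by (simp add: Z_def)
    show ?thesis
    proof (intro exI[of _ "Z powr (1 / p) * 2 powr (1 / p)"] conjI ballI)
      show "Z powr (1 / p) * 2 powr (1 / p) > 0" using Z by simp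
      fix P assume P: "P \<in> W0_Curl p \<Omega>"
      define s where "s = (LINT x|lebesgue_on \<Omega>. norm (dev (sym_part (P x))) powr p)"
      define d where "d = (LINT x|lebesgue_on \<Omega>. norm (dev (Curl \<Omega> P x)) powr p)"
      have sd: "s \<ge> 0" "d \<ge> 0" unfolding s_def d_def by (intro Bochner_Integration.integral_nonneg; simp)+
      have PL: "P \<in> Lp p \<Omega>" using P by (simp add: W0_Curl_def)
      \<comment> \<open>One scalar component L (P) at a time: duality with 14 (s + d) as its A
        converts the tested Laplacian bound into an L^p bound, with one C for all components and all
        P.\<close>
      have wp: "(LINT x|lebesgue_on \<Omega>. \<bar>L (P x)\<bar> powr p) \<le> C * (14 * (s + d))"
          "integrable (lebesgue_on \<Omega>) (\<lambda>x. \<bar>L (P x)\<bar> powr p)"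
        if L: "bounded_linear L" and b: "\<And>\<psi>. \<lbrakk>smooth \<psi>; compactly_supported \<psi>\<rbrakk> \<Longrightarrow> \<bar>LINT x|lebesgue_on \<Omega>. L (P x) * laplacian \<psi> x\<bar> \<le> 14 * ((s + d) +
        ((\<Sum>i\<in>UNIV. \<Sum>j\<in>UNIV. \<integral>x. \<bar>partial i (partial j \<psi>) x\<bar> powr q \<partial>lborel) + (\<Sum>j\<in>UNIV. \<integral>x. \<bar>partial j \<psi> x\<bar> powr q \<partial>lborel)))" for L :: "real^3^3 \<Rightarrow> real"
      proof -
        have "(\<lambda>x. L (P x)) \<in> Lp p \<Omega>" by (rule Lp_bounded_linear[OF PL L]) (use p in simp)
        then have m: "(\<lambda>x. L (P x)) \<in> borel_measurable (lebesgue_on \<Omega>)" and i: "integrable (lebesgue_on \<Omega>) (\<lambda>x. \<bar>L (P x)\<bar> powr p)"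
          by (auto simp: Lp_def)
        show "integrable (lebesgue_on \<Omega>) (\<lambda>x. \<bar>L (P x)\<bar> powr p)" by (rule i)
        show "(LINT x|lebesgue_on \<Omega>. \<bar>L (P x)\<bar> powr p) \<le> C * (14 * (s + d))"
          by (rule dual[OF Ol R(2) m i]) (use b in \<open>simp only: distrib_left\<close>)
      qed
      note lb = W0_Curl_laplacian_bound[OF \<Omega> p q_def P, folded s_def d_def]
      define z where "z = (\<lambda>X::real^3^3. (X $ 1 $ 1 + X $ 2 $ 2 + X $ 3 $ 3) / 3)"
      define k where "k = (\<lambda>i j (X::real^3^3). (X $ i $ j - X $ j $ i) / 2)"
      have bl: "bounded_linear z" "bounded_linear (k i j)" for i j
        unfolding linear_conv_bounded_linear[symmetric] z_def k_def by (intro linearI; simp add: field_simps)+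
      have wz: "(LINT x|lebesgue_on \<Omega>. \<bar>z (P x)\<bar> powr p) \<le> C * (14 * (s + d))" "integrable (lebesgue_on \<Omega>) (\<lambda>x. \<bar>z (P x)\<bar> powr p)"
        by (rule wp[OF bl(1)]; simp only: z_def lb(1))+
      have wk1: "(LINT x|lebesgue_on \<Omega>. \<bar>k 3 2 (P x)\<bar> powr p) \<le> C * (14 * (s + d))" "integrable (lebesgue_on \<Omega>) (\<lambda>x. \<bar>k 3 2 (P x)\<bar> powr p)"
        by (rule wp[OF bl(2)]; simp only: k_def lb(2))+
      have wk2: "(LINT x|lebesgue_on \<Omega>. \<bar>k 1 3 (P x)\<bar> powr p) \<le> C * (14 * (s + d))" "integrable (lebesgue_on \<Omega>) (\<lambda>x. \<bar>k 1 3 (P x)\<bar> powr p)"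
        by (rule wp[OF bl(2)]; simp only: k_def lb(3))+
      have wk3: "(LINT x|lebesgue_on \<Omega>. \<bar>k 2 1 (P x)\<bar> powr p) \<le> C * (14 * (s + d))" "integrable (lebesgue_on \<Omega>) (\<lambda>x. \<bar>k 2 1 (P x)\<bar> powr p)"
        by (rule wp[OF bl(2)]; simp only: k_def lb(4))+
      have Si: "integrable (lebesgue_on \<Omega>) (\<lambda>x. norm (dev (sym_part (P x))) powr p)"
        using Lp_bounded_linear[OF PL bounded_linear_dev_sym_part] p by (simp add: Lp_def)
      let ?B = "\<lambda>x. norm (dev (sym_part (P x))) powr p + \<bar>z (P x)\<bar> powr p + \<bar>k 3 2 (P x)\<bar> powr p + \<bar>k 1 3 (P x)\<bar> powr p + \<bar>k 2 1 (P x)\<bar> powr p"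
      have "(LINT x|lebesgue_on \<Omega>. norm (P x) powr p) \<le> (LINT x|lebesgue_on \<Omega>. 10 powr p * ?B x)"
      proof (rule integral_mono)
        show "integrable (lebesgue_on \<Omega>) (\<lambda>x. norm (P x) powr p)" using PL by (simp add: Lp_def)
        show "integrable (lebesgue_on \<Omega>) (\<lambda>x. 10 powr p * ?B x)"
          by (intro integrable_mult_right Bochner_Integration.integrable_add Si wz wk1 wk2 wk3)
        fix x
        have "norm (P x) powr p \<le> (norm (dev (sym_part (P x))) + 3 * \<bar>z (P x)\<bar> + 2 * \<bar>k 3 2 (P x)\<bar> + 2 * \<bar>k 1 3 (P x)\<bar> + 2 * \<bar>k 2 1 (P x)\<bar>) powr p"
          unfolding z_def k_def using p by (intro powr_mono2 norm_le_dev_sym_part) auto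
        also have "\<dots> \<le> 10 powr p * ?B x" using p by (intro powr_weighted_sum_le) auto
        finally show "norm (P x) powr p \<le> 10 powr p * ?B x" .
      qed
      also have "\<dots> = 10 powr p * (s + (LINT x|lebesgue_on \<Omega>. \<bar>z (P x)\<bar> powr p) + (LINT x|lebesgue_on \<Omega>. \<bar>k 3 2 (P x)\<bar> powr p)
          + (LINT x|lebesgue_on \<Omega>. \<bar>k 1 3 (P x)\<bar> powr p) + (LINT x|lebesgue_on \<Omega>. \<bar>k 2 1 (P x)\<bar> powr p))"
        by (simp add: s_def Si wz(2) wk1(2) wk2(2) wk3(2))
      also have "\<dots> \<le> 10 powr p * ((s + d) + 4 * (C * (14 * (s + d))))"
        using wz(1) wk1(1) wk2(1) wk3(1) sd by (intro mult_left_mono) (linarith, simp)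
      also have "\<dots> = Z * (s + d)" by (simp add: Z_def algebra_simps)
      finally have "(LINT x|lebesgue_on \<Omega>. norm (P x) powr p) powr (1 / p) \<le> (Z * (s + d)) powr (1 / p)"
        using p by (intro powr_mono2) (auto intro!: Bochner_Integration.integral_nonneg)
      also have "\<dots> = Z powr (1 / p) * (s + d) powr (1 / p)" using Z sd by (simp add: powr_mult)
      \<comment> \<open>Splitting the p-th root of s + d into the two norms costs the factor
        2^(1/p).\<close>
      also have "\<dots> \<le> Z powr (1 / p) * (2 powr (1 / p) * (s powr (1 / p) + d powr (1 / p)))"
        using sd p by (intro mult_left_mono powr_add_le) auto
      finally show "Lp_norm p \<Omega> P \<le> Z powr (1 / p) * 2 powr (1 / p) * (Lp_norm p \<Omega> (\<lambda>x. dev (sym_part (P x))) + Lp_norm p \<Omega> (\<lambda>x. dev (Curl \<Omega> P x)))"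
        by (simp add: Lp_norm_def s_def d_def mult.assoc)
    qed
  qed
qed

end
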